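(* Let $\mathbf U$ be a quantum covering group of super Kac-Moody type and $(\mathbf U,\mathbf U^\imath)$ a quasi-split quantum symmetric pair for $\mathbf U$, with bar involutions $\psi$ on $\mathbf U$ and $\psi_\imath$ on $\mathbf U^\imath$. There exists a unique family of elements $\Upsilon_\mu\in\mathbf U^+_\mu$ such that $\Upsilon_0=1$ and $\Upsilon=\sum_\mu\Upsilon_\mu$ satisfies the following identity in $\widehat{\mathbf U}$: $$\psi_\imath(u)\,\Upsilon=\Upsilon\,\psi(u)\qquad\text{for all }u\in\mathbf U^\imath .$$ Moreover, $\Upsilon_\mu=0$ for all $\mu$ with $p(\mu)=\bar1$ (i.e. $p(\mu)$ odd).
   Context: Quantum covering group. $\mathbb N=\{0,1,\dots\}$; $R^\pi=R[\pi]/(\pi^2-1)$ for a ring $R$. On $\mathbb Q(q)^\pi$ the bar involution is the $\mathbb Q$-algebra involution $\overline q=\pi q^{-1}$, $\overline\pi=\pi$; semilinear refers to it. A super Cartan datum is a finite set $I=I_{\bar0}\sqcup I_{\bar1}$, $I_{\bar1}\ne\emptyset$, with a symmetric bilinear form $\cdot:\mathbb Z[I]^2\to\mathbb Z$ such that $d_i=\frac{i\cdot i}2\in\mathbb Z_{>0}$; $a_{ij}=\frac{2\,i\cdot j}{i\cdot i}\in-\mathbb N$ for $i\ne j$; $a_{ij}\in2\mathbb Z$ if $i\in I_{\bar1}$; $d_i\equiv p(i)$ mod 2, where $p(i)=0,1$ for $i\in I_{\bar0},I_{\bar1}$, extended additively to $\mathbb Z[I]$. A root datum: finitely generated free abelian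 groups $Y,X$ with a perfect pairing $\langle\cdot,\cdot\rangle$ and embeddings $I\subset X$ ($i\mapsto i'$), $I\subset Y$ ($i\mapsto i$) with linearly independent images and $\langle i,j'\rangle=a_{ij}$. Put $q_i=q^{d_i}$, $\pi_i=\pi^{p(i)}$, $[n]_i=\frac{(\pi_iq_i)^n-q_i^{-n}}{\pi_iq_i-q_i^{-1}}$, with the usual factorials and binomials $\left[{m\atop n}\right]_i$. $\mathbf U$ is the associative $\mathbb Q(q)^\pi$-superalgebra with generators $E_i,F_i$ (parity $p(i)$), $K_\mu,J_\mu$ ($\mu\in Y$, even) and relations: $K_0=1$, $K_\mu K_{\mu'}=K_{\mu+\mu'}$, $J_{2\mu}=1$, $J_\mu J_{\mu'}=J_{\mu+\mu'}$, $J_\mu K_{\mu'}=K_{\mu'}J_\mu$, $K_\mu E_i=q^{\langle\mu,i'\rangle}E_iK_\mu$, $J_\mu E_i=\pi^{\langle\mu,i'\rangle}E_iJ_\mu$, $K_\mu F_i=q^{-\langle\mu,i'\rangle}F_iK_\mu$, $J_\mu F_i=\pi^{-\langle\mu,i'\rangle}F_iJ_\mu$, $E_iF_j-\pi^{p(i)p(j)}F_jE_i=\delta_{ij}\frac{\widetilde J_i\widetilde K_i-\widetilde K_i^{-1}}{\pi_iq_i-q_i^{-1}}$ with $\widetilde K_i=K_{d_ii}$, $\widetilde J_i=J_{d_ii}$, and for $i\ne j$, $\sum_{n=0}^{1-a_{ij}}(-1)^n\pi_i^{np(j)+\binom n2}\left[{1-a_{ij}\atop n}\right]_ix_i^nx_jx_i^{1-a_{ij}-n}=0$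 for $x=E$ and $x=F$. $\mathbf U^+,\mathbf U^-,\mathbf U^0$ are the subalgebras generated by the $E_i$, the $F_i$, and the $K_\mu,J_\mu$; $\mathbf U^+_\mu$ ($\mu\in\mathbb N[I]$) is the span of monomials in the $E_i$ of weight $\mu$; $\mathrm{ht}(\sum\nu_ii)=\sum\nu_i$. The bar involution $\psi$ of $\mathbf U$ is the semilinear $\mathbb Q$-algebra map fixing $E_i,F_i,J_\mu$ with $\psi(K_\mu)=J_\mu K_{-\mu}$. $\widehat{\mathbf U}$ is the completion of $\mathbf U$ with respect to the submodules $\mathbf U^-\mathbf U^0\big(\sum_{\mathrm{ht}(\mu)\ge N}\mathbf U^+_\mu\big)$; multiplication and $\psi$ extend by continuity. $\imath$quantum covering group. $\tau$ is an involution (possibly trivial) of $I$ with $\tau i\cdot\tau j=i\cdot j$, extended compatibly to $X,Y$ preserving the pairing; $Y^\imath=\{\mu\in Y:\tau\mu=-\mu\}$. Parameters $\varsigma_i\in(\mathbb Q(q)^\pi)^\times$ satisfy: $\overline{\varsigma_iq_i}=\varsigma_iq_i$ if $\tau i=i$ and $a_{ij}\ne0$ for some $j\in I\setminus\{i\}$; $\overline{\varsigma_i}=\varsigma_i=\varsigma_{\tau i}$ if $\tau i\ne i$ and $a_{i,\tau i}=0$; $\varsigma_{\tau i}=\pi_iq_i^{-a_{i,\tau i}}\overline{\varsigma_i}$ if $\tau i\ne i$ and $a_{i,\tau i}\ne0$. The quasi-split $\imath$quantum covering group $\mathbf U^\imath$ is the $\mathbb Q(q)^\pi$-subalgebra of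 $\mathbf U$ generated by $B_i=F_i+\varsigma_iE_{\tau i}\widetilde K_i^{-1}$, $\widetilde J_i$ ($i\in I$) and $K_\mu$ ($\mu\in Y^\imath$). Its bar involution $\psi_\imath$ is the semilinear $\mathbb Q$-algebra automorphism with $\psi_\imath(q)=\pi q^{-1}$, $\psi_\imath(B_i)=B_i$, $\psi_\imath(\widetilde J_i)=\widetilde J_i$, $\psi_\imath(K_\mu)=J_\mu K_\mu^{-1}$ ($\mu\in Y^\imath$).
   Formalization: The parameter condition that ς_i q_i is bar-invariant is also required for i with τi = i and a_ij = 0 for all j ≠ i; without it the claim fails, e.g. I = {i} odd, τ = id, ς_i = 1, and it is necessary for Υ to exist. *)

theory Defs
  imports
    "HOL-Algebra.Generated_Rings"
    "HOL-Algebra.Generated_Groups"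
    "HOL-Algebra.QuotRing"
    "HOL-Library.Poly_Mapping"
    "HOL-Computational_Algebra.Polynomial"
    "HOL-Computational_Algebra.Fraction_Field"
begin

section \<open>The ground ring\<close>

text \<open>\<open>Pi_ext a b\<close> stands for \<open>a + b \<pi>\<close> in \<open>R[\<pi>] / (\<pi>\<^sup>2 - 1)\<close>.\<close>

datatype 'a pi_ext = Pi_ext (pcoeff0: 'a) (pcoeff1: 'a)

instantiation pi_ext :: (comm_ring_1) comm_ring_1
begin

definition "0 = Pi_ext 0 0"
definition "1 = Pi_ext 1 0"
definition "x + y = Pi_ext (pcoeff0 x + pcoeff0 y) (pcoeff1 x + pcoeff1 y)"
definition "x - y = Pi_ext (pcoeff0 x - pcoeff0 y) (pcoeff1 x - pcoeff1 y)"
definition "- x = Pi_ext (- pcoeff0 x) (- pcoeff1 x)"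
definition "x * y = Pi_ext (pcoeff0 x * pcoeff0 y + pcoeff1 x * pcoeff1 y)
                           (pcoeff0 x * pcoeff1 y + pcoeff1 x * pcoeff0 y)"

instance
  by standard
     (auto simp: zero_pi_ext_def one_pi_ext_def plus_pi_ext_def minus_pi_ext_def
                 uminus_pi_ext_def times_pi_ext_def algebra_simps intro: pi_ext.expand)

end

text \<open>Over a field, \<open>inverse x\<close> is the true inverse of each unit \<open>x\<close>
  (and \<open>0\<close> on non-units); in particular \<open>powi\<close> is the integer power on units.\<close>

instantiation pi_ext :: (field) inverse
begin

definition "inverse x =
  (let n = pcoeff0 x ^ 2 - pcoeff1 x ^ 2 in Pi_ext (pcoeff0 x / n) (- pcoeff1 x / n))"
definition divide_pi_ext_def: "x div y = x * inverse (y :: 'a pi_ext)"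

instance ..

end

lemma pi_ext_mult_inverse:
  fixes x :: "'a::field pi_ext"
  assumes "x dvd 1"
  shows "x * inverse x = 1"
proof -
  obtain a b where x: "x = Pi_ext a b" by (cases x)
  from assms obtain y where y: "1 = x * y" by (auto simp: dvd_def)
  obtain c d where "y = Pi_ext c d" by (cases y)
  with x y have eqs: "a * c + b * d = 1" "a * d + b * c = 0"
    by (auto simp: one_pi_ext_def times_pi_ext_def)
  have "(a ^ 2 - b ^ 2) * (c ^ 2 - d ^ 2) = (a * c + b * d) ^ 2 - (a * d + b * c) ^ 2"
    by (simp add: power2_eq_square algebra_simps)
  then have "a ^ 2 - b ^ 2 \<noteq> 0" using eqs by auto
  then show ?thesis
    by (simp add: x inverse_pi_ext_def Let_def one_pi_ext_def times_pi_ext_def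
        power2_eq_square diff_divide_distrib[symmetric] mult.commute)
qed

type_synonym ratfun = "rat poly fract"
type_synonym qpi = "ratfun pi_ext"

definition qq :: qpi where "qq = Pi_ext (Fract [:0, 1:] 1) 0"
definition ppi :: qpi where "ppi = Pi_ext 0 1"

definition unital_ring_hom :: "('a::ring_1 \<Rightarrow> 'b::ring_1) \<Rightarrow> bool" where
  "unital_ring_hom f \<longleftrightarrow>
     f 1 = 1 \<and> (\<forall>x y. f (x + y) = f x + f y) \<and> (\<forall>x y. f (x * y) = f x * f y)"

text \<open>The bar involution of the ground ring. A unital ring homomorphism is automatically linear
  over the rational numbers.\<close>

definition qbar :: "qpi \<Rightarrow> qpi" where
  "qbar = (THE f. unital_ring_hom f \<and> f qq = ppi * inverse qq \<and> f ppi = ppi)"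

text \<open>Existence and uniqueness of \<open>qbar\<close>. Existence glues the substitutions \<open>q \<mapsto> q\<^sup>-\<^sup>1\<close>
  (at \<open>\<pi> = 1\<close>) and \<open>q \<mapsto> - q\<^sup>-\<^sup>1\<close> (at \<open>\<pi> = - 1\<close>); \<open>evq t\<close> evaluates a polynomial at \<open>t\<close>.\<close>

definition evq :: "ratfun \<Rightarrow> rat poly \<Rightarrow> ratfun" where
  "evq t p = poly (map_poly (\<lambda>r. Fract [:r:] 1) p) t"

lemma evq_pCons: "evq t (pCons a p) = Fract [:a:] 1 + t * evq t p"
  by (cases "a = 0 \<and> p = 0") (auto simp: evq_def map_poly_pCons Zero_fract_def)

lemma evq_0: "evq t 0 = 0" by (simp add: evq_def)

lemma evq_1: "evq t 1 = 1"
  using evq_pCons[of t 1 0] by (simp add: evq_0 One_fract_def one_pCons)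

lemma evq_add: "evq t (p + r) = evq t p + evq t r"
  by (induction p r rule: poly_induct2) (auto simp: evq_0 evq_pCons algebra_simps)

lemma evq_smult: "evq t (smult a p) = Fract [:a:] 1 * evq t p"
proof (induction p)
  case (pCons b p)
  have "Fract [:a * b:] 1 = Fract [:a:] 1 * Fract [:b:] (1 :: rat poly)"
    by (simp add: mult.commute)
  with pCons show ?case by (simp add: evq_pCons algebra_simps del: mult_fract)
qed (simp add: evq_0)

lemma evq_mult: "evq t (p * r) = evq t p * evq t r"
  by (induction p)
     (auto simp: evq_0 evq_pCons evq_add evq_smult Zero_fract_def[symmetric] algebra_simps)

lemma evq_monomial: "evq (Fract [:0, s:] 1) p = Fract (p \<circ>\<^sub>p [:0, s:]) 1"
  by (induction p) (auto simp: evq_0 evq_pCons pcompose_pCons Zero_fract_def)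

lemma evq_nonzero:
  assumes "s \<noteq> 0" "p \<noteq> 0"
  shows "evq (inverse (Fract [:0, s:] 1)) p \<noteq> 0"
proof
  let ?c = "\<lambda>r :: rat. Fract [:r:] 1" and ?Y = "Fract [:0, s:] 1"
  assume 0: "evq (inverse ?Y) p = 0"
  have Y: "?Y \<noteq> 0" using assms by (simp add: Zero_fract_def eq_fract)
  have c0: "?c 0 = 0" by (simp add: Zero_fract_def)
  have c: "?c r = 0 \<longleftrightarrow> r = 0" for r by (simp add: Zero_fract_def eq_fract)
  have deg: "degree (map_poly ?c p) = degree p" by (rule degree_map_poly) (use c in blast)
  have "reflect_poly (map_poly ?c p) = map_poly ?c (reflect_poly p)"
    by (intro poly_eqI)
       (simp add: coeff_reflect_poly coeff_map_poly[of ?c, OF c0] deg Zero_fract_def)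
  then have "evq ?Y (reflect_poly p) = ?Y ^ degree (map_poly ?c p) * evq (inverse ?Y) p"
    using poly_reflect_poly_nz[OF Y, of "map_poly ?c p"] by (simp add: evq_def)
  then have "evq ?Y (reflect_poly p) = 0" by (simp only: 0 mult_zero_right)
  then have "reflect_poly p \<circ>\<^sub>p [:0, s:] = 0"
    by (simp add: evq_monomial Zero_fract_def eq_fract)
  then have "reflect_poly p = 0" using assms(1) pcompose_eq_0 by force
  then show False using assms(2) by simp
qed

lemma ratfun_hom_exists:
  fixes s :: rat
  assumes "s \<noteq> 0"
  shows "\<exists>g :: ratfun \<Rightarrow> ratfun. unital_ring_hom g \<and> g (Fract [:0, 1:] 1) = inverse (Fract [:0, s:] 1)"
proof -
  let ?t = "inverse (Fract [:0, s:] 1)"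
  note nz = evq_nonzero[OF assms]
  define g where "g x = (let (a, b) = (SOME (a, b). b \<noteq> 0 \<and> x = Fract a b) in evq ?t a / evq ?t b)" for x
  have g: "g (Fract a b) = evq ?t a / evq ?t b" if "b \<noteq> 0" for a b
  proof -
    obtain a' b' where ab': "(SOME (a', b'). b' \<noteq> 0 \<and> Fract a b = Fract a' b') = (a', b')"
      by (meson surj_pair)
    have "case (a', b') of (a', b') \<Rightarrow> b' \<noteq> 0 \<and> Fract a b = Fract a' b'"
      unfolding ab'[symmetric] by (rule someI[of _ "(a, b)"]) (use that in auto)
    then have b': "b' \<noteq> 0" and "a * b' = a' * b" using that by (auto simp: eq_fract)
    then have "evq ?t a * evq ?t b' = evq ?t a' * evq ?t b" by (metis evq_mult)
    then show ?thesis using nz[OF that] nz[OF b']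
      by (simp add: g_def ab' field_simps)
  qed
  have "g (x + y) = g x + g y \<and> g (x * y) = g x * g y" for x y
  proof (cases x; cases y)
    fix a b c d assume "x = Fract a b" "b \<noteq> 0" "y = Fract c d" "d \<noteq> 0"
    then show ?thesis
      using nz by (simp add: g evq_add evq_mult add_divide_eq_iff divide_add_eq_iff field_simps)
  qed
  moreover have "g 1 = 1" by (simp add: One_fract_def g) (simp add: evq_1 One_fract_def[symmetric])
  moreover have "g (Fract [:0, 1:] 1) = ?t"
    by (simp add: g evq_1 evq_pCons evq_0 Zero_fract_def[symmetric] One_fract_def[symmetric]
        pCons_one)
  ultimately show ?thesis unfolding unital_ring_hom_def by blast
qed


lemma unital_ring_homD:
  assumes "unital_ring_hom f"
  shows "f 1 = 1" "f (x + y) = f x + f y" "f (x * y) = f x * f y" "f 0 = 0" "f (- x) = - f x"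
proof -
  show 1: "f 1 = 1" and 2: "\<And>x y. f (x + y) = f x + f y" and "f (x * y) = f x * f y"
    using assms by (auto simp: unital_ring_hom_def)
  show 3: "f 0 = 0" using 2[of 0 0] by simp
  show "f (- x) = - f x" using 2[of x "- x"] 3 by (simp add: eq_neg_iff_add_eq_0 add.commute)
qed

lemma qbar_exists: "\<exists>f. unital_ring_hom f \<and> f qq = ppi * inverse qq \<and> f ppi = ppi"
proof -
  obtain g :: "ratfun \<Rightarrow> ratfun" where g: "unital_ring_hom g"
    and gX: "g (Fract [:0, 1:] 1) = inverse (Fract [:0, 1:] 1)"
    using ratfun_hom_exists[of 1] by auto
  obtain h :: "ratfun \<Rightarrow> ratfun" where h: "unital_ring_hom h"
    and "h (Fract [:0, 1:] 1) = inverse (Fract [:0, - 1:] 1)"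
    using ratfun_hom_exists[of "- 1"] by auto
  moreover have "Fract [:0, - 1 :: rat:] 1 = - Fract [:0, 1:] 1" by simp
  ultimately have hX: "h (Fract [:0, 1:] 1) = - inverse (Fract [:0, 1:] 1)"
    by (simp del: minus_fract)
  note hom = unital_ring_homD[OF g] unital_ring_homD[OF h]
  have two: "(2 :: ratfun) \<noteq> 0"
    by (simp only: one_add_one[symmetric] One_fract_def Zero_fract_def) (simp add: eq_fract)
  have split: "x = y" if "pcoeff0 x + pcoeff1 x = pcoeff0 y + pcoeff1 y"
    "pcoeff0 x - pcoeff1 x = pcoeff0 y - pcoeff1 y" for x y :: qpi
  proof (rule pi_ext.expand)
    have "2 * pcoeff0 x = 2 * pcoeff0 y" "2 * pcoeff1 x = 2 * pcoeff1 y"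
      using arg_cong2[OF that, of "(+)"] arg_cong2[OF that, of "(-)"]
      by (simp_all add: mult_2 algebra_simps)
    with two show "pcoeff0 x = pcoeff0 y \<and> pcoeff1 x = pcoeff1 y" by simp
  qed
  define f where "f x = Pi_ext
      ((g (pcoeff0 x + pcoeff1 x) + h (pcoeff0 x - pcoeff1 x)) / 2)
      ((g (pcoeff0 x + pcoeff1 x) - h (pcoeff0 x - pcoeff1 x)) / 2)" for x :: qpi
  have f1: "pcoeff0 (f x) + pcoeff1 (f x) = g (pcoeff0 x + pcoeff1 x)"
    and f2: "pcoeff0 (f x) - pcoeff1 (f x) = h (pcoeff0 x - pcoeff1 x)" for x
    using two by (simp_all add: f_def add_divide_distrib[symmetric] diff_divide_distrib[symmetric])
  have m1: "pcoeff0 (x * y) + pcoeff1 (x * y) = (pcoeff0 x + pcoeff1 x) * (pcoeff0 y + pcoeff1 y)"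
    and m2: "pcoeff0 (x * y) - pcoeff1 (x * y) = (pcoeff0 x - pcoeff1 x) * (pcoeff0 y - pcoeff1 y)"
    and a1: "pcoeff0 (x + y) + pcoeff1 (x + y) = (pcoeff0 x + pcoeff1 x) + (pcoeff0 y + pcoeff1 y)"
    and a2: "pcoeff0 (x + y) - pcoeff1 (x + y) = (pcoeff0 x - pcoeff1 x) + (pcoeff0 y - pcoeff1 y)"
    for x y :: qpi
    by (simp_all add: times_pi_ext_def plus_pi_ext_def algebra_simps)
  have "f (x + y) = f x + f y" "f (x * y) = f x * f y" for x y
    by (rule split; simp only: f1 f2 m1 m2 a1 a2 hom)+
  moreover have "f 1 = 1"
    by (rule split; simp only: f1 f2) (simp_all add: one_pi_ext_def hom)
  moreover have "f ppi = ppi"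
    by (rule split; simp only: f1 f2) (simp_all add: ppi_def hom)
  moreover have "inverse (Pi_ext a 0) = Pi_ext (inverse a) 0" for a :: ratfun
    by (cases "a = 0") (simp_all add: inverse_pi_ext_def Let_def power2_eq_square field_simps)
  then have "f qq = ppi * inverse qq"
    by (intro split; simp only: f1 f2 m1 m2) (simp_all add: ppi_def qq_def gX hX)
  ultimately show ?thesis unfolding unital_ring_hom_def by blast
qed

lemma qbar_unique:
  assumes f: "unital_ring_hom f" "f qq = ppi * inverse qq" "f ppi = ppi"
    and f': "unital_ring_hom f'" "f' qq = ppi * inverse qq" "f' ppi = ppi"
  shows "f = (f' :: qpi \<Rightarrow> qpi)"
proof
  note hom = unital_ring_homD[OF f(1)] unital_ring_homD[OF f'(1)]
  have unit: "f y = f' y" if "f x = f' x" "x * y = 1" for x y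
  proof -
    have *: "f x * f y = 1" "f' x * f' y = 1"
      using hom(1,6) by (simp_all add: that(2) flip: hom(3,8))
    have "f y = f y * (f' x * f' y)" by (simp add: *)
    also have "\<dots> = (f x * f y) * f' y" by (simp add: that(1) ac_simps)
    finally show ?thesis by (simp add: *)
  qed
  let ?e = "\<lambda>a :: ratfun. Pi_ext a 0"
  have e_add: "?e (a + b) = ?e a + ?e b" and e_mult: "?e (a * b) = ?e a * ?e b" for a b
    by (simp_all add: plus_pi_ext_def times_pi_ext_def)
  have e_unit: "f (?e b) = f' (?e b)" if "f (?e a) = f' (?e a)" "a * b = 1" for a b
  proof (rule unit[OF that(1)])
    show "?e a * ?e b = 1" by (simp only: that(2) one_pi_ext_def flip: e_mult)
  qed
  have nat: "f (?e (of_nat n)) = f' (?e (of_nat n))" for n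
  proof (induction n)
    case 0
    then show ?case using hom by (simp add: zero_pi_ext_def[symmetric])
  next
    case (Suc n)
    then show ?case using hom by (simp add: e_add one_pi_ext_def[symmetric])
  qed
  have int: "f (?e (of_int n)) = f' (?e (of_int n))" for n
  proof (cases n)
    case (neg m)
    have "?e (of_int n) = - ?e (of_nat (Suc m))" by (simp add: neg uminus_pi_ext_def)
    then show ?thesis using nat[of "Suc m"] by (simp only: hom)
  qed (simp add: nat)
  have of_int: "Fract [:of_int n:] 1 = (of_int n :: ratfun)" for n
  proof -
    have *: "Fract [:of_nat m:] 1 = (of_nat m :: ratfun)" for m
    proof (induction m)
      case (Suc m)
      have "Fract [:of_nat (Suc m):] 1 = Fract [:of_nat m :: rat:] 1 + 1"
        by (simp add: One_fract_def one_pCons add.commute)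
      with Suc show ?case by (simp add: add.commute)
    qed (simp add: Zero_fract_def)
    show ?thesis
    proof (cases n)
      case (neg m)
      have "Fract [:of_int n:] 1 = - Fract [:of_nat (Suc m) :: rat:] 1" by (simp add: neg)
      then show ?thesis by (simp only: * neg of_int_minus of_int_of_nat_eq)
    next
      case (nonneg m)
      then show ?thesis using *[of m] by simp
    qed
  qed
  have rat: "f (?e (Fract [:r:] 1)) = f' (?e (Fract [:r:] 1))" for r
  proof (cases r)
    case (Fract a b)
    have "(of_int b :: ratfun) * Fract [:1 / of_int b:] 1 = 1"
      using Fract by (simp add: of_int[symmetric] One_fract_def one_pCons)
    from e_unit[OF int this] have "f (?e (Fract [:1 / of_int b:] 1)) = f' (?e (Fract [:1 / of_int b:] 1))" .
    moreover have "Fract [:r:] 1 = (of_int a :: ratfun) * Fract [:1 / of_int b:] 1"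
      using Fract by (simp add: of_int[symmetric] Fract_of_int_quotient)
    ultimately show ?thesis using int[of a] hom by (simp add: e_mult)
  qed
  have pol: "f (?e (Fract p 1)) = f' (?e (Fract p 1))" for p
  proof (induction p)
    case 0
    then show ?case using hom by (simp add: Zero_fract_def[symmetric] zero_pi_ext_def[symmetric])
  next
    case (pCons a p)
    have "?e (Fract (pCons a p) 1) = ?e (Fract [:a:] 1) + qq * ?e (Fract p 1)"
      by (simp add: qq_def flip: e_add e_mult)
    then show ?case using pCons rat[of a] f(2) f'(2) hom by simp
  qed
  have ratfun: "f (?e a) = f' (?e a)" for a
  proof (cases a)
    case (Fract p r)
    have "Fract r 1 * Fract 1 r = 1" using Fract by (simp add: One_fract_def eq_fract)
    from e_unit[OF pol this] have "f (?e (Fract 1 r)) = f' (?e (Fract 1 r))" .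
    moreover have "a = Fract p 1 * Fract 1 r" using Fract by simp
    ultimately show ?thesis using pol[of p] hom by (simp add: e_mult del: mult_fract)
  qed
  fix x
  have "x = ?e (pcoeff0 x) + ?e (pcoeff1 x) * ppi"
    by (rule pi_ext.expand) (simp add: plus_pi_ext_def times_pi_ext_def ppi_def)
  then have "f x = f (?e (pcoeff0 x) + ?e (pcoeff1 x) * ppi)"
    and "f' x = f' (?e (pcoeff0 x) + ?e (pcoeff1 x) * ppi)"
    by simp_all
  then show "f x = f' x" by (simp only: hom ratfun f(3) f'(3))
qed

lemma qbar:
  shows "unital_ring_hom qbar" "qbar qq = ppi * inverse qq" "qbar ppi = ppi"
proof -
  have "\<exists>!f. unital_ring_hom f \<and> f qq = ppi * inverse qq \<and> f ppi = ppi"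
    using qbar_exists qbar_unique by blast
  from theI'[OF this, folded qbar_def]
  show "unital_ring_hom qbar" "qbar qq = ppi * inverse qq" "qbar ppi = ppi" by auto
qed

section \<open>Finitely generated free abelian groups\<close>

definition zscale :: "int \<Rightarrow> 'a::ab_group_add \<Rightarrow> 'a" where
  "zscale k x = (\<Sum>_<nat k. x) - (\<Sum>_<nat (- k). x)"

lemma zscale_of_nat_diff: "zscale (int m - int n) x = (\<Sum>_<m. x) - (\<Sum>_<n. x)"
proof -
  have add: "(\<Sum>_<a + b. x) = (\<Sum>_<a. x) + (\<Sum>_<b. x)" for a b :: nat
    by (induction b) (auto simp: algebra_simps)
  show ?thesis
  proof (cases "m \<le> n")
    case True
    then obtain k where "n = m + k" using le_Suc_ex by blast
    then show ?thesis by (simp add: zscale_def add)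
  next
    case False
    then obtain k where "m = n + k" using le_Suc_ex nat_le_linear by blast
    then show ?thesis by (simp add: zscale_def add)
  qed
qed

interpretation zmod: Modules.module zscale
proof
  have add: "(\<Sum>_<a + b. x) = (\<Sum>_<a. x) + (\<Sum>_<b. x)" for a b :: nat and x :: 'a
    by (induction b) (auto simp: algebra_simps)
  have mult: "(\<Sum>_<a * b. x) = (\<Sum>_<a. \<Sum>_<b. x)" for a b :: nat and x :: 'a
    by (induction a) (auto simp: algebra_simps add)
  fix a b :: int and x y :: 'a
  obtain m n where a: "a = int m - int n" by (cases a rule: int_diff_cases) auto
  obtain k l where b: "b = int k - int l" by (cases b rule: int_diff_cases) auto
  show "zscale a (x + y) = zscale a x + zscale a y"
    by (simp add: zscale_def sum.distrib algebra_simps)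
  have "a + b = int (m + k) - int (n + l)" by (simp add: a b)
  then show "zscale (a + b) x = zscale a x + zscale b x"
    by (simp only: zscale_of_nat_diff a b add) (simp add: algebra_simps)
  have "a * b = int (m * k + n * l) - int (m * l + n * k)" by (simp add: a b algebra_simps)
  then show "zscale a (zscale b x) = zscale (a * b) x"
    by (simp only: zscale_of_nat_diff a b add mult sum_subtractf) (simp add: algebra_simps)
  show "zscale 1 x = x" by (simp add: zscale_def)
qed

definition fg_free_abelian :: "'a::ab_group_add itself \<Rightarrow> bool" where
  "fg_free_abelian _ \<longleftrightarrow>
     (\<exists>B :: 'a set. finite B \<and> zmod.independent B \<and> zmod.span B = UNIV)"

section \<open>Super Cartan data, root data and parameters\<close>

text \<open>The finite set \<open>I\<close> is the type \<open>'i\<close>; a bilinear form on \<open>\<int>[I]\<close> is given by its values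
  on \<open>I\<close>.\<close>

record ('i, 'x, 'y) root_datum =
  form :: "'i \<Rightarrow> 'i \<Rightarrow> int"
  odds :: "'i set"
  pairing :: "'y \<Rightarrow> 'x \<Rightarrow> int"
  root :: "'i \<Rightarrow> 'x"
  coroot :: "'i \<Rightarrow> 'y"

definition dd :: "('i, 'x, 'y, 'm) root_datum_scheme \<Rightarrow> 'i \<Rightarrow> nat" where
  "dd D i = nat (form D i i div 2)"

definition cartan :: "('i, 'x, 'y, 'm) root_datum_scheme \<Rightarrow> 'i \<Rightarrow> 'i \<Rightarrow> int" where
  "cartan D i j = 2 * form D i j div form D i i"

definition par :: "('i, 'x, 'y, 'm) root_datum_scheme \<Rightarrow> 'i \<Rightarrow> nat" where
  "par D i = of_bool (i \<in> odds D)"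

text \<open>The divisibility assumptions make the truncating \<open>div\<close> in \<open>dd\<close> and \<open>cartan\<close> exact.\<close>

definition super_cartan_datum :: "('i::finite, 'x, 'y, 'm) root_datum_scheme \<Rightarrow> bool" where
  "super_cartan_datum D \<longleftrightarrow>
     odds D \<noteq> {} \<and>
     (\<forall>i j. form D i j = form D j i) \<and>
     (\<forall>i. form D i i > 0 \<and> even (form D i i)) \<and>
     (\<forall>i j. i \<noteq> j \<longrightarrow> form D i i dvd 2 * form D i j \<and> cartan D i j \<le> 0) \<and>
     (\<forall>i j. i \<in> odds D \<longrightarrow> even (cartan D i j)) \<and>
     (\<forall>i. dd D i mod 2 = par D i)"

definition perfect_pairing :: "('y::ab_group_add \<Rightarrow> 'x::ab_group_add \<Rightarrow> int) \<Rightarrow> bool" where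
  "perfect_pairing b \<longleftrightarrow>
     (\<forall>x. additive (\<lambda>y. b y x)) \<and> (\<forall>y. additive (b y)) \<and>
     (\<forall>f. additive f \<longrightarrow> (\<exists>!x. \<forall>y. b y x = f y)) \<and>
     (\<forall>f. additive f \<longrightarrow> (\<exists>!y. \<forall>x. b y x = f x))"

definition super_root_datum ::
    "('i::finite, 'x::ab_group_add, 'y::ab_group_add, 'm) root_datum_scheme \<Rightarrow> bool" where
  "super_root_datum D \<longleftrightarrow>
     super_cartan_datum D \<and>
     fg_free_abelian TYPE('x) \<and> fg_free_abelian TYPE('y) \<and>
     perfect_pairing (pairing D) \<and>
     inj (root D) \<and> zmod.independent (range (root D)) \<and>
     inj (coroot D) \<and> zmod.independent (range (coroot D)) \<and>
     (\<forall>i j. pairing D (coroot D i) (root D j) = cartan D i j)"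

definition qi :: "('i, 'x, 'y, 'm) root_datum_scheme \<Rightarrow> 'i \<Rightarrow> qpi" where
  "qi D i = qq ^ dd D i"

definition ppii :: "('i, 'x, 'y, 'm) root_datum_scheme \<Rightarrow> 'i \<Rightarrow> qpi" where
  "ppii D i = ppi ^ par D i"

record ('i, 'x, 'y) isatake_datum = "('i, 'x, 'y) root_datum" +
  tau :: "'i \<Rightarrow> 'i"
  tauX :: "'x \<Rightarrow> 'x"
  tauY :: "'y \<Rightarrow> 'y"
  varsigma :: "'i \<Rightarrow> qpi"

definition diagram_involution ::
    "('i::finite, 'x::ab_group_add, 'y::ab_group_add, 'm) isatake_datum_scheme \<Rightarrow> bool" where
  "diagram_involution D \<longleftrightarrow>
     (\<forall>i. tau D (tau D i) = i) \<and>
     (\<forall>i j. form D (tau D i) (tau D j) = form D i j) \<and>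
     additive (tauX D) \<and> (\<forall>x. tauX D (tauX D x) = x) \<and>
     additive (tauY D) \<and> (\<forall>y. tauY D (tauY D y) = y) \<and>
     (\<forall>i. tauX D (root D i) = root D (tau D i)) \<and>
     (\<forall>i. tauY D (coroot D i) = coroot D (tau D i)) \<and>
     (\<forall>x y. pairing D (tauY D y) (tauX D x) = pairing D y x)"

definition admissible_parameters ::
    "('i::finite, 'x::ab_group_add, 'y::ab_group_add, 'm) isatake_datum_scheme \<Rightarrow> bool" where
  "admissible_parameters D \<longleftrightarrow>
     (\<forall>i. varsigma D i dvd 1) \<and>
     (\<forall>i. tau D i = i \<and> (\<exists>j. j \<noteq> i \<and> cartan D i j \<noteq> 0) \<longrightarrow>
        qbar (varsigma D i * qi D i) = varsigma D i * qi D i) \<and>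
     (\<forall>i. tau D i \<noteq> i \<and> cartan D i (tau D i) = 0 \<longrightarrow>
        qbar (varsigma D i) = varsigma D i \<and> varsigma D i = varsigma D (tau D i)) \<and>
     (\<forall>i. tau D i \<noteq> i \<and> cartan D i (tau D i) \<noteq> 0 \<longrightarrow>
        varsigma D (tau D i) =
          ppii D i * qi D i powi (- cartan D i (tau D i)) * qbar (varsigma D i))"

section \<open>Quantum integers\<close>

definition qint :: "('i, 'x, 'y, 'm) root_datum_scheme \<Rightarrow> 'i \<Rightarrow> nat \<Rightarrow> qpi" where
  "qint D i n = ((ppii D i * qi D i) ^ n - inverse (qi D i) ^ n) /
                (ppii D i * qi D i - inverse (qi D i))"

definition qfact :: "('i, 'x, 'y, 'm) root_datum_scheme \<Rightarrow> 'i \<Rightarrow> nat \<Rightarrow> qpi" where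
  "qfact D i n = (\<Prod>k=1..n. qint D i k)"

definition qbinom :: "('i, 'x, 'y, 'm) root_datum_scheme \<Rightarrow> 'i \<Rightarrow> nat \<Rightarrow> nat \<Rightarrow> qpi" where
  "qbinom D i m n = qfact D i m / (qfact D i n * qfact D i (m - n))"

section \<open>The quantum covering group\<close>

text \<open>The free monoid, written additively so that finitely supported functions on it
  (\<open>\<Rightarrow>\<^sub>0\<close>, with convolution) form the free associative algebra.\<close>

datatype 'g word = Word (letters: "'g list")

instantiation word :: (type) monoid_add
begin

definition "0 = Word []"
definition "u + v = Word (letters u @ letters v)"

instance
  by standard (auto simp: zero_word_def plus_word_def)

end

datatype ('i, 'y) generator = gen_E 'i | gen_F 'i | gen_K 'y | gen_J 'y

type_synonym ('i, 'y) free_alg = "('i, 'y) generator word \<Rightarrow>\<^sub>0 qpi"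

definition free_ring :: "('i, 'y) free_alg ring" where
  "free_ring = \<lparr>carrier = UNIV, monoid.mult = (*), one = 1, zero = 0, add = (+)\<rparr>"

definition scal :: "qpi \<Rightarrow> ('i, 'y) free_alg" where
  "scal c = Poly_Mapping.single 0 c"

definition gen :: "('i, 'y) generator \<Rightarrow> ('i, 'y) free_alg" where
  "gen g = Poly_Mapping.single (Word [g]) 1"

abbreviation "fE i \<equiv> gen (gen_E i)"
abbreviation "fF i \<equiv> gen (gen_F i)"
abbreviation "fK \<mu> \<equiv> gen (gen_K \<mu>)"
abbreviation "fJ \<mu> \<equiv> gen (gen_J \<mu>)"

definition serre ::
    "('i, 'x, 'y, 'm) root_datum_scheme \<Rightarrow> ('i \<Rightarrow> ('i, 'y) free_alg) \<Rightarrow> 'i \<Rightarrow> 'i \<Rightarrow> ('i, 'y) free_alg"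
  where
  "serre D x i j = (let m = nat (1 - cartan D i j) in
     \<Sum>n=0..m. scal ((- 1) ^ n * ppii D i ^ (n * par D j + (n choose 2)) * qbinom D i m n)
              * x i ^ n * x j * x i ^ (m - n))"

text \<open>A relation \<open>u = v\<close> is recorded as the element \<open>u - v\<close>.\<close>

inductive_set relators ::
    "('i, 'x, 'y::ab_group_add, 'm) root_datum_scheme \<Rightarrow> ('i, 'y) free_alg set"
  for D where
  K_zero: "fK 0 - 1 \<in> relators D"
| K_add: "fK \<mu> * fK \<nu> - fK (\<mu> + \<nu>) \<in> relators D"
| J_double: "fJ (\<mu> + \<mu>) - 1 \<in> relators D"
| J_add: "fJ \<mu> * fJ \<nu> - fJ (\<mu> + \<nu>) \<in> relators D"
| J_K: "fJ \<mu> * fK \<nu> - fK \<nu> * fJ \<mu> \<in> relators D"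
| K_E: "fK \<mu> * fE i - scal (qq powi pairing D \<mu> (root D i)) * fE i * fK \<mu> \<in> relators D"
| J_E: "fJ \<mu> * fE i - scal (ppi powi pairing D \<mu> (root D i)) * fE i * fJ \<mu> \<in> relators D"
| K_F: "fK \<mu> * fF i - scal (qq powi (- pairing D \<mu> (root D i))) * fF i * fK \<mu> \<in> relators D"
| J_F: "fJ \<mu> * fF i - scal (ppi powi (- pairing D \<mu> (root D i))) * fF i * fJ \<mu> \<in> relators D"
| E_F: "fE i * fF j - scal (ppi ^ (par D i * par D j)) * fF j * fE i
      - (if i = j
         then scal (1 / (ppii D i * qi D i - inverse (qi D i))) *
           (let \<kappa> = zscale (int (dd D i)) (coroot D i) in fJ \<kappa> * fK \<kappa> - fK (- \<kappa>))
         else 0) \<in> relators D"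
| serre_E: "i \<noteq> j \<Longrightarrow> serre D fE i j \<in> relators D"
| serre_F: "i \<noteq> j \<Longrightarrow> serre D fF i j \<in> relators D"

type_synonym ('i, 'y) Uelem = "('i, 'y) free_alg set"

definition relator_ideal ::
    "('i, 'x, 'y::ab_group_add, 'm) root_datum_scheme \<Rightarrow> ('i, 'y) free_alg set" where
  "relator_ideal D = Idl\<^bsub>free_ring\<^esub> (relators D)"

definition U ::
    "('i, 'x, 'y::ab_group_add, 'm) root_datum_scheme \<Rightarrow> ('i, 'y) Uelem ring" where
  "U D = free_ring Quot relator_ideal D"

definition cls ::
    "('i, 'x, 'y::ab_group_add, 'm) root_datum_scheme \<Rightarrow> ('i, 'y) free_alg \<Rightarrow> ('i, 'y) Uelem" where
  "cls D a = relator_ideal D +>\<^bsub>free_ring\<^esub> a"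

abbreviation "UE D i \<equiv> cls D (fE i)"
abbreviation "UF D i \<equiv> cls D (fF i)"
abbreviation "UK D \<mu> \<equiv> cls D (fK \<mu>)"
abbreviation "UJ D \<mu> \<equiv> cls D (fJ \<mu>)"
abbreviation "Ktilde D i \<equiv> UK D (zscale (int (dd D i)) (coroot D i))"
abbreviation "Ktilde_inv D i \<equiv> UK D (- zscale (int (dd D i)) (coroot D i))"
abbreviation "Jtilde D i \<equiv> UJ D (zscale (int (dd D i)) (coroot D i))"

definition smultU ::
    "('i, 'x, 'y::ab_group_add, 'm) root_datum_scheme \<Rightarrow> qpi \<Rightarrow> ('i, 'y) Uelem \<Rightarrow> ('i, 'y) Uelem" where
  "smultU D c u = cls D (scal c) \<otimes>\<^bsub>U D\<^esub> u"

definition subalgebra_gen ::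
    "('i, 'x, 'y::ab_group_add, 'm) root_datum_scheme \<Rightarrow> ('i, 'y) Uelem set \<Rightarrow> ('i, 'y) Uelem set" where
  "subalgebra_gen D S = generate_ring (U D) (range (\<lambda>c. cls D (scal c)) \<union> S)"

definition lin_span ::
    "('i, 'x, 'y::ab_group_add, 'm) root_datum_scheme \<Rightarrow> ('i, 'y) Uelem set \<Rightarrow> ('i, 'y) Uelem set" where
  "lin_span D S = generate (add_monoid (U D)) {smultU D c s | c s. s \<in> S}"

definition U_minus ::
    "('i, 'x, 'y::ab_group_add, 'm) root_datum_scheme \<Rightarrow> ('i, 'y) Uelem set" where
  "U_minus D = subalgebra_gen D (range (UF D))"

definition U_zero ::
    "('i, 'x, 'y::ab_group_add, 'm) root_datum_scheme \<Rightarrow> ('i, 'y) Uelem set" where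
  "U_zero D = subalgebra_gen D (range (UK D) \<union> range (UJ D))"

definition E_monomial ::
    "('i, 'x, 'y::ab_group_add, 'm) root_datum_scheme \<Rightarrow> 'i list \<Rightarrow> ('i, 'y) Uelem" where
  "E_monomial D w = foldr (\<lambda>i u. UE D i \<otimes>\<^bsub>U D\<^esub> u) w \<one>\<^bsub>U D\<^esub>"

text \<open>Elements of \<open>\<nat>[I]\<close> are functions \<open>'i \<Rightarrow> nat\<close>.\<close>

definition U_plus ::
    "('i, 'x, 'y::ab_group_add, 'm) root_datum_scheme \<Rightarrow> ('i \<Rightarrow> nat) \<Rightarrow> ('i, 'y) Uelem set" where
  "U_plus D \<mu> = lin_span D {E_monomial D w | w. \<forall>i. count_list w i = \<mu> i}"

definition ht :: "('i::finite \<Rightarrow> nat) \<Rightarrow> nat" where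
  "ht \<mu> = (\<Sum>i\<in>UNIV. \<mu> i)"

definition weight_par :: "('i::finite, 'x, 'y, 'm) root_datum_scheme \<Rightarrow> ('i \<Rightarrow> nat) \<Rightarrow> nat" where
  "weight_par D \<mu> = (\<Sum>i\<in>UNIV. \<mu> i * par D i)"

definition bar_involution ::
    "('i, 'x, 'y::ab_group_add, 'm) root_datum_scheme \<Rightarrow> (('i, 'y) Uelem \<Rightarrow> ('i, 'y) Uelem) \<Rightarrow> bool" where
  "bar_involution D \<psi> \<longleftrightarrow>
     \<psi> \<in> ring_hom (U D) (U D) \<and>
     (\<forall>c. \<forall>u\<in>carrier (U D). \<psi> (smultU D c u) = smultU D (qbar c) (\<psi> u)) \<and>
     (\<forall>i. \<psi> (UE D i) = UE D i \<and> \<psi> (UF D i) = UF D i) \<and>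
     (\<forall>\<mu>. \<psi> (UJ D \<mu>) = UJ D \<mu> \<and> \<psi> (UK D \<mu>) = UJ D \<mu> \<otimes>\<^bsub>U D\<^esub> UK D (- \<mu>))"

section \<open>The completion\<close>

definition filtration ::
    "('i::finite, 'x, 'y::ab_group_add, 'm) root_datum_scheme \<Rightarrow> nat \<Rightarrow> ('i, 'y) Uelem set" where
  "filtration D N = lin_span D
     {y \<otimes>\<^bsub>U D\<^esub> z \<otimes>\<^bsub>U D\<^esub> x | y z x.
        y \<in> U_minus D \<and> z \<in> U_zero D \<and> (\<exists>\<mu>. ht \<mu> \<ge> N \<and> x \<in> U_plus D \<mu>)}"

definition cauchy_ring ::
    "('i::finite, 'x, 'y::ab_group_add, 'm) root_datum_scheme \<Rightarrow> (nat \<Rightarrow> ('i, 'y) Uelem) ring" where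
  "cauchy_ring D =
     \<lparr>carrier = {s. range s \<subseteq> carrier (U D) \<and>
                    (\<forall>N. \<exists>k. \<forall>m\<ge>k. \<forall>n\<ge>k. s m \<ominus>\<^bsub>U D\<^esub> s n \<in> filtration D N)},
      monoid.mult = (\<lambda>s t n. s n \<otimes>\<^bsub>U D\<^esub> t n), one = (\<lambda>_. \<one>\<^bsub>U D\<^esub>),
      zero = (\<lambda>_. \<zero>\<^bsub>U D\<^esub>), add = (\<lambda>s t n. s n \<oplus>\<^bsub>U D\<^esub> t n)\<rparr>"

definition null_sequences ::
    "('i::finite, 'x, 'y::ab_group_add, 'm) root_datum_scheme \<Rightarrow> (nat \<Rightarrow> ('i, 'y) Uelem) set" where
  "null_sequences D =
     {s \<in> carrier (cauchy_ring D). \<forall>N. \<exists>k. \<forall>n\<ge>k. s n \<in> filtration D N}"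

text \<open>The completion of \<open>U\<close> with respect to the filtration, as Cauchy sequences modulo null
  sequences. Termwise multiplication of sequences is the continuous extension of the
  multiplication of \<open>U\<close>.\<close>

definition U_hat ::
    "('i::finite, 'x, 'y::ab_group_add, 'm) root_datum_scheme \<Rightarrow> (nat \<Rightarrow> ('i, 'y) Uelem) set ring" where
  "U_hat D = cauchy_ring D Quot null_sequences D"

definition hat_lim ::
    "('i::finite, 'x, 'y::ab_group_add, 'm) root_datum_scheme \<Rightarrow> (nat \<Rightarrow> ('i, 'y) Uelem) \<Rightarrow>
     (nat \<Rightarrow> ('i, 'y) Uelem) set" where
  "hat_lim D s = null_sequences D +>\<^bsub>cauchy_ring D\<^esub> s"

definition to_hat ::
    "('i::finite, 'x, 'y::ab_group_add, 'm) root_datum_scheme \<Rightarrow> ('i, 'y) Uelem \<Rightarrow>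
     (nat \<Rightarrow> ('i, 'y) Uelem) set" where
  "to_hat D u = hat_lim D (\<lambda>_. u)"

definition hat_sum ::
    "('i::finite, 'x, 'y::ab_group_add, 'm) root_datum_scheme \<Rightarrow> (('i \<Rightarrow> nat) \<Rightarrow> ('i, 'y) Uelem) \<Rightarrow>
     (nat \<Rightarrow> ('i, 'y) Uelem) set" where
  "hat_sum D \<Upsilon> = hat_lim D (\<lambda>n. finsum (U D) \<Upsilon> {\<mu>. ht \<mu> \<le> n})"

section \<open>The \<open>\<iota>\<close>quantum covering group\<close>

definition Y_iota ::
    "('i, 'x, 'y::ab_group_add, 'm) isatake_datum_scheme \<Rightarrow> 'y set" where
  "Y_iota D = {\<mu>. tauY D \<mu> = - \<mu>}"

definition UB ::
    "('i, 'x, 'y::ab_group_add, 'm) isatake_datum_scheme \<Rightarrow> 'i \<Rightarrow> ('i, 'y) Uelem" where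
  "UB D i = UF D i \<oplus>\<^bsub>U D\<^esub>
     smultU D (varsigma D i) (UE D (tau D i) \<otimes>\<^bsub>U D\<^esub> Ktilde_inv D i)"

definition U_iota ::
    "('i, 'x, 'y::ab_group_add, 'm) isatake_datum_scheme \<Rightarrow> ('i, 'y) Uelem set" where
  "U_iota D = subalgebra_gen D (range (UB D) \<union> range (Jtilde D) \<union> UK D ` Y_iota D)"

text \<open>The codomain is \<open>U\<close>, not \<open>U_iota\<close>: \<open>J\<^sub>\<mu> K\<^sub>-\<^sub>\<mu>\<close> with \<open>\<mu>\<close> in \<open>Y_iota\<close> need not lie in
  \<open>U_iota\<close>, for instance if \<open>\<mu>\<close> is the difference of two even simple coroots exchanged by
  \<open>tau\<close>. Every semilinear automorphism of \<open>U_iota\<close> with the prescribed values on generators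
  satisfies this predicate.\<close>

definition ibar_involution ::
    "('i, 'x, 'y::ab_group_add, 'm) isatake_datum_scheme \<Rightarrow> (('i, 'y) Uelem \<Rightarrow> ('i, 'y) Uelem) \<Rightarrow> bool" where
  "ibar_involution D \<psi> \<longleftrightarrow>
     \<psi> \<in> ring_hom ((U D)\<lparr>carrier := U_iota D\<rparr>) (U D) \<and>
     (\<forall>c. \<forall>u\<in>U_iota D. \<psi> (smultU D c u) = smultU D (qbar c) (\<psi> u)) \<and>
     (\<forall>i. \<psi> (UB D i) = UB D i \<and> \<psi> (Jtilde D i) = Jtilde D i) \<and>
     (\<forall>\<mu>\<in>Y_iota D. \<psi> (UK D \<mu>) = UJ D \<mu> \<otimes>\<^bsub>U D\<^esub> UK D (- \<mu>))"

definition quasi_K_matrix ::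
    "('i::finite, 'x, 'y::ab_group_add, 'm) isatake_datum_scheme \<Rightarrow>
     (('i, 'y) Uelem \<Rightarrow> ('i, 'y) Uelem) \<Rightarrow> (('i, 'y) Uelem \<Rightarrow> ('i, 'y) Uelem) \<Rightarrow>
     (('i \<Rightarrow> nat) \<Rightarrow> ('i, 'y) Uelem) \<Rightarrow> bool" where
  "quasi_K_matrix D \<psi> \<psi>\<^sub>\<iota> \<Upsilon> \<longleftrightarrow>
     (\<forall>\<mu>. \<Upsilon> \<mu> \<in> U_plus D \<mu>) \<and>
     \<Upsilon> (\<lambda>_. 0) = \<one>\<^bsub>U D\<^esub> \<and>
     (\<forall>u\<in>U_iota D. to_hat D (\<psi>\<^sub>\<iota> u) \<otimes>\<^bsub>U_hat D\<^esub> hat_sum D \<Upsilon>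
                  = hat_sum D \<Upsilon> \<otimes>\<^bsub>U_hat D\<^esub> to_hat D (\<psi> u))"

end

theory Submission
  imports Defs "HOL-Library.Function_Algebras"
begin

text \<open>Let \<open>'f\<close> be the free algebra on the \<open>\<theta>\<^sub>i\<close>, with its skew derivations \<open>ld i\<close>, \<open>rd i\<close> and
  the bilinear form they define. Commuting \<open>\<Upsilon>\<close> past \<open>F\<^sub>i\<close> turns the identity for
  \<open>u = B\<^sub>i\<close> into recursions for \<open>ld i (\<Upsilon> \<mu>)\<close> and \<open>rd i (\<Upsilon> \<mu>)\<close> in terms of
  \<open>\<Upsilon> (\<mu> - i - \<tau> i)\<close>. A solution is the family representing, through the form, the functional
  \<open>Phi\<close> given by one of the two recursions; it satisfies the other one because the parameters match
  them up and \<open>Phi\<close> kills the Serre elements. That identities verified against the form hold modulo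
  the Serre relations is the theorem that the radical of the form is the Serre ideal; as in Gabber and
  Kac, a Casimir operator on the Verma module of highest weight zero acts on a primitive vector of
  weight \<open>\<mu>\<close> (antidominant modulo the Serre relations, by local nilpotence) through a power of
  \<open>q\<close> that is trivial only if \<open>\<mu> = 0\<close>.

  For uniqueness, two solutions are compared on a universal Verma module over the group ring of \<open>Y\<close>, where the action of \<open>\<Upsilon>\<close> is determined recursively by the
  \<open>B\<^sub>i\<close>; the lowest exponent of \<open>x v\<close> for \<open>x\<close> in the positive part is, up to a unit, the pairing
  of \<open>x\<close> with \<open>v\<close>, so the difference lies in the radical.

  The two recursions are incompatible when \<open>i\<close> is odd, \<open>\<tau> i \<noteq> i\<close> and
  \<open>a\<^sub>i\<^sub>,\<^sub>\<tau>\<^sub>i = 0\<close>; but then no bar involution of the \<open>\<iota>\<close>quantum covering group exists.\<close>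

section \<open>The ground ring\<close>

text \<open>The scalars form a product of two fields, with zero divisors 1 - \<pi> and 1 + \<pi>.
  Cancellation is therefore always by an explicit unit, and nearly all units come from 1 - \<pi>^b
  q^a with a \<noteq> 0. The definition of \<open>U D\<close> by generators and relations gives no
  lower bound on its size: neither a triangular decomposition nor even that U does not collapse is
  built in. The two halves of the theorem need opposite information. Existence asks for membership
  in \<open>relator_ideal D\<close>; it suffices that an element of 'f orthogonal to everything
  follows from the Serre relations (\<open>Rad_Ser\<close>). Uniqueness draws conclusions from
  membership, and these are read off from a module on which the ideal acts into the radical
  (\<open>act_II\<close>). All computations take place on representatives in free algebras, each
  identity up to an ideal or a stable subgroup of errors, so that operators need not be descended to
  quotients.\<close>

abbreviation qX :: ratfun where "qX \<equiv> Fract [:0, 1:] 1"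

definition qpow :: "int \<Rightarrow> qpi" where "qpow n = Pi_ext (qX powi n) 0"
definition ppow :: "nat \<Rightarrow> qpi" where "ppow n = ppi ^ n"

lemma Pi_ext_0_mult: "Pi_ext a 0 * Pi_ext b 0 = Pi_ext (a * b) 0"
  by (simp add: times_pi_ext_def)

lemma qX_nonzero [simp]: "qX \<noteq> 0"
  by (simp add: Zero_fract_def eq_fract)

lemma qX_power: "qX ^ n = Fract (monom 1 n) 1"
  by (induction n) (auto simp: One_fract_def monom_Suc monom_0 mult_fract one_pCons)

lemma qX_powi_eq_1: "qX powi n = 1 \<longleftrightarrow> n = 0"
proof -
  have *: "qX ^ m = 1 \<longleftrightarrow> m = 0" for m
    by (simp add: qX_power One_fract_def eq_fract monom_eq_1_iff)
  show ?thesis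
  proof (cases "n \<ge> 0")
    case False
    then have "qX powi n = inverse (qX ^ nat (- n))" by (simp only: power_int_def if_False power_inverse)
    then show ?thesis using False * by (simp only: inverse_eq_1_iff) simp
  qed (simp add: power_int_def *)
qed

lemma qpow_0 [simp]: "qpow 0 = 1"
  by (simp add: qpow_def one_pi_ext_def)

lemma qpow_add: "qpow (a + b) = qpow a * qpow b"
  by (simp add: qpow_def Pi_ext_0_mult power_int_add)

lemma qpow_uminus: "qpow a * qpow (- a) = 1"
  by (simp flip: qpow_add)

lemma qq_qpow: "qq = qpow 1"
  by (simp add: qq_def qpow_def)

lemma qpow_power: "qpow a ^ n = qpow (a * int n)"
  by (induction n) (auto simp: algebra_simps qpow_add)

lemma inverse_Pi_ext_0: "inverse (Pi_ext a 0) = Pi_ext (inverse a) (0 :: 'a::field)"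
  by (cases "a = 0") (simp_all add: inverse_pi_ext_def Let_def power2_eq_square field_simps)

lemma inverse_qpow: "inverse (qpow a) = qpow (- a)"
  by (simp add: qpow_def inverse_Pi_ext_0 power_int_minus)

lemma qpow_powi: "qpow a powi n = qpow (a * n)"
  by (cases "n \<ge> 0") (auto simp: power_int_def inverse_qpow qpow_power)

lemma qq_powi: "qq powi n = qpow n"
  by (simp add: qq_qpow qpow_powi)

lemma ppow_0 [simp]: "ppow 0 = 1"
  by (simp add: ppow_def)

lemma ppow_add: "ppow (a + b) = ppow a * ppow b"
  by (simp add: ppow_def power_add)

lemma ppi_square: "ppi * ppi = 1"
  by (simp add: ppi_def times_pi_ext_def one_pi_ext_def)

lemma ppow_square [simp]: "ppow a * ppow a = 1"
  by (simp add: ppow_def ppi_square flip: power_mult_distrib)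

lemma ppow_square' [simp]: "ppow a * (ppow a * c) = c"
  by (simp flip: mult.assoc)

lemma ppow_even: "even n \<Longrightarrow> ppow n = 1"
  by (auto elim!: evenE simp: ppow_def power_mult power2_eq_square ppi_square)

lemma ppow_odd: "odd n \<Longrightarrow> ppow n = ppi"
  by (auto elim!: oddE simp: ppow_def power_add power_mult power2_eq_square ppi_square)

lemma ppow_cong: "even m = even n \<Longrightarrow> ppow m = ppow n"
  by (cases "even m") (simp_all add: ppow_even ppow_odd)

lemma inverse_ppi: "inverse ppi = ppi"
  by (simp add: ppi_def inverse_pi_ext_def)

lemma ppi_powi: "ppi powi n = ppow (nat \<bar>n\<bar>)"
  by (auto simp: power_int_def ppow_def inverse_ppi nat_mult_distrib abs_if)

subsection \<open>Units\<close>

text \<open>a^2 - b^2 is the norm of a + b \<pi>. It is multiplicative, and (a - b \<pi>) / (a^2 -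
  b^2) is the inverse if it does not vanish.\<close>

lemma unit_iff_norm: "(x :: 'a::field pi_ext) dvd 1 \<longleftrightarrow> pcoeff0 x ^ 2 \<noteq> pcoeff1 x ^ 2"
proof
  assume "x dvd 1"
  then obtain y where y: "x * y = 1" by (auto simp: dvd_def)
  obtain a b where x: "x = Pi_ext a b" by (cases x)
  obtain c d where yy: "y = Pi_ext c d" by (cases y)
  have e: "a * c + b * d = 1" "a * d + b * c = 0"
    using y by (auto simp: x yy one_pi_ext_def times_pi_ext_def)
  have "(a ^ 2 - b ^ 2) * (c ^ 2 - d ^ 2) = (a * c + b * d) ^ 2 - (a * d + b * c) ^ 2"
    by (simp add: power2_eq_square algebra_simps)
  then show "pcoeff0 x ^ 2 \<noteq> pcoeff1 x ^ 2" using e by (auto simp: x)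
next
  assume n: "pcoeff0 x ^ 2 \<noteq> pcoeff1 x ^ 2"
  obtain a b where x: "x = Pi_ext a b" by (cases x)
  define n where "n = a ^ 2 - b ^ 2"
  have "n \<noteq> 0" using n by (simp add: n_def x)
  then have 1: "x * Pi_ext (a / n) (- b / n) = 1"
    by (simp add: x one_pi_ext_def times_pi_ext_def field_simps)
       (simp add: n_def power2_eq_square algebra_simps)
  show "x dvd 1" by (rule dvdI[OF 1[symmetric]])
qed

lemma unit_qpow [simp]: "qpow a dvd 1"
  using dvdI[of 1 "qpow a" "qpow (- a)"] by (simp add: qpow_uminus)

lemma unit_ppow [simp]: "ppow a dvd 1"
  using dvdI[of 1 "ppow a" "ppow a"] by simp

text \<open>The conjugate 1 + \<pi>^b q^a eliminates \<pi>, because \<pi>^(2b) = 1; the product 1 -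
  q^(2a) is a nonzero rational function. The denominators \<open>hh\<close>, the quantum integers
  and the last factor of the Casimir argument are units for this reason.\<close>

lemma unit_one_minus: "a \<noteq> 0 \<Longrightarrow> (1 - ppow b * qpow a) dvd 1"
proof -
  assume a: "a \<noteq> 0"
  have "(1 - ppow b * qpow a) * (1 + ppow b * qpow a) = 1 - (ppow b * ppow b) * qpow (a + a)"
    by (simp only: qpow_add) (simp add: algebra_simps)
  also have "\<dots> = 1 - qpow (2 * a)" by simp
  also have "\<dots> dvd 1"
    unfolding unit_iff_norm using a
    by (simp add: qpow_def one_pi_ext_def minus_pi_ext_def qX_powi_eq_1)
  finally show ?thesis by (rule dvd_mult_left)
qed

lemma unit_mult: "(a :: qpi) dvd 1 \<Longrightarrow> b dvd 1 \<Longrightarrow> a * b dvd 1"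
  using mult_dvd_mono[of a 1 b 1] by simp

lemma unit_neg: "(a :: qpi) dvd 1 \<Longrightarrow> - a dvd 1"
  by simp

lemma unit_inverse: "(a :: qpi) dvd 1 \<Longrightarrow> inverse a dvd 1"
  using dvdI[of 1 "inverse a" a] pi_ext_mult_inverse[of a] by (simp add: mult.commute)

lemma unit_prod: "(\<And>i. i \<in> A \<Longrightarrow> f i dvd (1 :: qpi)) \<Longrightarrow> prod f A dvd 1"
  by (induction A rule: infinite_finite_induct) (auto intro: unit_mult)

lemma unit_power: "(a :: qpi) dvd 1 \<Longrightarrow> a ^ n dvd 1"
  by (induction n) (auto intro: unit_mult)

lemma unit_cancel:
  assumes "(a :: qpi) dvd 1" "a * b = a * c" shows "b = c"
proof -
  have *: "x = inverse a * (a * x)" for x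
    using pi_ext_mult_inverse[OF assms(1)] by (simp add: mult.assoc[symmetric] mult.commute[of "inverse a"])
  show ?thesis using *[of b] *[of c] assms(2) by simp
qed

lemma inverse_unique_ring:
  fixes a :: "'a::comm_monoid_mult"
  assumes "a * b = 1" "a * c = 1" shows "b = c"
proof -
  have "b = b * (a * c)" using assms by simp
  also have "\<dots> = (a * b) * c" by (simp only: mult_ac)
  finally show ?thesis using assms by simp
qed

lemma unit_two: "(2 :: qpi) dvd 1"
proof -
  have "(2 :: ratfun) \<noteq> 0"
    by (simp only: one_add_one[symmetric] One_fract_def Zero_fract_def) (simp add: eq_fract)
  then have "(Pi_ext 2 0 :: qpi) dvd 1" by (simp add: unit_iff_norm)
  also have "(Pi_ext 2 0 :: qpi) = 1 + 1" by (simp add: one_pi_ext_def plus_pi_ext_def)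
  finally show ?thesis by simp
qed

lemma qbar_hom: "qbar (a + b) = qbar a + qbar b" "qbar (a * b) = qbar a * qbar b"
  "qbar 1 = 1" "qbar 0 = 0" "qbar (- a) = - qbar a" "qbar (a - b) = qbar a - qbar b"
  using unital_ring_homD[OF qbar(1)] by (simp_all add: diff_conv_add_uminus del: add_uminus_conv_diff)

lemma qbar_power: "qbar (a ^ n) = qbar a ^ n"
  by (induction n) (auto simp: qbar_hom)

lemma qbar_ppow: "qbar (ppow n) = ppow n"
  by (simp add: ppow_def qbar_power qbar)

lemma qbar_qpow: "qbar (qpow n) = ppow (nat \<bar>n\<bar>) * qpow (- n)"
proof -
  have pos: "qbar (qpow (int m)) = ppow m * qpow (- int m)" for m
  proof -
    have "qpow (int m) = qq ^ m" by (simp add: qq_qpow qpow_power)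
    then show ?thesis
      by (simp only: qbar_power qbar power_mult_distrib) (simp add: ppow_def qq_qpow inverse_qpow qpow_power)
  qed
  show ?thesis
  proof (cases n)
    case (nonneg m) then show ?thesis using pos[of m] by simp
  next
    case (neg m')
    define m where "m = Suc m'"
    have n: "n = - int m" using neg by (simp add: m_def)
    have "qbar (qpow (int m)) * qbar (qpow n) = 1"
      unfolding n by (simp add: qpow_uminus qbar_hom(3) flip: qbar_hom(2))
    moreover have "qbar (qpow (int m)) * (ppow m * qpow (int m)) = 1"
      using qpow_uminus[of "int m"] unfolding pos by (simp add: mult_ac)
    ultimately have "qbar (qpow n) = ppow m * qpow (int m)" by (rule inverse_unique_ring)
    then show ?thesis by (simp add: n)
  qed
qed

subsection \<open>Generalized inverses\<close>

text \<open>Specialising \<pi> to 1 and to -1 identifies \<open>qpi\<close> with a product of two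
  copies of a field. In each copy either the row vanishes or some entry can be inverted, so the sum
  becomes 0 or 1 there, and the two solutions are glued. The sum is the idempotent generating the
  ideal of the entries.\<close>

lemma row_idempotent:
  fixes \<rho> :: "'a \<Rightarrow> qpi"
  assumes "finite B"
  shows "\<exists>e. \<forall>c\<in>B. (\<Sum>b\<in>B. \<rho> b * e b) * \<rho> c = \<rho> c"
proof -
  define s t where "s b = pcoeff0 (\<rho> b) + pcoeff1 (\<rho> b)" and "t b = pcoeff0 (\<rho> b) - pcoeff1 (\<rho> b)" for b
  have two: "(2 :: ratfun) \<noteq> 0"
    by (simp only: one_add_one[symmetric] One_fract_def Zero_fract_def) (simp add: eq_fract)
  have field: "\<exists>x. \<forall>c\<in>B. (\<Sum>b\<in>B. f b * x b) * f c = f c" for f :: "'a \<Rightarrow> ratfun"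
  proof (cases "\<exists>b\<in>B. f b \<noteq> 0")
    case True
    then obtain b where b: "b \<in> B" "f b \<noteq> 0" by blast
    have "(\<Sum>a\<in>B. f a * (if a = b then 1 / f b else 0)) = 1"
      using b assms by (simp add: if_distrib[of "(*) _"] sum.delta cong: if_cong)
    then show ?thesis by (intro exI[of _ "\<lambda>a. if a = b then 1 / f b else 0"]) auto
  qed auto
  obtain x where x: "\<forall>c\<in>B. (\<Sum>b\<in>B. s b * x b) * s c = s c" using field by blast
  obtain y where y: "\<forall>c\<in>B. (\<Sum>b\<in>B. t b * y b) * t c = t c" using field by blast
  define e where "e b = Pi_ext ((x b + y b) / 2) ((x b - y b) / 2)" for b
  have p0: "pcoeff0 (sum f C) = sum (\<lambda>b. pcoeff0 (f b)) C" and p1: "pcoeff1 (sum f C) = sum (\<lambda>b. pcoeff1 (f b)) C"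
    for f :: "'a \<Rightarrow> qpi" and C
    by (induction C rule: infinite_finite_induct) (auto simp: zero_pi_ext_def plus_pi_ext_def)
  have m1: "pcoeff0 (u * v) + pcoeff1 (u * v) = (pcoeff0 u + pcoeff1 u) * (pcoeff0 v + pcoeff1 v)"
    and m2: "pcoeff0 (u * v) - pcoeff1 (u * v) = (pcoeff0 u - pcoeff1 u) * (pcoeff0 v - pcoeff1 v)"
    for u v :: qpi
    by (simp_all add: times_pi_ext_def algebra_simps)
  have ex: "pcoeff0 (e b) + pcoeff1 (e b) = x b" "pcoeff0 (e b) - pcoeff1 (e b) = y b" for b
    using two by (simp_all add: e_def add_divide_distrib[symmetric] diff_divide_distrib[symmetric])
  have split: "u = v" if "pcoeff0 u + pcoeff1 u = pcoeff0 v + pcoeff1 v"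
    "pcoeff0 u - pcoeff1 u = pcoeff0 v - pcoeff1 v" for u v :: qpi
  proof (rule pi_ext.expand)
    have "2 * pcoeff0 u = 2 * pcoeff0 v" "2 * pcoeff1 u = 2 * pcoeff1 v"
      using arg_cong2[OF that, of "(+)"] arg_cong2[OF that, of "(-)"]
      by (simp_all add: mult_2 algebra_simps)
    with two show "pcoeff0 u = pcoeff0 v \<and> pcoeff1 u = pcoeff1 v" by simp
  qed
  have S1: "pcoeff0 (\<Sum>b\<in>B. \<rho> b * e b) + pcoeff1 (\<Sum>b\<in>B. \<rho> b * e b) = (\<Sum>b\<in>B. s b * x b)"
    unfolding p0 p1 sum.distrib[symmetric] m1 ex s_def ..
  have S2: "pcoeff0 (\<Sum>b\<in>B. \<rho> b * e b) - pcoeff1 (\<Sum>b\<in>B. \<rho> b * e b) = (\<Sum>b\<in>B. t b * y b)"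
    unfolding p0 p1 sum_subtractf[symmetric] m2 ex t_def ..
  have "(\<Sum>b\<in>B. \<rho> b * e b) * \<rho> c = \<rho> c" if "c \<in> B" for c
  proof (rule split)
    show "pcoeff0 ((\<Sum>b\<in>B. \<rho> b * e b) * \<rho> c) + pcoeff1 ((\<Sum>b\<in>B. \<rho> b * e b) * \<rho> c) = pcoeff0 (\<rho> c) + pcoeff1 (\<rho> c)"
      using bspec[OF x that] by (simp only: m1 S1) (simp only: s_def)
    show "pcoeff0 ((\<Sum>b\<in>B. \<rho> b * e b) * \<rho> c) - pcoeff1 ((\<Sum>b\<in>B. \<rho> b * e b) * \<rho> c) = pcoeff0 (\<rho> c) - pcoeff1 (\<rho> c)"
      using bspec[OF y that] by (simp only: m2 S2) (simp only: t_def)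
  qed
  then show ?thesis by blast
qed

text \<open>Induction on the rows. A solution \<open>h\<close> for the old rows gives P = h g with g
  P = g on them. What is missing for a new row \<open>r\<close> is its residue \<rho> = g_r - g_r P.
  The vector \<open>u\<close> is orthogonal to the old rows, and its product with row
  \<open>r\<close> fixes \<rho>; taking \<open>u\<close> as the new column and correcting the old
  columns by multiples of \<open>u\<close> restores the identity.\<close>

lemma generalized_inverse:
  fixes g :: "'a \<Rightarrow> 'b \<Rightarrow> qpi"
  assumes "finite A" "finite B"
  shows "\<exists>h. \<forall>a\<in>A. \<forall>c\<in>B. (\<Sum>b\<in>B. \<Sum>a'\<in>A. g a b * h b a' * g a' c) = g a c"
  using assms(1)
proof induction
  case (insert r A)
  then obtain h where h: "\<And>a c. a \<in> A \<Longrightarrow> c \<in> B \<Longrightarrow> (\<Sum>b\<in>B. \<Sum>a'\<in>A. g a b * h b a' * g a' c) = g a c"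
    by blast
  define P where "P b c = (\<Sum>a\<in>A. h b a * g a c)" for b c
  have gP: "(\<Sum>b\<in>B. g a b * P b c) = g a c" if "a \<in> A" "c \<in> B" for a c
    using h[OF that] by (simp add: P_def sum_distrib_left mult.assoc)
  define \<rho> where "\<rho> c = g r c - (\<Sum>b\<in>B. g r b * P b c)" for c
  obtain e where e: "\<forall>c\<in>B. (\<Sum>b\<in>B. \<rho> b * e b) * \<rho> c = \<rho> c"
    using row_idempotent[OF assms(2)] by blast
  define u where "u b = e b - (\<Sum>c\<in>B. P b c * e c)" for b
  have gu: "(\<Sum>b\<in>B. g a b * u b) = 0" if a: "a \<in> A" for a
  proof -
    have "(\<Sum>b\<in>B. g a b * (\<Sum>c\<in>B. P b c * e c)) = (\<Sum>c\<in>B. (\<Sum>b\<in>B. g a b * P b c) * e c)"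
      unfolding sum_distrib_left sum_distrib_right by (subst sum.swap) (simp add: mult_ac)
    also have "\<dots> = (\<Sum>c\<in>B. g a c * e c)" using gP[OF a] by simp
    finally show ?thesis by (simp add: u_def right_diff_distrib sum_subtractf)
  qed
  have gru: "(\<Sum>b\<in>B. g r b * u b) = (\<Sum>b\<in>B. \<rho> b * e b)"
  proof -
    have "(\<Sum>b\<in>B. g r b * (\<Sum>c\<in>B. P b c * e c)) = (\<Sum>c\<in>B. (\<Sum>b\<in>B. g r b * P b c) * e c)"
      unfolding sum_distrib_left sum_distrib_right by (subst sum.swap) (simp add: mult_ac)
    then show ?thesis by (simp add: u_def \<rho>_def right_diff_distrib left_diff_distrib sum_subtractf)
  qed
  define h' where "h' b a = (if a = r then u b else h b a - u b * (\<Sum>b'\<in>B. g r b' * h b' a))" for b a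
  have P': "(\<Sum>a'\<in>insert r A. h' b a' * g a' c) = P b c + u b * \<rho> c" if "c \<in> B" for b c
  proof -
    have "(\<Sum>a'\<in>insert r A. h' b a' * g a' c) = u b * g r c + (\<Sum>a'\<in>A. h' b a' * g a' c)"
      using insert by (simp add: h'_def)
    also have "(\<Sum>a'\<in>A. h' b a' * g a' c) = (\<Sum>a'\<in>A. (h b a' - u b * (\<Sum>b'\<in>B. g r b' * h b' a')) * g a' c)"
      using insert.hyps(2) by (intro sum.cong) (auto simp: h'_def)
    also have "\<dots> = P b c - u b * (\<Sum>a'\<in>A. \<Sum>b'\<in>B. g r b' * h b' a' * g a' c)"
      by (simp only: P_def left_diff_distrib sum_subtractf sum_distrib_left sum_distrib_right mult.assoc)
    also have "(\<Sum>a'\<in>A. \<Sum>b'\<in>B. g r b' * h b' a' * g a' c) = (\<Sum>b\<in>B. g r b * P b c)"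
      unfolding P_def sum_distrib_left by (subst sum.swap) (simp only: mult.assoc)
    finally show ?thesis by (simp add: \<rho>_def algebra_simps)
  qed
  have "(\<Sum>b\<in>B. \<Sum>a'\<in>insert r A. g a b * h' b a' * g a' c) = g a c" if a: "a \<in> insert r A" and c: "c \<in> B" for a c
  proof -
    have "(\<Sum>b\<in>B. \<Sum>a'\<in>insert r A. g a b * h' b a' * g a' c) = (\<Sum>b\<in>B. g a b * (\<Sum>a'\<in>insert r A. h' b a' * g a' c))"
      by (simp only: sum_distrib_left mult.assoc)
    also have "\<dots> = (\<Sum>b\<in>B. g a b * P b c) + (\<Sum>b\<in>B. g a b * u b) * \<rho> c"
      by (simp only: P'[OF c]) (simp add: distrib_left sum.distrib sum_distrib_right mult.assoc)
    also have "\<dots> = g a c"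
    proof (cases "a = r")
      case True
      then show ?thesis using e c by (simp add: gru) (simp add: \<rho>_def)
    next
      case False
      then show ?thesis using a c gP gu by simp
    qed
    finally show ?thesis .
  qed
  then show ?case by blast
qed simp

section \<open>Free algebras\<close>

abbreviation "lookup \<equiv> Poly_Mapping.lookup"
abbreviation "keys \<equiv> Poly_Mapping.keys"

definition smul :: "qpi \<Rightarrow> ('g word \<Rightarrow>\<^sub>0 qpi) \<Rightarrow> ('g word \<Rightarrow>\<^sub>0 qpi)" (infixr "\<cdot>" 75)
  where "c \<cdot> x = Poly_Mapping.single 0 c * x"

definition wd :: "'g list \<Rightarrow> ('g word \<Rightarrow>\<^sub>0 qpi)"
  where "wd w = Poly_Mapping.single (Word w) 1"

lemma wd_Nil: "wd [] = 1"
  by (simp add: wd_def zero_word_def flip: single_one)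

lemma wd_append: "wd (u @ v) = wd u * wd v"
  by (simp add: wd_def mult_single plus_word_def)

lemma wd_Cons: "wd (i # v) = wd [i] * wd v"
  by (simp flip: wd_append)

lemma smul_wd: "c \<cdot> wd w = Poly_Mapping.single (Word w) c"
  by (simp add: smul_def wd_def mult_single)

lemma poly_mapping_single_induct [case_names zero add single]:
  assumes "P 0" "\<And>x y. P x \<Longrightarrow> P y \<Longrightarrow> P (x + y)" "\<And>k c. P (Poly_Mapping.single k c)"
  shows "P (x :: 'a \<Rightarrow>\<^sub>0 'b::comm_monoid_add)"
proof (induction x rule: update_induct)
  case (update f a b)
  have "Poly_Mapping.update a b f = f + Poly_Mapping.single a b"
    using update(1) by (intro poly_mapping_eqI) (auto simp: lookup_update lookup_add lookup_single when_def in_keys_iff)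
  then show ?case using assms update by simp
qed (rule assms)

lemma single_central: "x * Poly_Mapping.single 0 c = Poly_Mapping.single 0 c * (x :: 'g word \<Rightarrow>\<^sub>0 qpi)"
proof (induction x rule: poly_mapping_single_induct)
  case (add f g) then show ?case by (simp add: algebra_simps)
next
  case (single k d)
  then show ?case by (simp add: mult_single mult.commute[of d c])
qed simp

interpretation fa: Modules.module "smul :: qpi \<Rightarrow> ('g word \<Rightarrow>\<^sub>0 qpi) \<Rightarrow> _"
  by standard
     (simp_all add: smul_def algebra_simps single_add mult_single flip: mult.assoc)

lemma smul_mult_left [simp]: "(c \<cdot> x) * y = c \<cdot> (x * y)"
  by (simp add: smul_def mult.assoc)

lemma smul_mult_right [simp]: "x * (c \<cdot> y) = c \<cdot> (x * y)"
  by (simp add: smul_def single_central flip: mult.assoc)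

lemma smul_smul [simp]: "a \<cdot> b \<cdot> x = (a * b) \<cdot> x"
  by simp

lemma smul_zero [simp]: "0 \<cdot> x = 0" "c \<cdot> 0 = 0"
  by (simp_all add: smul_def)

lemma lookup_smul: "lookup (c \<cdot> x) w = c * lookup x w"
  unfolding smul_def mult_map_scale_conv_mult[symmetric] by (simp add: map.rep_eq when_def)

lemma lookup_wd: "lookup (wd u) (Word v) = (if u = v then 1 else 0)"
  by (simp add: wd_def lookup_single when_def)

lemma fa_induct [case_names zero add word]:
  assumes "P 0" "\<And>x y. P x \<Longrightarrow> P y \<Longrightarrow> P (x + y)" "\<And>c w. P (c \<cdot> wd w)"
  shows "P x"
proof (induction x rule: poly_mapping_single_induct)
  case (single k v) then show ?case using assms(3)[of v "letters k"] by (simp add: smul_wd)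
qed (use assms in auto)

lemma smul_unit_cancel: "c dvd 1 \<Longrightarrow> inverse c \<cdot> c \<cdot> x = x"
  using pi_ext_mult_inverse[of c] by (simp add: mult.commute)

subsection \<open>Linear extension\<close>

text \<open>The scalar action of the target is a parameter, so that functionals into
  \<open>qpi\<close>, endomorphisms of a free algebra and orbit maps into modules share one set of
  lemmas.\<close>

definition lin :: "(qpi \<Rightarrow> 'm \<Rightarrow> 'm) \<Rightarrow> (('g word \<Rightarrow>\<^sub>0 qpi) \<Rightarrow> 'm::ab_group_add) \<Rightarrow> bool"
  where "lin s g \<longleftrightarrow> (\<forall>x y. g (x + y) = g x + g y) \<and> (\<forall>c x. g (c \<cdot> x) = s c (g x))"

definition lext :: "(qpi \<Rightarrow> 'm \<Rightarrow> 'm) \<Rightarrow> ('g list \<Rightarrow> 'm::ab_group_add) \<Rightarrow> ('g word \<Rightarrow>\<^sub>0 qpi) \<Rightarrow> 'm"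
  where "lext s \<phi> x = (\<Sum>w\<in>keys x. s (lookup x w) (\<phi> (letters w)))"

lemma linI: "(\<And>x y. g (x + y) = g x + g y) \<Longrightarrow> (\<And>c x. g (c \<cdot> x) = s c (g x)) \<Longrightarrow> lin s g"
  by (simp add: lin_def)

lemma lin_add: "lin s g \<Longrightarrow> g (x + y) = g x + g y"
  and lin_smul: "lin s g \<Longrightarrow> g (c \<cdot> x) = s c (g x)"
  by (simp_all add: lin_def)

lemma lin_0: "lin s g \<Longrightarrow> g 0 = 0"
  using lin_add[of s g 0 0] by simp

lemma lin_minus: "lin s g \<Longrightarrow> g (- x) = - g x"
  using lin_add[of s g x "- x"] lin_0[of s g] by (simp add: eq_neg_iff_add_eq_0 add.commute)

lemma lin_diff: "lin s g \<Longrightarrow> g (x - y) = g x - g y"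
  using lin_add[of s g x "- y"] lin_minus[of s g y] by simp

lemma lin_sum: "lin s g \<Longrightarrow> g (sum f A) = (\<Sum>a\<in>A. g (f a))"
  by (induction A rule: infinite_finite_induct) (auto simp: lin_0 lin_add)

lemma lin_eqI:
  assumes "lin s f" "lin s g" "\<And>w. f (wd w) = g (wd w)"
  shows "f x = g x"
  by (induction x rule: fa_induct)
     (use assms in \<open>simp_all add: lin_0[OF assms(1)] lin_0[OF assms(2)] lin_add[OF assms(1)] lin_add[OF assms(2)]
        lin_smul[OF assms(1)] lin_smul[OF assms(2)]\<close>)

lemma lext_superset:
  assumes "Modules.module s" "finite A" "keys x \<subseteq> A"
  shows "lext s \<phi> x = (\<Sum>w\<in>A. s (lookup x w) (\<phi> (letters w)))"
proof -
  interpret Modules.module s by fact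
  show ?thesis unfolding lext_def
    by (rule sum.mono_neutral_left) (use assms in \<open>auto simp: in_keys_iff\<close>)
qed

lemma lin_lext:
  fixes \<phi> :: "'g list \<Rightarrow> 'm::ab_group_add"
  assumes "Modules.module s" shows "lin s (lext s \<phi>)"
proof -
  interpret Modules.module s by fact
  show ?thesis
  proof (rule linI)
    fix x y :: "'g word \<Rightarrow>\<^sub>0 qpi"
    let ?A = "keys x \<union> keys y"
    have *: "keys (x + y) \<subseteq> ?A" by (rule keys_add)
    show "lext s \<phi> (x + y) = lext s \<phi> x + lext s \<phi> y"
      using lext_superset[OF assms _ *, of \<phi>] lext_superset[OF assms, of ?A x \<phi>] lext_superset[OF assms, of ?A y \<phi>]
      by (simp add: lookup_add scale_left_distrib sum.distrib)
  next
    fix c and x :: "'g word \<Rightarrow>\<^sub>0 qpi"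
    have *: "keys (c \<cdot> x) \<subseteq> keys x" by (auto simp: in_keys_iff lookup_smul)
    show "lext s \<phi> (c \<cdot> x) = s c (lext s \<phi> x)"
      using lext_superset[OF assms _ *, of \<phi>]
      by (simp add: lookup_smul lext_def scale_sum_right)
  qed
qed

lemma lext_wd: assumes "Modules.module s" shows "lext s \<phi> (wd w) = \<phi> w"
proof -
  interpret Modules.module s by fact
  show ?thesis by (simp add: lext_def wd_def)
qed

lemma module_times: "Modules.module ((*) :: qpi \<Rightarrow> qpi \<Rightarrow> qpi)"
  by standard (simp_all add: algebra_simps)

lemma module_smul: "Modules.module (smul :: qpi \<Rightarrow> ('g word \<Rightarrow>\<^sub>0 qpi) \<Rightarrow> _)"
  by (rule fa.module_axioms)

lemma lin_id: "lin smul (\<lambda>x. x)"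
  by (simp add: lin_def)

lemma lin_comp: "lin smul f \<Longrightarrow> lin s g \<Longrightarrow> lin s (\<lambda>x. g (f x))"
  by (simp add: lin_def)

lemma lin_scaled: "Modules.module s \<Longrightarrow> lin s f \<Longrightarrow> lin s (\<lambda>x. s c (f x))"
  by (simp add: lin_def Modules.module_def mult.commute)

lemma lin_mult_left: "lin smul f \<Longrightarrow> lin smul (\<lambda>x. a * f x)"
  and lin_mult_right: "lin smul f \<Longrightarrow> lin smul (\<lambda>x. f x * a)"
  by (simp_all add: lin_def algebra_simps)

lemma lin_lookup: "lin (*) (\<lambda>x. lookup x w)"
  by (simp add: lin_def lookup_add lookup_smul)

subsection \<open>Supports\<close>

text \<open>Homogeneity, bounds on the length and vanishing of the constant term are all
  instances.\<close>

definition spn :: "('g list \<Rightarrow> bool) \<Rightarrow> ('g word \<Rightarrow>\<^sub>0 qpi) \<Rightarrow> bool"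
  where "spn P x \<longleftrightarrow> (\<forall>w\<in>keys x. P (letters w))"

lemma spn_0 [simp]: "spn P 0"
  by (simp add: spn_def)

lemma spn_add: "spn P x \<Longrightarrow> spn P y \<Longrightarrow> spn P (x + y)"
  using keys_add[of x y] by (auto simp: spn_def)

lemma spn_smul: "spn P x \<Longrightarrow> spn P (c \<cdot> x)"
  by (auto simp: spn_def in_keys_iff lookup_smul)

lemma spn_minus: "spn P x \<Longrightarrow> spn P (- x)"
  using spn_smul[of P x "- 1"] by simp

lemma spn_diff: "spn P x \<Longrightarrow> spn P y \<Longrightarrow> spn P (x - y)"
  using spn_add[of P x "- y"] spn_minus[of P y] by simp

lemma spn_sum: "(\<And>a. a \<in> A \<Longrightarrow> spn P (f a)) \<Longrightarrow> spn P (sum f A)"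
  by (induction A rule: infinite_finite_induct) (auto intro: spn_add)

lemma spn_wd [simp]: "spn P (wd w) = P w"
  by (simp add: spn_def wd_def)

lemma spn_mono: "spn P x \<Longrightarrow> (\<And>w. P w \<Longrightarrow> Q w) \<Longrightarrow> spn Q x"
  by (auto simp: spn_def)

lemma fa_expand: "x = (\<Sum>w\<in>keys x. lookup x w \<cdot> wd (letters w))"
proof -
  have "lookup x v = lookup (\<Sum>w\<in>keys x. lookup x w \<cdot> wd (letters w)) v" for v
  proof -
    have "(\<Sum>w\<in>keys x. lookup (lookup x w \<cdot> wd (letters w)) v) = (\<Sum>w\<in>keys x. if v = w then lookup x w else 0)"
      by (intro sum.cong) (auto simp: smul_wd lookup_single when_def)
    then show ?thesis by (simp add: lookup_sum sum.delta' in_keys_iff)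
  qed
  then show ?thesis by (rule poly_mapping_eqI)
qed

lemma spn_induct [consumes 1, case_names zero add word]:
  assumes "spn P x" "Q 0" "\<And>x y. Q x \<Longrightarrow> Q y \<Longrightarrow> Q (x + y)" "\<And>c w. P w \<Longrightarrow> Q (c \<cdot> wd w)"
  shows "Q x"
proof -
  have "Q (\<Sum>w\<in>A. lookup x w \<cdot> wd (letters w))" if "finite A" "A \<subseteq> keys x" for A
    using that by (induction A rule: finite_induct) (use assms in \<open>auto simp: spn_def\<close>)
  from this[of "keys x"] show ?thesis by (simp flip: fa_expand)
qed

lemma spn_lin:
  assumes "lin smul g" "\<And>w. P w \<Longrightarrow> spn Q (g (wd w))" "spn P x"
  shows "spn Q (g x)"
  using assms(3)
  by (induction rule: spn_induct)
     (use assms in \<open>auto simp: lin_0[OF assms(1)] lin_add[OF assms(1)] lin_smul[OF assms(1)] intro: spn_add spn_smul\<close>)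

lemma spn_mult:
  assumes "spn P x" "spn Q y" "\<And>u v. P u \<Longrightarrow> Q v \<Longrightarrow> S (u @ v)"
  shows "spn S (x * y)"
proof (rule spn_lin[where g = "\<lambda>x. x * y", OF lin_mult_right[OF lin_id] _ assms(1)])
  fix u assume u: "P u"
  show "spn S (wd u * y)"
    by (rule spn_lin[where g = "\<lambda>y. wd u * y", OF lin_mult_left[OF lin_id] _ assms(2)])
       (use u assms(3) in \<open>auto simp flip: wd_append\<close>)
qed

lemma lin_eq_on:
  assumes "lin s f" "lin s g" "spn P x" "\<And>w. P w \<Longrightarrow> f (wd w) = g (wd w)"
  shows "f x = g x"
  using assms(3)
  by (induction rule: spn_induct)
     (simp_all add: assms(4) lin_0[OF assms(1)] lin_0[OF assms(2)] lin_add[OF assms(1)] lin_add[OF assms(2)]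
        lin_smul[OF assms(1)] lin_smul[OF assms(2)])

definition wt :: "'i list \<Rightarrow> 'i \<Rightarrow> nat" where "wt w = count_list w"

lemma wt_simps [simp]: "wt [] = (\<lambda>_. 0)" "wt (u @ v) = (\<lambda>k. wt u k + wt v k)"
  "wt (i # v) = (\<lambda>k. wt v k + (if k = i then 1 else 0))"
  by (auto simp: wt_def fun_eq_iff)

abbreviation homog :: "('i \<Rightarrow> nat) \<Rightarrow> ('i word \<Rightarrow>\<^sub>0 qpi) \<Rightarrow> bool"
  where "homog \<mu> \<equiv> spn (\<lambda>w. wt w = \<mu>)"

lemma length_wt: "length (w :: 'i::finite list) = ht (wt w)"
proof (induction w)
  case (Cons a w)
  have "ht (wt (a # w)) = ht (wt w) + (\<Sum>k\<in>UNIV. if k = a then 1 else 0)"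
    unfolding ht_def wt_simps sum.distrib ..
  then show ?case using Cons by simp
qed (simp add: ht_def)

lemma finite_words: "finite {w :: 'i::finite list. length w \<le> n}"
  using finite_lists_length_le[of "UNIV :: 'i set" n] by simp

lemma finite_wt: "finite {w :: 'i::finite list. wt w = \<mu>}"
  by (rule finite_subset[OF _ finite_words[of "ht \<mu>"]]) (auto simp: length_wt)

lemma finite_ht: "finite {\<mu> :: 'i::finite \<Rightarrow> nat. ht \<mu> \<le> n}"
proof -
  have "\<mu> i \<le> n" if "ht \<mu> \<le> n" for \<mu> :: "'i \<Rightarrow> nat" and i
  proof -
    have "\<mu> i \<le> ht \<mu>" unfolding ht_def by (rule member_le_sum) auto
    with that show ?thesis by simp
  qed
  then have "{\<mu> :: 'i \<Rightarrow> nat. ht \<mu> \<le> n} \<subseteq> Pi UNIV (\<lambda>_. {..n})" by auto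
  moreover have "finite (Pi (UNIV :: 'i set) (\<lambda>_. {..n}))"
    using finite_PiE[of "UNIV :: 'i set" "\<lambda>_. {..n}"] by (simp add: PiE_def)
  ultimately show ?thesis by (rule finite_subset)
qed

subsection \<open>Diagonal automorphisms\<close>

definition wprod :: "('i \<Rightarrow> qpi) \<Rightarrow> 'i list \<Rightarrow> qpi" where "wprod f w = prod_list (map f w)"

lemma wprod_simps [simp]: "wprod f [] = 1" "wprod f (i # w) = f i * wprod f w" "wprod f (u @ v) = wprod f u * wprod f v"
  by (simp_all add: wprod_def)

lemma wprod_wt: "wprod f (w :: 'i::finite list) = (\<Prod>i\<in>UNIV. f i ^ wt w i)"
proof (induction w)
  case (Cons a w)
  have "(\<Prod>i\<in>UNIV. f i ^ wt (a # w) i) = (\<Prod>i\<in>UNIV. f i ^ wt w i) * (\<Prod>i\<in>UNIV. if i = a then f i else 1)"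
    unfolding prod.distrib[symmetric] by (intro prod.cong) auto
  then show ?case using Cons by (simp add: mult.commute)
qed simp

text \<open>Torus operators, sign twists and the braiding factors in the derivations are all of this
  form.\<close>

definition Dg :: "('i \<Rightarrow> qpi) \<Rightarrow> ('i word \<Rightarrow>\<^sub>0 qpi) \<Rightarrow> ('i word \<Rightarrow>\<^sub>0 qpi)"
  where "Dg f = lext smul (\<lambda>w. wprod f w \<cdot> wd w)"

lemma lin_Dg: "lin smul (Dg f)"
  unfolding Dg_def by (rule lin_lext[OF module_smul])

lemma Dg_wd: "Dg f (wd w) = wprod f w \<cdot> wd w"
  by (simp add: Dg_def lext_wd[OF module_smul])

lemmas Dg_simps [simp] = Dg_wd lin_0[OF lin_Dg] lin_add[OF lin_Dg] lin_smul[OF lin_Dg] lin_diff[OF lin_Dg] lin_minus[OF lin_Dg]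

lemma Dg_mult: "Dg f (x * y) = Dg f x * Dg f y"
proof (induction x rule: fa_induct)
  case (word c w)
  then show ?case
    by (induction y rule: fa_induct) (simp_all add: algebra_simps flip: wd_append)
qed (simp_all add: algebra_simps)

lemma Dg_1 [simp]: "Dg f 1 = 1"
  using Dg_wd[of f "[]"] by (simp add: wd_Nil)

lemma Dg_Dg: "Dg f (Dg g x) = Dg (\<lambda>k. f k * g k) x"
proof (rule lin_eqI[where f = "\<lambda>x. Dg f (Dg g x)", OF lin_comp[OF lin_Dg lin_Dg] lin_Dg])
  have "wprod (\<lambda>k. f k * g k) w = wprod g w * wprod f w" for w by (induction w) (auto simp: mult_ac)
  then show "Dg f (Dg g (wd w)) = Dg (\<lambda>k. f k * g k) (wd w)" for w by simp
qed

lemma wprod_one [simp]: "wprod (\<lambda>_. 1) w = 1"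
  by (induction w) auto

lemma Dg_one: "Dg (\<lambda>_. 1) x = x"
  by (rule lin_eqI[OF lin_Dg lin_id]) simp

lemma Dg_hom: "homog \<mu> x \<Longrightarrow> Dg f x = (\<Prod>i\<in>UNIV. f i ^ \<mu> i) \<cdot> (x :: 'i::finite word \<Rightarrow>\<^sub>0 qpi)"
  by (induction rule: spn_induct) (auto simp: wprod_wt algebra_simps)

lemma spn_Dg: "spn P x \<Longrightarrow> spn P (Dg f x)"
  by (rule spn_lin[OF lin_Dg]) (auto intro: spn_smul)

lemma lookup_0_Dg [simp]: "lookup (Dg f x) 0 = lookup x 0"
proof (rule lin_eqI[where f = "\<lambda>x. lookup (Dg f x) 0", OF lin_comp[OF lin_Dg lin_lookup] lin_lookup])
  show "lookup (Dg f (wd w)) 0 = lookup (wd w) 0" for w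
    by (cases w) (auto simp: lookup_smul lookup_wd zero_word_def)
qed

section \<open>Skew derivations and the bilinear form\<close>

text \<open>Symmetry of \<chi> is what makes the left and right derivations commute
  (\<open>ld_rd\<close>) and the form symmetric (through \<open>bform_adj\<close>).\<close>

locale braiding =
  fixes \<chi> :: "'i::finite \<Rightarrow> 'i \<Rightarrow> qpi"
  assumes \<chi>_sym: "\<chi> i j = \<chi> j i"
begin

text \<open>Lusztig's skew derivations on words. An occurrence of \<open>i\<close> is moved to the
  right end (\<open>rw\<close>) or to the left end (\<open>lw\<close>) and removed there; the scalar
  collects \<chi> from the letters it passes.\<close>

primrec rw :: "'i \<Rightarrow> 'i list \<Rightarrow> ('i word \<Rightarrow>\<^sub>0 qpi)" where
  "rw i [] = 0"
| "rw i (j # w) = wd [j] * rw i w + (if i = j then Dg (\<chi> i) (wd w) else 0)"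

primrec lw :: "'i \<Rightarrow> 'i list \<Rightarrow> ('i word \<Rightarrow>\<^sub>0 qpi)" where
  "lw i [] = 0"
| "lw i (j # w) = \<chi> i j \<cdot> (wd [j] * lw i w) + (if i = j then wd w else 0)"

definition "rd i = lext smul (rw i)"
definition "ld i = lext smul (lw i)"

lemma lin_rd: "lin smul (rd i)" and lin_ld: "lin smul (ld i)"
  unfolding rd_def ld_def by (rule lin_lext[OF module_smul])+

lemmas rd_simps [simp] = lin_0[OF lin_rd] lin_add[OF lin_rd] lin_smul[OF lin_rd] lin_diff[OF lin_rd] lin_minus[OF lin_rd]
lemmas ld_simps [simp] = lin_0[OF lin_ld] lin_add[OF lin_ld] lin_smul[OF lin_ld] lin_diff[OF lin_ld] lin_minus[OF lin_ld]

lemma rd_wd: "rd i (wd w) = rw i w" and ld_wd: "ld i (wd w) = lw i w"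
  by (simp_all add: rd_def ld_def lext_wd[OF module_smul])

lemma rd_1 [simp]: "rd i 1 = 0" and ld_1 [simp]: "ld i 1 = 0"
  using rd_wd[of i "[]"] ld_wd[of i "[]"] by (simp_all add: wd_Nil)

lemma rd_Cons: "rd i (wd [j] * x) = wd [j] * rd i x + (if i = j then Dg (\<chi> i) x else 0)"
proof (induction x rule: fa_induct)
  case (word c w)
  have "rd i (wd [j] * wd w) = wd [j] * rd i (wd w) + (if i = j then Dg (\<chi> i) (wd w) else 0)"
    by (simp add: rd_wd flip: wd_append)
  then show ?case by (auto simp: algebra_simps)
qed (simp_all add: algebra_simps)

lemma ld_Cons: "ld i (wd [j] * x) = \<chi> i j \<cdot> (wd [j] * ld i x) + (if i = j then x else 0)"
proof (induction x rule: fa_induct)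
  case (word c w)
  have "ld i (wd [j] * wd w) = \<chi> i j \<cdot> (wd [j] * ld i (wd w)) + (if i = j then wd w else 0)"
    by (simp add: ld_wd flip: wd_append)
  then show ?case by (auto simp: algebra_simps)
qed (simp_all add: algebra_simps)

lemma rd_gen [simp]: "rd i (wd [j]) = (if i = j then 1 else 0)"
  and ld_gen [simp]: "ld i (wd [j]) = (if i = j then 1 else 0)"
  using rd_Cons[of i j 1] ld_Cons[of i j 1] by simp_all

lemma rd_mult: "rd i (x * y) = rd i x * Dg (\<chi> i) y + x * rd i y"
proof (induction x rule: fa_induct)
  case (word c w)
  have "rd i (wd w * y) = rd i (wd w) * Dg (\<chi> i) y + wd w * rd i y"
  proof (induction w)
    case (Cons j w)
    then show ?case
      by (simp add: wd_Cons[of j w] mult.assoc rd_Cons Dg_mult del: Dg_wd) (simp add: algebra_simps)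
  qed (simp add: wd_Nil)
  then show ?case by (simp add: algebra_simps)
qed (simp_all add: algebra_simps)

lemma ld_mult: "ld i (x * y) = ld i x * y + Dg (\<chi> i) x * ld i y"
proof (induction x rule: fa_induct)
  case (word c w)
  have "ld i (wd w * y) = ld i (wd w) * y + Dg (\<chi> i) (wd w) * ld i y"
  proof (induction w)
    case (Cons j w)
    then show ?case
      by (simp add: wd_Cons[of j w] mult.assoc ld_Cons Dg_mult) (simp add: algebra_simps)
  qed (simp add: wd_Nil)
  then show ?case by (simp add: algebra_simps)
qed (simp_all add: algebra_simps)

lemma rd_Dg: "rd i (Dg f x) = f i \<cdot> Dg f (rd i x)"
proof (induction x rule: fa_induct)
  case (word c w)
  have "rd i (Dg f (wd w)) = f i \<cdot> Dg f (rd i (wd w))"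
  proof (induction w)
    case (Cons j w)
    then show ?case
      by (cases "i = j")
         (simp_all add: wd_Cons[of j w] rd_Cons Dg_mult Dg_Dg Dg_wd[of f "[j]"] algebra_simps del: Dg_wd)
  qed (simp add: wd_Nil)
  then show ?case by (simp add: algebra_simps del: Dg_wd)
qed (simp_all add: algebra_simps)

lemma ld_Dg: "ld i (Dg f x) = f i \<cdot> Dg f (ld i x)"
proof (induction x rule: fa_induct)
  case (word c w)
  have "ld i (Dg f (wd w)) = f i \<cdot> Dg f (ld i (wd w))"
  proof (induction w)
    case (Cons j w)
    then show ?case
      by (cases "i = j")
         (simp_all add: wd_Cons[of j w] ld_Cons Dg_mult Dg_Dg Dg_wd[of f "[j]"] algebra_simps del: Dg_wd)
  qed (simp add: wd_Nil)
  then show ?case by (simp add: algebra_simps del: Dg_wd)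
qed (simp_all add: algebra_simps)

lemma ld_rd: "ld j (rd i x) = rd i (ld j x)"
proof (induction x rule: fa_induct)
  case (word c w)
  have "ld j (rd i (wd w)) = rd i (ld j (wd w))"
  proof (induction w)
    case (Cons k w)
    then show ?case
      using \<chi>_sym[of k j]
      by (simp add: wd_Cons[of k w] rd_Cons ld_Cons ld_Dg del: Dg_wd) (simp add: algebra_simps)
  qed (simp add: wd_Nil)
  then show ?case by simp
qed simp_all

text \<open>The prefix \<open>u\<close> generalises the induction over the word: the letters in
  front of the removed one have to stay visible to both predicates.\<close>

lemma spn_rd_aux:
  assumes "\<And>u v. P (u @ i # v) \<Longrightarrow> Q (u @ v)"
  shows "P (u @ w) \<Longrightarrow> spn (\<lambda>v. Q (u @ v)) (rd i (wd w)) \<and> spn (\<lambda>v. Q (u @ v)) (ld i (wd w))"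
proof (induction w arbitrary: u)
  case (Cons j w)
  have 1: "P ((u @ [j]) @ w)" using Cons.prems by simp
  have 2: "spn (\<lambda>v. Q (u @ v)) (wd [j] * y)" if "spn (\<lambda>v. Q ((u @ [j]) @ v)) y" for y
    by (rule spn_mult[OF _ that, of "\<lambda>v. v = [j]"]) auto
  have 3: "Q (u @ w)" if "i = j" using assms[of u w] Cons.prems that by simp
  have 4: "spn (\<lambda>v. Q (u @ v)) (if i = j then wd w else 0)" using 3 by simp
  have 5: "spn (\<lambda>v. Q (u @ v)) (if i = j then Dg (\<chi> i) (wd w) else 0)"
    using 3 by (simp add: spn_smul)
  note IH = Cons.IH[OF 1]
  show ?case
    unfolding wd_Cons[of j w] rd_Cons ld_Cons
    by (intro conjI spn_add spn_smul 4 5 2 conjunct1[OF IH] conjunct2[OF IH])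
qed (simp add: wd_Nil)

lemma spn_rd:
  assumes "\<And>u v. P (u @ i # v) \<Longrightarrow> Q (u @ v)" "spn P x" shows "spn Q (rd i x)"
proof (rule spn_lin[OF lin_rd _ assms(2)])
  show "spn Q (rd i (wd w))" if "P w" for w
    using spn_rd_aux[of P i Q "[]" w, OF assms(1)] that by simp
qed

lemma spn_ld:
  assumes "\<And>u v. P (u @ i # v) \<Longrightarrow> Q (u @ v)" "spn P x" shows "spn Q (ld i x)"
proof (rule spn_lin[OF lin_ld _ assms(2)])
  show "spn Q (ld i (wd w))" if "P w" for w
    using spn_rd_aux[of P i Q "[]" w, OF assms(1)] that by simp
qed

text \<open>The form is normalised by (\<theta>_i, \<theta>_i) = 1. Its left argument is consumed
  letter by letter, \<open>ld i\<close> being adjoint to left multiplication by \<theta>_i.\<close>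

primrec formw :: "'i list \<Rightarrow> ('i word \<Rightarrow>\<^sub>0 qpi) \<Rightarrow> qpi" where
  "formw [] y = lookup y 0"
| "formw (i # w) y = formw w (ld i y)"

lemma lin_formw: "lin (*) (formw w)"
proof (induction w)
  case (Cons i w)
  then show ?case using lin_comp[OF lin_ld Cons] by (simp add: lin_def)
qed (simp add: lin_def lookup_add lookup_smul)

lemmas formw_simps [simp] = lin_0[OF lin_formw] lin_add[OF lin_formw] lin_smul[OF lin_formw] lin_diff[OF lin_formw] lin_minus[OF lin_formw]

definition bform :: "('i word \<Rightarrow>\<^sub>0 qpi) \<Rightarrow> ('i word \<Rightarrow>\<^sub>0 qpi) \<Rightarrow> qpi" where
  "bform x y = lext (*) (\<lambda>w. formw w y) x"

lemma lin_bform: "lin (*) (\<lambda>x. bform x y)"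
  unfolding bform_def by (rule lin_lext[OF module_times])

lemmas bform_simps [simp] = lin_0[OF lin_bform] lin_add[OF lin_bform] lin_smul[OF lin_bform] lin_diff[OF lin_bform]

lemma bform_wd: "bform (wd w) y = formw w y"
  by (simp add: bform_def lext_wd[OF module_times])

lemma lin_bform_right: "lin (*) (bform x)"
proof (rule linI)
  show "bform x (y + z) = bform x y + bform x z" for y z
    by (induction x rule: fa_induct) (simp_all add: bform_wd algebra_simps)
  show "bform x (c \<cdot> y) = c * bform x y" for c y
    by (induction x rule: fa_induct) (simp_all add: bform_wd algebra_simps)
qed

lemmas bform_right_simps [simp] = lin_0[OF lin_bform_right] lin_add[OF lin_bform_right]
  lin_smul[OF lin_bform_right] lin_diff[OF lin_bform_right]

lemma bform_Cons: "bform (wd [i] * x) y = bform x (ld i y)"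
proof (induction x rule: fa_induct)
  case (word c w)
  show ?case using bform_wd[of "i # w" y] by (simp add: bform_wd flip: wd_append)
qed (simp_all add: algebra_simps)

lemma lookup_0_Cons [simp]: "lookup (wd [j] * z) 0 = 0"
  by (rule lin_eqI[where f = "\<lambda>z. lookup (wd [j] * z) 0" and g = "\<lambda>_. 0", OF lin_comp[OF lin_mult_left[OF lin_id] lin_lookup]])
     (auto simp: lin_def lookup_wd zero_word_def simp flip: wd_append)

text \<open>Since \<open>ld\<close> and \<open>rd\<close> commute, the last letter may be stripped
  ahead of the others. It remains to see that \<open>ld i y\<close> and \<open>rd i y\<close> have
  the same constant term: both pick the coefficient of the word \<open>[i]\<close>.\<close>

lemma formw_snoc: "formw (w @ [i]) y = formw w (rd i y)"
proof (induction w arbitrary: y)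
  case Nil
  have "lookup (ld i y) 0 = lookup (rd i y) 0"
  proof (rule lin_eqI[where f = "\<lambda>y. lookup (ld i y) 0", OF lin_comp[OF lin_ld lin_lookup] lin_comp[OF lin_rd lin_lookup]])
    fix w show "lookup (ld i (wd w)) 0 = lookup (rd i (wd w)) 0"
    proof (cases w)
      case (Cons j v)
      show ?thesis
        by (simp add: Cons wd_Cons[of j v] rd_Cons ld_Cons lookup_add lookup_smul del: Dg_wd)
    qed (simp add: wd_Nil)
  qed
  then show ?case by simp
qed (simp add: ld_rd)

lemma bform_adj: "bform x (wd [i] * y) = bform (ld i x) y"
proof (rule lin_eqI[where f = "\<lambda>x. bform x (wd [i] * y)", OF lin_bform lin_comp[OF lin_ld lin_bform]])
  fix w show "bform (wd w) (wd [i] * y) = bform (ld i (wd w)) y"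
  proof (induction w arbitrary: y)
    case Nil
    then show ?case using bform_wd[of "[]" "wd [i] * y"] by (simp add: wd_Nil)
  next
    case (Cons j w)
    show ?case
      using \<chi>_sym[of i j]
      by (simp add: bform_Cons wd_Cons[of j w] ld_Cons Cons.IH)
  qed
qed

lemma bform_wd_right: "bform x (wd v) = formw v x"
proof (induction v arbitrary: x)
  case Nil
  have "formw w (1 :: 'i word \<Rightarrow>\<^sub>0 qpi) = lookup (wd w) 0" for w
    by (cases w) (auto simp: wd_Nil lookup_wd zero_word_def)
  then have "bform (wd w) (wd []) = formw [] (wd w)" for w
    by (simp add: bform_wd wd_Nil)
  then show ?case
    by (rule lin_eqI[where f = "\<lambda>x. bform x (wd [])", OF lin_bform lin_formw])
next
  case (Cons i v)
  then show ?case by (simp add: wd_Cons[of i v] bform_adj)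
qed

lemma formw_sym: "formw u (wd v) = formw v (wd u)"
  using bform_wd_right[of "wd u" v] by (simp add: bform_wd)

lemma formw_hom: "homog \<mu> y \<Longrightarrow> wt w \<noteq> \<mu> \<Longrightarrow> formw w y = 0"
proof (induction w arbitrary: \<mu> y)
  case Nil
  from Nil(1) show ?case
    by (induction rule: spn_induct) (use Nil(2) in \<open>auto simp: lookup_add lookup_smul lookup_wd zero_word_def\<close>)
next
  case (Cons i w)
  show ?case
  proof (cases "\<mu> i = 0")
    case True
    have "spn (\<lambda>_. False) (ld i y)" by (rule spn_ld[OF _ Cons(2)]) (use True in auto)
    then have "ld i y = 0" by (simp add: spn_def)
    then show ?thesis by simp
  next
    case False
    define \<nu> where "\<nu> = \<mu>(i := \<mu> i - 1)"
    have "wt (u @ v) = \<nu>" if "wt (u @ i # v) = \<mu>" for u v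
      unfolding \<nu>_def that[symmetric] by (auto simp: fun_eq_iff)
    then have "homog \<nu> (ld i y)" by (rule spn_ld[OF _ Cons(2)])
    moreover have "wt w \<noteq> \<nu>"
    proof
      assume "wt w = \<nu>"
      then have "wt (i # w) = \<mu>" using False by (auto simp: \<nu>_def fun_eq_iff)
      with Cons(3) show False by simp
    qed
    ultimately show ?thesis using Cons(1) by simp
  qed
qed

subsection \<open>The radical\<close>

definition Rad :: "('i word \<Rightarrow>\<^sub>0 qpi) set" where "Rad = {y. \<forall>w. formw w y = 0}"

lemma Rad_0 [simp]: "0 \<in> Rad" by (simp add: Rad_def)
lemma Rad_add: "x \<in> Rad \<Longrightarrow> y \<in> Rad \<Longrightarrow> x + y \<in> Rad" by (simp add: Rad_def)
lemma Rad_diff: "x \<in> Rad \<Longrightarrow> y \<in> Rad \<Longrightarrow> x - y \<in> Rad" by (simp add: Rad_def)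
lemma Rad_smul: "x \<in> Rad \<Longrightarrow> c \<cdot> x \<in> Rad" by (simp add: Rad_def)

lemma Rad_ld: "x \<in> Rad \<Longrightarrow> ld i x \<in> Rad"
  by (auto simp: Rad_def simp flip: formw.simps(2))

lemma Rad_rd: "x \<in> Rad \<Longrightarrow> rd i x \<in> Rad"
  by (auto simp: Rad_def simp flip: formw_snoc)

lemma formw_Dg: "formw w (Dg f y) = wprod f w * formw w y"
  by (induction w arbitrary: y) (auto simp: ld_Dg)

lemma Rad_Dg: "x \<in> Rad \<Longrightarrow> Dg f x \<in> Rad"
  by (simp add: Rad_def formw_Dg)

lemma Rad_Cons: assumes "x \<in> Rad" shows "wd [i] * x \<in> Rad"
proof -
  have "formw w (wd [i] * x) = 0" if "x \<in> Rad" for w x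
    using that
  proof (induction w arbitrary: x)
    case (Cons j w)
    then show ?case by (auto simp: ld_Cons Rad_ld) (simp_all add: Rad_def)
  qed simp
  then show ?thesis using assms by (simp add: Rad_def)
qed

lemma Rad_snoc: assumes "x \<in> Rad" shows "x * wd [i] \<in> Rad"
proof -
  have "formw w (x * wd [i]) = 0" if "x \<in> Rad" for w x
    using that
  proof (induction w arbitrary: x rule: rev_induct)
    case Nil
    have "lookup (x * wd [i]) 0 = 0"
      by (rule lin_eqI[where f = "\<lambda>z. lookup (z * wd [i]) 0" and g = "\<lambda>_. 0", OF lin_comp[OF lin_mult_right[OF lin_id] lin_lookup]])
         (auto simp: lin_def lookup_wd zero_word_def simp flip: wd_append)
    then show ?case by simp
  next
    case (snoc j w)
    then show ?case by (auto simp: formw_snoc rd_mult Rad_rd) (auto simp: Rad_def)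
  qed
  then show ?thesis using assms by (simp add: Rad_def)
qed

lemma Rad_mult_left: assumes "x \<in> Rad" shows "y * x \<in> Rad"
proof (induction y rule: fa_induct)
  case (word c w)
  have "wd w * x \<in> Rad"
  proof (induction w)
    case (Cons j w) then show ?case by (simp add: wd_Cons[of j w] mult.assoc Rad_Cons)
  qed (use assms in \<open>simp add: wd_Nil\<close>)
  then show ?case by (simp add: Rad_smul)
qed (auto simp: algebra_simps intro: Rad_add)

lemma Rad_mult_right: assumes "x \<in> Rad" shows "x * y \<in> Rad"
proof (induction y rule: fa_induct)
  case (word c w)
  have "x * wd w \<in> Rad"
  proof (induction w rule: rev_induct)
    case (snoc j w) then show ?case by (simp add: wd_append Rad_snoc flip: mult.assoc)
  qed (use assms in \<open>simp add: wd_Nil\<close>)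
  then show ?case by (simp add: Rad_smul)
qed (auto simp: algebra_simps intro: Rad_add)

lemma Rad_lookup_0: "x \<in> Rad \<Longrightarrow> lookup x 0 = 0"
  unfolding Rad_def by (metis (mono_tags, lifting) formw.simps(1) mem_Collect_eq)

subsection \<open>Dual families\<close>

text \<open>The form is degenerate, so a generalized inverse of its Gram matrix on a weight space takes the
  place of the dual basis: \<open>star w\<close> is dual to the word \<open>w\<close> up to the radical only.\<close>

lemma star_exists:
  "\<exists>s. (\<forall>w. homog (wt w) (s w)) \<and>
       (\<forall>\<mu> u v. wt u = \<mu> \<longrightarrow> wt v = \<mu> \<longrightarrow>
          (\<Sum>w | wt w = \<mu>. formw u (s w) * formw w (wd v)) = formw u (wd v))"
proof -
  define Q where "Q \<mu> h \<longleftrightarrow> (\<forall>a\<in>{w. wt w = \<mu>}. \<forall>c\<in>{w. wt w = \<mu>}.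
      (\<Sum>b | wt b = \<mu>. \<Sum>a' | wt a' = \<mu>. formw a (wd b) * h b a' * formw a' (wd c)) = formw a (wd c))" for \<mu> h
  have "\<forall>\<mu>. \<exists>h. Q \<mu> h"
    unfolding Q_def by (rule allI, rule generalized_inverse) (rule finite_wt)+
  from choice[OF this] obtain h where h0: "\<And>\<mu>. Q \<mu> (h \<mu>)" by blast
  have h: "(\<Sum>b | wt b = \<mu>. \<Sum>a' | wt a' = \<mu>. formw a (wd b) * h \<mu> b a' * formw a' (wd c)) = formw a (wd c)"
    if "wt a = \<mu>" "wt c = \<mu>" for \<mu> a c
    using h0[of \<mu>] that unfolding Q_def by simp
  define s where "s w = (\<Sum>b | wt b = wt w. h (wt w) b w \<cdot> wd b)" for w
  have "homog (wt w) (s w)" for w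
    unfolding s_def by (intro spn_sum spn_smul) simp
  moreover have "(\<Sum>w | wt w = \<mu>. formw u (s w) * formw w (wd v)) = formw u (wd v)" if "wt u = \<mu>" "wt v = \<mu>" for \<mu> u v
  proof -
    have "(\<Sum>w | wt w = \<mu>. formw u (s w) * formw w (wd v)) =
        (\<Sum>w | wt w = \<mu>. \<Sum>b | wt b = \<mu>. formw u (wd b) * h \<mu> b w * formw w (wd v))"
      by (intro sum.cong refl) (simp add: s_def lin_sum[OF lin_formw] sum_distrib_left mult_ac)
    also have "\<dots> = formw u (wd v)" by (subst sum.swap) (rule h[OF that])
    finally show ?thesis .
  qed
  ultimately show ?thesis by (intro exI[of _ s]) blast
qed

definition star :: "'i list \<Rightarrow> ('i word \<Rightarrow>\<^sub>0 qpi)" where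
  "star = (SOME s. (\<forall>w. homog (wt w) (s w)) \<and>
       (\<forall>\<mu> u v. wt u = \<mu> \<longrightarrow> wt v = \<mu> \<longrightarrow>
          (\<Sum>w | wt w = \<mu>. formw u (s w) * formw w (wd v)) = formw u (wd v)))"

lemma star_hom: "homog (wt w) (star w)"
  and star_dual: "wt u = \<mu> \<Longrightarrow> wt v = \<mu> \<Longrightarrow> (\<Sum>w | wt w = \<mu>. formw u (star w) * formw w (wd v)) = formw u (wd v)"
  using someI_ex[OF star_exists] unfolding star_def[symmetric] by blast+

lemma star_expand: "homog \<mu> z \<Longrightarrow> z - (\<Sum>w | wt w = \<mu>. formw w z \<cdot> star w) \<in> Rad"
proof -
  assume z: "homog \<mu> z"
  have "formw u (z - (\<Sum>w | wt w = \<mu>. formw w z \<cdot> star w)) = 0" for u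
  proof (cases "wt u = \<mu>")
    case True
    from z have "(\<Sum>w | wt w = \<mu>. formw u (star w) * formw w z) = formw u z"
      by (induction rule: spn_induct)
         (use star_dual[OF True] in \<open>auto simp: algebra_simps sum.distrib simp flip: sum_distrib_left\<close>)
    then show ?thesis by (simp add: lin_sum[OF lin_formw] mult.commute)
  next
    case False
    have "homog \<mu> (z - (\<Sum>w | wt w = \<mu>. formw w z \<cdot> star w))"
      using z star_hom by (intro spn_diff spn_sum spn_smul) auto
    then show ?thesis using False by (rule formw_hom)
  qed
  then show ?thesis unfolding Rad_def by blast
qed

text \<open>The identity that expands a vector in the family \<open>star\<close> also expands a word
  in words, with pairings against \<open>star\<close> as coordinates; symmetry of the form exchanges
  the two arguments.\<close>

lemma star_expand_left: "wd v - (\<Sum>w | wt w = wt v. formw v (star w) \<cdot> wd w) \<in> Rad"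
proof -
  have "formw u (wd v - (\<Sum>w | wt w = wt v. formw v (star w) \<cdot> wd w)) = 0" for u
  proof (cases "wt u = wt v")
    case True
    have "(\<Sum>w | wt w = wt v. formw v (star w) * formw u (wd w)) = formw v (wd u)"
      using star_dual[OF refl True] by (simp add: formw_sym[of u])
    then show ?thesis by (simp add: lin_sum[OF lin_formw] formw_sym[of u v])
  next
    case False
    have "homog (wt v) (wd v - (\<Sum>w | wt w = wt v. formw v (star w) \<cdot> wd w))"
      by (intro spn_diff spn_sum spn_smul) auto
    then show ?thesis using False by (rule formw_hom)
  qed
  then show ?thesis unfolding Rad_def by blast
qed

end

section \<open>Cartan data and Serre elements\<close>

text \<open>The unbalanced quantum integer. Derivatives of \<theta>_i^n produce it directly, with t
  = \<open>tt i\<close>; \<open>qint_qn\<close> compares it with the balanced one.\<close>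

definition qn :: "qpi \<Rightarrow> nat \<Rightarrow> qpi" where "qn t n = (\<Sum>k<n. t ^ k)"

lemma qn_simps [simp]: "qn t 0 = 0" "qn t (Suc n) = qn t n + t ^ n"
  by (simp_all add: qn_def)

lemma qn_Suc': "qn t (Suc n) = 1 + t * qn t n"
proof (induction n)
  case (Suc n)
  have "qn t (Suc (Suc n)) = qn t (Suc n) + t ^ Suc n" by simp
  also have "\<dots> = 1 + t * qn t n + t ^ Suc n" by (simp only: Suc)
  finally show ?case by (simp only: qn_simps(2)[of t n] distrib_left power_Suc add.assoc)
qed simp

lemma qn_geom: "(1 - t) * qn t n = 1 - t ^ n"
proof (induction n)
  case (Suc n)
  have "(1 - t) * qn t (Suc n) = (1 - t) * qn t n + (t ^ n - t ^ Suc n)" by (simp add: algebra_simps)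
  then show ?case by (simp only: Suc) simp
qed simp

locale datum =
  fixes D :: "('i::finite, 'x, 'y, 'm) root_datum_scheme"
  assumes cartan_datum: "super_cartan_datum D"
begin

abbreviation "dg \<equiv> dd D"
abbreviation "pr \<equiv> par D"
abbreviation "fm \<equiv> form D"
abbreviation "ca \<equiv> cartan D"

lemma fm_sym: "fm i j = fm j i"
  and fm_diag: "fm i i > 0" "even (fm i i)"
  and ca_le: "i \<noteq> j \<Longrightarrow> ca i j \<le> 0"
  and ca_dvd: "i \<noteq> j \<Longrightarrow> fm i i dvd 2 * fm i j"
  and ca_even: "i \<in> odds D \<Longrightarrow> even (ca i j)"
  and dg_par: "dg i mod 2 = pr i"
  using cartan_datum unfolding super_cartan_datum_def by auto

lemma fm_ii: "fm i i = 2 * int (dg i)"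
  using fm_diag[of i] by (auto simp: dd_def)

lemma dg_pos: "dg i > 0"
  using fm_diag(1)[of i] fm_ii[of i] by simp

lemma fm_ca: "fm i j = int (dg i) * ca i j"
proof (cases "i = j")
  case True
  then show ?thesis using fm_diag[of i] by (simp add: cartan_def fm_ii)
next
  case False
  then have "2 * fm i j = ca i j * fm i i" using ca_dvd by (simp add: cartan_def)
  then show ?thesis by (simp add: fm_ii)
qed

lemma pr_odds: "pr i = (if i \<in> odds D then 1 else 0)"
  by (simp add: par_def)

lemma even_dg: "even (dg i) \<longleftrightarrow> pr i = 0"
  using dg_par[of i] by (auto simp: even_iff_mod_2_eq_zero)

lemma pr_sq [simp]: "pr i * pr i = pr i"
  by (simp add: pr_odds)

text \<open>For odd i the Cartan integer is even, for even i the factor d_i is. This is the reason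
  why each \<open>Jtilde D i\<close> commutes with all E_j (\<open>ppow_fm\<close>).\<close>

lemma fm_even: "even (fm i j)"
  using ca_even[of i j] even_dg[of i] by (auto simp: fm_ca pr_odds)

definition chi :: "'i \<Rightarrow> 'i \<Rightarrow> qpi" where "chi i j = ppow (pr i * pr j) * qpow (fm i j)"

sublocale braiding chi
  by standard (simp add: chi_def fm_sym mult.commute)

definition hh :: "'i \<Rightarrow> qpi" where "hh i = ppii D i * qi D i - inverse (qi D i)"

definition tt :: "'i \<Rightarrow> qpi" where "tt i = ppow (pr i) * qpow (2 * int (dg i))"

lemma ppii_ppow: "ppii D i = ppow (pr i)"
  by (simp add: ppii_def ppow_def)

lemma qi_qpow: "qi D i = qpow (int (dg i))"
  by (simp add: qi_def qq_qpow qpow_power)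

lemma hh_eq: "hh i = ppow (pr i) * qpow (int (dg i)) - qpow (- int (dg i))"
  by (simp add: hh_def ppii_ppow qi_qpow inverse_qpow)

lemma hh_tt: "hh i = - (qpow (- int (dg i)) * (1 - tt i))"
  by (simp add: hh_eq tt_def algebra_simps flip: qpow_add)

lemma unit_hh: "hh i dvd 1"
  unfolding hh_tt tt_def using dg_pos[of i]
  by (intro unit_neg unit_mult unit_one_minus unit_qpow) simp

lemma tt_chi: "chi i i = tt i"
  by (simp add: chi_def tt_def fm_ii)

lemma tt_power: "tt i ^ n = ppow (pr i * n) * qpow (2 * int (dg i) * int n)"
  by (simp add: tt_def power_mult_distrib qpow_power ppow_def power_mult)

lemma unit_one_minus_tt: "n > 0 \<Longrightarrow> (1 - tt i ^ n) dvd 1"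
  unfolding tt_power using dg_pos[of i] by (intro unit_one_minus) simp

lemma unit_qn: "n > 0 \<Longrightarrow> qn (tt i) n dvd 1"
  using unit_one_minus_tt[of n i] unfolding qn_geom[symmetric] by (rule dvd_mult_right)

abbreviation th :: "'i \<Rightarrow> nat \<Rightarrow> ('i word \<Rightarrow>\<^sub>0 qpi)" where "th i n \<equiv> wd (replicate n i)"

lemma th_Suc: "th i (Suc n) = wd [i] * th i n" and th_Suc': "th i (Suc n) = th i n * wd [i]"
  by (simp_all add: replicate_append_same flip: wd_append)

lemma wprod_replicate [simp]: "wprod f (replicate n i) = f i ^ n"
  by (induction n) auto

lemma rd_th: "rd k (th i n) = (if k = i then qn (tt i) n \<cdot> th i (n - 1) else 0)"
proof (induction n)
  case (Suc n)
  have *: "rd k (th i (Suc n)) = wd [i] * rd k (th i n) + (if k = i then Dg (chi k) (th i n) else 0)"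
    by (simp only: th_Suc rd_Cons)
  show ?case unfolding * Suc.IH
    by (cases n) (simp_all add: tt_chi wd_Nil fa.scale_left_distrib distrib_left th_Suc[symmetric] del: replicate_Suc)
qed (simp add: wd_Nil)

lemma ld_th: "ld k (th i n) = (if k = i then qn (tt i) n \<cdot> th i (n - 1) else 0)"
proof (induction n)
  case (Suc n)
  have *: "ld k (th i (Suc n)) = chi k i \<cdot> (wd [i] * ld k (th i n)) + (if k = i then th i n else 0)"
    by (simp only: th_Suc ld_Cons)
  show ?case unfolding * Suc.IH qn_Suc'[of _ n]
    by (cases n) (simp_all add: tt_chi wd_Nil algebra_simps th_Suc[symmetric] del: replicate_Suc)
qed (simp add: wd_Nil)

section \<open>Serre coefficients and the derivatives of Serre elements\<close>

definition sm :: "'i \<Rightarrow> 'i \<Rightarrow> nat" where "sm i j = nat (1 - ca i j)"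

definition sc :: "'i \<Rightarrow> 'i \<Rightarrow> nat \<Rightarrow> qpi" where
  "sc i j n = (- 1) ^ n * ppii D i ^ (n * pr j + (n choose 2)) * qbinom D i (sm i j) n"

definition serref :: "'i \<Rightarrow> 'i \<Rightarrow> ('i word \<Rightarrow>\<^sub>0 qpi)" where
  "serref i j = (\<Sum>n=0..sm i j. sc i j n \<cdot> (th i n * wd [j] * th i (sm i j - n)))"

lemma sm_ca: "i \<noteq> j \<Longrightarrow> int (sm i j) = 1 - ca i j"
  using ca_le[of i j] by (simp add: sm_def)

lemma sm_pos: "i \<noteq> j \<Longrightarrow> sm i j > 0"
  using ca_le[of i j] by (simp add: sm_def)

lemma qint_qn: "qint D i n = qpow (int (dg i) * (1 - int n)) * qn (tt i) n"
proof -
  have 1: "hh i * (qpow (int (dg i) * (1 - int n)) * qn (tt i) n) = (ppii D i * qi D i) ^ n - inverse (qi D i) ^ n"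
  proof -
    have "hh i * (qpow (int (dg i) * (1 - int n)) * qn (tt i) n)
        = - (qpow (- int (dg i)) * qpow (int (dg i) * (1 - int n)) * ((1 - tt i) * qn (tt i) n))"
      by (simp add: hh_tt mult_ac)
    also have "\<dots> = - (qpow (- int (dg i) * int n) * (1 - tt i ^ n))"
      unfolding qn_geom qpow_add[symmetric] by (simp add: algebra_simps)
    also have "\<dots> = qpow (- int (dg i) * int n) * tt i ^ n - qpow (- int (dg i) * int n)"
      by (simp add: algebra_simps)
    also have "qpow (- int (dg i) * int n) * tt i ^ n = ppow (pr i * n) * qpow (int (dg i) * int n)"
      by (simp add: tt_power mult.left_commute mult.commute[of "int n"] flip: qpow_add)
    finally show ?thesis
      by (simp add: ppii_ppow qi_qpow inverse_qpow qpow_power power_mult_distrib ppow_def power_mult)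
  qed
  have "qint D i n = ((ppii D i * qi D i) ^ n - inverse (qi D i) ^ n) * inverse (hh i)"
    by (simp add: qint_def divide_pi_ext_def hh_def)
  also have "\<dots> = (hh i * inverse (hh i)) * (qpow (int (dg i) * (1 - int n)) * qn (tt i) n)"
    unfolding 1[symmetric] by (simp only: mult_ac)
  finally show ?thesis using pi_ext_mult_inverse[OF unit_hh[of i]] by simp
qed

lemma unit_qint: "n > 0 \<Longrightarrow> qint D i n dvd 1"
  unfolding qint_qn by (intro unit_mult unit_qpow unit_qn)

lemma unit_qfact: "qfact D i n dvd 1"
  unfolding qfact_def by (intro unit_prod unit_qint) simp

lemma qfact_Suc: "qfact D i (Suc n) = qint D i (Suc n) * qfact D i n"
  by (simp add: qfact_def mult.commute)

lemma unit_qbinom: "qbinom D i m n dvd 1"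
  unfolding qbinom_def divide_pi_ext_def by (intro unit_mult unit_inverse unit_qfact)

lemma qbinom_eq: "qbinom D i m n * (qfact D i n * qfact D i (m - n)) = qfact D i m"
proof -
  have "qfact D i n * qfact D i (m - n) dvd 1" by (intro unit_mult unit_qfact)
  from pi_ext_mult_inverse[OF this] show ?thesis
    by (simp add: qbinom_def divide_pi_ext_def mult.assoc mult.commute[of "inverse _"])
qed

lemma qbinom_0: "qbinom D i m 0 = 1"
proof (rule unit_cancel[OF unit_qfact[of i m]])
  show "qfact D i m * qbinom D i m 0 = qfact D i m * 1"
    using qbinom_eq[of i m 0] by (simp add: qfact_def mult.commute)
qed

lemma qbinom_Suc:
  assumes "n < m"
  shows "qbinom D i m (Suc n) * qint D i (Suc n) = qbinom D i m n * qint D i (m - n)"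
proof -
  let ?u = "qfact D i n * qfact D i (m - Suc n)"
  have "Suc (m - Suc n) = m - n" using assms by simp
  then have f: "qfact D i (m - n) = qint D i (m - n) * qfact D i (m - Suc n)"
    using qfact_Suc[of i "m - Suc n"] by simp
  have "?u * (qbinom D i m (Suc n) * qint D i (Suc n)) = qfact D i m"
    unfolding qbinom_eq[of i m "Suc n", symmetric] qfact_Suc by (simp add: mult_ac)
  also have "\<dots> = ?u * (qbinom D i m n * qint D i (m - n))"
    unfolding qbinom_eq[of i m n, symmetric] f by (simp add: mult_ac)
  finally show ?thesis by (rule unit_cancel[rotated]) (intro unit_mult unit_qfact)
qed

lemma sc_0: "sc i j 0 = 1"
  by (simp add: sc_def qbinom_0 binomial_eq_0)

lemma unit_sc: "sc i j n dvd 1"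
  unfolding sc_def ppii_ppow by (intro unit_mult unit_power unit_qbinom unit_ppow) simp

lemma chi_sm: "i \<noteq> j \<Longrightarrow> chi i j = ppow (pr i * pr j) * qpow (int (dg i) * (1 - int (sm i j)))"
  by (simp add: chi_def fm_ca sm_ca)

lemma sm_odd: assumes "i \<noteq> j" shows "even (pr i * (sm i j - 1))"
proof (cases "i \<in> odds D")
  case True
  have "int (sm i j - 1) = - ca i j" using sm_ca[OF assms] sm_pos[OF assms] by linarith
  then have "even (int (sm i j - 1))" using ca_even[OF True, of j] by simp
  then show ?thesis by simp
qed (simp add: pr_odds)

text \<open>This ratio of consecutive coefficients is what lets neighbouring terms cancel in a
  derivative of the Serre element. The sign comes from (-1)^n, the power of \<pi>_i from (n+1 choose
  2) = (n choose 2) + n, the rest from the ratio of binomials.\<close>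

lemma sc_Suc:
  assumes "i \<noteq> j" "n < sm i j"
  shows "sc i j (Suc n) * qn (tt i) (Suc n) = - (chi i j * tt i ^ n * qn (tt i) (sm i j - n) * sc i j n)"
proof -
  let ?m = "sm i j" and ?d = "int (dg i)"
  have "Suc n choose 2 = (n choose 2) + n" by (simp add: numeral_2_eq_2)
  then have e: "ppii D i ^ (Suc n * pr j + (Suc n choose 2)) = ppow (pr i * (pr j + n)) * ppii D i ^ (n * pr j + (n choose 2))"
    by (simp add: ppii_ppow ppow_def algebra_simps flip: power_add power_mult)
  have 1: "sc i j (Suc n) * qint D i (Suc n) = - (ppow (pr i * (pr j + n)) * sc i j n * qint D i (?m - n))"
  proof -
    have "sc i j (Suc n) * qint D i (Suc n)
       = - ((- 1) ^ n * ppow (pr i * (pr j + n)) * ppii D i ^ (n * pr j + (n choose 2)) *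
           (qbinom D i ?m (Suc n) * qint D i (Suc n)))"
      unfolding sc_def e by (simp add: mult_ac)
    then show ?thesis unfolding qbinom_Suc[OF assms(2)] sc_def by (simp add: mult_ac)
  qed
  have i: "int (?m - n) = int ?m - int n" using assms by simp
  have q: "qpow (?d * int n) * qpow (?d * (1 - int (Suc n))) = 1"
    by (simp add: algebra_simps flip: qpow_add)
  have "sc i j (Suc n) * qn (tt i) (Suc n)
      = (qpow (?d * int n) * qpow (?d * (1 - int (Suc n)))) * (sc i j (Suc n) * qn (tt i) (Suc n))"
    by (simp only: q mult_1)
  also have "\<dots> = qpow (?d * int n) * (sc i j (Suc n) * qint D i (Suc n))"
    unfolding qint_qn by (simp only: mult_ac)
  also have "\<dots> = - (qpow (?d * int n) * qpow (?d * (1 - int (?m - n))) * ppow (pr i * (pr j + n)) * qn (tt i) (?m - n) * sc i j n)"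
    unfolding 1 by (simp add: qint_qn mult_ac del: qn_simps)
  also have "qpow (?d * int n) * qpow (?d * (1 - int (?m - n))) * ppow (pr i * (pr j + n)) = chi i j * tt i ^ n"
    unfolding chi_sm[OF assms(1)] tt_power i
    by (simp add: algebra_simps flip: qpow_add ppow_add) (simp add: algebra_simps ppow_add qpow_add)
  finally show ?thesis .
qed

text \<open>The powers of q cancel since a_ij = 1 - m for m = \<open>sm i j\<close>. The power of
  \<pi>_i that is left, m - 1, is even for odd i: here the evenness of a_ij is used.\<close>

lemma chi_inverse_square: assumes "i \<noteq> j" shows "chi i j * chi i j * tt i ^ (sm i j - 1) = 1"
proof -
  have i: "int (sm i j - 1) = int (sm i j) - 1" using sm_pos[OF assms] by simp
  have "chi i j * chi i j * tt i ^ (sm i j - 1) = (ppow (pr i * pr j) * ppow (pr i * pr j)) * ppow (pr i * (sm i j - 1)) *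
      qpow (int (dg i) * (1 - int (sm i j)) + int (dg i) * (1 - int (sm i j)) + 2 * int (dg i) * (int (sm i j) - 1))"
    unfolding chi_sm[OF assms] tt_power i qpow_add by (simp only: mult_ac)
  then show ?thesis using ppow_even[OF sm_odd[OF assms]] by (simp add: algebra_simps)
qed

lemma sc_1: assumes "i \<noteq> j" "ca i j = 0" shows "sm i j = 1" "sc i j 1 = - ppow (pr i * pr j)"
proof -
  show s: "sm i j = 1" using assms(2) by (simp add: sm_def)
  have "sc i j (Suc 0) * qn (tt i) (Suc 0) = - (chi i j * tt i ^ 0 * qn (tt i) (sm i j - 0) * sc i j 0)"
    by (rule sc_Suc[OF assms(1)]) (simp add: s)
  moreover have "fm i j = 0" using assms(2) by (simp add: fm_ca)
  ultimately show "sc i j 1 = - ppow (pr i * pr j)" by (simp add: s sc_0 chi_def)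
qed

text \<open>The generating function of the Serre coefficients satisfies a \<open>t\<close>-difference equation that
  forces it to vanish at \<open>t\<^sup>k \<chi>\<^sub>i\<^sub>j\<close> for \<open>k\<close> below the degree.\<close>

lemma sc_sum:
  assumes "i \<noteq> j" "k < sm i j"
  shows "(\<Sum>n=0..sm i j. sc i j n * (tt i ^ k * chi i j) ^ n) = 0"
proof -
  let ?m = "sm i j" and ?t = "tt i" and ?c = "chi i j"
  define f where "f z = (\<Sum>n=0..?m. sc i j n * z ^ n)" for z
  have rec: "sc i j (Suc n) * (1 - ?t ^ Suc n) = - (?c * (?t ^ n - ?t ^ ?m) * sc i j n)" if "n < ?m" for n
  proof -
    have "sc i j (Suc n) * (1 - ?t ^ Suc n) = (1 - ?t) * (sc i j (Suc n) * qn ?t (Suc n))"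
      unfolding qn_geom[symmetric] by (simp add: mult_ac)
    also have "\<dots> = - (?c * ?t ^ n * ((1 - ?t) * qn ?t (?m - n)) * sc i j n)"
      unfolding sc_Suc[OF assms(1) that] by (simp add: mult_ac)
    also have "\<dots> = - (?c * (?t ^ n - ?t ^ n * ?t ^ (?m - n)) * sc i j n)"
      unfolding qn_geom by (simp add: algebra_simps)
    also have "?t ^ n * ?t ^ (?m - n) = ?t ^ ?m" using that by (simp flip: power_add)
    finally show ?thesis .
  qed
  have diff: "f z - f (?t * z) = - (?c * z * (f (?t * z) - ?t ^ ?m * f z))" for z
  proof -
    have "f z - f (?t * z) = (\<Sum>n=0..?m. sc i j n * (1 - ?t ^ n) * z ^ n)"
      by (simp add: f_def sum_subtractf[symmetric] power_mult_distrib algebra_simps)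
    also have "\<dots> = (\<Sum>n<?m. sc i j (Suc n) * (1 - ?t ^ Suc n) * z ^ Suc n)"
      unfolding atLeast0AtMost lessThan_Suc_atMost[symmetric] by (subst sum.lessThan_Suc_shift) simp
    also have "\<dots> = (\<Sum>n<?m. - (?c * z * ((?t ^ n - ?t ^ ?m) * sc i j n * z ^ n)))"
      by (intro sum.cong refl) (simp add: rec del: power_Suc, simp add: mult_ac)
    also have "\<dots> = - (?c * z * (\<Sum>n<Suc ?m. (?t ^ n - ?t ^ ?m) * sc i j n * z ^ n))"
      by (simp add: sum_distrib_left sum_negf)
    also have "(\<Sum>n<Suc ?m. (?t ^ n - ?t ^ ?m) * sc i j n * z ^ n) = f (?t * z) - ?t ^ ?m * f z"
      unfolding f_def atLeast0AtMost lessThan_Suc_atMost sum_distrib_left sum_subtractf[symmetric]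
      by (intro sum.cong refl) (simp add: power_mult_distrib algebra_simps)
    finally show ?thesis .
  qed
  \<comment> \<open>This is \<open>diff\<close> at z = t^k c, simplified by c^2 t^(m-1) = 1. The
    same relation makes the last factor vanish for k = m - 1, which starts a downward induction on
    k; each 1 - t^(k+1) is a unit.\<close>
  have step: "f (?t ^ k * ?c) * (1 - ?t ^ Suc k) = f (?t ^ Suc k * ?c) * (1 - ?t ^ k * ?c * ?c)" for k
  proof -
    have m: "?t ^ ?m = ?t * ?t ^ (?m - 1)" using sm_pos[OF assms(1)] by (simp flip: power_Suc)
    have "?c * (?t ^ k * ?c) * ?t ^ ?m = ?t ^ Suc k * (?c * ?c * ?t ^ (?m - 1))"
      unfolding m by (simp add: mult_ac)
    then have c: "?c * (?t ^ k * ?c) * ?t ^ ?m = ?t ^ Suc k" using chi_inverse_square[OF assms(1)] by simp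
    have "f (?t ^ k * ?c) - f (?t ^ Suc k * ?c)
        = - (?c * (?t ^ k * ?c) * f (?t ^ Suc k * ?c)) + (?c * (?t ^ k * ?c) * ?t ^ ?m) * f (?t ^ k * ?c)"
      using diff[of "?t ^ k * ?c"] by (simp add: algebra_simps)
    then show ?thesis unfolding c by (simp add: algebra_simps)
  qed
  have "f (?t ^ k * ?c) = 0" if "k < ?m" for k
    using that
  proof (induction "?m - 1 - k" arbitrary: k)
    case 0
    then have "k = ?m - 1" by simp
    then have "?t ^ k * ?c * ?c = 1" using chi_inverse_square[OF assms(1)] by (simp add: mult_ac)
    then have "(1 - ?t ^ Suc k) * f (?t ^ k * ?c) = (1 - ?t ^ Suc k) * 0"
      using step[of k] by (simp add: mult.commute)
    then show ?case by (rule unit_cancel[OF unit_one_minus_tt[of "Suc k" i], rotated]) simp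
  next
    case (Suc l)
    then have "f (?t ^ Suc k * ?c) = 0" by (intro Suc.hyps(1)) auto
    then have "(1 - ?t ^ Suc k) * f (?t ^ k * ?c) = (1 - ?t ^ Suc k) * 0"
      using step[of k] by (simp add: mult.commute)
    then show ?case by (rule unit_cancel[OF unit_one_minus_tt[of "Suc k" i], rotated]) simp
  qed
  from this[OF assms(2)] show ?thesis by (simp add: f_def)
qed

text \<open>For k = i every \<theta>_i^n \<theta>_j \<theta>_i^(m-1-n) arises from two neighbouring
  summands, whose coefficients cancel by \<open>sc_Suc\<close>. For k = j only \<theta>_i^m
  survives; its coefficient is, up to a factor, the generating function of \<open>sc_sum\<close> at
  the zero t^(m-1) c, and in \<open>ld_serref\<close> at the zero c.\<close>

lemma rd_serref: assumes "i \<noteq> j" shows "rd k (serref i j) = 0"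
proof -
  let ?m = "sm i j" and ?t = "tt i" and ?c = "chi i j"
  have ji: "chi j i = ?c" by (rule \<chi>_sym)
  have t: "rd k (th i n * wd [j] * th i (?m - n)) =
      (if k = i then qn ?t (?m - n) \<cdot> (th i n * wd [j] * th i (?m - n - 1))
         + (qn ?t n * ?c * ?t ^ (?m - n)) \<cdot> (th i (n - 1) * wd [j] * th i (?m - n))
       else if k = j then ?c ^ (?m - n) \<cdot> th i ?m else 0)" if "n \<le> ?m" for n
  proof -
    have "th i n * th i (?m - n) = th i ?m" using that by (simp flip: wd_append replicate_add)
    then show ?thesis using assms ji
      by (auto simp: rd_mult rd_th tt_chi mult.assoc algebra_simps Dg_mult)
  qed
  consider "k = i" | "k = j" | "k \<noteq> i" "k \<noteq> j" by blast
  then show ?thesis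
  proof cases
    case 1
    let ?X = "\<lambda>n. th i n * wd [j] * th i (?m - Suc n)"
    have "rd k (serref i j) = (\<Sum>n=0..?m. (sc i j n * qn ?t (?m - n)) \<cdot> ?X n)
        + (\<Sum>n=0..?m. (sc i j n * qn ?t n * ?c * ?t ^ (?m - n)) \<cdot> (th i (n - 1) * wd [j] * th i (?m - n)))"
      unfolding serref_def lin_sum[OF lin_rd] sum.distrib[symmetric]
      by (intro sum.cong refl) (use 1 in \<open>simp add: t[unfolded 1] fa.scale_right_distrib add.commute mult.assoc[where 'a = qpi]\<close>)
    also have "(\<Sum>n=0..?m. (sc i j n * qn ?t (?m - n)) \<cdot> ?X n) = (\<Sum>n<?m. (sc i j n * qn ?t (?m - n)) \<cdot> ?X n)"
      unfolding atLeast0AtMost lessThan_Suc_atMost[symmetric] by simp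
    also have "(\<Sum>n=0..?m. (sc i j n * qn ?t n * ?c * ?t ^ (?m - n)) \<cdot> (th i (n - 1) * wd [j] * th i (?m - n)))
        = (\<Sum>n<?m. (sc i j (Suc n) * qn ?t (Suc n) * ?c * ?t ^ (?m - Suc n)) \<cdot> ?X n)"
      unfolding atLeast0AtMost lessThan_Suc_atMost[symmetric]
      by (subst sum.lessThan_Suc_shift) simp
    also have "\<dots> = (\<Sum>n<?m. (- (sc i j n * qn ?t (?m - n))) \<cdot> ?X n)"
    proof (intro sum.cong refl arg_cong2[where f = smul])
      fix n assume n: "n \<in> {..<?m}"
      have "?t ^ n * ?t ^ (?m - Suc n) = ?t ^ (?m - 1)" using n by (simp flip: power_add)
      then have c: "?c * ?c * (?t ^ n * ?t ^ (?m - Suc n)) = 1"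
        using chi_inverse_square[OF assms] by simp
      have "sc i j (Suc n) * qn ?t (Suc n) * ?c * ?t ^ (?m - Suc n)
        = - (sc i j n * qn ?t (?m - n)) * (?c * ?c * (?t ^ n * ?t ^ (?m - Suc n)))"
        using n by (simp add: sc_Suc[OF assms] mult_ac del: qn_simps)
      then show "sc i j (Suc n) * qn ?t (Suc n) * ?c * ?t ^ (?m - Suc n) = - (sc i j n * qn ?t (?m - n))"
        unfolding c by simp
    qed
    finally show ?thesis by (simp add: sum_negf)
  next
    case 2
    have c1: "?c * (?t ^ (?m - 1) * ?c) = 1"
      using chi_inverse_square[OF assms] by (simp add: mult_ac)
    have "rd k (serref i j) = (\<Sum>n=0..?m. sc i j n * ?c ^ (?m - n)) \<cdot> th i ?m"
      unfolding serref_def lin_sum[OF lin_rd] fa.scale_sum_left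
      by (intro sum.cong refl) (use 2 assms in \<open>simp add: t[unfolded 2]\<close>)
    also have "(\<Sum>n=0..?m. sc i j n * ?c ^ (?m - n)) = ?c ^ ?m * (\<Sum>n=0..?m. sc i j n * (?t ^ (?m - 1) * ?c) ^ n)"
      unfolding sum_distrib_left
    proof (intro sum.cong refl)
      fix n assume "n \<in> {0..?m}"
      then have "?c ^ ?m * (?t ^ (?m - 1) * ?c) ^ n = ?c ^ (?m - n) * (?c * (?t ^ (?m - 1) * ?c)) ^ n"
        by (simp add: power_mult_distrib mult_ac flip: power_add)
           (simp flip: power_add mult.assoc)
      then show "sc i j n * ?c ^ (?m - n) = ?c ^ ?m * (sc i j n * (?t ^ (?m - 1) * ?c) ^ n)"
        unfolding c1 by (simp add: mult.left_commute)
    qed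
    also have "\<dots> = 0" using sc_sum[OF assms, of "?m - 1"] sm_pos[OF assms] by simp
    finally show ?thesis by simp
  next
    case 3
    then show ?thesis unfolding serref_def lin_sum[OF lin_rd]
      by (intro sum.neutral ballI) (simp add: t)
  qed
qed

lemma ld_serref: assumes "i \<noteq> j" shows "ld k (serref i j) = 0"
proof -
  let ?m = "sm i j" and ?t = "tt i" and ?c = "chi i j"
  have ji: "chi j i = ?c" by (rule \<chi>_sym)
  have t: "ld k (th i n * wd [j] * th i (?m - n)) =
      (if k = i then qn ?t n \<cdot> (th i (n - 1) * wd [j] * th i (?m - n))
         + (qn ?t (?m - n) * ?c * ?t ^ n) \<cdot> (th i n * wd [j] * th i (?m - n - 1))
       else if k = j then ?c ^ n \<cdot> th i ?m else 0)" if "n \<le> ?m" for n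
  proof -
    have "th i n * th i (?m - n) = th i ?m" using that by (simp flip: wd_append replicate_add)
    then show ?thesis using assms ji
      by (auto simp: ld_mult ld_th tt_chi mult.assoc algebra_simps Dg_mult)
  qed
  consider "k = i" | "k = j" | "k \<noteq> i" "k \<noteq> j" by blast
  then show ?thesis
  proof cases
    case 1
    let ?X = "\<lambda>n. th i n * wd [j] * th i (?m - Suc n)"
    have "ld k (serref i j) = (\<Sum>n=0..?m. (sc i j n * qn ?t (?m - n) * ?c * ?t ^ n) \<cdot> ?X n)
        + (\<Sum>n=0..?m. (sc i j n * qn ?t n) \<cdot> (th i (n - 1) * wd [j] * th i (?m - n)))"
      unfolding serref_def lin_sum[OF lin_ld] sum.distrib[symmetric]
      by (intro sum.cong refl) (use 1 in \<open>simp add: t[unfolded 1] fa.scale_right_distrib add.commute mult.assoc[where 'a = qpi]\<close>)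
    also have "(\<Sum>n=0..?m. (sc i j n * qn ?t (?m - n) * ?c * ?t ^ n) \<cdot> ?X n)
        = (\<Sum>n<?m. (sc i j n * qn ?t (?m - n) * ?c * ?t ^ n) \<cdot> ?X n)"
      unfolding atLeast0AtMost lessThan_Suc_atMost[symmetric] by simp
    also have "(\<Sum>n=0..?m. (sc i j n * qn ?t n) \<cdot> (th i (n - 1) * wd [j] * th i (?m - n)))
        = (\<Sum>n<?m. (sc i j (Suc n) * qn ?t (Suc n)) \<cdot> ?X n)"
      unfolding atLeast0AtMost lessThan_Suc_atMost[symmetric]
      by (subst sum.lessThan_Suc_shift) simp
    also have "\<dots> = (\<Sum>n<?m. (- (sc i j n * qn ?t (?m - n) * ?c * ?t ^ n)) \<cdot> ?X n)"
      by (intro sum.cong refl arg_cong2[where f = smul]) (simp add: sc_Suc[OF assms] mult_ac del: qn_simps)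
    finally show ?thesis by (simp add: sum_negf)
  next
    case 2
    have "ld k (serref i j) = (\<Sum>n=0..?m. sc i j n * (?t ^ 0 * ?c) ^ n) \<cdot> th i ?m"
      unfolding serref_def lin_sum[OF lin_ld] fa.scale_sum_left
      by (intro sum.cong refl) (use 2 assms in \<open>simp add: t[unfolded 2]\<close>)
    then show ?thesis using sc_sum[OF assms, of 0] sm_pos[OF assms] by simp
  next
    case 3
    then show ?thesis unfolding serref_def lin_sum[OF lin_ld]
      by (intro sum.neutral ballI) (simp add: t)
  qed
qed

lemma th_word: "th i n * wd [j] * th i k = wd (replicate n i @ [j] @ replicate k i)"
  by (simp only: wd_append mult.assoc)

lemma serref_Rad: "i \<noteq> j \<Longrightarrow> serref i j \<in> Rad"
proof -
  assume ij: "i \<noteq> j"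
  have "formw w (serref i j) = 0" for w
  proof (cases w)
    case Nil
    have "serref i j = (\<Sum>n=0..sm i j. sc i j n \<cdot> wd (replicate n i @ [j] @ replicate (sm i j - n) i))"
      unfolding serref_def th_word ..
    then show ?thesis using Nil
      by (simp add: lookup_sum lookup_smul lookup_wd zero_word_def)
  next
    case (Cons k v)
    then show ?thesis using ld_serref[OF ij] by simp
  qed
  then show ?thesis unfolding Rad_def by blast
qed

subsection \<open>The Serre ideal\<close>

text \<open>Words on both sides already make this a two-sided ideal, and they keep every generator
  homogeneous, which \<open>Ser_rs\<close> relies on.\<close>

inductive_set Ser :: "('i word \<Rightarrow>\<^sub>0 qpi) set" where
  Ser_0: "0 \<in> Ser"
| Ser_step: "i \<noteq> j \<Longrightarrow> x \<in> Ser \<Longrightarrow> c \<cdot> (wd u * serref i j * wd v) + x \<in> Ser"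

lemma Ser_gen: "i \<noteq> j \<Longrightarrow> c \<cdot> (wd u * serref i j * wd v) \<in> Ser"
  using Ser_step[OF _ Ser_0] by simp

lemma Ser_add: "x \<in> Ser \<Longrightarrow> y \<in> Ser \<Longrightarrow> x + y \<in> Ser"
  by (induction rule: Ser.induct) (auto intro: Ser_step simp: add.assoc)

lemma Ser_lin:
  assumes "lin smul g" "\<And>i j u v. i \<noteq> j \<Longrightarrow> g (wd u * serref i j * wd v) \<in> A"
    "0 \<in> A" "\<And>x y. x \<in> A \<Longrightarrow> y \<in> A \<Longrightarrow> x + y \<in> A" "\<And>c x. x \<in> A \<Longrightarrow> c \<cdot> x \<in> A"
    "x \<in> Ser"
  shows "g x \<in> A"
  using assms(6)
  by (induction rule: Ser.induct)
     (use assms(2-5) in \<open>auto simp: lin_0[OF assms(1)] lin_add[OF assms(1)] lin_smul[OF assms(1)]\<close>)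

lemma Ser_smul: "x \<in> Ser \<Longrightarrow> c \<cdot> x \<in> Ser"
  by (induction rule: Ser.induct) (auto simp: fa.scale_right_distrib intro!: Ser_0 Ser_step)

lemma Ser_minus: "x \<in> Ser \<Longrightarrow> - x \<in> Ser"
  using Ser_smul[of x "- 1"] by simp

lemma Ser_diff: "x \<in> Ser \<Longrightarrow> y \<in> Ser \<Longrightarrow> x - y \<in> Ser"
  using Ser_add[of x "- y"] Ser_minus[of y] by simp

lemma Ser_sum: "(\<And>a. a \<in> A \<Longrightarrow> f a \<in> Ser) \<Longrightarrow> sum f A \<in> Ser"
  by (induction A rule: infinite_finite_induct) (auto intro: Ser_0 Ser_add)

lemma Ser_unit: "c dvd 1 \<Longrightarrow> c \<cdot> x \<in> Ser \<Longrightarrow> x \<in> Ser"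
  using Ser_smul[of "c \<cdot> x" "inverse c"] by (simp only: smul_unit_cancel)

lemma Ser_wd_left: "x \<in> Ser \<Longrightarrow> wd w * x \<in> Ser"
  by (rule Ser_lin[OF lin_mult_left[OF lin_id]])
     (use Ser_gen[where c = 1] in \<open>auto intro: Ser_0 Ser_add Ser_smul simp: wd_append[symmetric] mult.assoc[symmetric]\<close>)

lemma Ser_wd_right: "x \<in> Ser \<Longrightarrow> x * wd w \<in> Ser"
  by (rule Ser_lin[OF lin_mult_right[OF lin_id]])
     (use Ser_gen[where c = 1] in \<open>auto intro: Ser_0 Ser_add Ser_smul simp: wd_append[symmetric] mult.assoc\<close>)

lemma Ser_mult_left: "x \<in> Ser \<Longrightarrow> y * x \<in> Ser"
  by (induction y rule: fa_induct) (auto simp: algebra_simps intro: Ser_0 Ser_add Ser_smul Ser_wd_left)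

lemma Ser_mult_right: "x \<in> Ser \<Longrightarrow> x * y \<in> Ser"
  by (induction y rule: fa_induct) (auto simp: algebra_simps intro: Ser_0 Ser_add Ser_smul Ser_wd_right)

lemma serref_Ser: "i \<noteq> j \<Longrightarrow> serref i j \<in> Ser"
  using Ser_gen[of i j 1 "[]" "[]"] by (simp add: wd_Nil)

lemma homog_serref: "homog (\<lambda>k. (if k = i then sm i j else 0) + (if k = j then 1 else 0)) (serref i j)"
proof -
  have r: "wt (replicate n i) k = (if k = i then n else 0)" for n k
    by (induction n) auto
  have "serref i j = (\<Sum>n=0..sm i j. sc i j n \<cdot> wd (replicate n i @ [j] @ replicate (sm i j - n) i))"
    unfolding serref_def th_word ..
  then show ?thesis by (auto intro!: spn_sum spn_smul simp: r fun_eq_iff)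
qed

lemma Ser_mid: "i \<noteq> j \<Longrightarrow> a * serref i j * b \<in> Ser"
  by (intro Ser_mult_right Ser_mult_left serref_Ser)

lemma Ser_Dg: "x \<in> Ser \<Longrightarrow> Dg f x \<in> Ser"
  by (rule Ser_lin[OF lin_Dg])
     (auto intro!: Ser_0 Ser_add Ser_smul Ser_mid simp: Dg_mult Dg_hom[OF homog_serref])

lemma Ser_rd: "x \<in> Ser \<Longrightarrow> rd k x \<in> Ser"
  by (rule Ser_lin[OF lin_rd])
     (auto intro!: Ser_0 Ser_add Ser_smul Ser_mid simp: rd_mult rd_serref Dg_hom[OF homog_serref])

lemma Ser_ld: "x \<in> Ser \<Longrightarrow> ld k x \<in> Ser"
  by (rule Ser_lin[OF lin_ld])
     (auto intro!: Ser_0 Ser_add Ser_smul Ser_mid simp: ld_mult ld_serref Dg_mult Dg_hom[OF homog_serref])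

lemma Ser_Rad: "x \<in> Ser \<Longrightarrow> x \<in> Rad"
  by (induction rule: Ser.induct)
     (auto intro!: Rad_add Rad_smul Rad_mult_right[OF Rad_mult_left] serref_Rad)

end

lemma qpow_cancel [simp]: "qpow a * (qpow (- a) * c) = c" "qpow (- a) * (qpow a * c) = c"
  using arg_cong[OF qpow_uminus[of a], of "\<lambda>x. x * c"] by (simp_all add: mult_ac)

section \<open>Modules with quantum group operators\<close>

definition lop :: "(qpi \<Rightarrow> 'v \<Rightarrow> 'v) \<Rightarrow> ('v \<Rightarrow> 'v::ab_group_add) \<Rightarrow> bool" where
  "lop s f \<longleftrightarrow> (\<forall>x y. f (x + y) = f x + f y) \<and> (\<forall>c x. f (s c x) = s c (f x))"

lemma lopI: "(\<And>x y. f (x + y) = f x + f y) \<Longrightarrow> (\<And>c x. f (s c x) = s c (f x)) \<Longrightarrow> lop s f"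
  by (simp add: lop_def)

lemma lop_add: "lop s f \<Longrightarrow> f (x + y) = f x + f y"
  and lop_scale: "lop s f \<Longrightarrow> f (s c x) = s c (f x)"
  by (simp_all add: lop_def)

lemma lop_0: "lop s f \<Longrightarrow> f 0 = 0"
  using lop_add[of s f 0 0] by simp

lemma lop_minus: "lop s f \<Longrightarrow> f (- x) = - f x"
  using lop_add[of s f x "- x"] lop_0[of s f] by (simp add: eq_neg_iff_add_eq_0 add.commute)

lemma lop_diff: "lop s f \<Longrightarrow> f (x - y) = f x - f y"
  using lop_add[of s f x "- y"] lop_minus[of s f y] by simp

lemma lop_sum: "lop s f \<Longrightarrow> f (sum g A) = (\<Sum>a\<in>A. f (g a))"
  by (induction A rule: infinite_finite_induct) (auto simp: lop_0 lop_add)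

lemma lop_comp: "lop s f \<Longrightarrow> lop s g \<Longrightarrow> lop s (\<lambda>x. f (g x))"
  by (simp add: lop_def)

lemma lop_lin: "lop smul f \<longleftrightarrow> lin smul f"
  by (simp add: lop_def lin_def)

section \<open>Modules over a free algebra\<close>

definition rep :: "(qpi \<Rightarrow> 'v \<Rightarrow> 'v) \<Rightarrow> ('g \<Rightarrow> 'v \<Rightarrow> 'v::ab_group_add) \<Rightarrow> ('g word \<Rightarrow>\<^sub>0 qpi) \<Rightarrow> 'v \<Rightarrow> 'v" where
  "rep s op x m = lext s (\<lambda>w. foldr op w m) x"

locale representation = Modules.module s
  for s :: "qpi \<Rightarrow> 'v::ab_group_add \<Rightarrow> 'v" +
  fixes op :: "'g \<Rightarrow> 'v \<Rightarrow> 'v"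
  assumes lop_op: "\<And>g. lop s (op g)"
begin

lemma lin_rep: "lin s (\<lambda>x. rep s op x m)"
  unfolding rep_def by (rule lin_lext[OF module_axioms])

lemmas rep_simps = lin_0[OF lin_rep] lin_add[OF lin_rep] lin_smul[OF lin_rep] lin_diff[OF lin_rep]

lemma rep_wd: "rep s op (wd w) m = foldr op w m"
  by (simp add: rep_def lext_wd[OF module_axioms])

lemma rep_1: "rep s op 1 m = m"
  using rep_wd[of "[]" m] by (simp add: wd_Nil)

lemma rep_Cons: "rep s op (wd [j] * x) m = op j (rep s op x m)"
proof (induction x rule: fa_induct)
  case (word c w)
  have "rep s op (wd [j] * wd w) m = op j (rep s op (wd w) m)"
    by (simp add: rep_wd flip: wd_append)
  then show ?case by (simp add: rep_simps lop_scale[OF lop_op])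
qed (simp_all add: rep_simps lop_0[OF lop_op] lop_add[OF lop_op] distrib_left)

lemma rep_mult: "rep s op (x * y) m = rep s op x (rep s op y m)"
proof (induction x rule: fa_induct)
  case (word c w)
  have "rep s op (wd w * y) m = rep s op (wd w) (rep s op y m)"
  proof (induction w)
    case (Cons j w) then show ?case by (simp add: wd_Cons[of j w] mult.assoc rep_Cons)
  qed (simp add: wd_Nil rep_1)
  then show ?case by (simp add: rep_simps)
qed (simp_all add: rep_simps distrib_right)

lemma lop_rep: "lop s (rep s op x)"
proof (rule lopI)
  show "rep s op x (m + m') = rep s op x m + rep s op x m'" for m m'
  proof (induction x rule: fa_induct)
    case (word c w)
    have "rep s op (wd w) (m + m') = rep s op (wd w) m + rep s op (wd w) m'"
      by (induction w) (simp_all add: rep_wd lop_add[OF lop_op])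
    then show ?case by (simp add: rep_simps scale_right_distrib)
  qed (simp_all add: rep_simps)
  show "rep s op x (s c m) = s c (rep s op x m)" for c m
  proof (induction x rule: fa_induct)
    case (word d w)
    have "rep s op (wd w) (s c m) = s c (rep s op (wd w) m)"
      by (induction w) (simp_all add: rep_wd lop_scale[OF lop_op])
    then show ?case by (simp add: rep_simps mult.commute)
  qed (simp_all add: rep_simps scale_right_distrib)
qed

lemma rep_stable:
  assumes "0 \<in> A" "\<And>x y. x \<in> A \<Longrightarrow> y \<in> A \<Longrightarrow> x + y \<in> A" "\<And>c x. x \<in> A \<Longrightarrow> s c x \<in> A"
    "\<And>g x. x \<in> A \<Longrightarrow> op g x \<in> A" "m \<in> A"
  shows "rep s op x m \<in> A"
proof (induction x rule: fa_induct)
  case (word c w)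
  have "rep s op (wd w) m \<in> A" by (induction w) (simp_all add: rep_wd assms)
  then show ?case by (simp add: rep_simps assms)
qed (simp_all add: rep_simps assms)

end

text \<open>Operators satisfying the relations between the \<open>E\<close>, \<open>F\<close> and the torus modulo a stable
  subgroup \<open>N\<close>; the Serre relations are not imposed.\<close>

locale umod = datum D + Modules.module s
  for D :: "('i::finite, 'x, 'y, 'm) root_datum_scheme" and s :: "qpi \<Rightarrow> 'v::ab_group_add \<Rightarrow> 'v" +
  fixes EE FF KK KI JJ :: "'i \<Rightarrow> 'v \<Rightarrow> 'v" and N :: "'v set"
  assumes N_0: "0 \<in> N" and N_add: "\<And>x y. x \<in> N \<Longrightarrow> y \<in> N \<Longrightarrow> x + y \<in> N"
    and N_scale: "\<And>c x. x \<in> N \<Longrightarrow> s c x \<in> N"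
    and lop_E: "\<And>i. lop s (EE i)" and lop_F: "\<And>i. lop s (FF i)" and lop_K: "\<And>i. lop s (KK i)"
    and lop_KI: "\<And>i. lop s (KI i)" and lop_J: "\<And>i. lop s (JJ i)"
    and N_E: "\<And>i x. x \<in> N \<Longrightarrow> EE i x \<in> N" and N_F: "\<And>i x. x \<in> N \<Longrightarrow> FF i x \<in> N"
    and N_K: "\<And>i x. x \<in> N \<Longrightarrow> KK i x \<in> N" and N_KI: "\<And>i x. x \<in> N \<Longrightarrow> KI i x \<in> N"
    and N_J: "\<And>i x. x \<in> N \<Longrightarrow> JJ i x \<in> N"
    and K_E: "\<And>i j m. KK i (EE j m) - s (qpow (fm i j)) (EE j (KK i m)) \<in> N"
    and KI_E: "\<And>i j m. KI i (EE j m) - s (qpow (- fm i j)) (EE j (KI i m)) \<in> N"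
    and J_E: "\<And>i j m. JJ i (EE j m) - EE j (JJ i m) \<in> N"
    and E_F: "\<And>i j m. EE i (FF j m) - s (ppow (pr i * pr j)) (FF j (EE i m))
                - (if i = j then s (inverse (hh i)) (JJ i (KK i m) - KI i m) else 0) \<in> N"
begin

lemma N_minus: "x \<in> N \<Longrightarrow> - x \<in> N"
  using N_scale[of x "- 1"] by simp

lemma N_diff: "x \<in> N \<Longrightarrow> y \<in> N \<Longrightarrow> x - y \<in> N"
  using N_add[of x "- y"] N_minus[of y] by simp

lemma N_sum: "(\<And>a. a \<in> A \<Longrightarrow> f a \<in> N) \<Longrightarrow> sum f A \<in> N"
  by (induction A rule: infinite_finite_induct) (auto intro: N_0 N_add)

lemma N_trans: "x - y \<in> N \<Longrightarrow> y - z \<in> N \<Longrightarrow> x - z \<in> N"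
  using N_add[of "x - y" "y - z"] by simp

sublocale XE: representation s EE
  by unfold_locales (rule lop_E)

abbreviation xE :: "('i word \<Rightarrow>\<^sub>0 qpi) \<Rightarrow> 'v \<Rightarrow> 'v" where "xE \<equiv> rep s EE"

lemmas lin_xE = XE.lin_rep and xE_simps = XE.rep_simps and xE_wd = XE.rep_wd and xE_1 = XE.rep_1
  and xE_Cons = XE.rep_Cons and xE_mult = XE.rep_mult and lop_xE = XE.lop_rep

lemma N_xE: "m \<in> N \<Longrightarrow> xE x m \<in> N"
  by (rule XE.rep_stable) (auto intro: N_0 N_add N_scale N_E)

lemma op_xE:
  assumes P: "lop s P" "\<And>x. x \<in> N \<Longrightarrow> P x \<in> N" "\<And>j m. P (EE j m) - s (f j) (EE j (P m)) \<in> N"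
  shows "P (xE x m) - xE (Dg f x) (P m) \<in> N"
proof (induction x rule: fa_induct)
  case zero then show ?case by (simp add: xE_simps lop_0[OF P(1)] N_0)
next
  case (add x y)
  have "P (xE (x + y) m) - xE (Dg f (x + y)) (P m) = (P (xE x m) - xE (Dg f x) (P m)) + (P (xE y m) - xE (Dg f y) (P m))"
    by (simp add: xE_simps lop_add[OF P(1)])
  then show ?case using N_add[OF add] by simp
next
  case (word c w)
  have "P (xE (wd w) m) - xE (Dg f (wd w)) (P m) \<in> N"
  proof (induction w)
    case Nil then show ?case by (simp add: wd_Nil xE_1 N_0)
  next
    case (Cons j w)
    have "P (xE (wd (j # w)) m) - xE (Dg f (wd (j # w))) (P m)
       = (P (EE j (xE (wd w) m)) - s (f j) (EE j (P (xE (wd w) m))))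
         + s (f j) (EE j (P (xE (wd w) m) - xE (Dg f (wd w)) (P m)))"
      by (simp add: wd_Cons[of j w] xE_Cons Dg_mult xE_simps lop_diff[OF lop_E] lop_scale[OF lop_E] scale_right_diff_distrib del: Dg_wd)
         (simp add: xE_simps xE_Cons lop_scale[OF lop_E] mult.commute)
    then show ?case using N_add[OF P(3) N_scale[OF N_E[OF Cons]]] by simp
  qed
  from N_scale[OF this, of c] show ?case
    by (simp add: xE_simps lop_scale[OF P(1)] scale_right_diff_distrib mult.commute)
qed

abbreviation "Sg i \<equiv> Dg (\<lambda>k. ppow (pr i * pr k))"

text \<open>Moving F_i to the left through x leaves two boundary terms, with the torus at the right
  end of \<open>rd i x\<close> and at the left end of \<open>ld i x\<close>; the recursions of
  \<open>rd\<close> and \<open>ld\<close> on the first letter are those of the boundary terms. The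
  identity involves no Serre relation, so x ranges over the whole free algebra.\<close>

lemma xE_F:
  "xE x (FF i m) - (FF i (xE (Sg i x) m)
     + s (inverse (hh i)) (xE (rd i x) (JJ i (KK i m)) - KI i (xE (Sg i (ld i x)) m))) \<in> N"
proof (induction x rule: fa_induct)
  case zero then show ?case by (simp add: xE_simps lop_0[OF lop_F] lop_0[OF lop_KI] N_0)
next
  case (add x y)
  then show ?case
    using N_add[OF add]
    by (simp add: xE_simps lop_add[OF lop_F] lop_add[OF lop_KI] scale_right_distrib scale_right_diff_distrib algebra_simps)
next
  case (word c w)
  have "xE (wd w) (FF i m) - (FF i (xE (Sg i (wd w)) m)
     + s (inverse (hh i)) (xE (rd i (wd w)) (JJ i (KK i m)) - KI i (xE (Sg i (ld i (wd w))) m))) \<in> N"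
  proof (induction w)
    case Nil
    then show ?case by (simp add: wd_Nil xE_1 xE_simps lop_0[OF lop_KI] N_0)
  next
    case (Cons j w)
    define x where "x = wd w"
    let ?h = "inverse (hh i)" and ?p = "ppow (pr i * pr j)"
    define z where "z = xE (Sg i x) m"
    define u where "u = xE (Sg i (ld i x)) m"
    define v where "v = xE (rd i x) (JJ i (KK i m))"
    \<comment> \<open>The errors \<open>d1\<close> to \<open>d4\<close> come from the induction
      hypothesis, the relation between E_j and F_i, moving K_i^-1 past E_j, and moving J_i K_i past
      x. The difference of the two sides is an explicit combination of the four.\<close>
    define d1 where "d1 = xE x (FF i m) - (FF i z + s ?h (v - KI i u))"
    have d1: "d1 \<in> N" using Cons by (simp add: d1_def x_def z_def u_def v_def)
    define d2 where "d2 = EE j (FF i z) - s ?p (FF i (EE j z)) - (if j = i then s ?h (JJ i (KK i z) - KI i z) else 0)"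
    have d2: "d2 \<in> N" using E_F[of j i z] by (auto simp: d2_def mult.commute)
    define d3 where "d3 = KI i (EE j u) - s (qpow (- fm i j)) (EE j (KI i u))"
    have d3: "d3 \<in> N" unfolding d3_def by (rule KI_E)
    define d4 where "d4 = (if i = j then JJ i (KK i z) - xE (Dg (chi i) x) (JJ i (KK i m)) else 0)"
    have d4: "d4 \<in> N"
    proof (cases "i = j")
      case True
      have "JJ i (KK i (xE (Sg i x) m)) - xE (Dg (\<lambda>k. qpow (fm i k)) (Sg i x)) (JJ i (KK i m)) \<in> N"
      proof (rule op_xE[OF lop_comp[OF lop_J lop_K]])
        fix k m'
        have "JJ i (KK i (EE k m')) - s (qpow (fm i k)) (EE k (JJ i (KK i m')))
           = JJ i (KK i (EE k m') - s (qpow (fm i k)) (EE k (KK i m')))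
             + s (qpow (fm i k)) (JJ i (EE k (KK i m')) - EE k (JJ i (KK i m')))"
          by (simp add: lop_diff[OF lop_J] lop_scale[OF lop_J] scale_right_diff_distrib)
        then show "JJ i (KK i (EE k m')) - s (qpow (fm i k)) (EE k (JJ i (KK i m'))) \<in> N"
          using N_add[OF N_J[OF K_E] N_scale[OF J_E]] by simp
      qed (simp add: N_J N_K)
      moreover have "(\<lambda>k. qpow (fm i k) * ppow (pr i * pr k)) = chi i"
        by (simp add: fun_eq_iff chi_def mult.commute[of "qpow _"])
      ultimately show ?thesis
        using True by (simp add: d4_def z_def Dg_Dg)
    qed (simp add: d4_def N_0)
    have cw: "chi i j * ?p * qpow (- fm i j) = 1"
      using qpow_uminus[of "fm i j"] by (simp add: chi_def mult_ac)
    have xz: "xE (Sg i (wd [j] * x)) m = s ?p (EE j z)"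
      by (simp add: Dg_mult xE_simps xE_Cons z_def)
    have xu: "xE (Sg i (ld i (wd [j] * x))) m = s (chi i j * ?p) (EE j u) + (if i = j then z else 0)"
      by (simp add: ld_Cons Dg_mult xE_simps xE_Cons u_def z_def)
    have xv: "xE (rd i (wd [j] * x)) (JJ i (KK i m)) = EE j v + (if i = j then xE (Dg (chi i) x) (JJ i (KK i m)) else 0)"
      by (simp add: rd_Cons xE_simps xE_Cons v_def)
    have "xE (wd [j] * x) (FF i m) - (FF i (xE (Sg i (wd [j] * x)) m)
       + s ?h (xE (rd i (wd [j] * x)) (JJ i (KK i m)) - KI i (xE (Sg i (ld i (wd [j] * x))) m)))
       = EE j d1 + d2 + s ?h d4 + s (?h * chi i j * ?p) d3"
    proof -
      have E1: "EE j d1 = EE j (xE x (FF i m)) - (EE j (FF i z) + s ?h (EE j v - EE j (KI i u)))"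
        by (simp add: d1_def lop_diff[OF lop_E] lop_add[OF lop_E] lop_scale[OF lop_E])
      have E3: "s (?h * chi i j * ?p) d3 = s ?h (s (chi i j * ?p) (KI i (EE j u))) - s ?h (EE j (KI i u))"
      proof -
        have "?h * chi i j * ?p * qpow (- fm i j) = ?h" using cw by (simp add: mult.assoc)
        then show ?thesis by (simp add: d3_def scale_right_diff_distrib mult.assoc)
      qed
      show ?thesis
        unfolding xz xu xv xE_Cons E1 E3 d2_def d4_def
        by (auto simp: lop_0[OF lop_KI] lop_add[OF lop_KI] lop_scale[OF lop_KI] lop_scale[OF lop_F] scale_right_distrib scale_right_diff_distrib)
    qed
    then show ?case
      using N_add[OF N_add[OF N_add[OF N_E[OF d1] d2] N_scale[OF d4]] N_scale[OF d3]]
      by (simp add: wd_Cons[of j w] x_def del: Dg_wd)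
  qed
  from N_scale[OF this, of c] show ?case
    by (simp add: xE_simps lop_scale[OF lop_F] lop_scale[OF lop_KI] scale_right_distrib scale_right_diff_distrib mult.commute del: Dg_wd)
qed

text \<open>Closure under the torus is not built in: in \<open>xE_Rad\<close> a torus element in
  front of a vector is moved out through the positive part, at the price of a diagonal twist of
  x.\<close>

inductive_set Vgen :: "'v set" where
  vac: "(\<And>i. EE i m \<in> N) \<Longrightarrow> m \<in> Vgen"
| Vgen_F: "m \<in> Vgen \<Longrightarrow> FF i m \<in> Vgen"
| Vgen_add: "m \<in> Vgen \<Longrightarrow> m' \<in> Vgen \<Longrightarrow> m + m' \<in> Vgen"

lemma xE_vac:
  assumes "\<And>i. EE i m \<in> N"
  shows "xE x m - s (lookup x 0) m \<in> N"
proof (induction x rule: fa_induct)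
  case (add x y)
  have "xE (x + y) m - s (lookup (x + y) 0) m = (xE x m - s (lookup x 0) m) + (xE y m - s (lookup y 0) m)"
    by (simp add: xE_simps lookup_add scale_left_distrib)
  then show ?case using N_add[OF add] by simp
next
  case (word c w)
  have "xE (wd w) m - s (lookup (wd w) 0) m \<in> N"
  proof (cases w rule: rev_cases)
    case Nil then show ?thesis by (simp add: wd_Nil xE_1 N_0)
  next
    case (snoc u i)
    have "xE (wd u) (EE i m) \<in> N" by (rule N_xE[OF assms])
    moreover have "xE (wd w) m = xE (wd u) (EE i m)" by (simp add: snoc xE_wd)
    moreover have "lookup (wd w) 0 = 0" by (simp add: snoc lookup_wd zero_word_def)
    ultimately show ?thesis by simp
  qed
  from N_scale[OF this, of c] show ?case
    by (simp add: xE_simps lookup_smul scale_right_diff_distrib)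
qed (simp add: xE_simps N_0)

text \<open>By \<open>xE_F\<close> the action of x on F_i m reduces to actions on m of twists of x,
  \<open>rd i x\<close> and \<open>ld i x\<close>, and the radical is stable under twists and
  derivations. On a primitive vector x acts by its constant term, which is 0.\<close>

lemma xE_Rad:
  assumes "m \<in> Vgen" "x \<in> Rad"
  shows "xE x m \<in> N"
  using assms
proof (induction arbitrary: x)
  case (vac m)
  from xE_vac[OF vac(1), of x] Rad_lookup_0[OF vac(2)] show ?case by simp
next
  case (Vgen_F m i)
  have "xE (rd i x) (JJ i (KK i m)) \<in> N"
  proof -
    \<comment> \<open>This twist is inverse to the one picked up when K_i passes, so that
      \<open>rd i x\<close> itself appears behind K_i.\<close>
    let ?y = "Dg (\<lambda>k. qpow (- fm i k)) (rd i x)"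
    have "xE ?y m \<in> N" by (intro Vgen_F.IH Rad_Dg Rad_rd Vgen_F.prems)
    then have 1: "JJ i (KK i (xE ?y m)) \<in> N" by (intro N_J N_K)
    have 2: "KK i (xE ?y m) - xE (Dg (\<lambda>k. qpow (fm i k)) ?y) (KK i m) \<in> N"
      by (rule op_xE[OF lop_K N_K K_E])
    have 3: "Dg (\<lambda>k. qpow (fm i k)) ?y = rd i x"
      by (simp add: Dg_Dg qpow_uminus Dg_one)
    have 4: "JJ i (xE (rd i x) (KK i m)) - xE (Dg (\<lambda>_. 1) (rd i x)) (JJ i (KK i m)) \<in> N"
      by (rule op_xE[OF lop_J N_J]) (simp_all add: J_E)
    have "JJ i (KK i (xE ?y m)) - JJ i (xE (rd i x) (KK i m)) \<in> N"
      using N_J[OF 2] unfolding 3 by (simp add: lop_diff[OF lop_J])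
    from N_trans[OF this 4[unfolded Dg_one]] show ?thesis
      using N_diff[OF 1] by fastforce
  qed
  moreover have "xE (Sg i (ld i x)) m \<in> N" by (intro Vgen_F.IH Rad_Dg Rad_ld Vgen_F.prems)
  moreover have "xE (Sg i x) m \<in> N" by (intro Vgen_F.IH Rad_Dg Vgen_F.prems)
  ultimately have "FF i (xE (Sg i x) m)
     + s (inverse (hh i)) (xE (rd i x) (JJ i (KK i m)) - KI i (xE (Sg i (ld i x)) m)) \<in> N"
    by (intro N_add N_F N_scale N_diff N_KI)
  from N_add[OF xE_F[of x i m] this] show ?case by simp
next
  case (Vgen_add m m')
  then show ?case by (simp add: lop_add[OF lop_xE] N_add)
qed

end

section \<open>The Verma module with highest weight zero\<close>

context datum
begin

definition Kq :: "'i \<Rightarrow> ('i word \<Rightarrow>\<^sub>0 qpi) \<Rightarrow> ('i word \<Rightarrow>\<^sub>0 qpi)" where "Kq i = Dg (\<lambda>k. qpow (- fm i k))"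
definition KqI :: "'i \<Rightarrow> ('i word \<Rightarrow>\<^sub>0 qpi) \<Rightarrow> ('i word \<Rightarrow>\<^sub>0 qpi)" where "KqI i = Dg (\<lambda>k. qpow (fm i k))"
definition Sgn :: "'i \<Rightarrow> ('i word \<Rightarrow>\<^sub>0 qpi) \<Rightarrow> ('i word \<Rightarrow>\<^sub>0 qpi)" where "Sgn i = Dg (\<lambda>k. ppow (pr i * pr k))"

text \<open>The Verma module of highest weight 0 (without Serre relations) is the free algebra, with
  F_i acting as left multiplication by \<theta>_i. The formula for E_i is determined by its
  vanishing at 1 and the commutation relation \<open>Ev_Cons\<close>; it mirrors
  \<open>xE_F\<close>.\<close>

definition Ev :: "'i \<Rightarrow> ('i word \<Rightarrow>\<^sub>0 qpi) \<Rightarrow> ('i word \<Rightarrow>\<^sub>0 qpi)" where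
  "Ev i y = inverse (hh i) \<cdot> (Kq i (ld i y) - Sgn i (rd i y))"

lemma lin_Kq: "lin smul (Kq i)" and lin_KqI: "lin smul (KqI i)" and lin_Sgn: "lin smul (Sgn i)"
  unfolding Kq_def KqI_def Sgn_def by (rule lin_Dg)+

lemma lin_Ev: "lin smul (Ev i)"
  by (rule linI) (simp_all add: Ev_def lin_add[OF lin_Kq] lin_add[OF lin_Sgn] lin_smul[OF lin_Kq] lin_smul[OF lin_Sgn] algebra_simps)

lemma Sgn_chi: "Sgn i (Dg (chi i) y) = KqI i y" "Kq i (Dg (chi i) y) = Sgn i y"
proof -
  show "Sgn i (Dg (chi i) y) = KqI i y" by (simp add: Sgn_def KqI_def Dg_Dg chi_def)
  have "qpow (- fm i k) * chi i k = ppow (pr i * pr k)" for k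
    by (simp add: chi_def mult.commute[of "ppow _"])
  then show "Kq i (Dg (chi i) y) = Sgn i y" by (simp add: Sgn_def Kq_def Dg_Dg)
qed

lemma chi_q: "chi i j * qpow (- fm i j) = ppow (pr i * pr j)"
  by (simp add: chi_def mult_ac)

lemma chi_p: "chi i j * ppow (pr i * pr j) = qpow (fm i j)" "chi i i * ppow (pr i) = qpow (fm i i)"
  by (simp_all add: chi_def mult_ac)

lemma Ev_Cons: "Ev i (wd [j] * y) = ppow (pr i * pr j) \<cdot> (wd [j] * Ev i y)
    + (if i = j then inverse (hh i) \<cdot> (Kq i y - KqI i y) else 0)"
proof -
  have K: "Kq i (ld i (wd [j] * y)) = ppow (pr i * pr j) \<cdot> (wd [j] * Kq i (ld i y)) + (if i = j then Kq i y else 0)"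
    by (simp add: ld_Cons lin_add[OF lin_Kq] lin_smul[OF lin_Kq]) (simp add: Kq_def Dg_mult chi_q)
  have S: "Sgn i (rd i (wd [j] * y)) = ppow (pr i * pr j) \<cdot> (wd [j] * Sgn i (rd i y)) + (if i = j then KqI i y else 0)"
    by (simp add: rd_Cons lin_add[OF lin_Sgn] flip: Sgn_chi(1)) (simp add: Sgn_def Dg_mult)
  show ?thesis unfolding Ev_def K S by (simp add: algebra_simps)
qed

text \<open>As the highest weight is 0, each \<theta>_j is again primitive. Right multiplication by
  \<theta>_j embeds the Verma module with the weight of \<theta>_j as highest weight, and
  \<open>Evr i j\<close> is the action of E_i on that module.\<close>

definition Evr :: "'i \<Rightarrow> 'i \<Rightarrow> ('i word \<Rightarrow>\<^sub>0 qpi) \<Rightarrow> ('i word \<Rightarrow>\<^sub>0 qpi)" where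
  "Evr i j y = inverse (hh i) \<cdot> (qpow (- fm i j) \<cdot> Kq i (ld i y) - qpow (fm i j) \<cdot> Sgn i (rd i y))"

lemma Ev_snoc: "Ev i (y * wd [j]) = Evr i j y * wd [j]"
proof -
  have K: "Kq i (ld i (y * wd [j])) = qpow (- fm i j) \<cdot> (Kq i (ld i y) * wd [j]) + (if i = j then Sgn i y else 0)"
    by (simp add: ld_mult lin_add[OF lin_Kq] lin_smul[OF lin_Kq] lin_0[OF lin_Kq] flip: Sgn_chi(2)) (simp add: Kq_def Dg_mult)
  have S: "Sgn i (rd i (y * wd [j])) = qpow (fm i j) \<cdot> (Sgn i (rd i y) * wd [j]) + (if i = j then Sgn i y else 0)"
    by (simp add: rd_mult lin_add[OF lin_Sgn] lin_smul[OF lin_Sgn] lin_0[OF lin_Sgn]) (simp add: Sgn_def Dg_mult chi_p)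
  show ?thesis unfolding Ev_def K S Evr_def by (simp add: algebra_simps)
qed

lemma Ev_1 [simp]: "Ev i 1 = 0"
  by (simp add: Ev_def lin_0[OF lin_Kq] lin_0[OF lin_Sgn])

lemma Ev_gen [simp]: "Ev i (wd [j]) = 0"
  using Ev_snoc[of i 1 j] by (simp add: Evr_def lin_0[OF lin_Kq] lin_0[OF lin_Sgn])

lemma Ev_Dg: "Ev i (Dg f y) = f i \<cdot> Dg f (Ev i y)"
  by (simp add: Ev_def ld_Dg rd_Dg lin_smul[OF lin_Kq] lin_smul[OF lin_Sgn])
     (simp add: Kq_def Sgn_def Dg_Dg algebra_simps)

lemma Ser_Ev: "y \<in> Ser \<Longrightarrow> Ev i y \<in> Ser"
  unfolding Ev_def Kq_def Sgn_def by (intro Ser_smul Ser_diff Ser_Dg Ser_ld Ser_rd)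

lemma Rad_Ev: "y \<in> Rad \<Longrightarrow> Ev i y \<in> Rad"
  unfolding Ev_def Kq_def Sgn_def by (intro Rad_smul Rad_diff Rad_Dg Rad_ld Rad_rd)

lemma spn_Ev: "(\<And>u v. P (u @ i # v) \<Longrightarrow> Q (u @ v)) \<Longrightarrow> spn P x \<Longrightarrow> spn Q (Ev i x)"
  unfolding Ev_def Kq_def Sgn_def by (intro spn_smul spn_diff spn_Dg spn_ld spn_rd)

end

section \<open>The Serre ideal is the radical\<close>

definition rs :: "('g list \<Rightarrow> bool) \<Rightarrow> ('g word \<Rightarrow>\<^sub>0 qpi) \<Rightarrow> ('g word \<Rightarrow>\<^sub>0 qpi)" where
  "rs P = lext smul (\<lambda>w. if P w then wd w else 0)"

lemma lin_rs: "lin smul (rs P)"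
  unfolding rs_def by (rule lin_lext[OF module_smul])

lemma rs_wd: "rs P (wd w) = (if P w then wd w else 0)"
  by (simp add: rs_def lext_wd[OF module_smul])

lemma rs_id: "spn P x \<Longrightarrow> rs P x = x"
  by (rule lin_eq_on[OF lin_rs lin_id, where P = P]) (auto simp: rs_wd)

lemma rs_zero: "spn (\<lambda>w. \<not> P w) x \<Longrightarrow> rs P x = 0"
  by (induction rule: spn_induct) (simp_all add: lin_0[OF lin_rs] lin_add[OF lin_rs] lin_smul[OF lin_rs] rs_wd)

lemma spn_rs: "spn P (rs P x)"
  by (induction x rule: fa_induct)
     (auto simp: lin_0[OF lin_rs] lin_add[OF lin_rs] lin_smul[OF lin_rs] rs_wd intro: spn_add spn_smul)

lemma rs_sum:
  assumes "spn (\<lambda>w. ht (wt w) \<le> n) (x :: 'i::finite word \<Rightarrow>\<^sub>0 qpi)"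
  shows "x = (\<Sum>\<mu> | ht \<mu> \<le> n. rs (\<lambda>w. wt w = \<mu>) x)"
proof -
  have lin: "lin smul (\<lambda>x. \<Sum>\<mu> | ht \<mu> \<le> n. rs (\<lambda>w. wt w = \<mu>) x)"
    by (rule linI) (simp_all add: lin_add[OF lin_rs] lin_smul[OF lin_rs] sum.distrib fa.scale_sum_right)
  show ?thesis
  proof (rule lin_eq_on[OF lin_id lin assms])
    fix w :: "'i list" assume "ht (wt w) \<le> n"
    then show "wd w = (\<Sum>\<mu> | ht \<mu> \<le> n. rs (\<lambda>w. wt w = \<mu>) (wd w))"
      by (simp add: rs_wd finite_ht)
  qed
qed

definition lst :: "'g \<Rightarrow> ('g word \<Rightarrow>\<^sub>0 qpi) \<Rightarrow> ('g word \<Rightarrow>\<^sub>0 qpi)" where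
  "lst j = lext smul (\<lambda>w. if w \<noteq> [] \<and> hd w = j then wd (tl w) else 0)"

lemma lin_lst: "lin smul (lst j)"
  unfolding lst_def by (rule lin_lext[OF module_smul])

lemma lst_Cons: "lst j (wd [k] * y) = (if k = j then y else 0)"
proof (rule lin_eqI[where f = "\<lambda>y. lst j (wd [k] * y)" and g = "\<lambda>y. if k = j then y else 0"])
  show "lst j (wd [k] * wd w) = (if k = j then wd w else 0)" for w
    by (simp add: lst_def lext_wd[OF module_smul] flip: wd_append)
qed (auto simp: lin_def distrib_left lin_add[OF lin_lst] lin_smul[OF lin_lst])

lemma lst_1: "lst j 1 = 0"
  unfolding lst_def wd_Nil[symmetric] by (simp add: lext_wd[OF module_smul])

lemma lst_expand: "y = lookup y 0 \<cdot> 1 + (\<Sum>j\<in>UNIV. wd [j] * lst j y)" for y :: "'i::finite word \<Rightarrow>\<^sub>0 qpi"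
proof (rule lin_eqI[OF lin_id])
  show "lin smul (\<lambda>y :: 'i word \<Rightarrow>\<^sub>0 qpi. lookup y 0 \<cdot> 1 + (\<Sum>j\<in>UNIV. wd [j] * lst j y))"
    by (rule linI) (simp_all add: lin_add[OF lin_lst] lin_smul[OF lin_lst] lookup_add lookup_smul algebra_simps sum.distrib fa.scale_sum_right)
  fix w :: "'i list"
  show "wd w = lookup (wd w) 0 \<cdot> 1 + (\<Sum>j\<in>UNIV. wd [j] * lst j (wd w))"
  proof (cases w)
    case Nil
    then show ?thesis by (simp add: wd_Nil lst_1)
  next
    case (Cons k v)
    have "(\<Sum>j\<in>UNIV. wd [j] * lst j (wd w)) = (\<Sum>j\<in>UNIV. if k = j then wd [j] * wd v else 0)"
      by (intro sum.cong refl) (simp add: Cons wd_Cons[of k v] lst_Cons)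
    then have "(\<Sum>j\<in>UNIV. wd [j] * lst j (wd w)) = wd w" by (simp add: Cons wd_Cons[of k v])
    moreover have "lookup (wd w) 0 = 0" by (simp add: Cons lookup_wd zero_word_def)
    ultimately show ?thesis by simp
  qed
qed

lemma homog_mult: "homog \<mu> x \<Longrightarrow> homog \<nu> y \<Longrightarrow> homog (\<lambda>k. \<mu> k + \<nu> k) (x * y)"
  by (rule spn_mult[of "\<lambda>w. wt w = \<mu>" _ "\<lambda>w. wt w = \<nu>"]) auto

context datum
begin

lemma Ser_rs: "x \<in> Ser \<Longrightarrow> rs (\<lambda>w. wt w = \<mu>) x \<in> Ser"
proof (rule Ser_lin[OF lin_rs])
  fix i j :: 'i and u v assume ij: "i \<noteq> j"
  obtain \<nu> where \<nu>: "homog \<nu> (wd u * serref i j * wd v)"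
    using homog_mult[OF homog_mult[OF _ homog_serref], of "wt u" "wd u" "wt v" "wd v"] by auto
  show "rs (\<lambda>w. wt w = \<mu>) (wd u * serref i j * wd v) \<in> Ser"
  proof (cases "\<nu> = \<mu>")
    case True
    then show ?thesis using Ser_gen[OF ij, of 1 u v] \<nu> by (simp add: rs_id)
  next
    case False
    have "spn (\<lambda>w. \<not> wt w = \<mu>) (wd u * serref i j * wd v)"
      by (rule spn_mono[OF \<nu>]) (use False in auto)
    then show ?thesis by (simp add: rs_zero Ser_0)
  qed
qed (auto intro: Ser_0 Ser_add Ser_smul)

lemma Rad_rs: assumes "x \<in> Rad" shows "rs (\<lambda>w. wt w = \<mu>) x \<in> Rad"
proof -
  have "formw v (rs (\<lambda>w. wt w = \<mu>) x) = (if wt v = \<mu> then formw v x else 0)" for v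
  proof (induction x rule: fa_induct)
    case (word c w)
    show ?case using formw_hom[of "wt w" "wd w" v]
      by (auto simp: lin_smul[OF lin_rs] rs_wd)
  qed (simp_all add: lin_0[OF lin_rs] lin_add[OF lin_rs])
  then show ?thesis using assms by (simp add: Rad_def)
qed

subsection \<open>Primitive elements have antidominant weight\<close>

text \<open>Modulo the Serre ideal this is the left ideal generated by \<theta>_i^K. Dividing by the
  one for K = 1 makes F_i kill the highest weight vector, and then F_i is locally nilpotent by the
  Serre relations (\<open>th_nilpotent\<close>).\<close>

definition Lf :: "'i \<Rightarrow> nat \<Rightarrow> ('i word \<Rightarrow>\<^sub>0 qpi) set" where
  "Lf i K = {y. \<exists>z. y - z * th i K \<in> Ser}"

lemma Lf_I: "y - z * th i K \<in> Ser \<Longrightarrow> y \<in> Lf i K"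
  by (auto simp: Lf_def)

lemma Ser_Lf: "y \<in> Ser \<Longrightarrow> y \<in> Lf i K"
  by (rule Lf_I[of _ 0]) simp

lemma Lf_add: assumes "x \<in> Lf i K" "y \<in> Lf i K" shows "x + y \<in> Lf i K"
proof -
  obtain a b where "x - a * th i K \<in> Ser" "y - b * th i K \<in> Ser" using assms by (auto simp: Lf_def)
  from Ser_add[OF this] show ?thesis by (intro Lf_I[of _ "a + b"]) (simp add: algebra_simps)
qed

lemma Lf_left: assumes "x \<in> Lf i K" shows "y * x \<in> Lf i K"
proof -
  obtain a where "x - a * th i K \<in> Ser" using assms by (auto simp: Lf_def)
  from Ser_mult_left[OF this, of y] show ?thesis
    by (intro Lf_I[of _ "y * a"]) (simp add: algebra_simps)
qed

lemma Lf_smul: "x \<in> Lf i K \<Longrightarrow> c \<cdot> x \<in> Lf i K"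
  using Lf_left[of x i K "c \<cdot> 1"] by simp

lemma Lf_diff: "x \<in> Lf i K \<Longrightarrow> y \<in> Lf i K \<Longrightarrow> x - y \<in> Lf i K"
  using Lf_add[of x i K "- y"] Lf_smul[of y i K "- 1"] by simp

lemma Lf_unit: "c dvd 1 \<Longrightarrow> c \<cdot> x \<in> Lf i K \<Longrightarrow> x \<in> Lf i K"
  using Lf_smul[of "c \<cdot> x" i K "inverse c"] by (simp only: smul_unit_cancel)

lemma Lf_th: "a * th i K \<in> Lf i K"
  by (rule Lf_I[of _ a]) (simp add: Ser_0)

lemma th_add: "th i (a + b) = th i a * th i b"
  by (simp add: replicate_add wd_append)

text \<open>Let X_n be the word of length m with \<open>j\<close> at position n and \<open>i\<close>
  elsewhere. A letter \<theta>_i multiplied from the left can be pushed out on the right: \<theta>_i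
  X_n = X_(n+1) \<theta>_i for n < m - 1, and for n = m - 1 the Serre relation, whose leading
  coefficient is a unit, rewrites \<theta>_i X_n as a combination of the X_n' \<theta>_i.\<close>

lemma th_swap: assumes "i \<noteq> j" shows "th i (sm i j - 1 + K) * wd [j] \<in> Lf i K"
proof -
  let ?m = "sm i j"
  define X where "X n = th i n * wd [j] * th i (?m - 1 - n)" for n
  have step: "\<exists>d. wd [i] * X n - (\<Sum>n'<?m. d n' \<cdot> X n') * wd [i] \<in> Ser" if "n < ?m" for n
  proof (cases "Suc n < ?m")
    case True
    then have "?m - 1 - n = Suc (?m - 1 - Suc n)" by simp
    then have e: "th i (?m - 1 - n) = th i (?m - 1 - Suc n) * wd [i]" by (simp only: th_Suc')
    have "wd [i] * X n = X (Suc n) * wd [i]"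
      unfolding X_def e th_Suc by (simp only: mult.assoc)
    moreover have "X (Suc n) = (\<Sum>n'<?m. (if n' = Suc n then 1 else 0) \<cdot> X n')"
      using True by (simp add: if_distrib[of "\<lambda>c. c \<cdot> _"] sum.delta cong: if_cong)
    ultimately show ?thesis by (intro exI[of _ "\<lambda>n'. if n' = Suc n then 1 else 0"]) (simp add: Ser_0)
  next
    case False
    then have n: "?m = Suc n" using that by simp
    have "serref i j = (\<Sum>n'<?m. sc i j n' \<cdot> (X n' * wd [i])) + sc i j ?m \<cdot> (th i ?m * wd [j])"
    proof -
      have "X n' * wd [i] = th i n' * wd [j] * th i (?m - n')" if "n' < ?m" for n'
      proof -
        have "?m - n' = Suc (?m - 1 - n')" using that by simp
        then have "th i (?m - n') = th i (?m - 1 - n') * wd [i]" by (simp only: th_Suc')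
        then show ?thesis by (simp add: X_def mult.assoc)
      qed
      then show ?thesis
        unfolding serref_def atLeast0AtMost lessThan_Suc_atMost[symmetric] by (simp add: wd_Nil)
    qed
    then have "sc i j ?m \<cdot> (th i ?m * wd [j]) - (\<Sum>n'<?m. (- sc i j n') \<cdot> X n') * wd [i] = serref i j"
      by (simp add: sum_negf sum_distrib_right)
    then have S: "sc i j ?m \<cdot> (th i ?m * wd [j]) - (\<Sum>n'<?m. (- sc i j n') \<cdot> X n') * wd [i] \<in> Ser"
      using serref_Ser[OF assms] by simp
    have "wd [i] * X n = th i ?m * wd [j]"
      using th_Suc[of n i] by (simp add: X_def n wd_Nil mult.assoc[symmetric] del: replicate_Suc)
    moreover have "inverse (sc i j ?m) \<cdot> (sc i j ?m \<cdot> (th i ?m * wd [j]) - (\<Sum>n'<?m. (- sc i j n') \<cdot> X n') * wd [i])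
       = th i ?m * wd [j] - (\<Sum>n'<?m. (inverse (sc i j ?m) * - sc i j n') \<cdot> X n') * wd [i]"
    proof -
      have "(\<Sum>n'<?m. (inverse (sc i j ?m) * - sc i j n') \<cdot> X n') * wd [i] = inverse (sc i j ?m) \<cdot> ((\<Sum>n'<?m. (- sc i j n') \<cdot> X n') * wd [i])"
        by (simp only: smul_mult_left[symmetric] fa.scale_sum_right smul_smul)
      then show ?thesis by (simp only: fa.scale_right_diff_distrib smul_unit_cancel[OF unit_sc])
    qed
    ultimately show ?thesis using Ser_smul[OF S, of "inverse (sc i j ?m)"]
      by (intro exI[of _ "\<lambda>n'. inverse (sc i j ?m) * - sc i j n'"]) simp
  qed
  then have "\<forall>n\<in>{..<?m}. \<exists>d. wd [i] * X n - (\<Sum>n'<?m. d n' \<cdot> X n') * wd [i] \<in> Ser" by simp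
  from bchoice[OF this] obtain d where d: "\<And>n. n < ?m \<Longrightarrow> wd [i] * X n - (\<Sum>n'<?m. d n n' \<cdot> X n') * wd [i] \<in> Ser"
    by auto
  \<comment> \<open>Each further letter on the left is traded for one on the right, and the
    coefficients are multiplied by the matrix \<open>d\<close>.\<close>
  have "\<exists>c. th i (?m - 1 + K) * wd [j] - (\<Sum>n<?m. c n \<cdot> X n) * th i K \<in> Ser"
  proof (induction K)
    case 0
    have "X (?m - 1) = (\<Sum>n<?m. (if n = ?m - 1 then 1 else 0) \<cdot> X n)"
      using sm_pos[OF assms] by (simp add: if_distrib[of "\<lambda>c. c \<cdot> _"] sum.delta cong: if_cong)
    moreover have "th i (?m - 1) * wd [j] = X (?m - 1)" by (simp add: X_def wd_Nil)
    ultimately show ?case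
      by (intro exI[of _ "\<lambda>n. if n = ?m - 1 then 1 else 0"]) (simp add: Ser_0 wd_Nil)
  next
    case (Suc K)
    then obtain c where c: "th i (?m - 1 + K) * wd [j] - (\<Sum>n<?m. c n \<cdot> X n) * th i K \<in> Ser" by blast
    define c' where "c' n' = (\<Sum>n<?m. c n * d n n')" for n'
    have 1: "wd [i] * (th i (?m - 1 + K) * wd [j] - (\<Sum>n<?m. c n \<cdot> X n) * th i K) \<in> Ser"
      using c by (rule Ser_mult_left)
    have 2: "(\<Sum>n<?m. c n \<cdot> (wd [i] * X n - (\<Sum>n'<?m. d n n' \<cdot> X n') * wd [i])) * th i K \<in> Ser"
      by (intro Ser_mult_right Ser_sum Ser_smul d) simp
    have 3: "(\<Sum>n<?m. c n \<cdot> (\<Sum>n'<?m. d n n' \<cdot> X n')) = (\<Sum>n'<?m. c' n' \<cdot> X n')"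
      unfolding c'_def fa.scale_sum_left fa.scale_sum_right smul_smul by (rule sum.swap)
    have "(\<Sum>n<?m. c n \<cdot> (wd [i] * X n - (\<Sum>n'<?m. d n n' \<cdot> X n') * wd [i])) * th i K
       = wd [i] * ((\<Sum>n<?m. c n \<cdot> X n) * th i K) - (\<Sum>n'<?m. c' n' \<cdot> X n') * th i (Suc K)"
      unfolding 3[symmetric] th_Suc
      by (simp add: sum_subtractf sum_distrib_left sum_distrib_right left_diff_distrib fa.scale_right_diff_distrib mult.assoc del: smul_smul replicate_Suc)
    moreover have "th i (?m - 1 + Suc K) = wd [i] * th i (?m - 1 + K)"
      by (simp only: add_Suc_right th_Suc)
    ultimately have "th i (?m - 1 + Suc K) * wd [j] - (\<Sum>n<?m. c' n \<cdot> X n) * th i (Suc K) =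
       wd [i] * (th i (?m - 1 + K) * wd [j] - (\<Sum>n<?m. c n \<cdot> X n) * th i K)
       + (\<Sum>n<?m. c n \<cdot> (wd [i] * X n - (\<Sum>n'<?m. d n n' \<cdot> X n') * wd [i])) * th i K"
      by (simp add: right_diff_distrib mult.assoc del: replicate_Suc)
    then show ?case using Ser_add[OF 1 2] by (intro exI[of _ c']) simp
  qed
  then show ?thesis by (auto intro: Lf_I)
qed

text \<open>On words, by induction: \<theta>_i^N \<theta>_j can be rewritten with so many letters
  \<theta>_i at its right end that they absorb the rest of the word.\<close>

lemma th_nilpotent: "\<exists>N0. \<forall>N\<ge>N0. th i N * y \<in> Lf i K"
proof (induction y rule: fa_induct)
  case zero then show ?case by (simp add: Ser_Lf Ser_0)
next
  case (add x y)
  then obtain a b where ab: "\<forall>N\<ge>a. th i N * x \<in> Lf i K" "\<forall>N\<ge>b. th i N * y \<in> Lf i K" by blast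
  show ?case
    by (rule exI[of _ "max a b"]) (use ab in \<open>simp add: distrib_left Lf_add\<close>)
next
  case (word c w)
  have "\<exists>N. th i N * wd w \<in> Lf i K" for K
  proof (induction w)
    case Nil then show ?case using Lf_th[where a = 1 and i = i and K = K] by (auto simp: wd_Nil)
  next
    case (Cons j w)
    then obtain M where M: "th i M * wd w \<in> Lf i K" by blast
    have "\<exists>N. th i N * wd [j] \<in> Lf i M"
    proof (cases "i = j")
      case True
      then have "th i M * wd [j] = wd [j] * th i M" by (metis th_Suc th_Suc')
      then show ?thesis using Lf_th[where a = "wd [j]" and i = i and K = M] by (intro exI[of _ M]) simp
    qed (use th_swap in blast)
    then obtain N z where N: "th i N * wd [j] - z * th i M \<in> Ser" by (auto simp: Lf_def)
    have "th i N * wd (j # w) = (th i N * wd [j] - z * th i M) * wd w + z * (th i M * wd w)"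
      by (simp add: wd_Cons[of j w] left_diff_distrib mult.assoc)
    then have "th i N * wd (j # w) \<in> Lf i K"
      using Lf_add[OF Ser_Lf[OF Ser_mult_right[OF N]] Lf_left[OF M]] by simp
    then show ?case by blast
  qed
  then obtain N0 where N0: "th i N0 * wd w \<in> Lf i K" by blast
  have "th i N * (c \<cdot> wd w) \<in> Lf i K" if "N \<ge> N0" for N
  proof -
    have "th i N = th i (N - N0) * th i N0" using that by (simp flip: th_add)
    then show ?thesis using Lf_smul[OF Lf_left[OF N0, of "th i (N - N0)"], of c] by (simp add: mult.assoc)
  qed
  then show ?case by blast
qed

text \<open>If x is congruent to z \<theta>_i^(K+1), then \<open>rd i\<close> gives a unit times z
  \<theta>_i^K plus a multiple of \<theta>_i^(K+1), and the sum is 0 modulo Serre. Multiplied by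
  \<theta>_i on the right this puts x into the next left ideal, and so into all of them.\<close>

lemma Lf_primitive:
  assumes x: "homog \<mu> x" "rd i x \<in> Ser" "x \<in> Lf i 1"
  shows "x \<in> Ser"
proof -
  have "x \<in> Lf i (Suc K)" for K
  proof (induction K)
    case 0 then show ?case using x(3) by simp
  next
    case (Suc K)
    then obtain z where z: "x - z * th i (Suc K) \<in> Ser" by (auto simp: Lf_def)
    let ?q = "qn (tt i) (Suc K)" and ?c = "chi i i ^ Suc K"
    have "rd i x - rd i (x - z * th i (Suc K)) = rd i (z * th i (Suc K))" by simp
    also have "\<dots> = ?q \<cdot> (z * th i K) + ?c \<cdot> (rd i z * th i (Suc K))"
      by (simp add: rd_mult rd_th del: replicate_Suc qn_simps power_Suc)
    finally have e: "rd i x - rd i (x - z * th i (Suc K)) = ?q \<cdot> (z * th i K) + ?c \<cdot> (rd i z * th i (Suc K))" .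
    have "?q \<cdot> (z * th i K) + ?c \<cdot> (rd i z * th i (Suc K)) \<in> Ser"
      unfolding e[symmetric] by (rule Ser_diff[OF x(2) Ser_rd[OF z, of i]])
    from Ser_wd_right[OF this, of "[i]"]
    have "?q \<cdot> (z * th i (Suc K)) - (- ?c \<cdot> rd i z) * th i (Suc (Suc K)) \<in> Ser"
      by (simp only: th_Suc') (simp add: distrib_right mult.assoc)
    then have "?q \<cdot> (z * th i (Suc K)) \<in> Lf i (Suc (Suc K))" by (rule Lf_I)
    then have "z * th i (Suc K) \<in> Lf i (Suc (Suc K))" by (rule Lf_unit[rotated]) (rule unit_qn, simp)
    from Lf_add[OF Ser_Lf[OF z] this] show ?case by simp
  qed
  \<comment> \<open>A multiple of \<theta>_i^(ht \<mu> + 1) is too long to have a component of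
    weight \<mu>, so projecting to that weight leaves x alone.\<close>
  then obtain z where z: "x - z * th i (Suc (ht \<mu>)) \<in> Ser" by (fastforce simp: Lf_def)
  have "spn (\<lambda>w. \<not> wt w = \<mu>) (z * th i (Suc (ht \<mu>)))"
  proof (rule spn_mult[of "\<lambda>_. True" z "\<lambda>w. length w = Suc (ht \<mu>)"])
    show "\<not> wt (u @ v) = \<mu>" if "length v = Suc (ht \<mu>)" for u v
    proof
      assume "wt (u @ v) = \<mu>"
      then have "length (u @ v) = ht \<mu>" by (simp only: length_wt)
      then show False using that by simp
    qed
  qed (simp_all add: spn_def[of "\<lambda>_. True"])
  then have "rs (\<lambda>w. wt w = \<mu>) (x - z * th i (Suc (ht \<mu>))) = x"
    using x(1) by (simp add: lin_diff[OF lin_rs] rs_zero rs_id)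
  then show ?thesis using Ser_rs[OF z, of \<mu>] by simp
qed

definition fw :: "'i \<Rightarrow> ('i \<Rightarrow> nat) \<Rightarrow> int" where "fw i \<mu> = (\<Sum>k\<in>UNIV. fm i k * int (\<mu> k))"

abbreviation "pw \<equiv> weight_par D"
abbreviation inc :: "'i \<Rightarrow> ('i \<Rightarrow> nat) \<Rightarrow> 'i \<Rightarrow> nat" where "inc i \<nu> \<equiv> (\<lambda>k. \<nu> k + (if k = i then 1 else 0))"

lemma sum_inc: "(\<Sum>k\<in>UNIV. f k * of_nat (inc i \<nu> k)) = (\<Sum>k\<in>UNIV. f k * of_nat (\<nu> k)) + (f i :: 'a::comm_semiring_1)"
proof -
  have "(\<Sum>k\<in>UNIV. f k * of_nat (inc i \<nu> k)) = (\<Sum>k\<in>UNIV. f k * of_nat (\<nu> k) + (if k = i then f k else 0))"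
    by (intro sum.cong) (auto simp: algebra_simps)
  then show ?thesis by (simp add: sum.distrib)
qed

lemma fw_inc: "fw i (inc j \<nu>) = fw i \<nu> + fm i j"
  unfolding fw_def using sum_inc[of "fm i" \<nu> j] by simp

lemma pw_inc: "pw (inc i \<nu>) = pw \<nu> + pr i"
  unfolding weight_par_def using sum_inc[of pr \<nu> i] by (simp add: mult.commute)

lemma ht_inc: "ht (inc i \<nu>) = Suc (ht \<nu>)"
  unfolding ht_def sum.distrib by simp

lemma prod_inc: "(\<Prod>k\<in>UNIV. f k ^ inc i \<nu> k) = (\<Prod>k\<in>UNIV. f k ^ \<nu> k) * (f i :: 'a::comm_monoid_mult)"
proof -
  have "(\<Prod>k\<in>UNIV. f k ^ inc i \<nu> k) = (\<Prod>k\<in>UNIV. f k ^ \<nu> k * (if k = i then f k else 1))"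
    by (intro prod.cong) (auto simp: power_add)
  then show ?thesis by (simp add: prod.distrib)
qed

lemma prod_qpow: "(\<Prod>k\<in>UNIV. qpow (a * fm i k) ^ \<nu> k) = qpow (a * fw i \<nu>)"
proof -
  have "(\<Prod>k\<in>A. qpow (a * fm i k) ^ \<nu> k) = qpow (\<Sum>k\<in>A. a * fm i k * int (\<nu> k))" if "finite A" for A
    using that by induction (auto simp: qpow_add qpow_power)
  from this[of UNIV] show ?thesis by (simp add: fw_def sum_distrib_left mult.assoc)
qed

lemma prod_ppow: "(\<Prod>k\<in>UNIV. ppow (pr i * pr k) ^ \<nu> k) = ppow (pr i * pw \<nu>)"
proof -
  have "(\<Prod>k\<in>A. ppow (pr i * pr k) ^ \<nu> k) = ppow (\<Sum>k\<in>A. pr i * (\<nu> k * pr k))" if "finite A" for A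
    using that by induction (auto simp: ppow_def power_add mult.commute mult.left_commute simp flip: power_mult)
  from this[of UNIV] show ?thesis by (simp add: weight_par_def sum_distrib_left)
qed

lemma Kq_homog: "homog \<mu> y \<Longrightarrow> Kq i y = qpow (- fw i \<mu>) \<cdot> y"
  and KqI_homog: "homog \<mu> y \<Longrightarrow> KqI i y = qpow (fw i \<mu>) \<cdot> y"
  and Sgn_homog: "homog \<mu> y \<Longrightarrow> Sgn i y = ppow (pr i * pw \<mu>) \<cdot> y"
  using Dg_hom[of \<mu> y] prod_qpow[of "- 1" i \<mu>] prod_qpow[of 1 i \<mu>] prod_ppow[of i \<mu>]
  by (simp_all add: Kq_def KqI_def Sgn_def)

lemma wt_th: "homog (\<lambda>k. if k = i then n else 0) (th i n)"
proof -
  have "wt (replicate n i) = (\<lambda>k. if k = i then n else 0)"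
    by (induction n) (auto simp: fun_eq_iff)
  then show ?thesis by simp
qed

text \<open>E_i either passes all M letters, or it meets the one with l letters \<theta>_i behind it
  and leaves, up to a sign, K_i - K_i^-1 evaluated on the weight -(\<mu> + l i), divided by
  \<open>hh i\<close>.\<close>

lemma Ev_th:
  assumes "homog \<mu> y"
  shows "Ev i (th i M * y) = ppow (pr i * M) \<cdot> (th i M * Ev i y)
     + (ppow (pr i * (M - 1)) * inverse (hh i) * (\<Sum>l<M. ppow (pr i * l) * (qpow (- 2 * int (dg i) * int l - fw i \<mu>) - qpow (2 * int (dg i) * int l + fw i \<mu>)))) \<cdot> (th i (M - 1) * y)"
proof (induction M)
  case 0 then show ?case by (simp add: wd_Nil)
next
  case (Suc M)
  let ?s = "\<lambda>l. ppow (pr i * l) * (qpow (- 2 * int (dg i) * int l - fw i \<mu>) - qpow (2 * int (dg i) * int l + fw i \<mu>))"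
  let ?h = "inverse (hh i)"
  have h: "homog (\<lambda>k. (if k = i then M else 0) + \<mu> k) (th i M * y)"
    by (rule homog_mult[OF wt_th assms])
  have f: "fw i (\<lambda>k. (if k = i then M else 0) + \<mu> k) = 2 * int (dg i) * int M + fw i \<mu>"
  proof -
    have "fw i (\<lambda>k. (if k = i then M else 0) + \<mu> k) = (\<Sum>k\<in>UNIV. (if k = i then fm i k * int M else 0) + fm i k * int (\<mu> k))"
      unfolding fw_def by (intro sum.cong) (auto simp: algebra_simps)
    then show ?thesis by (simp add: sum.distrib fw_def fm_ii)
  qed
  have "Ev i (th i (Suc M) * y) = ppow (pr i) \<cdot> (wd [i] * Ev i (th i M * y)) + ?h \<cdot> (Kq i (th i M * y) - KqI i (th i M * y))"
    using Ev_Cons[of i i "th i M * y"] by (simp only: th_Suc mult.assoc) simp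
  also have "?h \<cdot> (Kq i (th i M * y) - KqI i (th i M * y)) = (ppow (pr i * M) * ?h * ?s M) \<cdot> (th i M * y)"
    unfolding Kq_homog[OF h] KqI_homog[OF h] f
  proof -
    have "ppow (pr i * M) * ?h * ?s M = ?h * (qpow (- (2 * int (dg i) * int M + fw i \<mu>)) - qpow (2 * int (dg i) * int M + fw i \<mu>))"
      by (simp add: mult_ac)
    then show "?h \<cdot> (qpow (- (2 * int (dg i) * int M + fw i \<mu>)) \<cdot> (th i M * y) - qpow (2 * int (dg i) * int M + fw i \<mu>) \<cdot> (th i M * y))
        = (ppow (pr i * M) * ?h * ?s M) \<cdot> (th i M * y)"
      by (simp only: fa.scale_left_diff_distrib fa.scale_right_diff_distrib smul_smul right_diff_distrib)
  qed
  also have "wd [i] * Ev i (th i M * y) = ppow (pr i * M) \<cdot> (th i (Suc M) * Ev i y)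
      + (ppow (pr i * (M - 1)) * ?h * (\<Sum>l<M. ?s l)) \<cdot> (th i M * y)"
    unfolding Suc.IH
    by (cases M) (simp_all add: distrib_left th_Suc mult.assoc del: replicate_Suc)
  finally have *: "Ev i (th i (Suc M) * y) = ppow (pr i) \<cdot> (ppow (pr i * M) \<cdot> (th i (Suc M) * Ev i y)
      + (ppow (pr i * (M - 1)) * ?h * (\<Sum>l<M. ?s l)) \<cdot> (th i M * y)) + (ppow (pr i * M) * ?h * ?s M) \<cdot> (th i M * y)" .
  have p: "ppow (pr i) * (ppow (pr i * (M - 1)) * ?h * (\<Sum>l<M. ?s l)) = ppow (pr i * M) * ?h * (\<Sum>l<M. ?s l)"
  proof (cases M)
    case (Suc M') then show ?thesis by (simp add: ppow_add mult_ac)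
  qed simp
  show ?case
    unfolding * fa.scale_right_distrib smul_smul p
    by (simp only: sum.lessThan_Suc distrib_left fa.scale_left_distrib diff_Suc_1 mult_Suc_right ppow_add add.assoc)
qed

text \<open>As in rank one: take the least M such that F_i^M x vanishes in the quotient by
  \<open>Lf i 1\<close>. Applying E_i yields a scalar multiple of F_i^(M-1) x, which is not 0 there,
  so the scalar cannot be a unit. It is a unit times 1 - \<pi>^b q^(2a + 2 d_i (M-1)) for a =
  \<open>fw i \<mu>\<close>, whence a = - d_i (M-1).\<close>

lemma antidominant:
  assumes x: "homog \<mu> x" "rd i x \<in> Ser" "ld i x \<in> Ser" "x \<notin> Ser"
  shows "fw i \<mu> \<le> 0"
proof -
  have x1: "x \<notin> Lf i 1" using Lf_primitive[OF x(1,2)] x(4) by blast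
  obtain N where "th i N * x \<in> Lf i 1" using th_nilpotent[of i x 1] by blast
  define M where "M = (LEAST N. th i N * x \<in> Lf i 1)"
  have M: "th i M * x \<in> Lf i 1" unfolding M_def by (rule LeastI) fact
  have "M \<noteq> 0"
  proof
    assume "M = 0" then show False using M x1 by (simp add: wd_Nil)
  qed
  then have M1: "th i (M - 1) * x \<notin> Lf i 1" unfolding M_def by (intro not_less_Least) simp
  define a where "a = fw i \<mu>"
  define G where "G = (\<Sum>l<M. ppow (pr i * l) * (qpow (- 2 * int (dg i) * int l - a) - qpow (2 * int (dg i) * int l + a)))"
  obtain z where z: "th i M * x - z * wd [i] \<in> Ser" using M by (auto simp: Lf_def)
  have "Ev i (th i M * x) - Evr i i z * wd [i] \<in> Ser"
    using Ser_Ev[OF z, of i] by (simp add: lin_diff[OF lin_Ev] Ev_snoc)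
  then have "Ev i (th i M * x) \<in> Lf i 1" by (intro Lf_I[of _ "Evr i i z"]) simp
  moreover have "ppow (pr i * M) \<cdot> (th i M * Ev i x) \<in> Lf i 1"
    unfolding Ev_def Kq_def Sgn_def by (intro Ser_Lf Ser_smul Ser_mult_left Ser_diff Ser_Dg x)
  ultimately have "(ppow (pr i * (M - 1)) * inverse (hh i) * G) \<cdot> (th i (M - 1) * x) \<in> Lf i 1"
    unfolding Ev_th[OF x(1)] a_def[symmetric] G_def[symmetric] using Lf_diff by fastforce
  then have nu: "\<not> G dvd 1"
    using M1 Lf_unit[of "ppow (pr i * (M - 1)) * inverse (hh i) * G"]
    by (meson unit_mult unit_ppow unit_inverse unit_hh)
  \<comment> \<open>Both halves of \<open>G\<close> are geometric sums, one in t^-1 and one in t.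
    The factor t^(M-1) reverses the first, after which \<open>qn (tt i) M\<close> comes out of
    both.\<close>
  have "tt i ^ (M - 1) * G = qn (tt i) M * (qpow (- a) * (1 - ppow (pr i * (M - 1)) * qpow (2 * a + 2 * int (dg i) * int (M - 1))))"
  proof -
    have A: "(\<Sum>l<M. ppow (pr i * l) * qpow (2 * int (dg i) * int l + a)) = qn (tt i) M * qpow a"
      unfolding qn_def sum_distrib_right by (intro sum.cong refl) (simp add: tt_power qpow_add mult_ac)
    have B: "tt i ^ (M - 1) * (\<Sum>l<M. ppow (pr i * l) * qpow (- 2 * int (dg i) * int l - a)) = qn (tt i) M * qpow (- a)"
    proof -
      have "tt i ^ (M - 1) * (\<Sum>l<M. ppow (pr i * l) * qpow (- 2 * int (dg i) * int l - a))
          = (\<Sum>l<M. tt i ^ (M - Suc l) * qpow (- a))"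
        unfolding sum_distrib_left
      proof (intro sum.cong refl)
        fix l assume l: "l \<in> {..<M}"
        then have "M - 1 = (M - Suc l) + l" by simp
        then have "tt i ^ (M - 1) = tt i ^ (M - Suc l) * tt i ^ l" by (metis power_add)
        moreover have "tt i ^ l * (ppow (pr i * l) * qpow (- 2 * int (dg i) * int l - a)) = qpow (- a)"
        proof -
          let ?e = "2 * int (dg i) * int l"
          have "qpow (- 2 * int (dg i) * int l - a) = qpow (- ?e) * qpow (- a)"
            by (simp flip: qpow_add)
          then have "tt i ^ l * (ppow (pr i * l) * qpow (- 2 * int (dg i) * int l - a))
              = (ppow (pr i * l) * ppow (pr i * l)) * (qpow ?e * qpow (- ?e)) * qpow (- a)"
            unfolding tt_power by (simp only: mult_ac)
          then show ?thesis by (simp add: qpow_uminus)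
        qed
        ultimately show "tt i ^ (M - 1) * (ppow (pr i * l) * qpow (- 2 * int (dg i) * int l - a)) = tt i ^ (M - Suc l) * qpow (- a)"
          by (simp only: mult.assoc)
      qed
      also have "\<dots> = qn (tt i) M * qpow (- a)"
        unfolding qn_def sum_distrib_right by (rule sum.nat_diff_reindex)
      finally show ?thesis .
    qed
    have "tt i ^ (M - 1) * G = tt i ^ (M - 1) * (\<Sum>l<M. ppow (pr i * l) * qpow (- 2 * int (dg i) * int l - a))
        - tt i ^ (M - 1) * (\<Sum>l<M. ppow (pr i * l) * qpow (2 * int (dg i) * int l + a))"
      unfolding G_def by (simp only: right_diff_distrib sum_subtractf)
    also have "\<dots> = qn (tt i) M * (qpow (- a) - tt i ^ (M - 1) * qpow a)"
      unfolding A B by (simp add: algebra_simps)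
    also have "tt i ^ (M - 1) * qpow a = qpow (- a) * (ppow (pr i * (M - 1)) * qpow (2 * a + 2 * int (dg i) * int (M - 1)))"
    proof -
      let ?e = "2 * int (dg i) * int (M - 1)" and ?p = "ppow (pr i * (M - 1))"
      have "qpow (2 * a + ?e) = qpow a * qpow a * qpow ?e" by (simp flip: qpow_add)
      then have "qpow (- a) * (?p * qpow (2 * a + ?e)) = (qpow a * qpow (- a)) * (?p * qpow ?e * qpow a)"
        by (simp only: mult_ac)
      then show ?thesis unfolding tt_power by (simp only: qpow_uminus mult_1)
    qed
    finally show ?thesis by (simp add: right_diff_distrib)
  qed
  moreover have "\<not> tt i ^ (M - 1) * G dvd 1" using nu dvd_mult_right by blast
  ultimately have "2 * a + 2 * int (dg i) * int (M - 1) = 0"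
    using \<open>M \<noteq> 0\<close> by (metis gr0I unit_mult unit_qn unit_qpow unit_one_minus)
  moreover have "0 \<le> int (dg i) * int (M - 1)" by simp
  ultimately show ?thesis unfolding a_def by linarith
qed

subsection \<open>The Casimir operator\<close>

text \<open>The sum over j of the radicals of the Verma modules generated by the primitive vectors
  \<theta>_j. The Casimir identities hold modulo this submodule, on vectors without constant term.
  It is small enough for the induction in \<open>Rad_Ser\<close>: removing the last letter of an
  element of \<open>NR\<close> gives radical elements that are shorter by one.\<close>

inductive_set NR :: "('i word \<Rightarrow>\<^sub>0 qpi) set" where
  NR_0: "0 \<in> NR"
| NR_step: "y \<in> Rad \<Longrightarrow> z \<in> NR \<Longrightarrow> y * wd [j] + z \<in> NR"

lemma NR_gen: "y \<in> Rad \<Longrightarrow> y * wd [j] \<in> NR"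
  using NR_step[OF _ NR_0] by simp

lemma NR_add: "x \<in> NR \<Longrightarrow> y \<in> NR \<Longrightarrow> x + y \<in> NR"
  by (induction rule: NR.induct) (auto intro: NR_step simp: add.assoc)

lemma NR_lin:
  assumes "lin smul g" "\<And>j y. y \<in> Rad \<Longrightarrow> g (y * wd [j]) \<in> NR" "x \<in> NR"
  shows "g x \<in> NR"
  using assms(3)
  by induction (use assms(2) in \<open>auto simp: lin_0[OF assms(1)] lin_add[OF assms(1)] intro: NR_0 NR_add\<close>)

lemma NR_smul: "x \<in> NR \<Longrightarrow> c \<cdot> x \<in> NR"
  by (rule NR_lin[where g = "\<lambda>x. c \<cdot> x"])
     (auto simp: lin_def algebra_simps simp flip: smul_mult_left intro: NR_gen Rad_smul)

lemma NR_Dg: "x \<in> NR \<Longrightarrow> Dg f x \<in> NR"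
  by (rule NR_lin[OF lin_Dg]) (auto simp: Dg_mult simp flip: smul_mult_left intro: NR_gen Rad_smul Rad_Dg)

lemma NR_left: "x \<in> NR \<Longrightarrow> a * x \<in> NR"
  by (rule NR_lin[OF lin_mult_left[OF lin_id]]) (auto simp flip: mult.assoc intro: NR_gen Rad_mult_left)

lemma Rad_Evr: "y \<in> Rad \<Longrightarrow> Evr i j y \<in> Rad"
  unfolding Evr_def Kq_def Sgn_def by (intro Rad_smul Rad_diff Rad_Dg Rad_ld Rad_rd)

lemma NR_Ev: "x \<in> NR \<Longrightarrow> Ev i x \<in> NR"
  by (rule NR_lin[OF lin_Ev]) (auto simp: Ev_snoc intro: NR_gen Rad_Evr)

lemma Dg_Ev: "Dg f (Ev i y) = c \<cdot> Ev i (Dg f y)" if "c * f i = 1"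
  using that by (simp add: Ev_Dg)

lemma umod_NR: "umod D smul Ev (\<lambda>i y. wd [i] * y) Kq KqI (\<lambda>i y. y) NR"
proof (unfold_locales, goal_cases)
  case (14 i j m)
  have "Kq i (Ev j m) = qpow (fm i j) \<cdot> Ev j (Kq i m)" unfolding Kq_def by (rule Dg_Ev) (rule qpow_uminus)
  then show ?case by (simp add: NR_0)
next
  case (15 i j m)
  have "KqI i (Ev j m) = qpow (- fm i j) \<cdot> Ev j (KqI i m)" unfolding KqI_def
    by (rule Dg_Ev) (simp add: mult.commute qpow_uminus)
  then show ?case by (simp add: NR_0)
next
  case (17 i j m)
  then show ?case by (simp add: Ev_Cons NR_0)
qed (auto simp: lop_lin lin_Ev lin_Kq lin_KqI lin_id lin_mult_left[OF lin_id] Kq_def KqI_def lin_Dg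
       intro: NR_0 NR_add NR_smul NR_Ev NR_Dg NR_left)

interpretation M0: umod D smul Ev "\<lambda>i y. wd [i] * y" Kq KqI "\<lambda>i y. y" NR
  by (rule umod_NR)

abbreviation plus :: "('i word \<Rightarrow>\<^sub>0 qpi) \<Rightarrow> bool" where "plus \<equiv> spn (\<lambda>w. w \<noteq> [])"

lemma plus_Vgen: "plus m \<Longrightarrow> m \<in> M0.Vgen"
proof (induction rule: spn_induct)
  case zero show ?case by (rule M0.vac) (simp add: lin_0[OF lin_Ev] NR_0)
next
  case (word c w)
  have "c \<cdot> wd w \<in> M0.Vgen" if "w \<noteq> []" for w
    using that
  proof (induction w)
    case (Cons i w)
    show ?case
    proof (cases "w = []")
      case True
      show ?thesis by (rule M0.vac) (simp add: True lin_smul[OF lin_Ev] NR_0)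
    next
      case False
      from M0.Vgen_F[OF Cons.IH[OF this], of i] show ?thesis by (simp add: wd_Cons[of i w])
    qed
  qed simp
  then show ?case using word .
qed (rule M0.Vgen_add)

lemma plus_Ev: "plus (Ev i m)"
proof (rule spn_lin[OF lin_Ev, of "\<lambda>_. True"])
  show "plus (Ev i (wd w))" for w
  proof (cases w rule: rev_cases)
    case (snoc u j)
    have "plus (Evr i j (wd u) * wd [j])" by (rule spn_mult[of "\<lambda>_. True" _ "\<lambda>w. w = [j]"]) (auto simp: spn_def[of "\<lambda>_. True"])
    then show ?thesis by (simp add: snoc wd_append Ev_snoc)
  qed (simp add: wd_Nil)
qed (simp add: spn_def)

lemma spn_xE:
  assumes "\<And>i y. spn P y \<Longrightarrow> spn P (Ev i y)" "spn P m" shows "spn P (M0.xE x m)"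
proof (induction x rule: fa_induct)
  case (word c w)
  have "spn P (M0.xE (wd w) m)" by (induction w) (use assms in \<open>auto simp: M0.xE_wd\<close>)
  then show ?case by (simp add: M0.xE_simps spn_smul)
qed (simp_all add: M0.xE_simps spn_add)

lemma plus_xE: "plus m \<Longrightarrow> plus (M0.xE x m)"
  by (rule spn_xE) (rule plus_Ev)

lemma xE_len:
  assumes "homog \<nu> x" "spn (\<lambda>w. length w \<le> n) m"
  shows "spn (\<lambda>w. length w + ht \<nu> \<le> n) (M0.xE x m)"
  using assms(1)
proof (induction rule: spn_induct)
  case (word c w)
  have "spn (\<lambda>v. length v + length w \<le> n) (M0.xE (wd w) m)"
  proof (induction w)
    case Nil then show ?case using assms(2) by (simp add: M0.xE_wd)
  next
    case (Cons i w)
    have "spn (\<lambda>v. length v + length (i # w) \<le> n) (Ev i (M0.xE (wd w) m))"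
      by (rule spn_Ev[OF _ Cons]) simp
    then show ?case by (simp add: M0.xE_wd)
  qed
  then show ?case using word by (auto simp: M0.xE_simps length_wt intro: spn_smul)
qed (simp_all add: M0.xE_simps spn_add)

lemma xE_len_0: "homog \<nu> x \<Longrightarrow> spn (\<lambda>w. length w \<le> n) m \<Longrightarrow> n < ht \<nu> \<Longrightarrow> M0.xE x m = 0"
  using xE_len[of \<nu> x n m] by (auto simp: spn_def)

lemma Rad_plus: assumes "r \<in> Rad" "plus z" shows "r * z \<in> NR"
  using assms(2)
proof (induction rule: spn_induct)
  case zero then show ?case by (simp add: NR_0)
next
  case (add x y) then show ?case by (simp add: distrib_left NR_add)
next
  case (word c w)
  then obtain u j where w: "w = u @ [j]" by (metis rev_exhaust)
  have "(r * wd u) * wd [j] \<in> NR" by (intro NR_gen Rad_mult_right assms(1))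
  then show ?case by (simp add: w wd_append mult.assoc NR_smul)
qed

lemma NR_sum: "(\<And>a. a \<in> A \<Longrightarrow> f a \<in> NR) \<Longrightarrow> sum f A \<in> NR"
  by (rule M0.N_sum)

text \<open>Components of a canonical element, with words on the F-side and their duals on the
  E-side. \<open>S2\<close> carries an extra F_i between the two sides; \<open>T1\<close> and
  \<open>T2\<close> carry a derivation on the E-side.\<close>

definition S1 where "S1 \<nu> m = (\<Sum>w | wt w = \<nu>. wd w * M0.xE (star w) m)"
definition S2 where "S2 \<nu> i m = (\<Sum>w | wt w = \<nu>. wd w * (wd [i] * M0.xE (star w) m))"
definition T1 where "T1 \<nu> i m = (\<Sum>w | wt w = \<nu>. wd w * M0.xE (rd i (star w)) m)"
definition T2 where "T2 \<nu> i m = (\<Sum>w | wt w = \<nu>. wd w * M0.xE (ld i (star w)) m)"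

text \<open>For a canonical element, \<open>g\<close> on one factor equals the adjoint of
  \<open>g\<close> on the other. As the families are dual only up to the radical, both sides are
  compared with the same double sum: errors in the E-factor act into \<open>NR\<close> by
  \<open>xE_Rad\<close>, errors in the F-factor by \<open>Rad_plus\<close>.\<close>

lemma dual_shift:
  assumes g: "\<And>y. homog (inc i \<nu>) y \<Longrightarrow> homog \<nu> (g y)"
    and u: "\<And>w y. formw w (g y) = formw (u w) y" "\<And>w. wt w = \<nu> \<Longrightarrow> wt (u w) = inc i \<nu>"
    and m: "plus m"
  shows "(\<Sum>w | wt w = inc i \<nu>. wd w * M0.xE (g (star w)) m) - (\<Sum>v | wt v = \<nu>. wd (u v) * M0.xE (star v) m) \<in> NR"
proof -
  let ?W = "{w. wt w = inc i \<nu>}" and ?V = "{v. wt v = \<nu>}"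
  have 1: "(\<Sum>w\<in>?W. wd w * M0.xE (g (star w) - (\<Sum>v\<in>?V. formw v (g (star w)) \<cdot> star v)) m) \<in> NR"
  proof (intro NR_sum NR_left)
    fix w assume "w \<in> ?W"
    then have "homog \<nu> (g (star w))" using g[of "star w"] star_hom[of w] by simp
    from star_expand[OF this]
    show "M0.xE (g (star w) - (\<Sum>v\<in>?V. formw v (g (star w)) \<cdot> star v)) m \<in> NR"
      by (rule M0.xE_Rad[OF plus_Vgen[OF m]])
  qed
  have 2: "(\<Sum>v\<in>?V. (wd (u v) - (\<Sum>w\<in>?W. formw (u v) (star w) \<cdot> wd w)) * M0.xE (star v) m) \<in> NR"
  proof (intro NR_sum)
    fix v assume "v \<in> ?V"
    then have "wt (u v) = inc i \<nu>" using u(2) by simp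
    with star_expand_left[of "u v"] have "wd (u v) - (\<Sum>w\<in>?W. formw (u v) (star w) \<cdot> wd w) \<in> Rad" by simp
    then show "(wd (u v) - (\<Sum>w\<in>?W. formw (u v) (star w) \<cdot> wd w)) * M0.xE (star v) m \<in> NR"
      by (rule Rad_plus) (rule plus_xE[OF m])
  qed
  let ?M = "\<Sum>w\<in>?W. \<Sum>v\<in>?V. formw (u v) (star w) \<cdot> (wd w * M0.xE (star v) m)"
  have 3: "(\<Sum>w\<in>?W. wd w * M0.xE (g (star w) - (\<Sum>v\<in>?V. formw v (g (star w)) \<cdot> star v)) m)
     = (\<Sum>w\<in>?W. wd w * M0.xE (g (star w)) m) - ?M"
    unfolding u(1) by (simp add: M0.xE_simps lin_sum[OF M0.lin_xE] right_diff_distrib sum_subtractf sum_distrib_left)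
  have 4: "(\<Sum>v\<in>?V. (wd (u v) - (\<Sum>w\<in>?W. formw (u v) (star w) \<cdot> wd w)) * M0.xE (star v) m)
     = (\<Sum>v\<in>?V. wd (u v) * M0.xE (star v) m) - ?M"
    by (subst sum.swap) (simp add: left_diff_distrib sum_subtractf sum_distrib_right)
  show ?thesis using M0.N_diff[OF 1 2] unfolding 3 4 by simp
qed

lemma wt_remove: "wt (u @ i # v) = inc i \<nu> \<Longrightarrow> wt (u @ v) = \<nu>"
proof
  fix k assume "wt (u @ i # v) = inc i \<nu>"
  from fun_cong[OF this, of k] show "wt (u @ v) k = \<nu> k" by (cases "k = i") auto
qed

lemma homog_rd: "homog (inc i \<nu>) y \<Longrightarrow> homog \<nu> (rd i y)"
  by (rule spn_rd[where P = "\<lambda>w. wt w = inc i \<nu>"]) (rule wt_remove)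

lemma homog_ld: "homog (inc i \<nu>) y \<Longrightarrow> homog \<nu> (ld i y)"
  by (rule spn_ld[where P = "\<lambda>w. wt w = inc i \<nu>"]) (rule wt_remove)

lemma T1_S2: assumes "plus m" shows "T1 (inc i \<nu>) i m - S2 \<nu> i m \<in> NR"
proof -
  have "(\<Sum>w | wt w = inc i \<nu>. wd w * M0.xE (rd i (star w)) m) - (\<Sum>v | wt v = \<nu>. wd (v @ [i]) * M0.xE (star v) m) \<in> NR"
    by (rule dual_shift) (simp_all add: homog_rd formw_snoc assms)
  then show ?thesis by (simp add: T1_def S2_def wd_append mult.assoc)
qed

lemma T2_S1: assumes "plus m" shows "T2 (inc i \<nu>) i m - wd [i] * S1 \<nu> m \<in> NR"
proof -
  have "(\<Sum>w | wt w = inc i \<nu>. wd w * M0.xE (ld i (star w)) m) - (\<Sum>v | wt v = \<nu>. wd ([i] @ v) * M0.xE (star v) m) \<in> NR"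
    by (rule dual_shift) (simp_all add: homog_ld assms)
  then show ?thesis by (simp only: T2_def S1_def wd_append mult.assoc sum_distrib_left)
qed

lemma rd_zero: "homog \<nu> y \<Longrightarrow> \<nu> i = 0 \<Longrightarrow> rd i y = 0"
  and ld_zero: "homog \<nu> y \<Longrightarrow> \<nu> i = 0 \<Longrightarrow> ld i y = 0"
proof -
  have f: "False" if "wt (u @ i # v) = \<nu>" "\<nu> i = 0" for u v using that by auto
  show "rd i y = 0" if "homog \<nu> y" "\<nu> i = 0"
    using spn_rd[of "\<lambda>w. wt w = \<nu>" i "\<lambda>_. False" y] f that by (auto simp: spn_def)
  show "ld i y = 0" if "homog \<nu> y" "\<nu> i = 0"
    using spn_ld[of "\<lambda>w. wt w = \<nu>" i "\<lambda>_. False" y] f that by (auto simp: spn_def)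
qed

text \<open>Solution of the recursion \<open>cw_inc\<close>, under which the terms of the Casimir
  operator telescope in \<open>Cas_F\<close>. The binomial exponent of \<pi> accounts for the signs:
  adding an odd letter costs one factor for each odd letter already present.\<close>

definition cw :: "('i \<Rightarrow> nat) \<Rightarrow> qpi" where
  "cw \<nu> = (\<Prod>k\<in>UNIV. (- (hh k * qpow (- fm k k))) ^ \<nu> k) * ppow (pw \<nu> choose 2)"

lemma cw_inc: "cw (inc i \<nu>) = - (hh i * qpow (- fm i i) * ppow (pr i * pw \<nu>) * cw \<nu>)"
proof -
  have "ppow (pw (inc i \<nu>) choose 2) = ppow (pr i * pw \<nu>) * ppow (pw \<nu> choose 2)"
    unfolding pw_inc by (cases "pr i = 0") (auto simp: pr_odds numeral_2_eq_2 ppow_add split: if_splits)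
  then show ?thesis unfolding cw_def prod_inc by (simp add: mult_ac)
qed

abbreviation "qw \<nu> \<equiv> Dg (\<lambda>j. qpow (fw j \<nu>))"

text \<open>The truncation loses nothing on elements of length at most n, since the E-factors of
  greater height act by 0 there. The factor \<open>qw \<nu>\<close> is the torus part of the
  operator.\<close>

definition Cas :: "nat \<Rightarrow> ('i word \<Rightarrow>\<^sub>0 qpi) \<Rightarrow> ('i word \<Rightarrow>\<^sub>0 qpi)" where
  "Cas n m = (\<Sum>\<nu> | ht \<nu> \<le> n. cw \<nu> \<cdot> S1 \<nu> (qw \<nu> m))"

lemma sum_ht_shift:
  fixes g :: "('i \<Rightarrow> nat) \<Rightarrow> 'b::comm_monoid_add"
  assumes "\<And>\<nu>. \<nu> i = 0 \<Longrightarrow> g \<nu> = 0"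
  shows "(\<Sum>\<nu> | ht \<nu> \<le> Suc n. g \<nu>) = (\<Sum>\<nu> | ht \<nu> \<le> n. g (inc i \<nu>))"
proof -
  have inj: "inj_on (inc i) {\<nu>. ht \<nu> \<le> n}"
    by (intro inj_onI) (simp add: fun_eq_iff)
  have "(\<Sum>\<nu> | ht \<nu> \<le> Suc n. g \<nu>) = sum g (inc i ` {\<nu>. ht \<nu> \<le> n})"
  proof (rule sum.mono_neutral_right[OF finite_ht])
    show "inc i ` {\<nu>. ht \<nu> \<le> n} \<subseteq> {\<nu>. ht \<nu> \<le> Suc n}" by (auto simp: ht_inc)
    show "\<forall>\<nu>\<in>{\<nu>. ht \<nu> \<le> Suc n} - inc i ` {\<nu>. ht \<nu> \<le> n}. g \<nu> = 0"
    proof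
      fix \<nu> assume \<nu>: "\<nu> \<in> {\<nu>. ht \<nu> \<le> Suc n} - inc i ` {\<nu>. ht \<nu> \<le> n}"
      have "\<nu> i = 0"
      proof (rule ccontr)
        assume "\<nu> i \<noteq> 0"
        then have e: "\<nu> = inc i (\<nu>(i := \<nu> i - 1))" by (auto simp: fun_eq_iff)
        then have "ht (\<nu>(i := \<nu> i - 1)) \<le> n" using \<nu> ht_inc[of "\<nu>(i := \<nu> i - 1)" i] by auto
        with e \<nu> show False by blast
      qed
      then show "g \<nu> = 0" by (rule assms)
    qed
  qed
  also have "\<dots> = (\<Sum>\<nu> | ht \<nu> \<le> n. g (inc i \<nu>))" by (rule sum.reindex_cong[OF inj refl refl])
  finally show ?thesis .
qed

lemma Cas_F_term:
  fixes \<nu> i m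
  defines "m' \<equiv> qw \<nu> m"
  defines "c \<equiv> cw \<nu> * qpow (fw i \<nu>)"
  shows "cw \<nu> \<cdot> S1 \<nu> (qw \<nu> (wd [i] * m)) - ((c * ppow (pr i * pw \<nu>)) \<cdot> S2 \<nu> i m'
     + (c * inverse (hh i)) \<cdot> (T1 \<nu> i (Kq i m') - (\<Sum>w | wt w = \<nu>. wd w * KqI i (M0.xE (Sgn i (ld i (star w))) m')))) \<in> NR"
proof -
  let ?h = "inverse (hh i)"
  define d where "d w = M0.xE (star w) (wd [i] * m') - (wd [i] * M0.xE (Sgn i (star w)) m'
     + ?h \<cdot> (M0.xE (rd i (star w)) (Kq i m') - KqI i (M0.xE (Sgn i (ld i (star w))) m')))" for w
  have d: "d w \<in> NR" for w
    using M0.xE_F[of "star w" i m'] by (simp add: d_def Sgn_def)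
  have "qw \<nu> (wd [i] * m) = qpow (fw i \<nu>) \<cdot> (wd [i] * m')"
    by (simp add: Dg_mult m'_def)
  then have 1: "cw \<nu> \<cdot> S1 \<nu> (qw \<nu> (wd [i] * m)) = c \<cdot> (\<Sum>w | wt w = \<nu>. wd w * M0.xE (star w) (wd [i] * m'))"
    by (simp add: S1_def lop_scale[OF M0.lop_xE] c_def fa.scale_sum_right)
  have 2: "ppow (pr i * pw \<nu>) \<cdot> S2 \<nu> i m' = (\<Sum>w | wt w = \<nu>. wd w * (wd [i] * M0.xE (Sgn i (star w)) m'))"
  proof -
    have "Sgn i (star w) = ppow (pr i * pw \<nu>) \<cdot> star w" if "wt w = \<nu>" for w
      using Sgn_homog[OF star_hom[of w]] that by simp
    then show ?thesis by (simp add: S2_def fa.scale_sum_right M0.xE_simps)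
  qed
  have "(c * ppow (pr i * pw \<nu>)) \<cdot> S2 \<nu> i m' = c \<cdot> (ppow (pr i * pw \<nu>) \<cdot> S2 \<nu> i m')" by simp
  then have "cw \<nu> \<cdot> S1 \<nu> (qw \<nu> (wd [i] * m)) - ((c * ppow (pr i * pw \<nu>)) \<cdot> S2 \<nu> i m'
     + (c * ?h) \<cdot> (T1 \<nu> i (Kq i m') - (\<Sum>w | wt w = \<nu>. wd w * KqI i (M0.xE (Sgn i (ld i (star w))) m'))))
    = c \<cdot> (\<Sum>w | wt w = \<nu>. wd w * d w)"
    unfolding 1 2 d_def T1_def
    by (simp add: right_diff_distrib distrib_left sum_subtractf sum.distrib fa.scale_right_diff_distrib fa.scale_right_distrib
         fa.scale_sum_right)
  then show ?thesis using NR_smul[OF NR_sum[OF NR_left[OF d]]] by simp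
qed

lemma KqI_T2:
  assumes m: "plus m"
  shows "(\<Sum>w | wt w = inc i \<nu>. wd w * KqI i (M0.xE (Sgn i (ld i (star w))) m))
     - (ppow (pr i * pw \<nu>) * qpow (- fw i \<nu>)) \<cdot> (wd [i] * S1 \<nu> (KqI i m)) \<in> NR"
proof -
  let ?c = "ppow (pr i * pw \<nu>) * qpow (- fw i \<nu>)"
  define d where "d w = KqI i (M0.xE (ld i (star w)) m) - M0.xE (Kq i (ld i (star w))) (KqI i m)" for w
  have d: "d w \<in> NR" for w
    unfolding d_def Kq_def by (rule M0.op_xE[OF M0.lop_KI M0.N_KI M0.KI_E])
  have h: "homog \<nu> (ld i (star w))" if "wt w = inc i \<nu>" for w
    using homog_ld[where i = i and \<nu> = \<nu> and y = "star w"] star_hom[of w] that by simp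
  have "(\<Sum>w | wt w = inc i \<nu>. wd w * KqI i (M0.xE (Sgn i (ld i (star w))) m)) - ?c \<cdot> T2 (inc i \<nu>) i (KqI i m)
     = (\<Sum>w | wt w = inc i \<nu>. ppow (pr i * pw \<nu>) \<cdot> (wd w * d w))"
    unfolding T2_def fa.scale_sum_right sum_subtractf[symmetric]
    by (intro sum.cong refl)
       (simp add: Sgn_homog[OF h] Kq_homog[OF h] M0.xE_simps lin_smul[OF lin_KqI] d_def right_diff_distrib fa.scale_right_diff_distrib)
  then have 1: "(\<Sum>w | wt w = inc i \<nu>. wd w * KqI i (M0.xE (Sgn i (ld i (star w))) m)) - ?c \<cdot> T2 (inc i \<nu>) i (KqI i m) \<in> NR"
    using d by (auto intro!: NR_sum NR_smul NR_left)
  have "plus (KqI i m)" unfolding KqI_def by (rule spn_Dg[OF m])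
  from NR_smul[OF T2_S1[OF this, where i = i and \<nu> = \<nu>], where c = ?c]
  have "?c \<cdot> T2 (inc i \<nu>) i (KqI i m) - ?c \<cdot> (wd [i] * S1 \<nu> (KqI i m)) \<in> NR"
    by (simp add: fa.scale_right_diff_distrib)
  from M0.N_trans[OF 1 this] show ?thesis .
qed

text \<open>By \<open>Cas_F_term\<close> the part of degree \<nu> splits into a term
  \<open>a\<close> with F_i between the two factors, and boundary terms \<open>b\<close>. In degree
  \<nu> + i one boundary term cancels \<open>a \<nu>\<close>, by \<open>T1_S2\<close>; the other one
  is F_i times the part of degree \<nu>, with the twist by K_i applied twice
  (\<open>T2_S1\<close>).\<close>

lemma Cas_F:
  assumes m: "plus m" "spn (\<lambda>w. length w \<le> n) m"
  shows "Cas (Suc n) (wd [i] * m) - wd [i] * Cas n (Dg (\<lambda>k. qpow (2 * fm i k)) m) \<in> NR"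
proof -
  let ?h = "inverse (hh i)"
  define c where "c \<nu> = cw \<nu> * qpow (fw i \<nu>)" for \<nu>
  define a where "a \<nu> = (c \<nu> * ppow (pr i * pw \<nu>)) \<cdot> S2 \<nu> i (qw \<nu> m)" for \<nu>
  define b where "b \<nu> = (c \<nu> * ?h) \<cdot> (T1 \<nu> i (Kq i (qw \<nu> m))
      - (\<Sum>w | wt w = \<nu>. wd w * KqI i (M0.xE (Sgn i (ld i (star w))) (qw \<nu> m))))" for \<nu>
  define e where "e \<nu> = cw \<nu> \<cdot> (wd [i] * S1 \<nu> (qw \<nu> (Dg (\<lambda>k. qpow (2 * fm i k)) m)))" for \<nu>
  have pl: "plus (qw \<nu> m)" for \<nu> by (rule spn_Dg[OF m(1)])
  have 1: "cw \<nu> \<cdot> S1 \<nu> (qw \<nu> (wd [i] * m)) - (a \<nu> + b \<nu>) \<in> NR" for \<nu>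
    unfolding a_def b_def c_def by (rule Cas_F_term)
  have b0: "b \<nu> = 0" if "\<nu> i = 0" for \<nu>
  proof -
    have "rd i (star w) = 0" "ld i (star w) = 0" if "wt w = \<nu>" for w
      using star_hom[of w] \<open>\<nu> i = 0\<close> that by (simp_all add: rd_zero ld_zero)
    then show ?thesis
      by (simp add: b_def T1_def M0.xE_simps lin_0[OF lin_Sgn] lin_0[OF lin_KqI])
  qed
  \<comment> \<open>In top degree the E-factor is longer than m. Hence the sum of \<open>a\<close>
    may stop at height n, to match the shifted sum of \<open>b\<close>.\<close>
  have a0: "a \<nu> = 0" if "ht \<nu> = Suc n" for \<nu>
  proof -
    have "M0.xE (star w) (qw \<nu> m) = 0" if "wt w = \<nu>" for w
      using star_hom[of w] \<open>ht \<nu> = Suc n\<close> that by (intro xE_len_0[OF _ spn_Dg[OF m(2)], of \<nu>]) auto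
    then show ?thesis by (simp add: a_def S2_def)
  qed
  have 2: "b (inc i \<nu>) - (e \<nu> - a \<nu>) \<in> NR" for \<nu>
  proof -
    let ?\<nu> = "inc i \<nu>"
    have ch: "c ?\<nu> * ?h = - (c \<nu> * ppow (pr i * pw \<nu>))"
    proof -
      have "c ?\<nu> * ?h = - ((hh i * ?h) * (qpow (- fm i i) * qpow (fm i i)) * (cw \<nu> * qpow (fw i \<nu>) * ppow (pr i * pw \<nu>)))"
        unfolding c_def cw_inc fw_inc qpow_add by (simp only: mult_minus_left mult_minus_right mult_ac)
      then show ?thesis using pi_ext_mult_inverse[OF unit_hh[of i]] qpow_uminus[of "- fm i i"] by (simp add: c_def)
    qed
    have Kq: "Kq i (qw ?\<nu> m) = qw \<nu> m"
    proof -
      have "qpow (- fm i k) * qpow (fw k ?\<nu>) = qpow (fw k \<nu>)" for k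
        unfolding fw_inc fm_sym[of k i] by (simp flip: qpow_add)
      then show ?thesis unfolding Kq_def Dg_Dg by simp
    qed
    have KI: "KqI i (qw ?\<nu> m) = qw \<nu> (Dg (\<lambda>k. qpow (2 * fm i k)) m)"
    proof -
      have "qpow (fm i k) * qpow (fw k ?\<nu>) = qpow (fw k \<nu>) * qpow (2 * fm i k)" for k
        unfolding fw_inc fm_sym[of k i] by (simp flip: qpow_add add: algebra_simps)
      then show ?thesis unfolding KqI_def Dg_Dg by simp
    qed
    have A: "T1 ?\<nu> i (Kq i (qw ?\<nu> m)) - S2 \<nu> i (qw \<nu> m) \<in> NR" unfolding Kq by (rule T1_S2[OF pl])
    let ?c = "ppow (pr i * pw \<nu>) * qpow (- fw i \<nu>)"
    have B: "(\<Sum>w | wt w = ?\<nu>. wd w * KqI i (M0.xE (Sgn i (ld i (star w))) (qw ?\<nu> m)))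
       - ?c \<cdot> (wd [i] * S1 \<nu> (KqI i (qw ?\<nu> m))) \<in> NR"
      by (rule KqI_T2[OF pl])
    have cc: "(c ?\<nu> * ?h) * ?c = - cw \<nu>"
    proof -
      have "(c ?\<nu> * ?h) * ?c = - ((ppow (pr i * pw \<nu>) * ppow (pr i * pw \<nu>)) * (qpow (fw i \<nu>) * qpow (- fw i \<nu>)) * cw \<nu>)"
        unfolding ch by (simp only: c_def mult_minus_left mult_minus_right mult_ac)
      then show ?thesis by (simp add: qpow_uminus)
    qed
    have "b ?\<nu> - (e \<nu> - a \<nu>) = (c ?\<nu> * ?h) \<cdot> ((T1 ?\<nu> i (Kq i (qw ?\<nu> m)) - S2 \<nu> i (qw \<nu> m))
       - ((\<Sum>w | wt w = ?\<nu>. wd w * KqI i (M0.xE (Sgn i (ld i (star w))) (qw ?\<nu> m)))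
          - ?c \<cdot> (wd [i] * S1 \<nu> (KqI i (qw ?\<nu> m)))))"
    proof -
      have E: "e \<nu> = - ((c ?\<nu> * ?h) \<cdot> ?c \<cdot> (wd [i] * S1 \<nu> (KqI i (qw ?\<nu> m))))"
        unfolding smul_smul cc KI e_def by simp
      have A': "a \<nu> = - ((c ?\<nu> * ?h) \<cdot> S2 \<nu> i (qw \<nu> m))"
        unfolding ch a_def by simp
      show ?thesis unfolding E A' b_def
        by (simp only: fa.scale_right_diff_distrib) (simp add: algebra_simps)
    qed
    then show ?thesis using NR_smul[OF M0.N_diff[OF A B]] by simp
  qed
  have s: "(\<Sum>\<nu> | ht \<nu> \<le> Suc n. a \<nu>) = (\<Sum>\<nu> | ht \<nu> \<le> n. a \<nu>)"
    by (rule sum.mono_neutral_right[OF finite_ht]) (auto simp: a0 le_Suc_eq)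
  have "Cas (Suc n) (wd [i] * m) - wd [i] * Cas n (Dg (\<lambda>k. qpow (2 * fm i k)) m)
     = (\<Sum>\<nu> | ht \<nu> \<le> Suc n. cw \<nu> \<cdot> S1 \<nu> (qw \<nu> (wd [i] * m)) - (a \<nu> + b \<nu>))
       + (\<Sum>\<nu> | ht \<nu> \<le> n. b (inc i \<nu>) - (e \<nu> - a \<nu>))"
    unfolding sum_subtractf sum.distrib s
    using sum_ht_shift[of i b n, OF b0]
    by (simp add: Cas_def e_def sum_distrib_left)
  then show ?thesis using 1 2 by (auto intro!: NR_add NR_sum)
qed

primrec ew :: "'i list \<Rightarrow> int" where
  "ew [] = 0"
| "ew (i # w) = 2 * fw i (wt w) + ew w"

text \<open>The exponent is (\<mu>, \<mu>) - 2 (\<rho>, \<mu>) with (\<rho>, k) = (k, k) / 2; in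
  particular it depends on the weight of the word only.\<close>

lemma ew_wt: "ew w = (\<Sum>k\<in>UNIV. fw k (wt w) * int (wt w k)) - (\<Sum>k\<in>UNIV. fm k k * int (wt w k))"
proof (induction w)
  case (Cons i w)
  define \<mu> where "\<mu> = wt w"
  have 1: "(\<Sum>k\<in>UNIV. fw k (inc i \<mu>) * int (inc i \<mu> k)) = (\<Sum>k\<in>UNIV. fw k (inc i \<mu>) * int (\<mu> k)) + fw i (inc i \<mu>)"
    by (rule sum_inc)
  have 2: "(\<Sum>k\<in>UNIV. fw k (inc i \<mu>) * int (\<mu> k)) = (\<Sum>k\<in>UNIV. fw k \<mu> * int (\<mu> k)) + fw i \<mu>"
    unfolding fw_inc distrib_right sum.distrib unfolding fw_def[of i] by (simp add: fm_sym)
  have 3: "(\<Sum>k\<in>UNIV. fm k k * int (inc i \<mu> k)) = (\<Sum>k\<in>UNIV. fm k k * int (\<mu> k)) + fm i i"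
    by (rule sum_inc)
  have w: "wt (i # w) = inc i \<mu>" by (simp add: \<mu>_def)
  show ?case unfolding w ew.simps(2)
    using Cons.IH 1 2 3 fw_inc[of i \<mu> i] unfolding \<mu>_def[symmetric] by linarith
qed (simp add: fw_def)

lemma S1_zero: "S1 (\<lambda>_. 0) m = m"
proof -
  have "spn (\<lambda>w. w = []) (star [])"
    by (rule spn_mono[OF star_hom]) (metis length_wt length_0_conv)
  then have s0: "star [] = lookup (star []) 0 \<cdot> 1"
    by (induction rule: spn_induct) (simp_all add: lookup_add lookup_smul algebra_simps wd_Nil)
  have "w = []" if "wt w = (\<lambda>_. 0)" for w :: "'i list"
    using length_wt[of w] that by (simp add: ht_def)
  then have W0: "{w :: 'i list. wt w = (\<lambda>_. 0)} = {[]}" by auto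
  have "formw [] (star []) * formw [] (wd []) = formw [] (wd [])"
    using star_dual[of "[]" "\<lambda>_. 0" "[]"] W0 by simp
  then have "lookup (star []) 0 = 1" by (simp add: wd_Nil)
  then show ?thesis unfolding S1_def W0 using s0 by (simp add: wd_Nil M0.xE_1)
qed

lemma cw_zero: "cw (\<lambda>_. 0) = 1"
  by (simp add: cw_def weight_par_def binomial_eq_0)

text \<open>\<theta>_j is primitive, so only \<nu> = 0 contributes. This starts the induction in
  \<open>Cas_word\<close>, where the exponent \<open>ew [j]\<close> is 0.\<close>

lemma Cas_gen: "Cas n (wd [j]) = wd [j]"
proof -
  have Sn: "S1 \<nu> (qw \<nu> (wd [j])) = 0" if "\<nu> \<noteq> (\<lambda>_. 0)" for \<nu>
  proof -
    have "M0.xE x (wd [j]) = lookup x 0 \<cdot> wd [j]" for x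
    proof (rule lin_eqI[OF M0.lin_xE])
      show "lin smul (\<lambda>x. lookup x 0 \<cdot> wd [j])" by (simp add: lin_def lookup_add lookup_smul algebra_simps)
      fix w :: "'i list"
      show "M0.xE (wd w) (wd [j]) = lookup (wd w) 0 \<cdot> wd [j]"
      proof (cases w rule: rev_cases)
        case (snoc u i)
        have "foldr Ev u 0 = 0" by (induction u) (simp_all add: lin_0[OF lin_Ev])
        then show ?thesis by (simp add: snoc M0.xE_wd lookup_wd zero_word_def)
      qed (simp add: wd_Nil M0.xE_1)
    qed
    moreover have "lookup (star w) 0 = 0" if "wt w = \<nu>" for w
      using formw_hom[OF star_hom[of w], of "[]"] that \<open>\<nu> \<noteq> (\<lambda>_. 0)\<close> by auto
    ultimately show ?thesis by (simp add: S1_def lop_scale[OF M0.lop_xE])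
  qed
  have "Cas n (wd [j]) = (\<Sum>\<nu>\<in>{\<lambda>_. 0}. cw \<nu> \<cdot> S1 \<nu> (qw \<nu> (wd [j])))"
    unfolding Cas_def
  proof (rule sum.mono_neutral_right[OF finite_ht])
    show "{\<lambda>_. 0} \<subseteq> {\<nu> :: 'i \<Rightarrow> nat. ht \<nu> \<le> n}" by (simp add: ht_def)
    show "\<forall>\<nu>\<in>{\<nu>. ht \<nu> \<le> n} - {\<lambda>_. 0}. cw \<nu> \<cdot> S1 \<nu> (qw \<nu> (wd [j])) = 0"
      using Sn by (simp del: Dg_wd)
  qed
  also have "\<dots> = wd [j]" by (simp add: S1_zero cw_zero fw_def)
  finally show ?thesis .
qed

lemma lin_Cas: "lin smul (Cas n)"
  unfolding Cas_def S1_def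
  by (rule linI)
     (simp_all add: lop_add[OF M0.lop_xE] lop_scale[OF M0.lop_xE] distrib_left sum.distrib fa.scale_right_distrib fa.scale_sum_right mult.commute)

lemma Cas_word: "w \<noteq> [] \<Longrightarrow> length w \<le> n \<Longrightarrow> Cas n (wd w) - qpow (ew w) \<cdot> wd w \<in> NR"
proof (induction w arbitrary: n)
  case (Cons i w)
  show ?case
  proof (cases "w = []")
    case True
    then show ?thesis by (simp add: Cas_gen fw_def NR_0)
  next
    case False
    obtain n' where n: "n = Suc n'" "length w \<le> n'" using Cons.prems by (cases n) auto
    have 1: "Cas n (wd [i] * wd w) - wd [i] * Cas n' (Dg (\<lambda>k. qpow (2 * fm i k)) (wd w)) \<in> NR"
      unfolding n(1) by (rule Cas_F) (use False n in auto)
    have q: "Dg (\<lambda>k. qpow (2 * fm i k)) (wd w) = qpow (2 * fw i (wt w)) \<cdot> wd w"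
      by (simp add: wprod_wt prod_qpow)
    have 2: "qpow (2 * fw i (wt w)) \<cdot> (wd [i] * (Cas n' (wd w) - qpow (ew w) \<cdot> wd w)) \<in> NR"
      by (intro NR_smul NR_left Cons.IH False n)
    have "Cas n (wd (i # w)) - qpow (ew (i # w)) \<cdot> wd (i # w) =
       (Cas n (wd [i] * wd w) - wd [i] * Cas n' (Dg (\<lambda>k. qpow (2 * fm i k)) (wd w)))
       + qpow (2 * fw i (wt w)) \<cdot> (wd [i] * (Cas n' (wd w) - qpow (ew w) \<cdot> wd w))"
      unfolding q wd_Cons[of i w]
      by (simp add: lin_smul[OF lin_Cas] right_diff_distrib fa.scale_right_diff_distrib qpow_add)
    then show ?thesis using NR_add[OF 1 2] by simp
  qed
qed simp

section \<open>Removing last letters, and the induction on the length\<close>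

definition rst :: "'i \<Rightarrow> ('i word \<Rightarrow>\<^sub>0 qpi) \<Rightarrow> ('i word \<Rightarrow>\<^sub>0 qpi)" where
  "rst j = lext smul (\<lambda>w. if w \<noteq> [] \<and> last w = j then wd (butlast w) else 0)"

lemma lin_rst: "lin smul (rst j)"
  unfolding rst_def by (rule lin_lext[OF module_smul])

lemma rst_snoc: "rst j (y * wd [k]) = (if k = j then y else 0)"
proof (rule lin_eqI[where f = "\<lambda>y. rst j (y * wd [k])" and g = "\<lambda>y. if k = j then y else 0"])
  show "rst j (wd w * wd [k]) = (if k = j then wd w else 0)" for w
    by (simp add: rst_def lext_wd[OF module_smul] flip: wd_append)
qed (auto simp: lin_def distrib_right lin_add[OF lin_rst] lin_smul[OF lin_rst])

lemma rst_NR: "z \<in> NR \<Longrightarrow> rst j z \<in> Rad"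
  by (induction rule: NR.induct) (auto simp: lin_0[OF lin_rst] lin_add[OF lin_rst] rst_snoc intro: Rad_add)

lemma rst_expand: "z \<in> NR \<Longrightarrow> z = (\<Sum>j\<in>UNIV. rst j z * wd [j])"
proof (induction rule: NR.induct)
  case NR_0
  show ?case by (simp add: lin_0[OF lin_rst])
next
  case (NR_step y z k)
  have "(\<Sum>j\<in>UNIV. rst j (y * wd [k] + z) * wd [j]) = (\<Sum>j\<in>UNIV. (if k = j then y * wd [j] else 0) + rst j z * wd [j])"
    by (intro sum.cong refl) (simp add: lin_add[OF lin_rst] rst_snoc distrib_right)
  also have "\<dots> = y * wd [k] + z" using NR_step.IH by (simp add: sum.distrib)
  finally show ?case by simp
qed

lemma spn_rst:
  assumes "spn (\<lambda>w. length w \<le> Suc n) z" shows "spn (\<lambda>w. length w \<le> n) (rst j z)"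
  by (rule spn_lin[OF lin_rst _ assms]) (auto simp: rst_def lext_wd[OF module_smul])

text \<open>For homogeneous y the Casimir operator is computed twice. By the eigenvalue it is q^e y
  up to \<open>NR\<close>, and that error is a sum of shorter radical elements times letters, hence
  in the Serre ideal by induction. By its definition it is y up to words times shorter radical
  elements, the parts with \<nu> \<noteq> 0, so again up to the Serre ideal. Thus (1 - q^e) y lies
  in the Serre ideal.\<close>

theorem Rad_Ser:
  assumes "x \<in> Rad" shows "x \<in> Ser"
proof -
  have len: "\<And>x. x \<in> Rad \<Longrightarrow> spn (\<lambda>w. length w \<le> n) x \<Longrightarrow> x \<in> Ser" for n
  proof (induction n)
    case 0
    from 0(2) have "x = lookup x 0 \<cdot> 1"
      by (induction rule: spn_induct) (simp_all add: lookup_add lookup_smul algebra_simps wd_Nil)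
    then show ?case using Rad_lookup_0[OF 0(1)] by (simp add: Ser_0)
  next
    case (Suc n)
    have main: "y \<in> Ser" if y: "y \<in> Rad" "homog \<mu> y" and \<mu>: "ht \<mu> \<le> Suc n" for y \<mu>
    proof (rule ccontr)
      assume ny: "y \<notin> Ser"
      have leny: "spn (\<lambda>w. length w = ht \<mu>) y" by (rule spn_mono[OF y(2)]) (simp add: length_wt)
      have "ht \<mu> = Suc n"
      proof (rule ccontr)
        assume "ht \<mu> \<noteq> Suc n"
        then have "spn (\<lambda>w. length w \<le> n) y" using \<mu> by (intro spn_mono[OF leny]) auto
        with Suc.IH[OF y(1)] ny show False by blast
      qed
      then have leny: "spn (\<lambda>w. length w = Suc n) y" using leny by simp
      have r: "rd i y \<in> Ser" "ld i y \<in> Ser" for i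
        by (rule Suc.IH[OF Rad_rd[OF y(1)]], rule spn_rd[OF _ leny], simp)
           (rule Suc.IH[OF Rad_ld[OF y(1)]], rule spn_ld[OF _ leny], simp)
      have anti: "fw i \<mu> \<le> 0" for i by (rule antidominant[OF y(2) r ny])
      define e where "e = (\<Sum>k\<in>UNIV. fw k \<mu> * int (\<mu> k)) - (\<Sum>k\<in>UNIV. fm k k * int (\<mu> k))"
      \<comment> \<open>Antidominance makes (\<mu>, \<mu>) nonpositive, while 2 (\<rho>, \<mu>) is
        at least the height.\<close>
      have e_neg: "e < 0"
      proof -
        have "(\<Sum>k\<in>UNIV. fw k \<mu> * int (\<mu> k)) \<le> 0"
          by (intro sum_nonpos) (simp add: anti mult_nonpos_nonneg)
        moreover have "(\<Sum>k\<in>UNIV. int (\<mu> k)) \<le> (\<Sum>k\<in>UNIV. fm k k * int (\<mu> k))"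
        proof (intro sum_mono)
          fix k show "int (\<mu> k) \<le> fm k k * int (\<mu> k)"
            using mult_right_mono[of 1 "fm k k" "int (\<mu> k)"] fm_diag(1)[of k] by simp
        qed
        moreover have "(\<Sum>k\<in>UNIV. int (\<mu> k)) = int (ht \<mu>)" by (simp add: ht_def)
        ultimately show ?thesis using \<open>ht \<mu> = Suc n\<close> by (simp add: e_def)
      qed
      have NR: "Cas (Suc n) y - qpow e \<cdot> y \<in> NR"
        using y(2)
      proof (induction rule: spn_induct)
        case zero then show ?case by (simp add: lin_0[OF lin_Cas] NR_0)
      next
        case (add x y)
        from NR_add[OF add] show ?case by (simp add: lin_add[OF lin_Cas] algebra_simps)
      next
        case (word c w)
        then have "w \<noteq> []" "length w \<le> Suc n" "ew w = e"
          using \<open>ht \<mu> = Suc n\<close> length_wt[of w] by (auto simp: ew_wt e_def)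
        from NR_smul[OF Cas_word[OF this(1,2)], of c] this(3) show ?case
          by (simp add: lin_smul[OF lin_Cas] fa.scale_right_diff_distrib mult.commute)
      qed
      have S1_Ser: "S1 \<nu> (qw \<nu> y) \<in> Ser" if "ht \<nu> \<noteq> 0" for \<nu>
        unfolding S1_def
      proof (intro Ser_sum Ser_wd_left)
        fix w assume "w \<in> {w. wt w = \<nu>}"
        then have hs: "homog \<nu> (star w)" using star_hom[of w] by simp
        have "M0.xE x (qw \<nu> y) \<in> Rad" for x
        proof (induction x rule: fa_induct)
          case (word c w)
          have "M0.xE (wd w) (qw \<nu> y) \<in> Rad"
            by (induction w) (simp_all add: M0.xE_wd Rad_Ev Rad_Dg[OF y(1)])
          then show ?case by (simp add: M0.xE_simps Rad_smul)
        qed (simp_all add: M0.xE_simps Rad_add)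
        moreover have "spn (\<lambda>w. length w + ht \<nu> \<le> Suc n) (M0.xE (star w) (qw \<nu> y))"
          by (rule xE_len[OF hs spn_Dg[OF spn_mono[OF leny]]]) simp
        then have "spn (\<lambda>w. length w \<le> n) (M0.xE (star w) (qw \<nu> y))"
          by (rule spn_mono) (use \<open>ht \<nu> \<noteq> 0\<close> in auto)
        ultimately show "M0.xE (star w) (qw \<nu> y) \<in> Ser" by (rule Suc.IH)
      qed
      have Cy: "Cas (Suc n) y - y \<in> Ser"
      proof -
        have "Cas (Suc n) y = cw (\<lambda>_. 0) \<cdot> S1 (\<lambda>_. 0) (qw (\<lambda>_. 0) y)
            + (\<Sum>\<nu>\<in>{\<nu>. ht \<nu> \<le> Suc n} - {\<lambda>_. 0}. cw \<nu> \<cdot> S1 \<nu> (qw \<nu> y))"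
          unfolding Cas_def by (rule sum.remove[OF finite_ht]) (simp add: ht_def)
        also have "cw (\<lambda>_. 0) \<cdot> S1 (\<lambda>_. 0) (qw (\<lambda>_. 0) y) = y"
          by (simp add: S1_zero cw_zero fw_def Dg_one)
        finally have "Cas (Suc n) y - y = (\<Sum>\<nu>\<in>{\<nu>. ht \<nu> \<le> Suc n} - {\<lambda>_. 0}. cw \<nu> \<cdot> S1 \<nu> (qw \<nu> y))" by simp
        moreover have "ht \<nu> \<noteq> 0" if "\<nu> \<noteq> (\<lambda>_. 0)" for \<nu> :: "'i \<Rightarrow> nat"
          using that by (auto simp: ht_def fun_eq_iff)
        ultimately show ?thesis using S1_Ser by (auto intro!: Ser_sum Ser_smul)
      qed
      have "Cas (Suc n) y - qpow e \<cdot> y \<in> Ser"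
      proof -
        let ?z = "Cas (Suc n) y - qpow e \<cdot> y"
        have lz: "spn (\<lambda>w. length w \<le> Suc n) ?z"
        proof (intro spn_diff spn_smul)
          show y': "spn (\<lambda>w. length w \<le> Suc n) y" by (rule spn_mono[OF leny]) simp
          show "spn (\<lambda>w. length w \<le> Suc n) (Cas (Suc n) y)"
            unfolding Cas_def S1_def
          proof (intro spn_sum spn_smul)
            fix \<nu> and w :: "'i list" assume "w \<in> {w. wt w = \<nu>}"
            then have w: "wt w = \<nu>" by simp
            then have "homog \<nu> (star w)" using star_hom[of w] by simp
            from xE_len[OF this spn_Dg[OF y']]
            have "spn (\<lambda>v. length v + ht \<nu> \<le> Suc n) (M0.xE (star w) (qw \<nu> y))" .
            then show "spn (\<lambda>w. length w \<le> Suc n) (wd w * M0.xE (star w) (qw \<nu> y))"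
              by (rule spn_mult[of "\<lambda>v. v = w" "wd w", rotated]) (use w length_wt[of w] in auto)
          qed
        qed
        have "rst j ?z * wd [j] \<in> Ser" for j
          by (intro Ser_wd_right Suc.IH rst_NR[OF NR] spn_rst[OF lz])
        then have "(\<Sum>j\<in>UNIV. rst j ?z * wd [j]) \<in> Ser" by (intro Ser_sum)
        then show ?thesis by (simp only: rst_expand[OF NR, symmetric])
      qed
      from Ser_diff[OF this Cy] have "(1 - qpow e) \<cdot> y \<in> Ser"
        by (simp add: fa.scale_left_diff_distrib)
      moreover have "1 - qpow e dvd 1" using unit_one_minus[of e 0] e_neg by simp
      ultimately show False using Ser_unit ny by blast
    qed
    have "spn (\<lambda>w. ht (wt w) \<le> Suc n) x" by (rule spn_mono[OF Suc.prems(2)]) (simp add: length_wt)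
    from rs_sum[OF this] show ?case
      using main[OF Rad_rs[OF Suc.prems(1)] spn_rs]
      by (metis (no_types, lifting) Ser_sum mem_Collect_eq)
  qed
  have "\<exists>n. spn (\<lambda>w. length w \<le> n) x"
  proof (induction x rule: fa_induct)
    case (add x y)
    then obtain a b where ab: "spn (\<lambda>w. length w \<le> a) x" "spn (\<lambda>w. length w \<le> b) y" by blast
    have "spn (\<lambda>w. length w \<le> max a b) (x + y)"
      by (intro spn_add spn_mono[OF ab(1)] spn_mono[OF ab(2)]) auto
    then show ?case by blast
  next
    case (word c w)
    have "spn (\<lambda>v. length v \<le> length w) (c \<cdot> wd w)" by (rule spn_smul) simp
    then show ?case by blast
  qed simp
  with len[OF assms] show ?thesis by blast
qed

end

section \<open>The components of the quasi \<open>K\<close>-matrix\<close>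

text \<open>The assumption \<open>isolated\<close> imposes the condition on fixed nodes also on
  those orthogonal to all other nodes. In weight i + i both recursions prescribe the multiple of
  E_i^2 in \<Upsilon>, and they agree only under this condition.\<close>

locale isat = datum D
  for D :: "('i::finite, 'x::ab_group_add, 'y::ab_group_add) isatake_datum" +
  assumes root_datum: "super_root_datum D"
    and involution: "diagram_involution D"
    and admissible: "admissible_parameters D"
    and isolated: "\<And>i. tau D i = i \<Longrightarrow> (\<forall>j. j \<noteq> i \<longrightarrow> cartan D i j = 0) \<Longrightarrow>
          qbar (varsigma D i * qi D i) = varsigma D i * qi D i"
begin

abbreviation "\<tau> \<equiv> tau D"
abbreviation "vs \<equiv> varsigma D"

lemma tau_tau [simp]: "\<tau> (\<tau> i) = i"
  and fm_tau: "fm (\<tau> i) (\<tau> j) = fm i j"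
  using involution by (auto simp: diagram_involution_def)

lemma fm_tau': "fm (\<tau> i) j = fm i (\<tau> j)"
  using fm_tau[of i "\<tau> j"] by simp

lemma dg_tau [simp]: "dg (\<tau> i) = dg i"
  by (simp add: dd_def fm_tau)

lemma pr_tau [simp]: "pr (\<tau> i) = pr i"
  using dg_par[of i] dg_par[of "\<tau> i"] by simp

lemma hh_tau [simp]: "hh (\<tau> i) = hh i"
  by (simp add: hh_eq)

lemma ca_zero: "ca i j = 0 \<longleftrightarrow> fm i j = 0"
  using dg_pos[of i] by (simp add: fm_ca)

text \<open>The values are forced by the identity for B_i. After \<open>xE_F\<close> the terms with
  J_i K_i on the right must balance those of \<Upsilon> \<psi>(B_i), which carry the conjugate
  parameter; the terms with K_i^-1 must balance E_(\<tau> i) K_i^-1 \<Upsilon>. The additional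
  factors of \<open>cl\<close> come from the sign twist and from moving K_i^-1 past E_(\<tau>
  i).\<close>

definition cr :: "'i \<Rightarrow> qpi" where "cr i = - (hh i * qbar (vs i))"
definition cl :: "'i \<Rightarrow> qpi" where "cl i = - (ppow (pr i) * hh i * vs i * qpow (fm i (\<tau> i)))"

text \<open>This is the purpose of the conditions on the parameters, one for each relative position
  of i and \<tau> i. In the orthogonal case the two sides differ by the factor \<pi>_i, which
  \<open>good\<close> makes trivial.\<close>

lemma cl_cr:
  assumes good: "\<tau> i \<noteq> i \<Longrightarrow> ca i (\<tau> i) = 0 \<Longrightarrow> pr i = 0"
  shows "cl i = cr (\<tau> i)"
proof -
  have "qbar (vs (\<tau> i)) = ppow (pr i) * vs i * qpow (fm i (\<tau> i))"
  proof (cases "\<tau> i = i")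
    case True
    have "qbar (vs i * qi D i) = vs i * qi D i"
      using True isolated[of i] admissible unfolding admissible_parameters_def by blast
    moreover have "qbar (qi D i) = ppow (pr i) * qpow (- int (dg i))"
    proof -
      have "ppow (dg i) = ppow (pr i)" using dg_par[of i] by (intro ppow_cong) presburger
      then show ?thesis by (simp add: qi_qpow qbar_qpow)
    qed
    ultimately have 1: "qbar (vs i) * (ppow (pr i) * qpow (- int (dg i))) = vs i * qpow (int (dg i))"
      by (simp add: qbar_hom qi_qpow)
    have "qbar (vs i) = qbar (vs i) * (ppow (pr i) * ppow (pr i)) * (qpow (int (dg i)) * qpow (- int (dg i)))"
      by (simp add: qpow_uminus)
    also have "\<dots> = (qbar (vs i) * (ppow (pr i) * qpow (- int (dg i)))) * (ppow (pr i) * qpow (int (dg i)))"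
      by (simp only: mult_ac)
    also have "\<dots> = ppow (pr i) * vs i * (qpow (int (dg i)) * qpow (int (dg i)))"
      unfolding 1 by (simp only: mult_ac)
    finally show ?thesis by (simp add: True fm_ii flip: qpow_add)
  next
    case ni: False
    show ?thesis
    proof (cases "ca i (\<tau> i) = 0")
      case True
      then have f: "fm i (\<tau> i) = 0" by (simp add: ca_zero)
      then have "ca (\<tau> i) (\<tau> (\<tau> i)) = 0" by (simp add: ca_zero fm_sym[of "\<tau> i"])
      then have "qbar (vs (\<tau> i)) = vs (\<tau> i)" "vs (\<tau> i) = vs (\<tau> (\<tau> i))"
        using admissible ni unfolding admissible_parameters_def by (metis tau_tau)+
      then show ?thesis using good[OF ni True] f by simp
    next
      case False
      then have "ca (\<tau> i) (\<tau> (\<tau> i)) \<noteq> 0" by (simp add: ca_zero fm_sym[of "\<tau> i"])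
      then have "vs (\<tau> (\<tau> i)) = ppii D (\<tau> i) * qi D (\<tau> i) powi (- ca (\<tau> i) (\<tau> (\<tau> i))) * qbar (vs (\<tau> i))"
        using admissible ni unfolding admissible_parameters_def by (metis tau_tau)
      moreover have "int (dg i) * ca (\<tau> i) i = fm i (\<tau> i)" using fm_ca[of "\<tau> i" i] fm_sym[of i "\<tau> i"] by simp
      ultimately have 1: "vs i = ppow (pr i) * qpow (- fm i (\<tau> i)) * qbar (vs (\<tau> i))"
        by (simp add: ppii_ppow qi_qpow qpow_powi)
      show ?thesis
        by (subst 1) (simp add: mult_ac qpow_uminus)
    qed
  qed
  then show ?thesis by (simp add: cl_def cr_def mult_ac)
qed

text \<open>The functional that the quasi \<open>K\<close>-matrix represents through the bilinear form.\<close>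

fun Phi :: "nat \<Rightarrow> ('i word \<Rightarrow>\<^sub>0 qpi) \<Rightarrow> qpi" where
  "Phi 0 y = lookup y 0"
| "Phi (Suc 0) y = 0"
| "Phi (Suc (Suc n)) y = (\<Sum>i\<in>UNIV. cl i * Phi n (ld (\<tau> i) (lst i y)))"

lemma lin_Phi: "lin (*) (Phi n)"
proof (induction n rule: Phi.induct[of "\<lambda>n _. lin (*) (Phi n)" _ undefined, simplified])
  case 1 then show ?case using lin_lookup[of 0] by (simp add: lin_def)
next
  case 2 then show ?case by (simp add: lin_def)
next
  case (3 n)
  then have "lin (*) (Phi n)" by simp
  then show ?case
    by (simp add: lin_def lin_add[OF lin_lst] lin_smul[OF lin_lst] sum.distrib distrib_left sum_distrib_left mult.left_commute)
qed

lemmas Phi_lin = lin_0[OF lin_Phi] lin_add[OF lin_Phi] lin_smul[OF lin_Phi] lin_diff[OF lin_Phi]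

lemma Phi_Cons: "Phi (Suc (Suc n)) (wd [i] * y) = cl i * Phi n (ld (\<tau> i) y)"
proof -
  have "Phi (Suc (Suc n)) (wd [i] * y) = (\<Sum>k\<in>UNIV. if k = i then cl i * Phi n (ld (\<tau> i) y) else 0)"
    unfolding Phi.simps by (intro sum.cong refl) (auto simp: lst_Cons Phi_lin)
  then show ?thesis by simp
qed

text \<open>Each step of \<open>Phi\<close> removes a letter i together with a letter \<tau> i, so a
  character with f_k f_(\<tau> k) = 1 is invisible to it.\<close>

lemma Phi_Dg:
  assumes f: "\<And>k. f k * f (\<tau> k) = 1"
  shows "Phi n (Dg f y) = Phi n y"
proof (induction n arbitrary: y rule: less_induct)
  case (less n)
  show ?case
  proof (rule lin_eqI[where f = "\<lambda>y. Phi n (Dg f y)", OF lin_comp[OF lin_Dg lin_Phi] lin_Phi])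
    fix w :: "'i list"
    consider "n = 0" | "n = Suc 0" | m where "n = Suc (Suc m)" by (metis not0_implies_Suc)
    then show "Phi n (Dg f (wd w)) = Phi n (wd w)"
    proof cases
      case 1 then show ?thesis by (simp del: Dg_wd)
    next
      case (3 m)
      show ?thesis
      proof (cases w)
        case (Cons i v)
        have "Phi n (Dg f (wd w)) = f i * (cl i * Phi m (ld (\<tau> i) (Dg f (wd v))))"
          by (simp add: Cons wd_Cons[of i v] Dg_mult Dg_wd[of f "[i]"] 3 Phi_lin Phi_Cons del: Dg_wd Phi.simps)
        also have "\<dots> = (f i * f (\<tau> i)) * (cl i * Phi m (Dg f (ld (\<tau> i) (wd v))))"
          by (simp add: ld_Dg Phi_lin mult_ac del: Dg_wd)
        also have "\<dots> = cl i * Phi m (ld (\<tau> i) (wd v))"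
          using less.IH[of m] 3 by (simp add: f)
        also have "\<dots> = Phi n (wd w)"
          by (simp add: Cons wd_Cons[of i v] 3 Phi_Cons del: Phi.simps)
        finally show ?thesis .
      qed (simp add: wd_Nil)
    qed simp
  qed
qed

text \<open>A character invisible to \<open>Phi\<close> multiplies a homogeneous element by its
  value on the weight. If 1 minus this value is a unit, \<open>Phi\<close> has to vanish
  there.\<close>

lemma Phi_weight:
  fixes f :: "'i \<Rightarrow> qpi"
  assumes "\<And>k. f k * f (\<tau> k) = 1" "homog \<mu> y" "1 - (\<Prod>i\<in>UNIV. f i ^ \<mu> i) dvd 1"
  shows "Phi n y = 0"
proof -
  have "Phi n y = (\<Prod>i\<in>UNIV. f i ^ \<mu> i) * Phi n y"
    using Phi_Dg[of f n y, OF assms(1)] unfolding Dg_hom[OF assms(2)] by (simp add: Phi_lin)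
  then have "(1 - (\<Prod>i\<in>UNIV. f i ^ \<mu> i)) * Phi n y = (1 - (\<Prod>i\<in>UNIV. f i ^ \<mu> i)) * 0"
    by (simp add: left_diff_distrib)
  then show ?thesis by (rule unit_cancel[OF assms(3)])
qed

end

locale isat_good = isat D
  for D :: "('i::finite, 'x::ab_group_add, 'y::ab_group_add) isatake_datum" +
  assumes good: "\<And>i. tau D i \<noteq> i \<Longrightarrow> cartan D i (tau D i) = 0 \<Longrightarrow> par D i = 0"
begin

lemma cl_cr': "cl i = cr (\<tau> i)"
  by (rule cl_cr) (rule good)

text \<open>(\<tau> i, k) - (i, k) changes sign when k is replaced by \<tau> k, so the two twists
  differ by a character invisible to \<open>Phi\<close>.\<close>

lemma Phi_chi: "Phi n (Dg (chi (\<tau> i)) y) = Phi n (Dg (chi i) y)"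
proof -
  let ?f = "\<lambda>k. qpow (fm (\<tau> i) k - fm i k)"
  have "?f k * ?f (\<tau> k) = 1" for k
    using fm_tau'[of i k] fm_tau[of i k] by (simp flip: qpow_add)
  from Phi_Dg[of ?f n "Dg (chi i) y", OF this]
  have "Phi n (Dg (\<lambda>k. ?f k * chi i k) y) = Phi n (Dg (chi i) y)" by (simp add: Dg_Dg)
  moreover have "?f k * chi i k = chi (\<tau> i) k" for k
    by (simp add: chi_def mult.left_commute flip: qpow_add)
  ultimately show ?thesis by simp
qed

text \<open>\<open>Phi\<close> is defined by unfolding from the left, and this is the recursion from
  the right. The first letter is stripped on both sides; as left and right derivations commute, the
  induction hypothesis applies to what is between the two ends.\<close>

lemma Phi_snoc: "Phi (Suc (Suc n)) (y * wd [j]) = cr j * Phi n (rd (\<tau> j) y)"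
proof (induction n arbitrary: y rule: less_induct)
  case (less n)
  show ?case
  proof (rule lin_eqI[where f = "\<lambda>y. Phi (Suc (Suc n)) (y * wd [j])" and g = "\<lambda>y. cr j * Phi n (rd (\<tau> j) y)"])
    show "lin (*) (\<lambda>y. Phi (Suc (Suc n)) (y * wd [j]))" by (rule lin_comp[OF lin_mult_right[OF lin_id] lin_Phi])
    show "lin (*) (\<lambda>y. cr j * Phi n (rd (\<tau> j) y))" by (rule lin_scaled[OF module_times lin_comp[OF lin_rd lin_Phi]])
    fix w :: "'i list"
    show "Phi (Suc (Suc n)) (wd w * wd [j]) = cr j * Phi n (rd (\<tau> j) (wd w))"
    proof (cases w)
      case Nil
      then show ?thesis using Phi_Cons[of n j 1] by (simp add: wd_Nil Phi_lin del: Phi.simps)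
    next
      case (Cons i v)
      have main: "cl i * Phi n (ld (\<tau> i) (wd v) * wd [j]) = cr j * Phi n (wd [i] * rd (\<tau> j) (wd v))"
      proof -
        consider "n = 0" | "n = Suc 0" | m where "n = Suc (Suc m)" by (metis not0_implies_Suc)
        then show ?thesis
        proof cases
          case 1
          have "formw [] (z * wd [j]) = 0" for z
          proof (rule lin_eqI[where f = "\<lambda>z. formw [] (z * wd [j])" and g = "\<lambda>_. 0"])
            show "formw [] (wd w * wd [j]) = 0" for w
              by (simp add: lookup_wd zero_word_def flip: wd_append)
          qed (auto simp: lin_def lookup_add lookup_smul distrib_right)
          then show ?thesis using 1 by simp
        next
          case (3 m)
          then show ?thesis
            using less.IH[of m "ld (\<tau> i) (wd v)"]
            by (simp add: Phi_Cons ld_rd mult.left_commute del: Phi.simps)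
        qed simp
      qed
      \<comment> \<open>The one contribution not covered by the induction hypothesis: the first and
        the last letter are removed together. Here the parameters must satisfy
        \<open>cl i = cr (\<tau> i)\<close>.\<close>
      have delta: "cl i * Phi n (if \<tau> i = j then Dg (chi (\<tau> i)) (wd v) else 0)
          = cr j * Phi n (if \<tau> j = i then Dg (chi (\<tau> j)) (wd v) else 0)"
      proof (cases "\<tau> i = j")
        case True
        then show ?thesis using cl_cr'[of i] Phi_chi[of n i "wd v"] by auto
      next
        case False
        then have "\<tau> j \<noteq> i" by auto
        with False show ?thesis by (simp add: Phi_lin)
      qed
      have l: "ld (\<tau> i) (wd v * wd [j]) = ld (\<tau> i) (wd v) * wd [j] + (if \<tau> i = j then Dg (chi (\<tau> i)) (wd v) else 0)"
        by (simp add: ld_mult)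
      have r: "rd (\<tau> j) (wd [i] * wd v) = wd [i] * rd (\<tau> j) (wd v) + (if \<tau> j = i then Dg (chi (\<tau> j)) (wd v) else 0)"
        by (rule rd_Cons)
      show ?thesis
        unfolding Cons wd_Cons[of i v] mult.assoc Phi_Cons l r Phi_lin distrib_left main delta ..
    qed
  qed
qed

lemma prod_serref_weight:
  fixes f :: "'i \<Rightarrow> qpi"
  assumes "i \<noteq> j"
  shows "(\<Prod>k\<in>UNIV. f k ^ ((if k = i then n else 0) + (if k = j then 1 else 0))) = f i ^ n * f j"
proof -
  have "(\<Prod>k\<in>UNIV. f k ^ ((if k = i then n else 0) + (if k = j then 1 else 0)))
     = (\<Prod>k\<in>UNIV. (if k = i then f k ^ n else 1) * (if k = j then f k else 1))"
    by (intro prod.cong refl) (auto simp: power_add)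
  then show ?thesis by (simp add: prod.distrib)
qed

lemma Phi_serref: assumes ij: "i \<noteq> j" shows "Phi n (serref i j) = 0"
proof -
  note h = homog_serref[of i j]
  show ?thesis
  proof (cases "\<tau> j = j")
    case True
    \<comment> \<open>\<theta>_j occurs once in every word of the Serre element, so the value of
      this character is -1, and 1 - (-1) = 2 is a unit.\<close>
    let ?f = "\<lambda>k. if k = j then - 1 else 1 :: qpi"
    have "\<tau> k = j \<longleftrightarrow> k = j" for k using True by (metis tau_tau)
    then show ?thesis
      by (intro Phi_weight[of ?f _ "serref i j", OF _ h]) (use ij unit_two in \<open>simp_all only: prod_serref_weight[OF ij], simp_all\<close>)
  next
    case tj: False
    \<comment> \<open>Its value on the Serre element is q if \<tau> j \<noteq> i, and q^(1-m) with m
      = \<open>sm i j\<close> if \<tau> j = i. It is trivial only for \<tau> j = i and m = 1, when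
      the Serre element is a commutator of two even letters and \<open>cl i = cl j\<close>.\<close>
    let ?f = "\<lambda>k. if k = j then qpow 1 else if k = \<tau> j then qpow (- 1) else 1"
    have eq: "\<tau> k = j \<longleftrightarrow> k = \<tau> j" "\<tau> k = \<tau> j \<longleftrightarrow> k = j" for k by (metis tau_tau)+
    have f: "?f k * ?f (\<tau> k) = 1" for k
      using qpow_uminus[of 1] tj by (auto simp: eq mult.commute)
    show ?thesis
    proof (cases "\<tau> j = i")
      case False
      then show ?thesis
        by (intro Phi_weight[of ?f _ "serref i j", OF f h])
           (use ij tj unit_one_minus[of 1 0] in \<open>simp only: prod_serref_weight[OF ij], auto\<close>)
    next
      case True
      show ?thesis
      proof (cases "sm i j = 1")
        case False
        have "?f i ^ sm i j * ?f j = qpow (1 - int (sm i j))"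
          using True ij by (auto simp: qpow_power simp flip: qpow_add)
        then have "1 - (\<Prod>k\<in>UNIV. ?f k ^ ((if k = i then sm i j else 0) + (if k = j then 1 else 0))) dvd 1"
          unfolding prod_serref_weight[OF ij] using unit_one_minus[of "1 - int (sm i j)" 0] False by simp
        then show ?thesis by (rule Phi_weight[of ?f _ "serref i j", OF f h])
      next
        case sm1: True
        then have ca: "ca i j = 0" using sm_ca[OF ij] by simp
        then have fm0: "fm i j = 0" by (simp add: ca_zero)
        have ti: "\<tau> i = j" using True by auto
        then have pi: "pr i = 0" using good[of i] ij ca by auto
        have "\<forall>i. \<tau> i \<noteq> i \<and> ca i (\<tau> i) = 0 \<longrightarrow> qbar (vs i) = vs i \<and> vs i = vs (\<tau> i)"
          using admissible unfolding admissible_parameters_def by (elim conjE)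
        then have "vs i = vs (\<tau> i)" using ij ca ti by metis
        moreover have "hh j = hh i" "pr j = pr i" using hh_tau[of i] pr_tau[of i] unfolding ti by simp_all
        ultimately have cl: "cl i = cl j" using True ti fm0 fm_sym[of i j] by (simp add: cl_def)
        have sc1: "sc i j 1 = - 1" using sc_1(2)[OF ij ca] by (simp add: pi)
        have s: "serref i j = wd [j] * wd [i] - wd [i] * wd [j]"
          by (simp add: serref_def sm1 sc_0 sc1[simplified] wd_Nil)
        consider "n = 0" | "n = Suc 0" | m where "n = Suc (Suc m)" by (metis not0_implies_Suc)
        then show ?thesis
        proof cases
          case 1 then show ?thesis using Rad_lookup_0[OF serref_Rad[OF ij]] by simp
        next
          case (3 m)
          have "Phi n (serref i j) = Phi n (wd [j] * wd [i]) - Phi n (wd [i] * wd [j])"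
            unfolding s by (rule lin_diff[OF lin_Phi])
          then show ?thesis unfolding 3 Phi_Cons by (simp add: True ti cl)
        qed simp
      qed
    qed
  qed
qed

text \<open>\<open>Phi\<close> unfolds from either end, and both derivations preserve the Serre
  ideal. The letters around a Serre element can thus be stripped until \<open>Phi_serref\<close>
  applies.\<close>

lemma Phi_Ser: "x \<in> Ser \<Longrightarrow> Phi n x = 0"
proof (induction n arbitrary: x rule: less_induct)
  case (less n)
  from less.prems have "Phi n x \<in> {0}"
  proof (induction rule: Ser.induct)
    case (Ser_step i j x c u v)
    have "Phi n (wd u * serref i j * wd v) = 0"
    proof -
      consider "n = 0" | "n = Suc 0" | m where "n = Suc (Suc m)" by (metis not0_implies_Suc)
      then show ?thesis
      proof cases
        case 1
        then show ?thesis
          using Rad_lookup_0[OF Ser_Rad[OF Ser_mid[OF Ser_step(1)]]] by simp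
      next
        case (3 m)
        show ?thesis
        proof (cases u)
          case (Cons k u')
          have "Phi m (ld (\<tau> k) (wd u' * serref i j * wd v)) = 0"
            by (rule less.IH) (simp_all add: 3 Ser_ld Ser_mid Ser_step)
          then show ?thesis
            by (simp add: Cons wd_Cons[of k u'] mult.assoc 3 Phi_Cons del: Phi.simps)
        next
          case Nil
          show ?thesis
          proof (cases v rule: rev_cases)
            case (snoc v' k)
            have "Phi m (rd (\<tau> k) (wd u * serref i j * wd v')) = 0"
              by (rule less.IH) (simp_all add: 3 Ser_rd Ser_mid Ser_step)
            then show ?thesis
              using Phi_snoc[of m "wd u * serref i j * wd v'" k] by (simp add: snoc wd_append mult.assoc 3 del: Phi.simps)
          qed (simp add: Nil wd_Nil Phi_serref[OF Ser_step(1)])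
        qed
      qed simp
    qed
    then show ?case using Ser_step by (simp add: Phi_lin)
  qed (simp add: Phi_lin)
  then show ?case by simp
qed

section \<open>The representing family and its two recursions\<close>

definition xm :: "('i \<Rightarrow> nat) \<Rightarrow> ('i word \<Rightarrow>\<^sub>0 qpi)" where
  "xm \<mu> = (\<Sum>w | wt w = \<mu>. Phi (ht \<mu>) (wd w) \<cdot> star w)"

lemma xm_homog: "homog \<mu> (xm \<mu>)"
  unfolding xm_def using star_hom by (intro spn_sum spn_smul) auto

text \<open>The family \<open>star\<close> is dual to the words only up to the radical. That
  discrepancy is harmless because the radical is the Serre ideal, on which \<open>Phi\<close>
  vanishes.\<close>

lemma formw_xm: assumes "wt v = \<mu>" shows "formw v (xm \<mu>) = Phi (ht \<mu>) (wd v)"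
proof -
  have "Phi (ht \<mu>) (wd v - (\<Sum>w | wt w = wt v. formw v (star w) \<cdot> wd w)) = 0"
    by (rule Phi_Ser[OF Rad_Ser[OF star_expand_left]])
  then show ?thesis using assms
    by (simp add: Phi_lin lin_sum[OF lin_Phi] xm_def lin_sum[OF lin_formw] mult.commute)
qed

lemma bform_xm: "homog \<mu> y \<Longrightarrow> bform y (xm \<mu>) = Phi (ht \<mu>) y"
  by (induction rule: spn_induct) (simp_all add: Phi_lin bform_wd formw_xm)

lemma xm_0: "xm (\<lambda>_. 0) = 1"
proof -
  have z: "w = []" if "wt w = (\<lambda>_. 0)" for w :: "'i list"
    using length_wt[of w] that by (simp add: ht_def)
  have "spn (\<lambda>w. w = []) (xm (\<lambda>_. 0))" by (rule spn_mono[OF xm_homog z])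
  then have "xm (\<lambda>_. 0) = lookup (xm (\<lambda>_. 0)) 0 \<cdot> 1"
    by (induction rule: spn_induct) (simp_all add: lookup_add lookup_smul algebra_simps wd_Nil)
  moreover have "lookup (xm (\<lambda>_. 0)) 0 = 1"
    using formw_xm[of "[]" "\<lambda>_. 0"] by (simp add: wd_Nil ht_def)
  ultimately show ?thesis by simp
qed

lemma xm_Dg: assumes "\<And>k. f k * f (\<tau> k) = 1" shows "Dg f (xm \<mu>) = xm \<mu>"
proof -
  have "wprod f w * Phi n (wd w) = Phi n (wd w)" for n w
    using Phi_Dg[of f n "wd w", OF assms] by (simp add: Phi_lin)
  moreover have "Dg f (star w) = wprod f w \<cdot> star w" for w
    using Dg_hom[OF star_hom, of f w] by (simp add: wprod_wt)
  ultimately show ?thesis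
    by (simp add: xm_def lin_sum[OF lin_Dg] mult.commute)
qed

text \<open>Since \<tau> preserves parity, the parity character is invisible to \<open>Phi\<close>.
  On an odd weight its value is -1, and 2 is a unit.\<close>

lemma xm_odd: assumes "odd (pw \<mu>)" shows "xm \<mu> = 0"
proof -
  let ?f = "\<lambda>k. (- 1) ^ pr k :: qpi"
  have f: "?f k * ?f (\<tau> k) = 1" for k by (simp flip: power_add)
  have "(\<Prod>k\<in>A. ?f k ^ \<mu> k) = (- 1) ^ (\<Sum>k\<in>A. \<mu> k * pr k)" if "finite A" for A
    using that by induction (auto simp: power_add mult.commute simp flip: power_mult)
  from this[of UNIV] have "(\<Prod>k\<in>UNIV. ?f k ^ \<mu> k) = - 1"
    using assms by (simp add: weight_par_def)
  then have "1 - (\<Prod>k\<in>UNIV. ?f k ^ \<mu> k) dvd 1" using unit_two by simp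
  from Phi_weight[OF f _ this] have "Phi (ht \<mu>) (wd w) = 0" if "wt w = \<mu>" for w
    using that by simp
  then show ?thesis by (simp add: xm_def)
qed

lemma Rad_homogI:
  assumes "homog \<mu> y" "\<And>v. wt v = \<mu> \<Longrightarrow> formw v y = 0" shows "y \<in> Rad"
proof -
  have "formw v y = 0" for v using assms(2)[of v] formw_hom[OF assms(1), of v] by blast
  then show ?thesis by (simp add: Rad_def)
qed

lemma bform_adj_right: "bform x (y * wd [k]) = bform (rd k x) y"
proof (induction y rule: fa_induct)
  case (word c u)
  have "bform x (wd u * wd [k]) = formw (u @ [k]) x" using bform_wd_right[of x "u @ [k]"] by (simp add: wd_append)
  then show ?case by (simp add: formw_snoc bform_wd_right)
qed (simp_all add: distrib_right)

lemma inc_cases: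
  obtains "\<mu> i = 0" | \<kappa> where "\<mu> = inc i \<kappa>"
proof (cases "\<mu> i")
  case (Suc n)
  then have "\<mu> = inc i (\<mu>(i := n))" by (auto simp: fun_eq_iff)
  then show ?thesis by (rule that(2))
qed (rule that(1))

lemma Phi_ld: assumes "wt v = \<kappa>" shows "Phi (ht (inc i \<kappa>)) (wd (i # v)) = (if \<kappa> = (\<lambda>_. 0) then 0 else cl i * Phi (ht \<kappa> - 1) (ld (\<tau> i) (wd v)))"
proof (cases "\<kappa> = (\<lambda>_. 0)")
  case True
  then show ?thesis by (simp add: ht_inc) (simp add: ht_def)
next
  case False
  have "ht \<kappa> \<noteq> 0" using False by (auto simp: ht_def fun_eq_iff)
  then obtain n where n: "ht \<kappa> = Suc n" by (cases "ht \<kappa>") auto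
  show ?thesis unfolding ht_inc n wd_Cons[of i v] Phi_Cons using False by simp
qed

lemma Phi_rd: assumes "wt v = \<kappa>" shows "Phi (ht (inc i \<kappa>)) (wd (v @ [i])) = (if \<kappa> = (\<lambda>_. 0) then 0 else cr i * Phi (ht \<kappa> - 1) (rd (\<tau> i) (wd v)))"
proof (cases "\<kappa> = (\<lambda>_. 0)")
  case True
  then show ?thesis by (simp add: ht_inc) (simp add: ht_def)
next
  case False
  have "ht \<kappa> \<noteq> 0" using False by (auto simp: ht_def fun_eq_iff)
  then obtain n where n: "ht \<kappa> = Suc n" by (cases "ht \<kappa>") auto
  show ?thesis unfolding ht_inc n wd_append Phi_snoc using False by simp
qed

lemma inc_nonzero: "inc i \<nu> \<noteq> (\<lambda>_. 0)"
  by (auto simp: fun_eq_iff)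

text \<open>Tested against words: adjointness turns \<open>ld i\<close> into prefixing i, where
  \<open>Phi\<close> unfolds by one step, and the result is the pairing with the right-hand term.
  Equal pairings mean equality modulo the radical, which \<open>Rad_Ser\<close> converts into the
  Serre ideal.\<close>

lemma ld_xm: "ld i (xm (inc i (inc (\<tau> i) \<nu>))) - cl i \<cdot> (wd [\<tau> i] * xm \<nu>) \<in> Ser"
proof (rule Rad_Ser, rule Rad_homogI)
  have "homog (inc (\<tau> i) \<nu>) (wd [\<tau> i] * xm \<nu>)"
    by (rule spn_mult[OF _ xm_homog[of \<nu>], of "\<lambda>w. w = [\<tau> i]"]) auto
  then show "homog (inc (\<tau> i) \<nu>) (ld i (xm (inc i (inc (\<tau> i) \<nu>))) - cl i \<cdot> (wd [\<tau> i] * xm \<nu>))"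
    by (intro spn_diff spn_smul homog_ld xm_homog)
  fix v assume v: "wt v = inc (\<tau> i) \<nu>"
  have "formw v (ld i (xm (inc i (inc (\<tau> i) \<nu>)))) = formw (i # v) (xm (inc i (inc (\<tau> i) \<nu>)))" by simp
  also have "\<dots> = Phi (ht (inc i (inc (\<tau> i) \<nu>))) (wd (i # v))" by (rule formw_xm) (simp add: v)
  also have "\<dots> = cl i * Phi (ht \<nu>) (ld (\<tau> i) (wd v))"
    unfolding Phi_ld[OF v] using inc_nonzero[of \<nu> "\<tau> i"] by (simp add: ht_inc)
  also have "Phi (ht \<nu>) (ld (\<tau> i) (wd v)) = bform (ld (\<tau> i) (wd v)) (xm \<nu>)"
    by (rule bform_xm[symmetric], rule homog_ld) (simp add: v)
  also have "\<dots> = formw v (wd [\<tau> i] * xm \<nu>)" by (simp only: bform_adj[symmetric] bform_wd)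
  finally show "formw v (ld i (xm (inc i (inc (\<tau> i) \<nu>))) - cl i \<cdot> (wd [\<tau> i] * xm \<nu>)) = 0" by simp
qed

lemma rd_xm: "rd i (xm (inc i (inc (\<tau> i) \<nu>))) - cr i \<cdot> (xm \<nu> * wd [\<tau> i]) \<in> Ser"
proof (rule Rad_Ser, rule Rad_homogI)
  have "homog (inc (\<tau> i) \<nu>) (xm \<nu> * wd [\<tau> i])"
    by (rule spn_mult[OF xm_homog[of \<nu>], of "\<lambda>w. w = [\<tau> i]"]) auto
  then show "homog (inc (\<tau> i) \<nu>) (rd i (xm (inc i (inc (\<tau> i) \<nu>))) - cr i \<cdot> (xm \<nu> * wd [\<tau> i]))"
    by (intro spn_diff spn_smul homog_rd xm_homog)
  fix v assume v: "wt v = inc (\<tau> i) \<nu>"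
  have "formw v (rd i (xm (inc i (inc (\<tau> i) \<nu>)))) = formw (v @ [i]) (xm (inc i (inc (\<tau> i) \<nu>)))"
    by (simp only: formw_snoc)
  also have "\<dots> = Phi (ht (inc i (inc (\<tau> i) \<nu>))) (wd (v @ [i]))" by (rule formw_xm) (simp add: v)
  also have "\<dots> = cr i * Phi (ht \<nu>) (rd (\<tau> i) (wd v))"
    unfolding Phi_rd[OF v] using inc_nonzero[of \<nu> "\<tau> i"] by (simp add: ht_inc)
  also have "Phi (ht \<nu>) (rd (\<tau> i) (wd v)) = bform (rd (\<tau> i) (wd v)) (xm \<nu>)"
    by (rule bform_xm[symmetric], rule homog_rd) (simp add: v)
  also have "\<dots> = formw v (xm \<nu> * wd [\<tau> i])" by (simp only: bform_adj_right[symmetric] bform_wd)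
  finally show "formw v (rd i (xm (inc i (inc (\<tau> i) \<nu>))) - cr i \<cdot> (xm \<nu> * wd [\<tau> i])) = 0" by simp
qed

text \<open>Either i does not occur in \<mu>, or after one i is removed no \<tau> i is left for
  \<open>Phi\<close> to pair it with.\<close>

lemma ld_xm_0: assumes "\<And>\<nu>. \<mu> \<noteq> inc i (inc (\<tau> i) \<nu>)" shows "ld i (xm \<mu>) \<in> Ser"
proof (cases rule: inc_cases[of \<mu> i])
  case 1 then show ?thesis using ld_zero[OF xm_homog] by (simp add: Ser_0)
next
  case (2 \<kappa>)
  have k: "\<kappa> (\<tau> i) = 0" by (cases rule: inc_cases[of \<kappa> "\<tau> i"]) (use assms 2 in auto)
  have "formw v (ld i (xm \<mu>)) = 0" if v: "wt v = \<kappa>" for v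
  proof -
    have "formw v (ld i (xm \<mu>)) = formw (i # v) (xm \<mu>)" by simp
    also have "\<dots> = Phi (ht (inc i \<kappa>)) (wd (i # v))" unfolding 2 by (rule formw_xm) (simp add: v)
    also have "ld (\<tau> i) (wd v) = 0" by (rule ld_zero[of \<kappa>]) (simp_all add: v k)
    then have "Phi (ht (inc i \<kappa>)) (wd (i # v)) = 0" unfolding Phi_ld[OF v] by (simp add: Phi_lin)
    finally show ?thesis .
  qed
  moreover have "homog \<kappa> (ld i (xm \<mu>))" unfolding 2 by (rule homog_ld[OF xm_homog])
  ultimately show ?thesis by (intro Rad_Ser Rad_homogI)
qed

lemma rd_xm_0: assumes "\<And>\<nu>. \<mu> \<noteq> inc i (inc (\<tau> i) \<nu>)" shows "rd i (xm \<mu>) \<in> Ser"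
proof (cases rule: inc_cases[of \<mu> i])
  case 1 then show ?thesis using rd_zero[OF xm_homog] by (simp add: Ser_0)
next
  case (2 \<kappa>)
  have k: "\<kappa> (\<tau> i) = 0" by (cases rule: inc_cases[of \<kappa> "\<tau> i"]) (use assms 2 in auto)
  have "formw v (rd i (xm \<mu>)) = 0" if v: "wt v = \<kappa>" for v
  proof -
    have "formw v (rd i (xm \<mu>)) = formw (v @ [i]) (xm \<mu>)" by (simp only: formw_snoc)
    also have "\<dots> = Phi (ht (inc i \<kappa>)) (wd (v @ [i]))" unfolding 2 by (rule formw_xm) (simp add: v)
    also have "rd (\<tau> i) (wd v) = 0" by (rule rd_zero[of \<kappa>]) (simp_all add: v k)
    then have "Phi (ht (inc i \<kappa>)) (wd (v @ [i])) = 0" unfolding Phi_rd[OF v] by (simp add: Phi_lin)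
    finally show ?thesis .
  qed
  moreover have "homog \<kappa> (rd i (xm \<mu>))" unfolding 2 by (rule homog_rd[OF xm_homog])
  ultimately show ?thesis by (intro Rad_Ser Rad_homogI)
qed

end

section \<open>The quantum covering group as a quotient of the free algebra\<close>

lemma ring_free_ring: "ring (free_ring :: ('i, 'y) free_alg ring)"
proof (rule ringI)
  show "abelian_group (free_ring :: ('i, 'y) free_alg ring)"
  proof (rule abelian_groupI)
    fix x :: "('i, 'y) free_alg"
    show "\<exists>y\<in>carrier free_ring. y \<oplus>\<^bsub>free_ring\<^esub> x = \<zero>\<^bsub>free_ring\<^esub>"
      by (rule bexI[of _ "- x"]) (simp_all add: free_ring_def)
  qed (simp_all add: free_ring_def add_ac)
  show "Group.monoid (free_ring :: ('i, 'y) free_alg ring)"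
    by (rule monoidI) (simp_all add: free_ring_def mult.assoc)
qed (simp_all add: free_ring_def distrib_left distrib_right)

locale rdatum = datum D
  for D :: "('i::finite, 'x::ab_group_add, 'y::ab_group_add, 'm) root_datum_scheme" +
  assumes root_datum': "super_root_datum D"
begin

abbreviation "II \<equiv> relator_ideal D"
abbreviation "UU \<equiv> U D"

lemma ideal_II: "ideal II (free_ring :: ('i, 'y) free_alg ring)"
proof -
  interpret ring "free_ring :: ('i, 'y) free_alg ring" by (rule ring_free_ring)
  show ?thesis unfolding relator_ideal_def by (rule genideal_ideal) (simp add: free_ring_def)
qed

lemma free_ring_minus: "\<ominus>\<^bsub>free_ring\<^esub> x = - (x :: ('i, 'y) free_alg)"
proof -
  interpret ring "free_ring :: ('i, 'y) free_alg ring" by (rule ring_free_ring)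
  have "- x \<oplus>\<^bsub>free_ring\<^esub> x = \<zero>\<^bsub>free_ring\<^esub>" "x \<in> carrier free_ring" "- x \<in> carrier free_ring"
    by (simp_all add: free_ring_def)
  then show ?thesis using minus_equality by blast
qed

lemma II_0: "0 \<in> II" and II_add: "a \<in> II \<Longrightarrow> b \<in> II \<Longrightarrow> a + b \<in> II"
  and II_left: "a \<in> II \<Longrightarrow> x * a \<in> II" and II_right: "a \<in> II \<Longrightarrow> a * x \<in> II"
  using additive_subgroup.zero_closed[OF ideal.axioms(1)[OF ideal_II]]
    additive_subgroup.a_closed[OF ideal.axioms(1)[OF ideal_II], of a b]
    ideal.I_l_closed[OF ideal_II, of a x] ideal.I_r_closed[OF ideal_II, of a x]
  by (simp_all add: free_ring_def)

lemma II_smul: "a \<in> II \<Longrightarrow> c \<cdot> a \<in> II"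
  unfolding smul_def by (rule II_left)

lemma II_minus: "a \<in> II \<Longrightarrow> - a \<in> II"
  using II_smul[of a "- 1"] by simp

lemma II_diff: "a \<in> II \<Longrightarrow> b \<in> II \<Longrightarrow> a - b \<in> II"
  using II_add[of a "- b"] II_minus[of b] by simp

lemma II_relator: "r \<in> relators D \<Longrightarrow> r \<in> II"
proof -
  interpret ring "free_ring :: ('i, 'y) free_alg ring" by (rule ring_free_ring)
  show "r \<in> relators D \<Longrightarrow> r \<in> II"
    unfolding relator_ideal_def using genideal_self[of "relators D"] by (auto simp: free_ring_def)
qed

lemma II_min:
  assumes "\<And>r. r \<in> relators D \<Longrightarrow> P r" "P 0" "\<And>a b. P a \<Longrightarrow> P b \<Longrightarrow> P (a + b)"
    "\<And>a x. P a \<Longrightarrow> P (x * a)" "\<And>a x. P a \<Longrightarrow> P (a * x)" "a \<in> II"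
  shows "P a"
proof -
  interpret ring "free_ring :: ('i, 'y) free_alg ring" by (rule ring_free_ring)
  have "subgroup {a. P a} (add_monoid (free_ring :: ('i, 'y) free_alg ring))"
  proof (rule group.subgroupI[OF a_group])
    show "inv\<^bsub>add_monoid free_ring\<^esub> a \<in> {a. P a}" if "a \<in> {a. P a}" for a
      using assms(4)[of a "- 1"] that free_ring_minus[of a] by (simp add: a_inv_def)
  qed (use assms in \<open>auto simp: free_ring_def\<close>)
  then have "ideal {a. P a} (free_ring :: ('i, 'y) free_alg ring)"
    by (rule idealI[OF ring_free_ring]) (use assms in \<open>auto simp: free_ring_def\<close>)
  then have "II \<subseteq> {a. P a}" unfolding relator_ideal_def by (rule genideal_minimal) (use assms in auto)
  then show ?thesis using assms(6) by blast
qed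

lemma cls_eq: "cls D a = cls D b \<longleftrightarrow> a - b \<in> II"
proof -
  interpret ring "free_ring :: ('i, 'y) free_alg ring" by (rule ring_free_ring)
  have "a \<ominus>\<^bsub>free_ring\<^esub> b = a - b"
    by (simp only: a_minus_def free_ring_minus) (simp add: free_ring_def)
  then show ?thesis
    using quotient_eq_iff_same_a_r_cos[OF ideal_II, of a b] by (auto simp: cls_def free_ring_def)
qed

lemma ring_UU: "ring UU"
  unfolding U_def by (rule ideal.quotient_is_ring[OF ideal_II])

lemma carrier_UU: "carrier UU = range (cls D)"
proof -
  have "carrier (free_ring :: ('i, 'y) free_alg ring) = UNIV" by (simp add: free_ring_def)
  then show ?thesis unfolding U_def FactRing_def cls_def A_RCOSETS_def' by auto
qed

lemma cls_carrier [simp]: "cls D a \<in> carrier UU"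
  by (simp add: carrier_UU)

lemma cls_mult: "cls D a \<otimes>\<^bsub>UU\<^esub> cls D b = cls D (a * b)"
  using ideal.rcoset_mult_add[OF ideal_II, of a b] by (simp add: U_def FactRing_def cls_def) (simp add: free_ring_def)

lemma cls_add: "cls D a \<oplus>\<^bsub>UU\<^esub> cls D b = cls D (a + b)"
  using ideal.a_rcos_sum[OF ideal_II, of a b] by (simp add: U_def FactRing_def cls_def) (simp add: free_ring_def)

lemma cls_one: "\<one>\<^bsub>UU\<^esub> = cls D 1"
  by (simp add: U_def FactRing_def cls_def) (simp add: free_ring_def)

lemma cls_zero: "\<zero>\<^bsub>UU\<^esub> = cls D 0"
proof -
  interpret ring "free_ring :: ('i, 'y) free_alg ring" by (rule ring_free_ring)
  have "II +>\<^bsub>free_ring\<^esub> \<zero>\<^bsub>free_ring\<^esub> = II"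
    by (rule a_coset_add_zero) (simp add: free_ring_def)
  then show ?thesis by (simp add: U_def FactRing_def cls_def) (simp add: free_ring_def)
qed

lemma cls_uminus: "\<ominus>\<^bsub>UU\<^esub> cls D a = cls D (- a)"
proof -
  interpret ring UU by (rule ring_UU)
  have "cls D (- a) \<oplus>\<^bsub>UU\<^esub> cls D a = \<zero>\<^bsub>UU\<^esub>" by (simp add: cls_add cls_zero)
  then show ?thesis using minus_equality by simp
qed

lemma cls_minus: "cls D a \<ominus>\<^bsub>UU\<^esub> cls D b = cls D (a - b)"
  by (simp add: a_minus_def cls_uminus cls_add)

lemma cls_smul: "smultU D c (cls D a) = cls D (c \<cdot> a)"
  by (simp add: smultU_def cls_mult scal_def smul_def)

lemma cls_sum: "finite A \<Longrightarrow> finsum UU (\<lambda>a. cls D (f a)) A = cls D (sum f A)"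
proof (induction A rule: finite_induct)
  case empty
  interpret ring UU by (rule ring_UU)
  show ?case by (simp add: cls_zero)
next
  case (insert x A)
  interpret ring UU by (rule ring_UU)
  show ?case using insert by (simp add: finsum_insert cls_add)
qed

lemma cls_cases:
  assumes "u \<in> carrier UU" obtains a where "u = cls D a"
  using assms that by (auto simp: carrier_UU)

subsection \<open>Root datum\<close>

abbreviation "prg \<equiv> pairing D"

lemma prg_add: "prg (x + y) z = prg x z + prg y z" and prg_0: "prg 0 z = 0" and prg_neg: "prg (- x) z = - prg x z"
proof -
  have "additive (\<lambda>y. prg y z)"
    using root_datum' by (simp add: super_root_datum_def perfect_pairing_def)
  from additive.add[OF this, of x y] additive.zero[OF this] additive.minus[OF this, of x]
  show "prg (x + y) z = prg x z + prg y z" "prg 0 z = 0" "prg (- x) z = - prg x z" by simp_all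
qed

lemma prg_zscale: "prg (zscale k x) z = k * prg x z"
proof -
  have *: "prg (\<Sum>_<n. x) z = int n * prg x z" for n :: nat
    by (induction n) (auto simp: prg_0 prg_add algebra_simps)
  have "prg (a - b) z = prg a z - prg b z" for a b
    using prg_add[of a "- b" z] by (simp add: prg_neg)
  then show ?thesis by (cases "k \<ge> 0") (auto simp: zscale_def * prg_neg)
qed

definition kap :: "'i \<Rightarrow> 'y" where "kap i = zscale (int (dg i)) (coroot D i)"

lemma prg_kap: "prg (kap i) (root D j) = fm i j"
proof -
  have "prg (coroot D i) (root D j) = ca i j"
    using root_datum' by (simp add: super_root_datum_def)
  then show ?thesis by (simp add: kap_def prg_zscale fm_ca)
qed

abbreviation "pg \<mu> j \<equiv> prg \<mu> (root D j)"

subsection \<open>Relations\<close>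

lemma gen_wd: "gen g = wd [g]"
  by (simp add: gen_def wd_def)

lemma scal_smul: "scal c * x = c \<cdot> x"
  by (simp add: scal_def smul_def)

lemma scal_one: "scal c = c \<cdot> 1"
  by (simp add: scal_def smul_def)

lemma rel_KE: "fK \<mu> * fE j - qpow (pg \<mu> j) \<cdot> (fE j * fK \<mu>) \<in> II"
  using II_relator[OF K_E[of \<mu> j D]] by (simp add: scal_smul qq_powi)

lemma rel_JE: "fJ \<mu> * fE j - ppow (nat \<bar>pg \<mu> j\<bar>) \<cdot> (fE j * fJ \<mu>) \<in> II"
  using II_relator[OF J_E[of \<mu> j D]] by (simp add: scal_smul ppi_powi)

lemma rel_KF: "fK \<mu> * fF j - qpow (- pg \<mu> j) \<cdot> (fF j * fK \<mu>) \<in> II"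
  using II_relator[OF K_F[of \<mu> j D]] by (simp add: scal_smul qq_powi)

lemma rel_JF: "fJ \<mu> * fF j - ppow (nat \<bar>pg \<mu> j\<bar>) \<cdot> (fF j * fJ \<mu>) \<in> II"
  using II_relator[OF J_F[of \<mu> j D]] by (simp add: scal_smul ppi_powi)

lemma rel_EF: "fE i * fF j - ppow (pr i * pr j) \<cdot> (fF j * fE i)
   - (if i = j then inverse (hh i) \<cdot> (fJ (kap i) * fK (kap i) - fK (- kap i)) else 0) \<in> II"
proof -
  have "(1 :: qpi) / (ppii D i * qi D i - inverse (qi D i)) = inverse (hh i)"
    by (simp add: divide_pi_ext_def hh_def)
  then show ?thesis using II_relator[OF E_F[of i j D]]
    by (cases "i = j") (simp_all add: scal_smul Let_def kap_def ppow_def mult.assoc)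
qed

lemma rel_KK: "fK \<mu> * fK \<nu> - fK (\<mu> + \<nu>) \<in> II"
  and rel_JJ: "fJ \<mu> * fJ \<nu> - fJ (\<mu> + \<nu>) \<in> II" and rel_J2: "fJ (\<mu> + \<mu>) - 1 \<in> II"
  by (rule II_relator, rule relators.intros)+

lemma ppow_fm: "ppow (nat \<bar>fm i j\<bar>) = 1"
  by (rule ppow_even) (simp add: even_nat_iff fm_even)

text \<open>U acting on itself from the left, on the level of representatives: the error subgroup is
  the ideal of relations. Applied to m = 1, the general commutation formulas become identities in
  U.\<close>

lemma umod_UU: "umod D smul (\<lambda>i m. fE i * m) (\<lambda>i m. fF i * m) (\<lambda>i m. fK (kap i) * m)
    (\<lambda>i m. fK (- kap i) * m) (\<lambda>i m. fJ (kap i) * m) II"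
proof (unfold_locales, goal_cases)
  case (14 i j m)
  from II_right[OF rel_KE[of "kap i" j], of m] show ?case
    by (simp add: left_diff_distrib mult.assoc prg_kap)
next
  case (15 i j m)
  from II_right[OF rel_KE[of "- kap i" j], of m] show ?case
    by (simp add: left_diff_distrib mult.assoc prg_kap prg_neg)
next
  case (16 i j m)
  from II_right[OF rel_JE[of "kap i" j], of m] show ?case
    by (simp add: left_diff_distrib mult.assoc prg_kap ppow_fm)
next
  case (17 i j m)
  from II_right[OF rel_EF[of i j], of m] show ?case
    by (cases "i = j") (simp_all add: left_diff_distrib mult.assoc)
qed (auto simp: lop_def distrib_left intro: II_0 II_add II_smul II_left)

sublocale UM: umod D smul "\<lambda>i m. fE i * m" "\<lambda>i m. fF i * m" "\<lambda>i m. fK (kap i) * m"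
    "\<lambda>i m. fK (- kap i) * m" "\<lambda>i m. fJ (kap i) * m" II
  by (rule umod_UU)

definition iE :: "('i word \<Rightarrow>\<^sub>0 qpi) \<Rightarrow> ('i, 'y) free_alg" where
  "iE = lext smul (\<lambda>w. wd (map gen_E w))"

lemma lin_iE: "lin smul iE"
  unfolding iE_def by (rule lin_lext[OF module_smul])

lemmas iE_simps = lin_0[OF lin_iE] lin_add[OF lin_iE] lin_smul[OF lin_iE] lin_diff[OF lin_iE]

lemma iE_wd: "iE (wd w) = wd (map gen_E w)"
  by (simp add: iE_def lext_wd[OF module_smul])

lemma iE_1: "iE 1 = 1"
  using iE_wd[of "[]"] by (simp add: wd_Nil)

lemma iE_gen: "iE (wd [i]) = fE i"
  by (simp add: iE_wd gen_wd)

lemma iE_mult: "iE (x * y) = iE x * iE y"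
proof (induction x rule: fa_induct)
  case (word c w)
  show ?case
  proof (induction y rule: fa_induct)
    case (word d v)
    have "iE (wd w * wd v) = iE (wd w) * iE (wd v)" by (simp add: iE_wd flip: wd_append)
    then show ?case by (simp add: iE_simps)
  qed (simp_all add: iE_simps distrib_left)
qed (simp_all add: iE_simps distrib_right)

lemma xE_iE: "UM.xE x m = iE x * m"
proof (induction x rule: fa_induct)
  case (word c w)
  have "UM.xE (wd w) m = iE (wd w) * m"
  proof (induction w)
    case (Cons j w)
    have "UM.xE (wd (j # w)) m = fE j * UM.xE (wd w) m" by (simp add: UM.xE_wd)
    moreover have "iE (wd (j # w)) = fE j * iE (wd w)"
      by (simp only: iE_wd list.map wd_Cons[of "gen_E j" "map gen_E w"] gen_wd)
    ultimately show ?case by (simp only: Cons mult.assoc)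
  qed (simp add: UM.xE_1 iE_1 wd_Nil)
  then show ?case by (simp add: UM.xE_simps iE_simps)
qed (simp_all add: UM.xE_simps iE_simps distrib_right)

lemma iE_power: "iE (th i n) = fE i ^ n"
proof (induction n)
  case (Suc n)
  then show ?case by (simp add: th_Suc iE_mult iE_gen del: replicate_Suc)
qed (simp add: wd_Nil iE_1)

lemma iE_serref: "iE (serref i j) = serre D fE i j"
  unfolding serref_def serre_def Let_def lin_sum[OF lin_iE] sm_def[symmetric]
  by (intro sum.cong refl) (simp add: iE_simps iE_mult iE_power iE_gen scal_smul sc_def mult.assoc)

lemma iE_Ser: "x \<in> Ser \<Longrightarrow> iE x \<in> II"
proof (induction rule: Ser.induct)
  case (Ser_step i j x c u v)
  have "iE (serref i j) \<in> II" unfolding iE_serref by (rule II_relator[OF serre_E[OF Ser_step(1)]])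
  then show ?case using Ser_step by (auto simp: iE_simps iE_mult intro!: II_add II_smul II_right[OF II_left])
qed (simp add: iE_simps II_0)

lemma K_iE: "fK \<mu> * iE x - iE (Dg (\<lambda>j. qpow (pg \<mu> j)) x) * fK \<mu> \<in> II"
proof -
  have "fK \<mu> * UM.xE x 1 - UM.xE (Dg (\<lambda>j. qpow (pg \<mu> j)) x) (fK \<mu> * 1) \<in> II"
  proof (rule UM.op_xE)
    show "fK \<mu> * (fE j * m) - qpow (pg \<mu> j) \<cdot> (fE j * (fK \<mu> * m)) \<in> II" for j m
      using II_right[OF rel_KE[of \<mu> j], of m] by (simp add: left_diff_distrib mult.assoc)
  qed (auto simp: lop_def distrib_left II_left)
  then show ?thesis by (simp add: xE_iE)
qed

lemma J_iE: "fJ \<mu> * iE x - iE (Dg (\<lambda>j. ppow (nat \<bar>pg \<mu> j\<bar>)) x) * fJ \<mu> \<in> II"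
proof -
  have "fJ \<mu> * UM.xE x 1 - UM.xE (Dg (\<lambda>j. ppow (nat \<bar>pg \<mu> j\<bar>)) x) (fJ \<mu> * 1) \<in> II"
  proof (rule UM.op_xE)
    show "fJ \<mu> * (fE j * m) - ppow (nat \<bar>pg \<mu> j\<bar>) \<cdot> (fE j * (fJ \<mu> * m)) \<in> II" for j m
      using II_right[OF rel_JE[of \<mu> j], of m] by (simp add: left_diff_distrib mult.assoc)
  qed (auto simp: lop_def distrib_left II_left)
  then show ?thesis by (simp add: xE_iE)
qed

lemma iE_K: "iE x * fK \<mu> - fK \<mu> * iE (Dg (\<lambda>j. qpow (- pg \<mu> j)) x) \<in> II"
proof -
  have "Dg (\<lambda>j. qpow (pg \<mu> j)) (Dg (\<lambda>j. qpow (- pg \<mu> j)) x) = x"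
    by (simp add: Dg_Dg qpow_uminus Dg_one)
  then show ?thesis using II_minus[OF K_iE[of \<mu> "Dg (\<lambda>j. qpow (- pg \<mu> j)) x"]] by simp
qed

lemma iE_J: "iE x * fJ \<mu> - fJ \<mu> * iE (Dg (\<lambda>j. ppow (nat \<bar>pg \<mu> j\<bar>)) x) \<in> II"
proof -
  have "Dg (\<lambda>j. ppow (nat \<bar>pg \<mu> j\<bar>)) (Dg (\<lambda>j. ppow (nat \<bar>pg \<mu> j\<bar>)) x) = x"
    by (simp add: Dg_Dg Dg_one)
  then show ?thesis using II_minus[OF J_iE[of \<mu> "Dg (\<lambda>j. ppow (nat \<bar>pg \<mu> j\<bar>)) x"]] by simp
qed

lemma iE_F: "iE x * fF i - (fF i * iE (Sgn i x)
     + inverse (hh i) \<cdot> (iE (rd i x) * (fJ (kap i) * fK (kap i)) - fK (- kap i) * iE (Sgn i (ld i x)))) \<in> II"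
  using UM.xE_F[of x i 1] by (simp add: xE_iE Sgn_def)

subsection \<open>The positive part\<close>

lemma E_monomial_cls: "E_monomial D w = cls D (iE (wd w))"
proof (induction w)
  case Nil then show ?case by (simp add: E_monomial_def cls_one iE_1 wd_Nil)
next
  case (Cons i w)
  have "E_monomial D (i # w) = UE D i \<otimes>\<^bsub>UU\<^esub> E_monomial D w" by (simp add: E_monomial_def)
  then show ?case by (simp add: Cons cls_mult iE_wd gen_wd flip: wd_append)
qed

lemma gen_span:
  assumes "u \<in> lin_span D S" "\<And>v. v \<in> S \<Longrightarrow> v \<in> carrier UU"
    "P 0" "\<And>a b. P a \<Longrightarrow> P b \<Longrightarrow> P (a + b)" "\<And>v. v \<in> S \<Longrightarrow> \<exists>a. v = cls D a \<and> (\<forall>c. P (c \<cdot> a))"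
  shows "\<exists>a. u = cls D a \<and> P a"
proof -
  interpret ring UU by (rule ring_UU)
  have s: "\<exists>a. v = cls D a \<and> P a \<and> P (- a)" if "v \<in> {smultU D c s | c s. s \<in> S}" for v
  proof -
    from that obtain c t where v: "v = smultU D c t" "t \<in> S" by blast
    then obtain a where a: "t = cls D a" "\<forall>c. P (c \<cdot> a)" using assms(5) by blast
    then have "v = cls D (c \<cdot> a)" "P (c \<cdot> a)" "P (- (c \<cdot> a))"
      using spec[OF a(2), of "- c"] v by (simp_all add: cls_smul)
    then show ?thesis by blast
  qed
  from assms(1)[unfolded lin_span_def] show ?thesis
  proof (induction rule: generate.induct)
    case one then show ?case using assms(3) cls_zero by auto
  next
    case (incl h) then show ?case using s by blast
  next
    case (inv h)
    then obtain a where "h = cls D a" "P (- a)" using s by blast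
    then show ?case using cls_uminus[of a] by (auto simp: a_inv_def)
  next
    case (eng h1 h2)
    then obtain a b where "h1 = cls D a" "P a" "h2 = cls D b" "P b" by blast
    then show ?case using cls_add[of a b] assms(4) by auto
  qed
qed

lemma lin_span_add: "cls D a \<in> lin_span D S \<Longrightarrow> cls D b \<in> lin_span D S \<Longrightarrow> cls D (a + b) \<in> lin_span D S"
  unfolding lin_span_def using generate.eng[of "cls D a" "add_monoid UU" _ "cls D b"] by (simp add: cls_add)

lemma lin_span_0: "cls D 0 \<in> lin_span D S"
  unfolding lin_span_def using generate.one[of "add_monoid UU"] by (simp add: cls_zero)

lemma lin_span_incl: "cls D a \<in> S \<Longrightarrow> cls D (c \<cdot> a) \<in> lin_span D S"
  unfolding lin_span_def by (rule generate.incl) (auto simp flip: cls_smul)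

lemma U_plus_iff: "u \<in> U_plus D \<mu> \<longleftrightarrow> (\<exists>x. homog \<mu> x \<and> u = cls D (iE x))"
proof
  let ?S = "{E_monomial D w | w. \<forall>i. count_list w i = \<mu> i}"
  assume "u \<in> U_plus D \<mu>"
  then have "\<exists>a. u = cls D a \<and> (\<exists>x. homog \<mu> x \<and> a = iE x)"
    unfolding U_plus_def
  proof (rule gen_span)
    show "v \<in> carrier UU" if "v \<in> ?S" for v using that by (auto simp: E_monomial_cls)
    show "\<exists>x. homog \<mu> x \<and> 0 = iE x" by (rule exI[of _ 0]) (simp add: iE_simps)
    show "\<exists>x. homog \<mu> x \<and> a + b = iE x" if "\<exists>x. homog \<mu> x \<and> a = iE x" "\<exists>x. homog \<mu> x \<and> b = iE x" for a b
      using that by (metis iE_simps(2) spn_add)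
    show "\<exists>a. v = cls D a \<and> (\<forall>c. \<exists>x. homog \<mu> x \<and> c \<cdot> a = iE x)" if v: "v \<in> ?S" for v
    proof -
      from v obtain w where w: "v = E_monomial D w" "wt w = \<mu>" by (auto simp: wt_def)
      have "\<exists>x. homog \<mu> x \<and> c \<cdot> iE (wd w) = iE x" for c
        by (rule exI[of _ "c \<cdot> wd w"]) (simp add: iE_simps spn_smul w)
      then show ?thesis using w by (auto simp: E_monomial_cls)
    qed
  qed
  then show "\<exists>x. homog \<mu> x \<and> u = cls D (iE x)" by blast
next
  assume "\<exists>x. homog \<mu> x \<and> u = cls D (iE x)"
  then obtain x where x: "homog \<mu> x" and u: "u = cls D (iE x)" by blast
  from x have "cls D (iE x) \<in> U_plus D \<mu>" unfolding U_plus_def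
  proof (induction rule: spn_induct)
    case (word c w)
    have "cls D (iE (wd w)) \<in> {E_monomial D w | w. \<forall>i. count_list w i = \<mu> i}"
      using word by (auto simp: wt_def E_monomial_cls)
    then show ?case unfolding iE_simps by (rule lin_span_incl)
  qed (simp_all add: iE_simps lin_span_0 lin_span_add)
  then show "u \<in> U_plus D \<mu>" using u by simp
qed

subsection \<open>The filtration\<close>

text \<open>\<open>FL N\<close> is the preimage of \<open>filtration D N\<close>. Allowing an arbitrary left factor makes it a
  left ideal by construction.\<close>

inductive_set FL :: "nat \<Rightarrow> ('i, 'y) free_alg set" for N where
  FL_II: "a \<in> II \<Longrightarrow> a \<in> FL N"
| FL_step: "N \<le> length w \<Longrightarrow> a \<in> FL N \<Longrightarrow> u * iE (wd w) + a \<in> FL N"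

lemma FL_0: "0 \<in> FL N"
  by (rule FL_II[OF II_0])

lemma FL_add: "a \<in> FL N \<Longrightarrow> b \<in> FL N \<Longrightarrow> a + b \<in> FL N"
proof (induction rule: FL.induct)
  case (FL_II a)
  from this(2,1) show ?case
  proof (induction rule: FL.induct)
    case (FL_II b) then show ?case by (simp add: II_add FL.FL_II)
  next
    case (FL_step w b u)
    from FL.FL_step[OF FL_step(1) FL_step.IH[OF FL_step.prems], of u] show ?case by (simp add: add_ac)
  qed
qed (auto intro: FL_step simp: add.assoc)

lemma FL_left: "a \<in> FL N \<Longrightarrow> x * a \<in> FL N"
  by (induction rule: FL.induct) (auto simp: distrib_left intro: FL_II II_left FL_step simp flip: mult.assoc)

lemma FL_smul: "a \<in> FL N \<Longrightarrow> c \<cdot> a \<in> FL N"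
  unfolding smul_def by (rule FL_left)

lemma FL_minus: "a \<in> FL N \<Longrightarrow> - a \<in> FL N"
  using FL_smul[of a _ "- 1"] by simp

lemma FL_diff: "a \<in> FL N \<Longrightarrow> b \<in> FL N \<Longrightarrow> a - b \<in> FL N"
  using FL_add[of a _ "- b"] FL_minus[of b] by simp

lemma FL_cong: "a - b \<in> II \<Longrightarrow> b \<in> FL N \<Longrightarrow> a \<in> FL N"
  by (metis FL_add FL_II diff_add_cancel)

lemma FL_mono: "a \<in> FL N \<Longrightarrow> M \<le> N \<Longrightarrow> a \<in> FL M"
  by (induction rule: FL.induct) (auto intro: FL_II FL_step)

lemma FL_wd: "N \<le> length w \<Longrightarrow> u * iE (wd w) \<in> FL N"
  using FL_step[OF _ FL_0, of _ w u] FL_0 by simp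

lemma FL_iE: "spn (\<lambda>w. N \<le> length w) x \<Longrightarrow> u * iE x \<in> FL N"
  by (induction rule: spn_induct) (auto simp: iE_simps distrib_left intro: FL_0 FL_add FL_smul FL_wd)

text \<open>Only g = F_i lowers the level: in \<open>iE_F\<close> the two derivations shorten the
  E-word by one letter. The torus just twists the E-word, and E_j lengthens it.\<close>

lemma FL_gen: assumes "a \<in> FL (Suc N)" shows "a * gen g \<in> FL N"
  using assms
proof (induction rule: FL.induct)
  case (FL_II a) then show ?case by (simp add: FL.FL_II II_right)
next
  case (FL_step w a u)
  have "iE (wd w) * gen g \<in> FL N"
  proof (cases g)
    case (gen_E j)
    have "iE (wd w) * fE j = 1 * iE (wd (w @ [j]))" by (simp add: wd_append iE_mult iE_gen)
    then show ?thesis using FL_wd[of N "w @ [j]" 1] FL_step(1) gen_E by simp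
  next
    case (gen_K \<mu>)
    have "fK \<mu> * iE (Dg (\<lambda>j. qpow (- pg \<mu> j)) (wd w)) \<in> FL N"
      by (rule FL_iE[OF spn_Dg]) (use FL_step(1) in simp)
    then show ?thesis unfolding gen_K by (rule FL_cong[OF iE_K])
  next
    case (gen_J \<mu>)
    have "fJ \<mu> * iE (Dg (\<lambda>j. ppow (nat \<bar>pg \<mu> j\<bar>)) (wd w)) \<in> FL N"
      by (rule FL_iE[OF spn_Dg]) (use FL_step(1) in simp)
    then show ?thesis unfolding gen_J by (rule FL_cong[OF iE_J])
  next
    case (gen_F i)
    have w: "spn (\<lambda>w. Suc N \<le> length w) (wd w)" using FL_step(1) by simp
    have r: "spn (\<lambda>w. N \<le> length w) (rd i (wd w))" "spn (\<lambda>w. N \<le> length w) (ld i (wd w))"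
      by (rule spn_rd[OF _ w], simp, rule spn_ld[OF _ w], simp)
    have "iE (rd i (wd w)) * fJ (kap i) * fK (kap i) \<in> FL N"
    proof -
      let ?y = "Dg (\<lambda>j. ppow (nat \<bar>pg (kap i) j\<bar>)) (rd i (wd w))"
      let ?z = "Dg (\<lambda>j. qpow (- pg (kap i) j)) ?y"
      have 1: "iE (rd i (wd w)) * fJ (kap i) * fK (kap i) - fJ (kap i) * (iE ?y * fK (kap i)) \<in> II"
        using II_right[OF iE_J[of "rd i (wd w)" "kap i"], of "fK (kap i)"] by (simp only: left_diff_distrib mult.assoc)
      have 2: "fJ (kap i) * (iE ?y * fK (kap i)) - fJ (kap i) * (fK (kap i) * iE ?z) \<in> II"
        using II_left[OF iE_K[of ?y "kap i"], of "fJ (kap i)"] by (simp only: right_diff_distrib)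
      have "fJ (kap i) * fK (kap i) * iE ?z \<in> FL N" by (rule FL_iE) (intro spn_Dg r)
      then have "fJ (kap i) * (fK (kap i) * iE ?z) \<in> FL N" by (simp only: mult.assoc)
      from FL_cong[OF 1 FL_cong[OF 2 this]] show ?thesis .
    qed
    moreover have "fK (- kap i) * iE (Sgn i (ld i (wd w))) \<in> FL N"
      unfolding Sgn_def by (rule FL_iE) (intro spn_Dg r)
    moreover have "fF i * iE (Sgn i (wd w)) \<in> FL N"
      unfolding Sgn_def by (rule FL_iE[OF spn_Dg]) (use FL_step(1) in simp)
    ultimately have "fF i * iE (Sgn i (wd w))
     + inverse (hh i) \<cdot> (iE (rd i (wd w)) * (fJ (kap i) * fK (kap i)) - fK (- kap i) * iE (Sgn i (ld i (wd w)))) \<in> FL N"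
      by (intro FL_add FL_smul FL_diff) (simp_all only: mult.assoc)
    then show ?thesis unfolding gen_F by (rule FL_cong[OF iE_F])
  qed
  from FL_add[OF FL_left[OF this, of u] FL_step.IH] show ?case by (simp add: distrib_right mult.assoc)
qed

text \<open>Continuity of right multiplication. By \<open>FL_gen\<close> a word costs at most its
  length in levels; for a sum the larger loss counts.\<close>

lemma FL_right: "\<exists>M. \<forall>a\<in>FL M. a * x \<in> FL N"
proof (induction x rule: fa_induct)
  case zero show ?case using FL_0 by auto
next
  case (add x y)
  then obtain M1 M2 where M: "\<forall>a\<in>FL M1. a * x \<in> FL N" "\<forall>a\<in>FL M2. a * y \<in> FL N" by blast
  have "a * (x + y) \<in> FL N" if "a \<in> FL (max M1 M2)" for a
    using M FL_mono[OF that, of M1] FL_mono[OF that, of M2] by (simp add: distrib_left FL_add)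
  then show ?case by blast
next
  case (word c w)
  have "a * wd w \<in> FL N" if "a \<in> FL (N + length w)" for a
    using that
  proof (induction w arbitrary: a)
    case Nil then show ?case by (simp add: wd_Nil)
  next
    case (Cons g w)
    from Cons.IH[OF FL_gen[of a "N + length w" g]] Cons.prems
    show ?case by (simp add: gen_wd wd_Cons[of g w] mult.assoc)
  qed
  then have "\<forall>a\<in>FL (N + length w). a * (c \<cdot> wd w) \<in> FL N" by (simp add: FL_smul)
  then show ?case by blast
qed

subsection \<open>Triangular decomposition\<close>

definition KJ :: "('i, 'y) generator set" where "KJ = range gen_K \<union> range gen_J"

text \<open>\<open>filtration\<close> is defined through products from U^-, U^0 and U^+, while
  \<open>FL\<close> allows any left factor. The two agree because everything can be straightened
  into this order without shortening the E-word at the right end; this is the spanning half of the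
  triangular decomposition.\<close>

inductive_set Tri :: "nat \<Rightarrow> ('i, 'y) free_alg set" for N where
  Tri_II: "a \<in> II \<Longrightarrow> a \<in> Tri N"
| Tri_step: "N \<le> length w \<Longrightarrow> set z \<subseteq> KJ \<Longrightarrow> a \<in> Tri N \<Longrightarrow>
     c \<cdot> (wd (map gen_F f) * (wd z * iE (wd w))) + a \<in> Tri N"

lemma Tri_0: "0 \<in> Tri N"
  by (rule Tri_II[OF II_0])

lemma Tri_gen: "N \<le> length w \<Longrightarrow> set z \<subseteq> KJ \<Longrightarrow> c \<cdot> (wd (map gen_F f) * (wd z * iE (wd w))) \<in> Tri N"
  using Tri_step[OF _ _ Tri_0, of N w z c f] by simp

lemma Tri_add: "a \<in> Tri N \<Longrightarrow> b \<in> Tri N \<Longrightarrow> a + b \<in> Tri N"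
proof (induction rule: Tri.induct)
  case (Tri_II a)
  from this(2,1) show ?case
  proof (induction rule: Tri.induct)
    case (Tri_II b) then show ?case by (simp add: II_add Tri.Tri_II)
  next
    case (Tri_step w z b c f)
    from Tri.Tri_step[OF Tri_step(1,2) Tri_step.IH[OF Tri_step.prems], of c f] show ?case by (simp only: add_ac)
  qed
next
  case (Tri_step w z a c f)
  from Tri.Tri_step[OF Tri_step(1,2) Tri_step.IH[OF Tri_step.prems], of c f] show ?case by (simp only: add.assoc)
qed

lemma Tri_cong: "a - b \<in> II \<Longrightarrow> b \<in> Tri N \<Longrightarrow> a \<in> Tri N"
  by (metis Tri_add Tri_II diff_add_cancel)

lemma Tri_lin:
  assumes "lin smul g" "\<And>a. a \<in> II \<Longrightarrow> g a \<in> Tri M"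
    "\<And>w z f c. N \<le> length w \<Longrightarrow> set z \<subseteq> KJ \<Longrightarrow> c \<cdot> g (wd (map gen_F f) * (wd z * iE (wd w))) \<in> Tri M"
    "a \<in> Tri N"
  shows "g a \<in> Tri M"
  using assms(4)
proof induction
  case (Tri_step w z a c f)
  have "g (c \<cdot> (wd (map gen_F f) * (wd z * iE (wd w))) + a) = c \<cdot> g (wd (map gen_F f) * (wd z * iE (wd w))) + g a"
    by (simp only: lin_add[OF assms(1)] lin_smul[OF assms(1)])
  then show ?case using Tri_add[OF assms(3)[OF Tri_step(1,2)] Tri_step.IH] by simp
qed (rule assms(2))

lemma Tri_smul: "a \<in> Tri N \<Longrightarrow> c \<cdot> a \<in> Tri N"
  by (rule Tri_lin[where g = "\<lambda>a. c \<cdot> a"]) (auto simp: lin_def algebra_simps intro: Tri_II II_smul Tri_gen)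

lemma Tri_F: "a \<in> Tri N \<Longrightarrow> fF i * a \<in> Tri N"
proof (rule Tri_lin[OF lin_mult_left[OF lin_id]])
  fix w :: "'i list" and z :: "('i, 'y) generator list" and f :: "'i list" and c assume "N \<le> length w" "set z \<subseteq> KJ"
  from Tri_gen[OF this, of c "i # f"]
  show "c \<cdot> (fF i * (wd (map gen_F f) * (wd z * iE (wd w)))) \<in> Tri N"
    by (simp add: gen_wd wd_Cons[of "gen_F i" "map gen_F f"] mult.assoc)
qed (auto intro: Tri_II II_left)

lemma KJ_F: assumes "g \<in> KJ" shows "\<exists>c. gen g * wd (map gen_F f) - c \<cdot> (wd (map gen_F f) * gen g) \<in> II"
proof (induction f)
  case Nil
  show ?case by (rule exI[of _ 1]) (simp add: wd_Nil II_0)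
next
  case (Cons j f)
  then obtain c where c: "gen g * wd (map gen_F f) - c \<cdot> (wd (map gen_F f) * gen g) \<in> II" by blast
  obtain d where d: "gen g * fF j - d \<cdot> (fF j * gen g) \<in> II"
    using assms rel_KF rel_JF by (fastforce simp: KJ_def)
  have w: "wd (map gen_F (j # f)) = fF j * wd (map gen_F f)"
    by (simp add: gen_wd flip: wd_append)
  have "gen g * wd (map gen_F (j # f)) - (d * c) \<cdot> (wd (map gen_F (j # f)) * gen g)
     = (gen g * fF j - d \<cdot> (fF j * gen g)) * wd (map gen_F f) + d \<cdot> (fF j * (gen g * wd (map gen_F f) - c \<cdot> (wd (map gen_F f) * gen g)))"
    unfolding w by (simp add: left_diff_distrib right_diff_distrib fa.scale_right_diff_distrib mult.assoc)
  then show ?case using II_add[OF II_right[OF d] II_smul[OF II_left[OF c]]] by metis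
qed

lemma Tri_KJ: assumes "g \<in> KJ" "a \<in> Tri N" shows "gen g * a \<in> Tri N"
proof (rule Tri_lin[OF lin_mult_left[OF lin_id] _ _ assms(2)])
  fix w :: "'i list" and z :: "('i, 'y) generator list" and f :: "'i list" and c assume w: "N \<le> length w" "set z \<subseteq> KJ"
  obtain d where d: "gen g * wd (map gen_F f) - d \<cdot> (wd (map gen_F f) * gen g) \<in> II"
    using KJ_F[OF assms(1)] by blast
  have "gen g * (wd (map gen_F f) * (wd z * iE (wd w))) - d \<cdot> (wd (map gen_F f) * (wd (g # z) * iE (wd w))) \<in> II"
    using II_right[OF d, of "wd z * iE (wd w)"]
    by (simp add: left_diff_distrib mult.assoc gen_wd wd_Cons[of g z])
  moreover have "d \<cdot> (wd (map gen_F f) * (wd (g # z) * iE (wd w))) \<in> Tri N"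
    using w assms(1) by (intro Tri_gen) auto
  ultimately show "c \<cdot> (gen g * (wd (map gen_F f) * (wd z * iE (wd w)))) \<in> Tri N"
    by (rule Tri_smul[OF Tri_cong])
qed (auto intro: Tri_II II_left)

lemma KJ_E: assumes "set z \<subseteq> KJ" shows "\<exists>c. fE i * wd z - c \<cdot> (wd z * fE i) \<in> II"
  using assms
proof (induction z)
  case Nil
  show ?case by (rule exI[of _ 1]) (simp add: wd_Nil II_0)
next
  case (Cons g z)
  then obtain c where c: "fE i * wd z - c \<cdot> (wd z * fE i) \<in> II" by auto
  obtain d where d: "fE i * gen g - d \<cdot> (gen g * fE i) \<in> II"
  proof -
    from Cons.prems consider \<mu> where "g = gen_K \<mu>" | \<mu> where "g = gen_J \<mu>" by (auto simp: KJ_def)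
    then show ?thesis
    proof cases
      case (1 \<mu>)
      then show ?thesis using iE_K[of "wd [i]" \<mu>] by (intro that) (simp add: iE_simps iE_gen)
    next
      case (2 \<mu>)
      then show ?thesis using iE_J[of "wd [i]" \<mu>] by (intro that) (simp add: iE_simps iE_gen)
    qed
  qed
  have w: "wd (g # z) = gen g * wd z" by (simp add: gen_wd wd_Cons[of g z])
  have "fE i * wd (g # z) - (d * c) \<cdot> (wd (g # z) * fE i)
     = (fE i * gen g - d \<cdot> (gen g * fE i)) * wd z + d \<cdot> (gen g * (fE i * wd z - c \<cdot> (wd z * fE i)))"
    unfolding w by (simp add: left_diff_distrib right_diff_distrib fa.scale_right_diff_distrib mult.assoc)
  then show ?case using II_add[OF II_right[OF d] II_smul[OF II_left[OF c]]] by metis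
qed

text \<open>Induction on the F-word: exchanging E_i with the first F_j leaves torus elements, which
  \<open>Tri_KJ\<close> absorbs. The level is kept because letters E are only added to the
  E-word.\<close>

lemma Tri_E: "a \<in> Tri N \<Longrightarrow> fE i * a \<in> Tri N"
proof (rule Tri_lin[OF lin_mult_left[OF lin_id]])
  fix w :: "'i list" and z :: "('i, 'y) generator list" and f :: "'i list" and c assume w: "N \<le> length w" "set z \<subseteq> KJ"
  have "fE i * (wd (map gen_F f) * (wd z * iE (wd w))) \<in> Tri N"
  proof (induction f)
    case Nil
    obtain d where "fE i * wd z - d \<cdot> (wd z * fE i) \<in> II" using KJ_E[OF w(2)] by blast
    from II_right[OF this, of "iE (wd w)"]
    have "fE i * (wd z * iE (wd w)) - d \<cdot> (wd z * iE (wd (i # w))) \<in> II"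
      by (simp add: left_diff_distrib mult.assoc wd_Cons[of i w] iE_mult iE_gen)
    moreover have "d \<cdot> (wd z * iE (wd (i # w))) \<in> Tri N"
      using Tri_gen[of N "i # w" z d "[]"] w by (simp add: wd_Nil)
    ultimately show ?case by (simp add: wd_Nil Tri_cong)
  next
    case (Cons j f)
    let ?X = "wd (map gen_F f) * (wd z * iE (wd w))"
    have X: "?X \<in> Tri N" using Tri_gen[OF w, of 1 f] by simp
    let ?y = "ppow (pr i * pr j) \<cdot> (fF j * (fE i * ?X)) + (if i = j then inverse (hh i) \<cdot> (fJ (kap i) * (fK (kap i) * ?X) - fK (- kap i) * ?X) else 0)"
    have "fE i * (fF j * ?X) - ?y \<in> II"
      using II_right[OF rel_EF[of i j], of ?X]
      by (cases "i = j") (simp_all add: left_diff_distrib right_diff_distrib mult.assoc algebra_simps)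
    moreover have "?y \<in> Tri N"
    proof -
      have k: "gen_K \<mu> \<in> KJ" "gen_J \<mu> \<in> KJ" for \<mu> by (auto simp: KJ_def)
      have "fJ (kap i) * (fK (kap i) * ?X) + (- 1) \<cdot> (fK (- kap i) * ?X) \<in> Tri N"
        by (intro Tri_add Tri_smul Tri_KJ k X)
      then have "inverse (hh i) \<cdot> (fJ (kap i) * (fK (kap i) * ?X) - fK (- kap i) * ?X) \<in> Tri N"
        using Tri_smul by fastforce
      then show ?thesis using Cons by (auto intro!: Tri_add Tri_smul Tri_F Tri_0)
    qed
    ultimately have "fE i * (fF j * ?X) \<in> Tri N" by (rule Tri_cong)
    then show ?case by (simp add: gen_wd wd_Cons[of "gen_F j" "map gen_F f"] mult.assoc)
  qed
  then show "c \<cdot> (fE i * (wd (map gen_F f) * (wd z * iE (wd w)))) \<in> Tri N" by (rule Tri_smul)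
qed (auto intro: Tri_II II_left)

lemma Tri_left: "a \<in> Tri N \<Longrightarrow> u * a \<in> Tri N"
proof (induction u rule: fa_induct)
  case zero show ?case by (simp add: Tri_0)
next
  case (add x y) then show ?case by (simp add: distrib_right Tri_add)
next
  case (word c w)
  have "wd w * a \<in> Tri N"
  proof (induction w)
    case Nil then show ?case using word by (simp add: wd_Nil)
  next
    case (Cons g w)
    have "gen g * (wd w * a) \<in> Tri N"
      using Cons by (cases g) (auto intro: Tri_E Tri_F Tri_KJ simp: KJ_def)
    then show ?case by (simp add: gen_wd wd_Cons[of g w] mult.assoc)
  qed
  then show ?case by (simp add: Tri_smul)
qed

lemma FL_Tri: "a \<in> FL N \<Longrightarrow> a \<in> Tri N"
proof (induction rule: FL.induct)
  case (FL_step w a u)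
  have "iE (wd w) \<in> Tri N" using Tri_gen[of N w "[]" 1 "[]"] FL_step by (simp add: wd_Nil)
  then show ?case using FL_step by (intro Tri_add Tri_left)
qed (rule Tri_II)

lemma generate_ring_carrier: "u \<in> subalgebra_gen D S \<Longrightarrow> S \<subseteq> carrier UU \<Longrightarrow> u \<in> carrier UU"
proof -
  interpret ring UU by (rule ring_UU)
  show "u \<in> subalgebra_gen D S \<Longrightarrow> S \<subseteq> carrier UU \<Longrightarrow> u \<in> carrier UU"
    unfolding subalgebra_gen_def by (rule generate_ring_in_carrier) auto
qed

lemma cls_word_subalgebra: "(\<And>g. g \<in> set w \<Longrightarrow> cls D (gen g) \<in> S) \<Longrightarrow> cls D (wd w) \<in> subalgebra_gen D S"
proof (induction w)
  case Nil
  show ?case unfolding subalgebra_gen_def wd_Nil cls_one[symmetric] by (rule generate_ring.one)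
next
  case (Cons g w)
  then have "cls D (gen g) \<otimes>\<^bsub>UU\<^esub> cls D (wd w) \<in> subalgebra_gen D S"
    unfolding subalgebra_gen_def
    by (intro generate_ring.eng_mult) (auto simp: subalgebra_gen_def intro: generate_ring.incl)
  then show ?case by (simp add: cls_mult gen_wd wd_Cons[of g w])
qed

lemma filtration_iff: "cls D a \<in> filtration D N \<longleftrightarrow> a \<in> FL N"
proof
  interpret ring UU by (rule ring_UU)
  let ?S = "{y \<otimes>\<^bsub>UU\<^esub> z \<otimes>\<^bsub>UU\<^esub> x | y z x. y \<in> U_minus D \<and> z \<in> U_zero D \<and> (\<exists>\<mu>. ht \<mu> \<ge> N \<and> x \<in> U_plus D \<mu>)}"
  have S: "\<exists>b. v = cls D b \<and> (\<forall>c. c \<cdot> b \<in> FL N)" if "v \<in> ?S" for v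
  proof -
    from that obtain y z x \<mu> where v: "v = y \<otimes>\<^bsub>UU\<^esub> z \<otimes>\<^bsub>UU\<^esub> x" "y \<in> U_minus D" "z \<in> U_zero D" "ht \<mu> \<ge> N" "x \<in> U_plus D \<mu>"
      by blast
    have "y \<in> carrier UU" using v(2) unfolding U_minus_def by (rule generate_ring_carrier) auto
    then obtain y' where y: "y = cls D y'" by (rule cls_cases)
    have "z \<in> carrier UU" using v(3) unfolding U_zero_def by (rule generate_ring_carrier) auto
    then obtain z' where z: "z = cls D z'" by (rule cls_cases)
    obtain x' where x: "homog \<mu> x'" "x = cls D (iE x')" using v(5) by (auto simp: U_plus_iff)
    have "spn (\<lambda>w. N \<le> length w) x'" by (rule spn_mono[OF x(1)]) (use v(4) in \<open>simp add: length_wt\<close>)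
    then have "(y' * z') * iE x' \<in> FL N" by (rule FL_iE)
    then show ?thesis using v(1) y z x by (auto simp: cls_mult intro: FL_smul)
  qed
  {
    assume "cls D a \<in> filtration D N"
    then have "\<exists>b. cls D a = cls D b \<and> b \<in> FL N"
      unfolding filtration_def
    proof (rule gen_span)
      show "v \<in> carrier UU" if "v \<in> ?S" for v using S[OF that] by auto
    qed (auto simp: FL_0 FL_add S)
    then show "a \<in> FL N" by (auto simp: cls_eq intro: FL_cong)
  }
  assume "a \<in> FL N"
  then have "a \<in> Tri N" by (rule FL_Tri)
  then show "cls D a \<in> filtration D N"
    unfolding filtration_def
  proof (induction rule: Tri.induct)
    case (Tri_II a)
    then have "cls D a = cls D 0" by (simp add: cls_eq)
    then show ?case by (simp add: lin_span_0)
  next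
    case (Tri_step w z a c f)
    have "cls D (wd (map gen_F f)) \<in> U_minus D"
      unfolding U_minus_def by (rule cls_word_subalgebra) auto
    moreover have "cls D (wd z) \<in> U_zero D"
      unfolding U_zero_def by (rule cls_word_subalgebra) (use Tri_step(2) in \<open>auto simp: KJ_def\<close>)
    moreover have "cls D (iE (wd w)) \<in> U_plus D (wt w)"
      unfolding U_plus_iff by (rule exI[of _ "wd w"]) simp
    moreover have "ht (wt w) \<ge> N" using Tri_step(1) length_wt[of w] by simp
    moreover have "cls D (wd (map gen_F f) * (wd z * iE (wd w))) = cls D (wd (map gen_F f)) \<otimes>\<^bsub>UU\<^esub> cls D (wd z) \<otimes>\<^bsub>UU\<^esub> cls D (iE (wd w))"
      by (simp add: cls_mult mult.assoc)
    ultimately have "cls D (wd (map gen_F f) * (wd z * iE (wd w))) \<in> ?S" by blast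
    from lin_span_add[OF lin_span_incl[OF this, of c] Tri_step.IH] show ?case .
  qed
qed

end

section \<open>The universal Verma module\<close>

type_synonym ('a, 'b) verma = "'b \<Rightarrow> ('a word \<Rightarrow>\<^sub>0 qpi)"

context datum
begin

lemma Kq_ld_Cons: "Kq i (ld i (wd [j] * y)) = ppow (pr i * pr j) \<cdot> (wd [j] * Kq i (ld i y)) + (if i = j then Kq i y else 0)"
  by (simp add: ld_Cons lin_add[OF lin_Kq] lin_smul[OF lin_Kq] lin_0[OF lin_Kq]) (simp add: Kq_def Dg_mult chi_q)

lemma Sgn_rd_Cons: "Sgn i (rd i (wd [j] * y)) = ppow (pr i * pr j) \<cdot> (wd [j] * Sgn i (rd i y)) + (if i = j then KqI i y else 0)"
  by (simp add: rd_Cons lin_add[OF lin_Sgn] lin_0[OF lin_Sgn] flip: Sgn_chi(1)) (simp add: Sgn_def Dg_mult)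

end

context rdatum
begin

text \<open>A function \<open>m\<close> stands for the sum of \<open>m \<kappa> \<otimes> K\<^sub>\<kappa>\<close>, so that \<open>K\<^sub>\<mu>\<close> acts by translation.\<close>

definition sM :: "qpi \<Rightarrow> ('i, 'y) verma \<Rightarrow> ('i, 'y) verma" where "sM c m = (\<lambda>\<kappa>. c \<cdot> m \<kappa>)"
text \<open>As in \<open>Ev\<close>, but K_i acts on the highest weight vector by the formal symbol
  of \<open>kap i\<close> in place of 1. The two terms therefore translate in opposite directions,
  which makes them distinguishable.\<close>

definition EM :: "'i \<Rightarrow> ('i, 'y) verma \<Rightarrow> ('i, 'y) verma" where
  "EM i m = (\<lambda>\<kappa>. inverse (hh i) \<cdot> (Kq i (ld i (m (\<kappa> - kap i))) - Sgn i (rd i (m (\<kappa> + kap i)))))"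
definition FM :: "'i \<Rightarrow> ('i, 'y) verma \<Rightarrow> ('i, 'y) verma" where "FM i m = (\<lambda>\<kappa>. wd [i] * m \<kappa>)"
definition KM :: "'y \<Rightarrow> ('i, 'y) verma \<Rightarrow> ('i, 'y) verma" where
  "KM \<mu> m = (\<lambda>\<kappa>. Dg (\<lambda>k. qpow (- pg \<mu> k)) (m (\<kappa> - \<mu>)))"
text \<open>All J_\<mu> act on the highest weight vector by 1, so there is no translation, and each
  \<open>Jtilde D i\<close> acts as the identity (\<open>JM_kap\<close>).\<close>

definition JM :: "'y \<Rightarrow> ('i, 'y) verma \<Rightarrow> ('i, 'y) verma" where
  "JM \<mu> m = (\<lambda>\<kappa>. Dg (\<lambda>k. ppow (nat \<bar>pg \<mu> k\<bar>)) (m \<kappa>))"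

definition NM :: "('i, 'y) verma set" where "NM = {m. \<forall>\<kappa>. m \<kappa> \<in> Rad}"

lemma module_sM: "Modules.module sM"
  by standard (auto simp: sM_def fun_eq_iff plus_fun_def algebra_simps)

lemma KM_kap: "KM (kap i) m = (\<lambda>\<kappa>. Kq i (m (\<kappa> - kap i)))" "KM (- kap i) m = (\<lambda>\<kappa>. KqI i (m (\<kappa> + kap i)))"
  by (simp_all add: KM_def Kq_def KqI_def prg_kap prg_neg)

lemma JM_kap: "JM (kap i) m = m"
  by (simp add: JM_def prg_kap ppow_fm Dg_one)

lemma lop_EM: "lop sM (EM i)" and lop_FM: "lop sM (FM i)" and lop_KM: "lop sM (KM \<mu>)" and lop_JM: "lop sM (JM \<mu>)"
  by (auto intro!: lopI simp: EM_def FM_def KM_def JM_def sM_def fun_eq_iff plus_fun_def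
      lin_add[OF lin_Kq] lin_add[OF lin_Sgn] lin_smul[OF lin_Kq] lin_smul[OF lin_Sgn] algebra_simps)

lemma EM_KM: "EM j (KM \<mu> m) = sM (qpow (- pg \<mu> j)) (KM \<mu> (EM j m))"
  unfolding EM_def KM_def sM_def
  by (simp add: fun_eq_iff ld_Dg rd_Dg lin_smul[OF lin_Kq] lin_smul[OF lin_Sgn] algebra_simps)
     (simp add: Kq_def Sgn_def Dg_Dg mult.commute)

lemma EM_JM: "EM j (JM \<mu> m) = sM (ppow (nat \<bar>pg \<mu> j\<bar>)) (JM \<mu> (EM j m))"
  unfolding EM_def JM_def sM_def
  by (simp add: fun_eq_iff ld_Dg rd_Dg lin_smul[OF lin_Kq] lin_smul[OF lin_Sgn] algebra_simps)
     (simp add: Kq_def Sgn_def Dg_Dg mult.commute)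

lemma KM_EM: "KM \<mu> (EM j m) = sM (qpow (pg \<mu> j)) (EM j (KM \<mu> m))"
  by (simp add: EM_KM sM_def qpow_uminus)

lemma JM_EM: "JM \<mu> (EM j m) = sM (ppow (nat \<bar>pg \<mu> j\<bar>)) (EM j (JM \<mu> m))"
  by (simp add: EM_JM sM_def)

lemma EM_FM: "EM i (FM j m) = sM (ppow (pr i * pr j)) (FM j (EM i m))
    + (if i = j then sM (inverse (hh i)) (KM (kap i) m - KM (- kap i) m) else 0)"
  by (simp add: fun_eq_iff EM_def FM_def KM_kap sM_def plus_fun_def Kq_ld_Cons Sgn_rd_Cons algebra_simps)

lemma umod_MM: "umod D sM EM FM (\<lambda>i. KM (kap i)) (\<lambda>i. KM (- kap i)) (\<lambda>i. JM (kap i)) NM"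
proof (intro umod.intro umod_axioms.intro datum_axioms module_sM lop_EM lop_FM lop_KM lop_JM, goal_cases)
  case (1) show ?case by (simp add: NM_def)
next
  case (2 x y) then show ?case by (simp add: NM_def plus_fun_def Rad_add)
next
  case (3 x c) then show ?case by (simp add: NM_def sM_def Rad_smul)
next
  case (4 x i) then show ?case by (simp add: NM_def EM_def Kq_def Sgn_def Rad_smul Rad_diff Rad_Dg Rad_ld Rad_rd)
next
  case (5 x i) then show ?case by (simp add: NM_def FM_def Rad_Cons)
next
  case (6 x i) then show ?case by (simp add: NM_def KM_def Rad_Dg)
next
  case (7 x i) then show ?case by (simp add: NM_def KM_def Rad_Dg)
next
  case (8 x i) then show ?case by (simp add: NM_def JM_def Rad_Dg)
next
  case (9 i j m) show ?case by (simp add: KM_EM prg_kap NM_def)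
next
  case (10 i j m) show ?case by (simp add: KM_EM prg_kap prg_neg NM_def)
next
  case (11 i j m) show ?case by (simp add: JM_kap NM_def)
next
  case (12 i j m) show ?case by (simp add: EM_FM JM_kap NM_def)
qed

sublocale MM: umod D sM EM FM "\<lambda>i. KM (kap i)" "\<lambda>i. KM (- kap i)" "\<lambda>i. JM (kap i)" NM
  by (rule umod_MM)

section \<open>The free algebra acting on the universal Verma module, and the relations\<close>

primrec opM :: "('i, 'y) generator \<Rightarrow> ('i, 'y) verma \<Rightarrow> ('i, 'y) verma" where
  "opM (gen_E i) = EM i"
| "opM (gen_F i) = FM i"
| "opM (gen_K \<mu>) = KM \<mu>"
| "opM (gen_J \<mu>) = JM \<mu>"

sublocale RM: representation sM opM
proof (intro representation.intro module_sM representation_axioms.intro)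
  show "lop sM (opM g)" for g by (cases g) (simp_all add: lop_EM lop_FM lop_KM lop_JM)
qed

abbreviation "act \<equiv> rep sM opM"

lemma act_gen: "act (gen g) m = opM g m"
  using RM.rep_Cons[of g 1 m] by (simp add: gen_wd RM.rep_1)

lemma act_gen_mult: "act (gen g * x) m = opM g (act x m)"
  by (simp add: RM.rep_mult act_gen)

lemma act_iE: "act (iE x) m = MM.xE x m"
proof (induction x rule: fa_induct)
  case (word c w)
  have "act (iE (wd w)) m = MM.xE (wd w) m"
    by (simp add: iE_wd RM.rep_wd MM.xE_wd foldr_map comp_def)
  then show ?case by (simp add: iE_simps RM.rep_simps MM.xE_simps)
qed (simp_all add: iE_simps RM.rep_simps MM.xE_simps)

lemma opM_NM: "m \<in> NM \<Longrightarrow> opM g m \<in> NM"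
  by (cases g) (auto simp: MM.N_E MM.N_F, auto simp: NM_def KM_def JM_def Rad_Dg)

lemma act_NM: "m \<in> NM \<Longrightarrow> act x m \<in> NM"
  by (rule RM.rep_stable) (auto intro: MM.N_0 MM.N_add MM.N_scale opM_NM)

definition bd :: "nat \<Rightarrow> ('i, 'y) verma \<Rightarrow> bool" where "bd n m \<longleftrightarrow> (\<forall>\<kappa>. spn (\<lambda>w. length w \<le> n) (m \<kappa>))"
text \<open>A vector may have infinitely many components, so finiteness is imposed by one bound for
  all of them. It makes the vector a finite sum of F-words applied to primitive vectors
  (\<open>bd_Vgen\<close>), and long E-words act on it by 0.\<close>

definition Bd :: "('i, 'y) verma set" where "Bd = {m. \<exists>n. bd n m}"

lemma bd_mono: "bd n m \<Longrightarrow> n \<le> n' \<Longrightarrow> bd n' m"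
  by (auto simp: bd_def intro: spn_mono)

lemma bd_EM: "bd (Suc n) m \<Longrightarrow> bd n (EM i m)"
  unfolding bd_def EM_def Kq_def Sgn_def
  by (intro allI spn_smul spn_diff spn_Dg) (rule spn_ld[where P = "\<lambda>w. length w \<le> Suc n"], simp, erule spec, rule spn_rd[where P = "\<lambda>w. length w \<le> Suc n"], simp, erule spec)

lemma bd_EM': "bd n m \<Longrightarrow> bd n (EM i m)"
  by (rule bd_EM, rule bd_mono) auto

lemma bd_KM: "bd n m \<Longrightarrow> bd n (KM \<mu> m)" and bd_JM: "bd n m \<Longrightarrow> bd n (JM \<mu> m)"
  by (auto simp: bd_def KM_def JM_def intro: spn_Dg)

lemma bd_FM: "bd n m \<Longrightarrow> bd (Suc n) (FM i m)"
  unfolding bd_def FM_def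
proof
  fix \<kappa> assume "\<forall>\<kappa>. spn (\<lambda>w. length w \<le> n) (m \<kappa>)"
  then show "spn (\<lambda>w. length w \<le> Suc n) (wd [i] * m \<kappa>)"
    by (intro spn_mult[of "\<lambda>w. w = [i]" _ "\<lambda>w. length w \<le> n"]) auto
qed

lemma opM_Bd: "m \<in> Bd \<Longrightarrow> opM g m \<in> Bd"
  by (cases g) (auto simp: Bd_def intro: bd_EM' bd_FM bd_KM bd_JM)

lemma Bd_add: "m \<in> Bd \<Longrightarrow> m' \<in> Bd \<Longrightarrow> m + m' \<in> Bd"
proof -
  assume "m \<in> Bd" "m' \<in> Bd"
  then obtain a b where "bd a m" "bd b m'" by (auto simp: Bd_def)
  then have "bd (max a b) m" "bd (max a b) m'" by (auto intro: bd_mono)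
  then have "bd (max a b) (m + m')" by (simp add: bd_def plus_fun_def spn_add)
  then show ?thesis by (auto simp: Bd_def)
qed

lemma act_Bd: "m \<in> Bd \<Longrightarrow> act x m \<in> Bd"
  by (rule RM.rep_stable) (auto intro: Bd_add opM_Bd, auto simp: Bd_def bd_def sM_def intro: spn_smul)

lemma foldr_Cons_0: "foldr EM u m = 0 \<Longrightarrow> foldr EM (i # u) m = 0"
  using lop_0[OF lop_EM, of i] by (metis comp_apply foldr_Cons)

lemma act_iE_zero: assumes "N < length w" "bd N m" shows "act (iE (wd w)) m = 0"
proof -
  have "bd (N - length u) (foldr EM u m) \<and> (length u > N \<longrightarrow> foldr EM u m = 0)" for u
  proof (induction u)
    case Nil then show ?case using assms by simp
  next
    case (Cons i u)
    show ?case
    proof (cases "length u > N")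
      case True
      then have "foldr EM (i # u) m = 0" using Cons.IH by (metis foldr_Cons_0)
      moreover have "bd k 0" for k by (simp add: bd_def)
      ultimately show ?thesis by metis
    next
      case False
      show ?thesis
      proof (cases "N = length u")
        case True
        have "bd 0 (foldr EM u m)" using Cons True by simp
        then have "EM i (foldr EM u m) = 0"
        proof -
          assume b: "bd 0 (foldr EM u m)"
          have "ld i y = 0 \<and> rd i y = 0" if "spn (\<lambda>w. length w \<le> 0) y" for y
            using that by (induction rule: spn_induct) (simp_all add: wd_Nil)
          then show ?thesis using b
            by (simp add: bd_def EM_def fun_eq_iff lin_0[OF lin_Kq] lin_0[OF lin_Sgn])
        qed
        then show ?thesis by (simp add: bd_def)
      next
        case nn: False
        then have "N - length u = Suc (N - length (i # u))" using False by simp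
        then show ?thesis using Cons bd_EM[of "N - length (i # u)" "foldr EM u m" i] nn False by simp
      qed
    qed
  qed
  from this[of w] show ?thesis using assms(1) by (simp add: act_iE MM.xE_wd)
qed

lemma bd_Suc_cases:
  assumes "bd (Suc n) m"
  obtains e l where "bd 0 e" "\<And>j. bd n (l j)" "m = e + (\<Sum>j\<in>UNIV. FM j (l j))"
proof
  let ?e = "\<lambda>\<kappa>. lookup (m \<kappa>) 0 \<cdot> (1 :: 'i word \<Rightarrow>\<^sub>0 qpi)" and ?l = "\<lambda>j \<kappa>. lst j (m \<kappa>)"
  show "bd 0 ?e" using spn_wd[of _ "[]"] by (auto simp: bd_def wd_Nil intro!: spn_smul)
  show "bd n (?l j)" for j
    unfolding bd_def
  proof
    fix \<kappa>
    have "spn (\<lambda>w. length w \<le> Suc n) (m \<kappa>)" using assms by (simp add: bd_def)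
    then show "spn (\<lambda>w. length w \<le> n) (lst j (m \<kappa>))"
      by (rule spn_lin[OF lin_lst, rotated]) (auto simp: lst_def lext_wd[OF module_smul])
  qed
  show "m = ?e + (\<Sum>j\<in>UNIV. FM j (?l j))"
  proof
    fix \<kappa>
    have "(\<Sum>j\<in>A. FM j (?l j)) \<kappa> = (\<Sum>j\<in>A. wd [j] * lst j (m \<kappa>))" for A
      by (induction A rule: infinite_finite_induct) (simp_all add: plus_fun_def FM_def)
    then show "m \<kappa> = (?e + (\<Sum>j\<in>UNIV. FM j (?l j))) \<kappa>"
      unfolding plus_fun_def using lst_expand[of "m \<kappa>"] by simp
  qed
qed

lemma bd_Vgen: "bd n m \<Longrightarrow> m \<in> MM.Vgen"
proof (induction n arbitrary: m)
  case 0
  have "EM i m = 0" for i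
    using act_iE_zero[of 0 "[i]" m] 0 by (simp add: act_iE MM.xE_wd)
  then show ?case by (intro MM.vac) (simp add: MM.N_0)
next
  case (Suc n)
  obtain e l where e: "bd 0 e" and l: "\<And>j. bd n (l j)" and m: "m = e + (\<Sum>j\<in>UNIV. FM j (l j))"
    using bd_Suc_cases[OF Suc.prems] by metis
  have "EM i e = 0" for i
    using act_iE_zero[of 0 "[i]" e] e by (simp add: act_iE MM.xE_wd)
  then have e': "e \<in> MM.Vgen" by (intro MM.vac) (simp add: MM.N_0)
  have l': "FM j (l j) \<in> MM.Vgen" for j by (intro MM.Vgen_F Suc.IH l)
  have "e + (\<Sum>j\<in>A. FM j (l j)) \<in> MM.Vgen" if "finite A" for A
    using that
  proof induction
    case (insert x A)
    have eq: "e + (\<Sum>j\<in>insert x A. FM j (l j)) = FM x (l x) + (e + (\<Sum>j\<in>A. FM j (l j)))"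
      unfolding sum.insert[OF insert(1,2)] by (simp only: add.left_commute)
    show ?case unfolding eq by (rule MM.Vgen_add[OF l' insert.IH])
  qed (simp add: e')
  from this[OF finite_class.finite_UNIV] show ?case unfolding m .
qed

lemma act_F_power: "act (fF i ^ n) m = (\<lambda>\<kappa>. th i n * m \<kappa>)"
proof (induction n)
  case (Suc n)
  then show ?case by (simp add: act_gen_mult FM_def th_Suc mult.assoc del: replicate_Suc)
qed (simp add: RM.rep_1 wd_Nil)

text \<open>The torus and commutation relations hold exactly. Both kinds of Serre relations hold
  because Serre elements lie in the radical: those in the F act by left multiplication, those in the
  E by \<open>xE_Rad\<close>, which needs a vector generated from primitive ones.\<close>

lemma act_relator: assumes "r \<in> relators D" "m \<in> Bd" shows "act r m \<in> NM"
  using assms(1)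
proof cases
  case K_zero
  have "KM 0 m = m" by (simp add: KM_def prg_0 Dg_one)
  then show ?thesis by (simp add: K_zero RM.rep_simps act_gen RM.rep_1 MM.N_0)
next
  case (K_add \<mu> \<nu>)
  have "qpow (- pg \<mu> k) * qpow (- pg \<nu> k) = qpow (- pg (\<mu> + \<nu>) k)" for k
    by (simp add: prg_add flip: qpow_add)
  then have "KM \<mu> (KM \<nu> m) = KM (\<mu> + \<nu>) m" by (simp add: KM_def Dg_Dg algebra_simps)
  then show ?thesis by (simp add: K_add RM.rep_simps act_gen act_gen_mult MM.N_0)
next
  case (J_double \<mu>)
  have "ppow (nat \<bar>pg (\<mu> + \<mu>) k\<bar>) = 1" for k by (rule ppow_even) (simp add: prg_add even_nat_iff)
  then have "JM (\<mu> + \<mu>) m = m" by (simp add: JM_def Dg_one)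
  then show ?thesis by (simp add: J_double RM.rep_simps act_gen RM.rep_1 MM.N_0)
next
  case (J_add \<mu> \<nu>)
  have "ppow (nat \<bar>pg \<mu> k\<bar>) * ppow (nat \<bar>pg \<nu> k\<bar>) = ppow (nat \<bar>pg (\<mu> + \<nu>) k\<bar>)" for k
    unfolding ppow_add[symmetric] by (rule ppow_cong) (simp add: prg_add even_nat_iff)
  then have "JM \<mu> (JM \<nu> m) = JM (\<mu> + \<nu>) m" by (simp add: JM_def Dg_Dg)
  then show ?thesis by (simp add: J_add RM.rep_simps act_gen act_gen_mult MM.N_0)
next
  case (J_K \<mu> \<nu>)
  have "JM \<mu> (KM \<nu> m) = KM \<nu> (JM \<mu> m)" by (simp add: JM_def KM_def Dg_Dg mult.commute)
  then show ?thesis by (simp add: J_K RM.rep_simps act_gen act_gen_mult MM.N_0)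
next
  case (K_E \<mu> i)
  then show ?thesis
    by (simp add: RM.rep_simps act_gen act_gen_mult scal_smul mult.assoc qq_powi KM_EM MM.N_0)
next
  case (J_E \<mu> i)
  then show ?thesis
    by (simp add: RM.rep_simps act_gen act_gen_mult scal_smul mult.assoc ppi_powi JM_EM MM.N_0)
next
  case (K_F \<mu> i)
  have "KM \<mu> (FM i m) = sM (qpow (- pg \<mu> i)) (FM i (KM \<mu> m))" by (simp add: KM_def FM_def sM_def Dg_mult)
  then show ?thesis
    by (simp add: K_F RM.rep_simps act_gen act_gen_mult scal_smul mult.assoc qq_powi MM.N_0)
next
  case (J_F \<mu> i)
  have "JM \<mu> (FM i m) = sM (ppow (nat \<bar>pg \<mu> i\<bar>)) (FM i (JM \<mu> m))" by (simp add: JM_def FM_def sM_def Dg_mult)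
  then show ?thesis
    by (simp add: J_F RM.rep_simps act_gen act_gen_mult scal_smul mult.assoc ppi_powi MM.N_0)
next
  case (E_F i j)
  have h: "(1 :: qpi) / (ppii D i * qi D i - inverse (qi D i)) = inverse (hh i)"
    by (simp add: divide_pi_ext_def hh_def)
  show ?thesis unfolding E_F h Let_def kap_def[symmetric]
    by (cases "i = j")
       (simp_all add: RM.rep_simps act_gen act_gen_mult scal_smul mult.assoc EM_FM JM_kap MM.N_0 ppow_def[symmetric])
next
  case (serre_E i j)
  obtain n where n: "bd n m" using assms(2) by (auto simp: Bd_def)
  have "MM.xE (serref i j) m \<in> NM" by (rule MM.xE_Rad[OF bd_Vgen[OF n] serref_Rad[OF serre_E(2)]])
  then show ?thesis unfolding serre_E(1) iE_serref[symmetric] act_iE .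
next
  case (serre_F i j)
  have s: "(\<Sum>n\<in>A. f n) \<kappa> = (\<Sum>n\<in>A. f n \<kappa>)" for f :: "nat \<Rightarrow> ('i, 'y) verma" and A \<kappa>
    by (induction A rule: infinite_finite_induct) (simp_all add: plus_fun_def)
  have "act (serre D fF i j) m = (\<lambda>\<kappa>. serref i j * m \<kappa>)"
  proof
    fix \<kappa>
    have "act (serre D fF i j) m = (\<Sum>n=0..sm i j. sM (sc i j n) (\<lambda>\<kappa>. th i n * wd [j] * th i (sm i j - n) * m \<kappa>))"
      unfolding serre_def Let_def sm_def[symmetric] lin_sum[OF RM.lin_rep]
      by (intro sum.cong refl)
         (simp add: scal_smul mult.assoc RM.rep_simps sc_def RM.rep_mult act_F_power act_gen FM_def)
    then show "act (serre D fF i j) m \<kappa> = serref i j * m \<kappa>"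
      by (simp add: s sM_def serref_def sum_distrib_right)
  qed
  then show ?thesis using serref_Rad[OF serre_F(2)] by (simp add: serre_F(1) NM_def Rad_mult_right)
qed

lemma act_II: assumes "a \<in> II" "m \<in> Bd" shows "act a m \<in> NM"
proof -
  have "\<forall>m\<in>Bd. act a m \<in> NM"
  proof (rule II_min[OF _ _ _ _ _ assms(1)])
    show "\<forall>m\<in>Bd. act r m \<in> NM" if "r \<in> relators D" for r using act_relator[OF that] by blast
    show "\<forall>m\<in>Bd. act 0 m \<in> NM" unfolding RM.rep_simps using MM.N_0 by blast
    show "\<forall>m\<in>Bd. act (a + b) m \<in> NM" if "\<forall>m\<in>Bd. act a m \<in> NM" "\<forall>m\<in>Bd. act b m \<in> NM" for a b
      unfolding RM.rep_simps using MM.N_add that by blast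
    show "\<forall>m\<in>Bd. act (x * a) m \<in> NM" if "\<forall>m\<in>Bd. act a m \<in> NM" for a x
      unfolding RM.rep_mult using act_NM that by blast
    show "\<forall>m\<in>Bd. act (a * x) m \<in> NM" if "\<forall>m\<in>Bd. act a m \<in> NM" for a x
      unfolding RM.rep_mult using act_Bd that by blast
  qed
  then show ?thesis using assms(2) by blast
qed

lemma act_FL: "a \<in> FL N \<Longrightarrow> bd n m \<Longrightarrow> n < N \<Longrightarrow> act a m \<in> NM"
proof (induction rule: FL.induct)
  case (FL_II a) then show ?case using act_II by (auto simp: Bd_def)
next
  case (FL_step w a u)
  have "act (iE (wd w)) m = 0" by (rule act_iE_zero[of n]) (use FL_step in auto)
  then show ?case using FL_step by (simp add: RM.rep_simps RM.rep_mult lop_0[OF RM.lop_rep])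
qed

subsection \<open>Leading coefficients\<close>

lemma kap_independent:
  assumes "(\<Sum>k\<in>UNIV. zscale (c k) (kap k)) = 0" shows "c k = 0"
proof -
  have ind: "zmod.independent (range (coroot D))" and inj: "inj (coroot D)"
    using root_datum' by (auto simp: super_root_datum_def)
  let ?u = "\<lambda>v. c (inv_into UNIV (coroot D) v) * int (dg (inv_into UNIV (coroot D) v))"
  have "(\<Sum>v\<in>range (coroot D). zscale (?u v) v) = (\<Sum>k\<in>UNIV. zscale (c k * int (dg k)) (coroot D k))"
    by (simp add: sum.reindex[OF inj] inj mult.commute)
  also have "\<dots> = (\<Sum>k\<in>UNIV. zscale (c k) (kap k))" by (simp add: kap_def)
  finally have "(\<Sum>v\<in>range (coroot D). zscale (?u v) v) = 0" using assms by simp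
  then have "?u (coroot D k) = 0"
    using zmod.independentD[OF ind, of "range (coroot D)" ?u "coroot D k"] by auto
  then show ?thesis using dg_pos[of k] inj by simp
qed

primrec kw :: "'i list \<Rightarrow> 'y" where
  "kw [] = 0"
| "kw (i # w) = kap i + kw w"

lemma kw_wt: "kw w = (\<Sum>k\<in>UNIV. zscale (int (wt w k)) (kap k))"
proof (induction w)
  case (Cons i w)
  have "(\<Sum>k\<in>UNIV. zscale (int (wt (i # w) k)) (kap k)) = (\<Sum>k\<in>UNIV. zscale (int (wt w k)) (kap k) + (if k = i then kap k else 0))"
    by (intro sum.cong refl) (auto simp: zmod.scale_left_distrib)
  then show ?case by (simp add: Cons sum.distrib)
qed simp

definition dl :: "('i word \<Rightarrow>\<^sub>0 qpi) \<Rightarrow> ('i, 'y) verma" where "dl y = (\<lambda>\<kappa>. if \<kappa> = 0 then y else 0)"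

text \<open>The result of always choosing the summand of \<open>EM\<close> that translates by -
  \<open>kap i\<close>.\<close>

primrec low :: "'i list \<Rightarrow> ('i word \<Rightarrow>\<^sub>0 qpi) \<Rightarrow> ('i word \<Rightarrow>\<^sub>0 qpi)" where
  "low [] y = y"
| "low (i # w) y = - inverse (hh i) \<cdot> Sgn i (rd i (low w y))"

lemma act_dl_support:
  "foldr EM w (dl y) \<kappa> \<noteq> 0 \<Longrightarrow> \<exists>n. \<kappa> = - kw w + (\<Sum>k\<in>UNIV. zscale (2 * int (n k)) (kap k))"
proof (induction w arbitrary: \<kappa>)
  case Nil
  then show ?case by (intro exI[of _ "\<lambda>_. 0"]) (simp add: dl_def split: if_splits)
next
  case (Cons i w)
  have ex: "\<exists>n'. \<kappa> = - kw (i # w) + (\<Sum>k\<in>UNIV. zscale (2 * int (n' k)) (kap k))"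
    if "\<kappa> = - kw w + (\<Sum>k\<in>UNIV. zscale (2 * int (n k)) (kap k)) + kap i" for n
  proof -
    have "(\<Sum>k\<in>UNIV. zscale (2 * int (inc i n k)) (kap k)) = (\<Sum>k\<in>UNIV. zscale (2 * int (n k)) (kap k) + (if k = i then kap k + kap k else 0))"
      by (intro sum.cong refl) (auto simp: zmod.scale_left_distrib[of "_" 2, simplified] algebra_simps zmod.scale_left_distrib[of 1 1, simplified])
    then have "(\<Sum>k\<in>UNIV. zscale (2 * int (inc i n k)) (kap k)) = (\<Sum>k\<in>UNIV. zscale (2 * int (n k)) (kap k)) + (kap i + kap i)"
      by (simp add: sum.distrib)
    then show ?thesis using that by (intro exI[of _ "inc i n"]) (simp add: algebra_simps)
  qed
  from Cons.prems have "foldr EM w (dl y) (\<kappa> - kap i) \<noteq> 0 \<or> foldr EM w (dl y) (\<kappa> + kap i) \<noteq> 0"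
    by (auto simp: EM_def[of i] lin_0[OF lin_Kq] lin_0[OF lin_Sgn])
  then show ?case
  proof
    assume "foldr EM w (dl y) (\<kappa> - kap i) \<noteq> 0"
    from Cons.IH[OF this] obtain n where "\<kappa> - kap i = - kw w + (\<Sum>k\<in>UNIV. zscale (2 * int (n k)) (kap k))" ..
    then have "\<kappa> = - kw w + (\<Sum>k\<in>UNIV. zscale (2 * int (n k)) (kap k)) + kap i" by (metis diff_add_cancel)
    then show ?thesis by (rule ex)
  next
    assume "foldr EM w (dl y) (\<kappa> + kap i) \<noteq> 0"
    from Cons.IH[OF this] obtain n where n: "\<kappa> + kap i = - kw w + (\<Sum>k\<in>UNIV. zscale (2 * int (n k)) (kap k))" ..
    then show ?thesis by (intro exI[of _ n]) (simp add: algebra_simps)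
  qed
qed

text \<open>Each E_i translates by \<open>kap i\<close> or by - \<open>kap i\<close>. By linear
  independence the lowest exponent - \<open>kw w\<close> is reached only if the negative direction
  is chosen every time.\<close>

lemma act_dl_low: "foldr EM w (dl y) (- kw w) = low w y"
proof (induction w)
  case (Cons i w)
  have "foldr EM w (dl y) (- kw (i # w) - kap i) = 0"
  proof (rule ccontr)
    assume "foldr EM w (dl y) (- kw (i # w) - kap i) \<noteq> 0"
    from act_dl_support[OF this] obtain n where n: "- kw (i # w) - kap i = - kw w + (\<Sum>k\<in>UNIV. zscale (2 * int (n k)) (kap k))" ..
    have "(\<Sum>k\<in>UNIV. zscale (2 * int (n k) + (if k = i then 2 else 0)) (kap k))
       = (\<Sum>k\<in>UNIV. zscale (2 * int (n k)) (kap k) + (if k = i then zscale 2 (kap i) else 0))"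
      by (intro sum.cong refl) (simp add: zmod.scale_left_distrib)
    also have "\<dots> = (\<Sum>k\<in>UNIV. zscale (2 * int (n k)) (kap k)) + (kap i + kap i)"
      using zmod.scale_left_distrib[of 1 1 "kap i"] by (simp add: sum.distrib)
    also have "\<dots> = 0"
    proof -
      have "- kap i - kap i = (\<Sum>k\<in>UNIV. zscale (2 * int (n k)) (kap k))"
        using arg_cong[OF n, of "\<lambda>x. x + kw w"] by simp
      from this[symmetric] show ?thesis by simp
    qed
    finally have "2 * int (n i) + (if i = i then 2 else 0) = 0" by (rule kap_independent)
    then show False by simp
  qed
  then show ?case
    using Cons by (simp add: EM_def[of i] lin_0[OF lin_Kq] algebra_simps)
qed (simp add: dl_def)

definition uc :: "('i \<Rightarrow> nat) \<Rightarrow> qpi" where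
  "uc \<mu> = (\<Prod>k\<in>UNIV. (- inverse (hh k)) ^ \<mu> k) * ppow (pw \<mu> choose 2)"

lemma unit_uc: "uc \<mu> dvd 1"
  unfolding uc_def by (intro unit_mult unit_prod unit_power unit_ppow unit_neg unit_inverse unit_hh)

text \<open>\<open>low\<close> strips letters by right derivations, so that pairing with v gives the
  pairing with v @ w. The sign twists and the denominators accumulate to a unit that depends only on
  weights.\<close>

lemma low_form: "formw v (low w y) = ppow (pw (wt v) * pw (wt w)) * uc (wt w) * formw (v @ w) y"
proof (induction w arbitrary: v)
  case Nil then show ?case by (simp add: uc_def weight_par_def binomial_eq_0)
next
  case (Cons i w)
  have w: "wt (i # w) = inc i (wt w)" "wt (v @ [i]) = inc i (wt v)" by simp_all
  have c: "ppow (pw (inc i \<mu>) choose 2) = ppow (pr i * pw \<mu>) * ppow (pw \<mu> choose 2)" for \<mu>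
    unfolding pw_inc by (cases "pr i = 0") (auto simp: pr_odds numeral_2_eq_2 ppow_add split: if_splits)
  have uci: "uc (inc i (wt w)) = - inverse (hh i) * ppow (pr i * pw (wt w)) * uc (wt w)"
    unfolding uc_def prod_inc c by (simp add: mult_ac)
  have "wprod (\<lambda>k. ppow (pr i * pr k)) v = ppow (pr i * pw (wt v))"
    by (simp add: wprod_wt prod_ppow)
  then have "formw v (low (i # w) y) = - inverse (hh i) * ppow (pr i * pw (wt v)) * formw (v @ [i]) (low w y)"
    by (simp add: Sgn_def formw_Dg formw_snoc)
  also have "\<dots> = - inverse (hh i) * ppow (pr i * pw (wt v)) * (ppow (pw (wt (v @ [i])) * pw (wt w)) * uc (wt w) * formw (v @ i # w) y)"
    unfolding Cons by simp
  also have "\<dots> = ppow (pw (wt v) * pw (wt (i # w))) * uc (wt (i # w)) * formw (v @ i # w) y"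
    unfolding w uci pw_inc by (simp add: distrib_left distrib_right ppow_add mult_ac)
  finally show ?case .
qed

lemma act_dl_weight:
  assumes "\<And>\<kappa>. homog \<alpha> (m \<kappa>)" "wt w \<noteq> \<alpha>" shows "lookup (foldr EM w m \<kappa>) 0 = 0"
  using assms
proof (induction w arbitrary: m \<alpha> rule: rev_induct)
  case Nil
  then show ?case using formw_hom[of \<alpha> "m \<kappa>" "[]"] by simp
next
  case (snoc i w)
  show ?case
  proof (cases "\<alpha> i")
    case 0
    then have "EM i m = 0"
      using ld_zero[OF snoc.prems(1)] rd_zero[OF snoc.prems(1)]
      by (simp add: EM_def fun_eq_iff lin_0[OF lin_Kq] lin_0[OF lin_Sgn])
    moreover have "foldr EM w 0 = 0"
    proof (induction w)
      case (Cons j w) then show ?case by (rule foldr_Cons_0)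
    qed simp
    ultimately show ?thesis by simp
  next
    case (Suc n)
    define \<beta> where "\<beta> = \<alpha>(i := n)"
    have \<alpha>: "\<alpha> = inc i \<beta>" using Suc by (auto simp: \<beta>_def fun_eq_iff)
    have "homog \<beta> (EM i m \<kappa>)" for \<kappa>
      unfolding EM_def Kq_def Sgn_def using snoc.prems(1) unfolding \<alpha>
      by (intro spn_smul spn_diff spn_Dg homog_ld homog_rd)
    moreover have "wt w \<noteq> \<beta>" using snoc.prems(2) \<alpha> by auto
    ultimately show ?thesis using snoc.IH[of \<beta> "EM i m"] by simp
  qed
qed

text \<open>The sum is applied to a word v of weight \<mu>, and the constant term is read at the
  exponent - \<open>kw v\<close>. Components of other weights contribute nothing, and z \<mu>
  contributes a unit times its pairing with v.\<close>

lemma act_nondegenerate: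
  assumes z: "\<And>\<nu>. ht \<nu> \<le> n \<Longrightarrow> homog \<nu> (z \<nu>)"
    and 0: "\<And>m. bd n m \<Longrightarrow> act (iE (\<Sum>\<nu> | ht \<nu> \<le> n. z \<nu>)) m \<in> NM" and \<mu>: "ht \<mu> = n"
  shows "z \<mu> \<in> Rad"
proof -
  have "formw v (z \<mu>) = 0" if v: "wt v = \<mu>" for v
  proof -
    let ?m = "dl (wd v)"
    have hm: "homog \<mu> (?m \<kappa>)" for \<kappa> using v by (simp add: dl_def)
    have "bd n ?m" using v \<mu> length_wt[of v] by (simp add: bd_def dl_def)
    from 0[OF this] have "act (iE (\<Sum>\<nu> | ht \<nu> \<le> n. z \<nu>)) ?m (- kw v) \<in> Rad" by (simp add: NM_def)
    from Rad_lookup_0[OF this]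
    have e: "lookup (MM.xE (\<Sum>\<nu> | ht \<nu> \<le> n. z \<nu>) ?m (- kw v)) 0 = 0" by (simp add: act_iE)
    have lin: "lin (*) (\<lambda>x. lookup (MM.xE x ?m (- kw v)) 0)"
      by (rule linI) (simp_all add: MM.xE_simps plus_fun_def sM_def lookup_add lookup_smul)
    have "lookup (MM.xE (z \<nu>) ?m (- kw v)) 0 = 0" if "ht \<nu> \<le> n" "\<nu> \<noteq> \<mu>" for \<nu>
      using z[OF that(1)]
    proof (induction rule: spn_induct)
      case (word c w)
      have "lookup (foldr EM w ?m (- kw v)) 0 = 0"
        by (rule act_dl_weight[OF hm]) (use word that in simp)
      then show ?case by (simp add: lin_smul[OF lin] MM.xE_wd)
    qed (simp_all add: lin_0[OF lin] lin_add[OF lin])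
    then have "(\<Sum>\<nu> | ht \<nu> \<le> n. lookup (MM.xE (z \<nu>) ?m (- kw v)) 0) = (\<Sum>\<nu>\<in>{\<mu>}. lookup (MM.xE (z \<nu>) ?m (- kw v)) 0)"
      using \<mu> by (intro sum.mono_neutral_right finite_ht) auto
    then have "lookup (MM.xE (z \<mu>) ?m (- kw v)) 0 = 0"
      using e unfolding lin_sum[OF lin] by simp
    moreover have "lookup (MM.xE x ?m (- kw v)) 0 = uc \<mu> * bform x (wd v)" if "homog \<mu> x" for x
      using that
    proof (induction rule: spn_induct)
      case (word c w)
      have "kw v = kw w" using word v by (simp add: kw_wt)
      then have "lookup (foldr EM w ?m (- kw v)) 0 = formw [] (low w (wd v))"
        by (simp add: act_dl_low)
      also have "\<dots> = uc \<mu> * formw w (wd v)" using word by (simp add: low_form del: formw.simps) (simp add: weight_par_def)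
      finally show ?case by (simp add: lin_smul[OF lin] MM.xE_wd bform_wd mult.left_commute)
    qed (simp_all add: lin_0[OF lin] lin_add[OF lin] distrib_left)
    ultimately have "uc \<mu> * bform (z \<mu>) (wd v) = uc \<mu> * 0" using z \<mu> by simp
    then have "bform (z \<mu>) (wd v) = 0" by (rule unit_cancel[OF unit_uc])
    then show ?thesis by (simp add: bform_wd_right)
  qed
  moreover have "formw v (z \<mu>) = 0" if "wt v \<noteq> \<mu>" for v
    using formw_hom[OF z _ ] that \<mu> by blast
  ultimately show ?thesis unfolding Rad_def by blast
qed

section \<open>The completion\<close>

definition cau :: "(nat \<Rightarrow> ('i, 'y) free_alg) \<Rightarrow> bool" where
  "cau a \<longleftrightarrow> (\<forall>N. \<exists>k. \<forall>m\<ge>k. \<forall>n\<ge>k. a m - a n \<in> FL N)"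

definition nul :: "(nat \<Rightarrow> ('i, 'y) free_alg) \<Rightarrow> bool" where
  "nul a \<longleftrightarrow> (\<forall>N. \<exists>k. \<forall>n\<ge>k. a n \<in> FL N)"

lemma nul_cau: "nul a \<Longrightarrow> cau a"
  unfolding nul_def cau_def by (meson FL_diff)

lemma nul_0: "nul (\<lambda>_. 0)"
  by (simp add: nul_def FL_0)

lemma nul_add: assumes "nul a" "nul b" shows "nul (\<lambda>n. a n + b n)"
  unfolding nul_def
proof
  fix N
  obtain j k where "\<forall>n\<ge>j. a n \<in> FL N" "\<forall>n\<ge>k. b n \<in> FL N" using assms unfolding nul_def by blast
  then have "\<forall>n\<ge>max j k. a n + b n \<in> FL N" by (simp add: FL_add)
  then show "\<exists>k. \<forall>n\<ge>k. a n + b n \<in> FL N" ..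
qed

lemma nul_left: "nul b \<Longrightarrow> nul (\<lambda>n. a n * b n)"
  unfolding nul_def by (meson FL_left)

lemma nul_smul: "nul a \<Longrightarrow> nul (\<lambda>n. c \<cdot> a n)"
  unfolding smul_def by (rule nul_left)

lemma nul_minus: "nul a \<Longrightarrow> nul (\<lambda>n. - a n)"
  using nul_smul[of a "- 1"] by simp

lemma nul_diff: "nul a \<Longrightarrow> nul b \<Longrightarrow> nul (\<lambda>n. a n - b n)"
  using nul_add[of a "\<lambda>n. - b n"] nul_minus[of b] by simp

lemma nul_II: "(\<And>n. a n \<in> II) \<Longrightarrow> nul a"
  by (simp add: nul_def FL_II)

lemma nul_FL: "(\<And>n. a n \<in> FL (n - d)) \<Longrightarrow> nul a"
  unfolding nul_def
proof
  fix N assume "\<And>n. a n \<in> FL (n - d)"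
  then have "\<forall>n\<ge>N + d. a n \<in> FL N" using FL_mono by (metis le_diff_conv2 add_leD2)
  then show "\<exists>k. \<forall>n\<ge>k. a n \<in> FL N" ..
qed

lemma cau_const: "cau (\<lambda>_. a)"
  by (simp add: cau_def FL_0)

lemma cau_add: assumes "cau a" "cau b" shows "cau (\<lambda>n. a n + b n)"
  unfolding cau_def
proof
  fix N
  obtain j k where jk: "\<forall>m\<ge>j. \<forall>n\<ge>j. a m - a n \<in> FL N" "\<forall>m\<ge>k. \<forall>n\<ge>k. b m - b n \<in> FL N"
    using assms unfolding cau_def by blast
  have "(a m + b m) - (a n + b n) \<in> FL N" if "m \<ge> max j k" "n \<ge> max j k" for m n
    using FL_add[of "a m - a n" N "b m - b n"] jk that by (simp add: algebra_simps)
  then show "\<exists>k. \<forall>m\<ge>k. \<forall>n\<ge>k. (a m + b m) - (a n + b n) \<in> FL N" by blast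
qed

text \<open>\<open>FL_right\<close> controls multiplication by one fixed element only. The Cauchy
  property replaces b n by the fixed b k, up to an error that is absorbed from the left.\<close>

lemma nul_right: assumes "nul a" "cau b" shows "nul (\<lambda>n. a n * b n)"
  unfolding nul_def
proof
  fix N
  obtain k where k: "\<forall>m\<ge>k. \<forall>n\<ge>k. b m - b n \<in> FL N" using assms unfolding cau_def by blast
  obtain M where M: "\<forall>x\<in>FL M. x * b k \<in> FL N" using FL_right by blast
  obtain j where j: "\<forall>n\<ge>j. a n \<in> FL M" using assms unfolding nul_def by blast
  have "a n * b n \<in> FL N" if "n \<ge> max j k" for n
    using FL_add[of "a n * b k" N "a n * (b n - b k)"] M j k that
    by (simp add: right_diff_distrib[symmetric] FL_left) (simp add: algebra_simps)
  then show "\<exists>k. \<forall>n\<ge>k. a n * b n \<in> FL N" by blast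
qed

lemma cau_mult: assumes "cau a" "cau b" shows "cau (\<lambda>n. a n * b n)"
  unfolding cau_def
proof
  fix N
  obtain k where k: "\<forall>m\<ge>k. \<forall>n\<ge>k. b m - b n \<in> FL N" using assms unfolding cau_def by blast
  obtain M where M: "\<forall>x\<in>FL M. x * b k \<in> FL N" using FL_right by blast
  obtain j where j: "\<forall>m\<ge>j. \<forall>n\<ge>j. a m - a n \<in> FL M" using assms unfolding cau_def by blast
  have "a m * b m - a n * b n \<in> FL N" if mn: "m \<ge> max j k" "n \<ge> max j k" for m n
  proof -
    have "a m * (b m - b n) + ((a m - a n) * b k + (a m - a n) * (b n - b k)) \<in> FL N"
    proof (intro FL_add)
      show "a m * (b m - b n) \<in> FL N" "(a m - a n) * (b n - b k) \<in> FL N" using k mn by (simp_all add: FL_left)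
      show "(a m - a n) * b k \<in> FL N" using j M mn by simp
    qed
    then show ?thesis by (simp add: algebra_simps)
  qed
  then show "\<exists>k. \<forall>m\<ge>k. \<forall>n\<ge>k. a m * b m - a n * b n \<in> FL N" by blast
qed

abbreviation "CR \<equiv> cauchy_ring D"
abbreviation "NS \<equiv> null_sequences D"
abbreviation (input) "sq a \<equiv> \<lambda>n. cls D (a n)"

lemma sq_carrier: "sq a \<in> carrier CR \<longleftrightarrow> cau a"
  by (auto simp: cauchy_ring_def cau_def cls_minus filtration_iff)

lemma carrier_CR: assumes "s \<in> carrier CR" obtains a where "s = sq a" "cau a"
proof -
  have "\<forall>n. \<exists>a. s n = cls D a" using assms unfolding cauchy_ring_def carrier_UU by (simp, blast)
  then obtain a where "\<And>n. s n = cls D (a n)" by metis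
  then have "s = sq a" by (simp add: fun_eq_iff)
  then show ?thesis using that[of a] assms sq_carrier[of a] by simp
qed

lemma sq_null: "sq a \<in> NS \<longleftrightarrow> nul a"
  using nul_cau[of a] by (auto simp: null_sequences_def sq_carrier filtration_iff nul_def)

lemma CR_simps: "sq a \<otimes>\<^bsub>CR\<^esub> sq b = sq (\<lambda>n. a n * b n)" "sq a \<oplus>\<^bsub>CR\<^esub> sq b = sq (\<lambda>n. a n + b n)"
  "\<one>\<^bsub>CR\<^esub> = sq (\<lambda>_. 1)" "\<zero>\<^bsub>CR\<^esub> = sq (\<lambda>_. 0)"
  by (simp_all add: cauchy_ring_def cls_mult cls_add cls_one cls_zero)

lemma ring_CR: "ring CR"
proof (rule ringI)
  show "abelian_group CR"
  proof (rule abelian_groupI, goal_cases)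
    case (6 x)
    then obtain a where a: "x = sq a" "cau a" by (rule carrier_CR)
    have "cau (\<lambda>n. - a n)" using cau_mult[OF cau_const a(2), of "- 1"] by simp
    then show ?case by (intro bexI[of _ "sq (\<lambda>n. - a n)"]) (simp_all add: a CR_simps sq_carrier)
  qed (auto elim!: carrier_CR simp: CR_simps sq_carrier cau_add cau_const add_ac)
  show "Group.monoid CR"
    by (rule monoidI) (auto elim!: carrier_CR simp: CR_simps sq_carrier cau_mult cau_const mult.assoc)
qed (auto elim!: carrier_CR simp: CR_simps distrib_left distrib_right)

lemma CR_minus: assumes "cau a" "cau b" shows "sq a \<ominus>\<^bsub>CR\<^esub> sq b = sq (\<lambda>n. a n - b n)"
proof -
  interpret ring CR by (rule ring_CR)
  have c: "cau (\<lambda>n. - b n)" using cau_mult[OF cau_const assms(2), of "- 1"] by simp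
  have "\<ominus>\<^bsub>CR\<^esub> sq b = sq (\<lambda>n. - b n)"
    by (rule minus_equality) (simp_all add: CR_simps sq_carrier c assms)
  then show ?thesis by (simp add: a_minus_def CR_simps)
qed

lemma ideal_NS: "ideal NS CR"
proof -
  interpret ring CR by (rule ring_CR)
  have NS: "\<exists>a. s = sq a \<and> nul a" if "s \<in> NS" for s
  proof -
    have "s \<in> carrier CR" using that by (simp add: null_sequences_def)
    then obtain a where "s = sq a" by (rule carrier_CR)
    then show ?thesis using that sq_null by auto
  qed
  show ?thesis
  proof (rule idealI[OF ring_CR])
    show "subgroup NS (add_monoid CR)"
    proof (rule group.subgroupI[OF a_group])
      show "NS \<subseteq> carrier (add_monoid CR)" by (auto simp: null_sequences_def)
      show "NS \<noteq> {}" using sq_null nul_0 by blast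
      show "inv\<^bsub>add_monoid CR\<^esub> s \<in> NS" if s: "s \<in> NS" for s
      proof -
        obtain a where a: "s = sq a" "nul a" using NS[OF s] by blast
        have "\<ominus>\<^bsub>CR\<^esub> sq a = sq (\<lambda>n. - a n)"
          by (rule minus_equality) (simp_all add: CR_simps sq_carrier nul_cau nul_minus a)
        then show ?thesis using a sq_null[of "\<lambda>n. - a n"] by (simp add: a_inv_def nul_minus)
      qed
      show "s \<otimes>\<^bsub>add_monoid CR\<^esub> t \<in> NS" if st: "s \<in> NS" "t \<in> NS" for s t
      proof -
        obtain a b where "s = sq a" "nul a" "t = sq b" "nul b" using NS[OF st(1)] NS[OF st(2)] by blast
        then show ?thesis using sq_null[of "\<lambda>n. a n + b n"] by (simp add: CR_simps nul_add)
      qed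
    qed
  qed (auto elim!: carrier_CR dest!: NS simp: CR_simps sq_null nul_left nul_right)
qed

lemma hat_lim_eq: assumes "cau a" "cau b" shows "hat_lim D (sq a) = hat_lim D (sq b) \<longleftrightarrow> nul (\<lambda>n. a n - b n)"
proof -
  interpret ring CR by (rule ring_CR)
  show ?thesis
    using quotient_eq_iff_same_a_r_cos[OF ideal_NS, of "sq a" "sq b"] assms
    by (auto simp: hat_lim_def sq_carrier CR_minus sq_null)
qed

lemma hat_lim_mult: assumes "cau a" "cau b"
  shows "hat_lim D (sq a) \<otimes>\<^bsub>U_hat D\<^esub> hat_lim D (sq b) = hat_lim D (sq (\<lambda>n. a n * b n))"
  using ideal.rcoset_mult_add[OF ideal_NS, of "sq a" "sq b"] assms
  by (simp add: sq_carrier CR_simps hat_lim_def U_hat_def FactRing_def)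

definition psum :: "(('i \<Rightarrow> nat) \<Rightarrow> ('i word \<Rightarrow>\<^sub>0 qpi)) \<Rightarrow> nat \<Rightarrow> ('i word \<Rightarrow>\<^sub>0 qpi)" where
  "psum z n = (\<Sum>\<mu> | ht \<mu> \<le> n. z \<mu>)"

lemma hat_sum_psum: "hat_sum D (\<lambda>\<mu>. cls D (iE (z \<mu>))) = hat_lim D (sq (\<lambda>n. iE (psum z n)))"
  by (simp add: hat_sum_def psum_def cls_sum finite_ht lin_sum[OF lin_iE])

lemma psum_diff: assumes "\<And>\<mu>. homog \<mu> (z \<mu>)" "k \<le> n"
  shows "spn (\<lambda>w. Suc k \<le> length w) (psum z n - psum z k)"
proof -
  have "psum z n - psum z k = (\<Sum>\<mu>\<in>{\<mu>. ht \<mu> \<le> n} - {\<mu>. ht \<mu> \<le> k}. z \<mu>)"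
    unfolding psum_def using assms(2) by (subst sum_diff) (auto simp: finite_ht)
  moreover have "spn (\<lambda>w. Suc k \<le> length w) (z \<mu>)" if "\<not> ht \<mu> \<le> k" for \<mu>
    by (rule spn_mono[OF assms(1)]) (use that in \<open>auto simp: length_wt\<close>)
  ultimately show ?thesis by (auto intro: spn_sum)
qed

lemma psum_FL: assumes "\<And>\<mu>. homog \<mu> (z \<mu>)" "k \<le> n" shows "iE (psum z n) - iE (psum z k) \<in> FL (Suc k)"
  using FL_iE[OF psum_diff[OF assms], of 1] by (simp add: iE_simps)

lemma cau_psum: assumes "\<And>\<mu>. homog \<mu> (z \<mu>)" shows "cau (\<lambda>n. iE (psum z n))"
  unfolding cau_def
proof
  fix N
  have k: "iE (psum z n) - iE (psum z N) \<in> FL N" if "n \<ge> N" for n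
    by (rule FL_mono[OF psum_FL[OF assms that]]) simp
  have "iE (psum z m) - iE (psum z n) \<in> FL N" if "m \<ge> N" "n \<ge> N" for m n
    using FL_diff[OF k[OF that(1)] k[OF that(2)]] by simp
  then show "\<exists>k. \<forall>m\<ge>k. \<forall>n\<ge>k. iE (psum z m) - iE (psum z n) \<in> FL N" by blast
qed

lemma hat_identity: assumes "\<And>\<mu>. homog \<mu> (z \<mu>)"
  shows "to_hat D (cls D p) \<otimes>\<^bsub>U_hat D\<^esub> hat_sum D (\<lambda>\<mu>. cls D (iE (z \<mu>)))
    = hat_sum D (\<lambda>\<mu>. cls D (iE (z \<mu>))) \<otimes>\<^bsub>U_hat D\<^esub> to_hat D (cls D r)
    \<longleftrightarrow> nul (\<lambda>n. p * iE (psum z n) - iE (psum z n) * r)"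
proof -
  note c = cau_psum[OF assms] cau_const
  show ?thesis unfolding hat_sum_psum to_hat_def
    by (simp only: hat_lim_mult[OF c(2,1)] hat_lim_mult[OF c(1,2)] hat_lim_eq[OF cau_mult[OF c(2,1)] cau_mult[OF c(1,2)]])
qed

end

section \<open>Uniqueness\<close>

sublocale isat \<subseteq> rdatum D
  by unfold_locales (rule root_datum)

locale isat_bar = isat D
  for D :: "('i::finite, 'x::ab_group_add, 'y::ab_group_add) isatake_datum" +
  fixes \<psi> \<psi>\<^sub>\<iota> :: "('i, 'y) Uelem \<Rightarrow> ('i, 'y) Uelem"
  assumes bar: "bar_involution D \<psi>" and ibar: "ibar_involution D \<psi>\<^sub>\<iota>"
begin

lemma psi_hom: "\<psi> \<in> ring_hom UU UU" using bar by (simp add: bar_involution_def)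

lemma psi_mult: "\<psi> (cls D a \<otimes>\<^bsub>UU\<^esub> cls D b) = \<psi> (cls D a) \<otimes>\<^bsub>UU\<^esub> \<psi> (cls D b)"
  and psi_add: "\<psi> (cls D a \<oplus>\<^bsub>UU\<^esub> cls D b) = \<psi> (cls D a) \<oplus>\<^bsub>UU\<^esub> \<psi> (cls D b)"
  and psi_one: "\<psi> (cls D 1) = cls D 1"
  and psi_smul: "\<psi> (cls D (c \<cdot> a)) = smultU D (qbar c) (\<psi> (cls D a))"
  and psi_gen: "\<psi> (UE D i) = UE D i" "\<psi> (UF D i) = UF D i" "\<psi> (UJ D \<mu>) = UJ D \<mu>"
    "\<psi> (UK D \<mu>) = cls D (fJ \<mu> * fK (- \<mu>))"
  using bar ring_hom_mult[OF psi_hom, of "cls D a" "cls D b"] ring_hom_add[OF psi_hom, of "cls D a" "cls D b"]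
    ring_hom_one[OF psi_hom]
  by (simp_all only: bar_involution_def cls_carrier cls_one cls_mult simp_thms flip: cls_smul)

definition fB :: "'i \<Rightarrow> ('i, 'y) free_alg" where
  "fB i = fF i + vs i \<cdot> (fE (\<tau> i) * fK (- kap i))"

definition fB' :: "'i \<Rightarrow> ('i, 'y) free_alg" where
  "fB' i = fF i + qbar (vs i) \<cdot> (fE (\<tau> i) * (fJ (- kap i) * fK (kap i)))"

lemma UB_cls: "UB D i = cls D (fB i)"
  by (simp add: UB_def fB_def kap_def[symmetric] cls_mult cls_smul cls_add)

lemma psi_UB: "\<psi> (UB D i) = cls D (fB' i)"
proof -
  have "\<psi> (UB D i) = \<psi> (UF D i \<oplus>\<^bsub>UU\<^esub> cls D (vs i \<cdot> (fE (\<tau> i) * fK (- kap i))))"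
    by (simp add: UB_cls fB_def cls_add)
  also have "\<dots> = UF D i \<oplus>\<^bsub>UU\<^esub> smultU D (qbar (vs i)) (\<psi> (UE D (\<tau> i) \<otimes>\<^bsub>UU\<^esub> UK D (- kap i)))"
    by (simp add: psi_add psi_smul psi_gen cls_mult)
  also have "\<dots> = cls D (fB' i)"
    unfolding psi_mult by (simp add: psi_gen cls_mult cls_smul cls_add fB'_def)
  finally show ?thesis .
qed

lemma U_iota_gen: "UB D i \<in> U_iota D" "Jtilde D i \<in> U_iota D" "\<mu> \<in> Y_iota D \<Longrightarrow> UK D \<mu> \<in> U_iota D"
  "cls D (c \<cdot> 1) \<in> U_iota D"
  unfolding U_iota_def subalgebra_gen_def scal_one[symmetric] by (auto intro: generate_ring.incl)

lemma U_iota_carrier: "u \<in> U_iota D \<Longrightarrow> u \<in> carrier UU"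
  unfolding U_iota_def by (rule generate_ring_carrier) (auto simp: UB_cls)

lemma psi_iota_hom:
  "u \<in> U_iota D \<Longrightarrow> v \<in> U_iota D \<Longrightarrow> \<psi>\<^sub>\<iota> (u \<otimes>\<^bsub>UU\<^esub> v) = \<psi>\<^sub>\<iota> u \<otimes>\<^bsub>UU\<^esub> \<psi>\<^sub>\<iota> v"
  "u \<in> U_iota D \<Longrightarrow> v \<in> U_iota D \<Longrightarrow> \<psi>\<^sub>\<iota> (u \<oplus>\<^bsub>UU\<^esub> v) = \<psi>\<^sub>\<iota> u \<oplus>\<^bsub>UU\<^esub> \<psi>\<^sub>\<iota> v"
  "\<psi>\<^sub>\<iota> (cls D 1) = cls D 1"
  "cls D a \<in> U_iota D \<Longrightarrow> \<psi>\<^sub>\<iota> (cls D (c \<cdot> a)) = smultU D (qbar c) (\<psi>\<^sub>\<iota> (cls D a))"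
proof -
  have h: "\<psi>\<^sub>\<iota> \<in> ring_hom (UU\<lparr>carrier := U_iota D\<rparr>) UU"
    and s: "\<And>c u. u \<in> U_iota D \<Longrightarrow> \<psi>\<^sub>\<iota> (smultU D c u) = smultU D (qbar c) (\<psi>\<^sub>\<iota> u)"
    using ibar by (auto simp: ibar_involution_def)
  show "u \<in> U_iota D \<Longrightarrow> v \<in> U_iota D \<Longrightarrow> \<psi>\<^sub>\<iota> (u \<otimes>\<^bsub>UU\<^esub> v) = \<psi>\<^sub>\<iota> u \<otimes>\<^bsub>UU\<^esub> \<psi>\<^sub>\<iota> v"
    "u \<in> U_iota D \<Longrightarrow> v \<in> U_iota D \<Longrightarrow> \<psi>\<^sub>\<iota> (u \<oplus>\<^bsub>UU\<^esub> v) = \<psi>\<^sub>\<iota> u \<oplus>\<^bsub>UU\<^esub> \<psi>\<^sub>\<iota> v"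
    using ring_hom_mult[OF h, of u v] ring_hom_add[OF h, of u v] by simp_all
  show "\<psi>\<^sub>\<iota> (cls D 1) = cls D 1" using ring_hom_one[OF h] by (simp add: cls_one)
  show "cls D a \<in> U_iota D \<Longrightarrow> \<psi>\<^sub>\<iota> (cls D (c \<cdot> a)) = smultU D (qbar c) (\<psi>\<^sub>\<iota> (cls D a))"
    using s[of "cls D a" c] by (simp add: cls_smul)
qed

lemma U_iota_one: "cls D 1 \<in> U_iota D"
  using U_iota_gen(4)[of 1] by simp

lemma quasi_K_iE:
  assumes "quasi_K_matrix D \<psi> \<psi>\<^sub>\<iota> \<Upsilon>"
  obtains z where "\<forall>\<mu>. homog \<mu> (z \<mu>)" "\<forall>\<mu>. \<Upsilon> \<mu> = cls D (iE (z \<mu>))" "iE (z (\<lambda>_. 0)) - 1 \<in> II"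
    "\<forall>i. nul (\<lambda>n. fB i * iE (psum z n) - iE (psum z n) * fB' i)"
proof -
  have "\<forall>\<mu>. \<exists>x. homog \<mu> x \<and> \<Upsilon> \<mu> = cls D (iE x)"
    using assms by (auto simp: quasi_K_matrix_def U_plus_iff)
  then obtain z where z: "\<And>\<mu>. homog \<mu> (z \<mu>)" "\<And>\<mu>. \<Upsilon> \<mu> = cls D (iE (z \<mu>))" by metis
  then have \<Upsilon>: "\<Upsilon> = (\<lambda>\<mu>. cls D (iE (z \<mu>)))" by blast
  have "iE (z (\<lambda>_. 0)) - 1 \<in> II"
    using assms unfolding quasi_K_matrix_def \<Upsilon> cls_one cls_eq by blast
  moreover have "nul (\<lambda>n. fB i * iE (psum z n) - iE (psum z n) * fB' i)" for i
  proof -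
    have "\<psi>\<^sub>\<iota> (UB D i) = cls D (fB i)" using ibar by (simp add: ibar_involution_def UB_cls)
    moreover have "to_hat D (\<psi>\<^sub>\<iota> (UB D i)) \<otimes>\<^bsub>U_hat D\<^esub> hat_sum D \<Upsilon> = hat_sum D \<Upsilon> \<otimes>\<^bsub>U_hat D\<^esub> to_hat D (\<psi> (UB D i))"
      using assms U_iota_gen(1) unfolding quasi_K_matrix_def by blast
    ultimately show ?thesis unfolding psi_UB \<Upsilon> using hat_identity[of z, OF z(1)] by simp
  qed
  ultimately show ?thesis using that z by blast
qed

lemma act_diff_FL: "x - y \<in> FL N \<Longrightarrow> bd n m \<Longrightarrow> n < N \<Longrightarrow> act y m \<in> NM \<Longrightarrow> act x m \<in> NM"
  using MM.N_add[OF act_FL[of "x - y" N n m], of "act y m"] by (simp add: RM.rep_simps)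

text \<open>Let T be the partial sum. The identity gives T F_i l = B_i T l - c T (E J K l) up to
  high order, with c the conjugate parameter. T is known on both l and E J K l, the bound not being
  raised by E and the torus. Vanishing on the highest weight vectors therefore propagates to all
  bounded vectors.\<close>

lemma act_psum_NM:
  assumes z: "\<And>\<mu>. homog \<mu> (z \<mu>)" and 0: "iE (z (\<lambda>_. 0)) \<in> II"
    and B: "\<And>i. nul (\<lambda>n. fB i * iE (psum z n) - iE (psum z n) * fB' i)"
  shows "bd k m \<Longrightarrow> k \<le> n \<Longrightarrow> act (iE (psum z n)) m \<in> NM"
proof (induction k arbitrary: m n)
  case 0
  have "{\<mu> :: 'i \<Rightarrow> nat. ht \<mu> \<le> 0} = {\<lambda>_. 0}" by (auto simp: ht_def)
  then have "psum z 0 = z (\<lambda>_. 0)" by (simp add: psum_def)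
  moreover have "m \<in> Bd" using 0 by (auto simp: Bd_def)
  ultimately have "act (iE (psum z 0)) m \<in> NM" using act_II assms(2) by metis
  then show ?case by (rule act_diff_FL[OF psum_FL[OF z le0] 0(1) zero_less_Suc])
next
  case (Suc k)
  have F: "act (iE (psum z n)) (FM i l) \<in> NM" if l: "bd k l" for i l
  proof -
    obtain n0 where n0: "\<forall>n\<ge>n0. fB i * iE (psum z n) - iE (psum z n) * fB' i \<in> FL (Suc k)"
      using B[of i] unfolding nul_def by blast
    \<comment> \<open>From \<open>n1\<close> on, the error of the identity lies deep enough to kill
      vectors of length at most k. The return from \<open>n1\<close> to n is possible because the
      two partial sums differ only in heights above n, too large for F_i l.\<close>
    define n1 where "n1 = max n0 n"
    let ?T = "iE (psum z n1)" and ?X = "fE (\<tau> i) * (fJ (- kap i) * fK (kap i))"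
    have k: "k \<le> n1" using Suc.prems unfolding n1_def by simp
    have "act (fB i * ?T) l \<in> NM" unfolding RM.rep_mult by (rule act_NM[OF Suc.IH[OF l k]])
    moreover have "act (fB i * ?T - ?T * fB' i) l \<in> NM"
      by (rule act_FL[OF _ l lessI]) (use n0 in \<open>simp add: n1_def\<close>)
    ultimately have 1: "act (?T * fB' i) l \<in> NM"
      using MM.N_diff[of "act (fB i * ?T) l" "act (fB i * ?T - ?T * fB' i) l"] by (simp add: RM.rep_simps)
    have "bd k (act ?X l)" unfolding RM.rep_mult act_gen opM.simps by (intro bd_EM' bd_JM bd_KM l)
    then have 2: "act ?T (act ?X l) \<in> NM" using Suc.IH k by blast
    have e: "act (?T * fB' i) l = act ?T (FM i l) + sM (qbar (vs i)) (act ?T (act ?X l))"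
      by (simp add: fB'_def RM.rep_mult RM.rep_simps act_gen lop_add[OF RM.lop_rep] lop_scale[OF RM.lop_rep])
    have T: "act ?T (FM i l) \<in> NM"
      using MM.N_diff[OF 1 MM.N_scale[OF 2, of "qbar (vs i)"]] unfolding e by simp
    have "iE (psum z n1) - iE (psum z n) \<in> FL (Suc (Suc k))"
      by (rule FL_mono[OF psum_FL[OF z]]) (use Suc.prems in \<open>simp_all add: n1_def\<close>)
    then have "iE (psum z n) - iE (psum z n1) \<in> FL (Suc (Suc k))"
      using FL_minus[of "iE (psum z n1) - iE (psum z n)"] by simp
    from act_diff_FL[OF this bd_FM[OF l] lessI T] show ?thesis .
  qed
  obtain e l where e: "bd 0 e" and l: "\<And>j. bd k (l j)" and m: "m = e + (\<Sum>j\<in>UNIV. FM j (l j))"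
    using bd_Suc_cases[OF Suc.prems(1)] by metis
  have "act (iE (psum z n)) e \<in> NM"
    by (rule Suc.IH[OF bd_mono[OF e]]) (use Suc.prems in simp_all)
  then show ?case
    unfolding m lop_add[OF RM.lop_rep] lop_sum[OF RM.lop_rep] by (intro MM.N_add MM.N_sum F l)
qed

lemma uniqueness:
  assumes "quasi_K_matrix D \<psi> \<psi>\<^sub>\<iota> \<Upsilon>" "quasi_K_matrix D \<psi> \<psi>\<^sub>\<iota> \<Upsilon>'"
  shows "\<Upsilon> = \<Upsilon>'"
proof
  obtain z where z: "\<forall>\<mu>. homog \<mu> (z \<mu>)" "\<forall>\<mu>. \<Upsilon> \<mu> = cls D (iE (z \<mu>))" "iE (z (\<lambda>_. 0)) - 1 \<in> II"
    "\<forall>i. nul (\<lambda>n. fB i * iE (psum z n) - iE (psum z n) * fB' i)"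
    by (rule quasi_K_iE[OF assms(1)])
  obtain y where y: "\<forall>\<mu>. homog \<mu> (y \<mu>)" "\<forall>\<mu>. \<Upsilon>' \<mu> = cls D (iE (y \<mu>))" "iE (y (\<lambda>_. 0)) - 1 \<in> II"
    "\<forall>i. nul (\<lambda>n. fB i * iE (psum y n) - iE (psum y n) * fB' i)"
    by (rule quasi_K_iE[OF assms(2)])
  define d where "d \<mu> = z \<mu> - y \<mu>" for \<mu>
  have d: "homog \<mu> (d \<mu>)" for \<mu> unfolding d_def using z y by (intro spn_diff) auto
  have p: "psum d n = psum z n - psum y n" for n by (simp add: psum_def d_def sum_subtractf)
  have 0: "iE (d (\<lambda>_. 0)) \<in> II" using II_diff[OF z(3) y(3)] by (simp add: d_def iE_simps)
  have B: "nul (\<lambda>n. fB i * iE (psum d n) - iE (psum d n) * fB' i)" for i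
    using nul_diff[OF z(4)[rule_format, of i] y(4)[rule_format, of i]] by (simp add: p iE_simps left_diff_distrib right_diff_distrib algebra_simps)
  fix \<mu>
  have "d \<mu> \<in> Rad"
  proof (rule act_nondegenerate[OF d])
    fix m assume "bd (ht \<mu>) m"
    from act_psum_NM[OF d 0 B this, of "ht \<mu>"]
    show "act (iE (\<Sum>\<nu> | ht \<nu> \<le> ht \<mu>. d \<nu>)) m \<in> NM" by (simp add: psum_def)
  qed simp
  then have "iE (d \<mu>) \<in> II" by (intro iE_Ser Rad_Ser)
  then show "\<Upsilon> \<mu> = \<Upsilon>' \<mu>" by (simp add: z y cls_eq d_def iE_simps)
qed

end

section \<open>Existence\<close>

context rdatum
begin

lemma J_neg: "fJ (- \<mu>) - fJ \<mu> \<in> II"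
proof -
  have 1: "fJ (- \<mu>) * (fJ (\<mu> + \<mu>) - 1) \<in> II" by (rule II_left[OF rel_J2])
  have 2: "fJ (- \<mu>) * fJ (\<mu> + \<mu>) - fJ \<mu> \<in> II" using rel_JJ[of "- \<mu>" "\<mu> + \<mu>"] by simp
  from II_diff[OF 2 1] show ?thesis by (simp add: right_diff_distrib)
qed

lemma nul_shift: assumes "nul (\<lambda>n. a (n + k))" shows "nul a"
  unfolding nul_def
proof
  fix N
  obtain j where j: "\<forall>n\<ge>j. a (n + k) \<in> FL N" using assms unfolding nul_def by blast
  have "a n \<in> FL N" if "n \<ge> j + k" for n
    using j[rule_format, of "n - k"] that by simp
  then show "\<exists>j. \<forall>n\<ge>j. a n \<in> FL N" by blast
qed

lemma nul_cong: "nul b \<Longrightarrow> (\<And>n. a n - b n \<in> II) \<Longrightarrow> nul a"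
  using nul_add[of b "\<lambda>n. a n - b n"] nul_II[of "\<lambda>n. a n - b n"] by simp

end

locale isat_good_bar = isat_bar D \<psi> \<psi>\<^sub>\<iota> + isat_good D
  for D :: "('i::finite, 'x::ab_group_add, 'y::ab_group_add) isatake_datum" and \<psi> \<psi>\<^sub>\<iota>
begin

lemma psum_Ser:
  assumes "\<And>\<nu>. f (inc i (inc j \<nu>)) - h \<nu> \<in> Ser" "\<And>\<mu>. (\<And>\<nu>. \<mu> \<noteq> inc i (inc j \<nu>)) \<Longrightarrow> f \<mu> \<in> Ser"
  shows "(\<Sum>\<mu> | ht \<mu> \<le> n + 2. f \<mu>) - (\<Sum>\<nu> | ht \<nu> \<le> n. h \<nu>) \<in> Ser"
proof -
  let ?A = "{\<mu>. ht \<mu> \<le> n + 2}" and ?B = "{\<nu>. ht \<nu> \<le> n}" and ?e = "\<lambda>\<nu>. inc i (inc j \<nu>)"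
  have inj: "inj_on ?e ?B"
  proof (rule inj_onI)
    fix \<nu> \<nu>' assume e: "?e \<nu> = ?e \<nu>'"
    show "\<nu> = \<nu>'"
    proof
      fix k show "\<nu> k = \<nu>' k" using fun_cong[OF e, of k] by simp
    qed
  qed
  have "?e ` ?B \<subseteq> ?A" by (auto simp: ht_inc)
  then have "sum f ?A = sum f (?A - ?e ` ?B) + sum f (?e ` ?B)"
    by (rule sum.subset_diff[OF _ finite_ht])
  also have "sum f (?e ` ?B) = (\<Sum>\<nu>\<in>?B. f (?e \<nu>))" by (simp add: sum.reindex[OF inj])
  finally have "sum f ?A - sum h ?B = sum f (?A - ?e ` ?B) + (\<Sum>\<nu>\<in>?B. f (?e \<nu>) - h \<nu>)"
    by (simp add: sum_subtractf)
  moreover have "f \<mu> \<in> Ser" if "\<mu> \<in> ?A - ?e ` ?B" for \<mu>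
  proof (rule assms(2))
    fix \<nu> show "\<mu> \<noteq> ?e \<nu>" using that by (auto simp: ht_inc)
  qed
  ultimately show ?thesis using assms(1) by (auto intro!: Ser_add Ser_sum)
qed

abbreviation "X n \<equiv> psum xm n"

lemma ld_psum: "ld i (X (n + 2)) - cl i \<cdot> (wd [\<tau> i] * X n) \<in> Ser"
  using psum_Ser[of "\<lambda>\<mu>. ld i (xm \<mu>)" "\<tau> i" i "\<lambda>\<nu>. cl i \<cdot> (wd [\<tau> i] * xm \<nu>)" n, OF ld_xm ld_xm_0]
  by (simp add: psum_def lin_sum[OF lin_ld] sum_distrib_left fa.scale_sum_right)

lemma rd_psum: "rd i (X (n + 2)) - cr i \<cdot> (X n * wd [\<tau> i]) \<in> Ser"
  using psum_Ser[of "\<lambda>\<mu>. rd i (xm \<mu>)" "\<tau> i" i "\<lambda>\<nu>. cr i \<cdot> (xm \<nu> * wd [\<tau> i])" n, OF rd_xm rd_xm_0]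
  by (simp add: psum_def lin_sum[OF lin_rd] sum_distrib_right fa.scale_sum_right)

lemma psum_Dg: "(\<And>k. f k * f (\<tau> k) = 1) \<Longrightarrow> Dg f (X n) = X n"
  unfolding psum_def lin_sum[OF lin_Dg] by (intro sum.cong refl xm_Dg)

lemma Sgn_psum: "Sgn i (X n) = X n"
  unfolding Sgn_def by (rule psum_Dg) simp

text \<open>With x and y the partial sums up to height n + 2 and n, R and L stand for the
  derivatives of x. Once the recursions replace them by multiples of y, what remains is an
  expression in x - y, which tends to 0. Stated for arbitrary elements, so that the claim is a
  polynomial identity with visible multiples of the relations.\<close>

lemma B_combination:
  fixes F E K' J J' K x y R L :: "('i, 'y) free_alg"
  assumes "x * F - (F * x + hi \<cdot> (R * (J * K) - K' * L)) \<in> II" "R - c \<cdot> (y * E) \<in> II" "L - l \<cdot> (E * y) \<in> II"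
    "K' * E - q \<cdot> (E * K') \<in> II" "J' - J \<in> II" "hi * c = - vb" "hi * l * q = - v"
  shows "(F + v \<cdot> (E * K')) * x - x * (F + vb \<cdot> (E * (J' * K)))
    - (v \<cdot> (E * K' * (x - y)) - vb \<cdot> ((x - y) * (E * (J * K)))) \<in> II"
proof -
  have eq: "(F + v \<cdot> (E * K')) * x - x * (F + vb \<cdot> (E * (J' * K)))
    - (v \<cdot> (E * K' * (x - y)) - vb \<cdot> ((x - y) * (E * (J * K))))
    = hi \<cdot> (K' * (L - l \<cdot> (E * y))) + (hi * l) \<cdot> ((K' * E - q \<cdot> (E * K')) * y)
      - vb \<cdot> (x * E * ((J' - J) * K)) - hi \<cdot> ((R - c \<cdot> (y * E)) * (J * K))
      - (x * F - (F * x + hi \<cdot> (R * (J * K) - K' * L)))"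
    using assms(6,7)
    by (simp add: algebra_simps fa.scale_right_diff_distrib fa.scale_right_distrib)
  show ?thesis unfolding eq
    by (intro II_diff II_add II_smul II_left[OF assms(3)] II_right[OF assms(4)] II_left[OF II_right[OF assms(5)]]
        II_right[OF assms(2)] assms(1))
qed

lemma nul_B: "nul (\<lambda>n. fB i * iE (X n) - iE (X n) * fB' i)"
proof (rule nul_shift[where k = 2])
  let ?E = "fE (\<tau> i)" and ?K' = "fK (- kap i)" and ?J = "fJ (kap i)" and ?K = "fK (kap i)"
  have pp: "ppow (pr i * pr i) = ppow (pr i)" by (rule ppow_cong) simp
  have h: "inverse (hh i) * hh i = 1" using pi_ext_mult_inverse[OF unit_hh[of i]] by (simp add: mult.commute)
  have c: "fB i * iE (X (n + 2)) - iE (X (n + 2)) * fB' i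
    - (vs i \<cdot> (?E * ?K' * (iE (X (n + 2)) - iE (X n))) - qbar (vs i) \<cdot> ((iE (X (n + 2)) - iE (X n)) * (?E * (?J * ?K)))) \<in> II"
    for n
    unfolding fB_def fB'_def
  proof (rule B_combination)
    show "iE (X (n + 2)) * fF i - (fF i * iE (X (n + 2)) + inverse (hh i) \<cdot> (iE (rd i (X (n + 2))) * (?J * ?K)
      - ?K' * iE (Sgn i (ld i (X (n + 2)))))) \<in> II"
      using iE_F[of "X (n + 2)" i] by (simp only: Sgn_psum)
    show "iE (rd i (X (n + 2))) - cr i \<cdot> (iE (X n) * ?E) \<in> II"
      using iE_Ser[OF rd_psum[of i n]] by (simp add: iE_simps iE_mult iE_gen)
    have "Sgn i (ld i (X (n + 2)) - cl i \<cdot> (wd [\<tau> i] * X n))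
      = Sgn i (ld i (X (n + 2))) - (cl i * ppow (pr i)) \<cdot> (wd [\<tau> i] * X n)"
      using pp Sgn_psum[of i n]
      by (simp add: lin_diff[OF lin_Sgn] lin_smul[OF lin_Sgn]) (simp add: Sgn_def Dg_mult)
    then show "iE (Sgn i (ld i (X (n + 2)))) - (cl i * ppow (pr i)) \<cdot> (?E * iE (X n)) \<in> II"
      using iE_Ser[OF Ser_Dg[OF ld_psum[of i n], of "\<lambda>k. ppow (pr i * pr k)", folded Sgn_def]]
      by (simp add: iE_simps iE_mult iE_gen)
    show "?K' * ?E - qpow (- fm i (\<tau> i)) \<cdot> (?E * ?K') \<in> II"
      using rel_KE[of "- kap i" "\<tau> i"] by (simp add: prg_neg prg_kap)
    show "inverse (hh i) * cr i = - qbar (vs i)"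
      using h by (simp add: cr_def flip: mult.assoc)
    have "inverse (hh i) * (cl i * ppow (pr i)) * qpow (- fm i (\<tau> i))
      = - ((inverse (hh i) * hh i) * vs i * (ppow (pr i) * ppow (pr i)) * (qpow (fm i (\<tau> i)) * qpow (- fm i (\<tau> i))))"
      by (simp only: cl_def mult_ac mult_minus_left mult_minus_right)
    then show "inverse (hh i) * (cl i * ppow (pr i)) * qpow (- fm i (\<tau> i)) = - vs i"
      by (simp add: h qpow_uminus)
  qed (rule J_neg)
  have d: "nul (\<lambda>n. iE (X (n + 2)) - iE (X n))"
    by (rule nul_FL[of _ 0]) (rule FL_mono[OF psum_FL[OF xm_homog]], simp_all)
  show "nul (\<lambda>n. fB i * iE (X (n + 2)) - iE (X (n + 2)) * fB' i)"
    by (rule nul_cong[OF nul_diff[OF nul_smul[OF nul_left[OF d]] nul_smul[OF nul_right[OF d cau_const]]] c])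
qed

lemma J_commutes: "fJ (kap i) * iE x - iE x * fJ (kap i) \<in> II"
  using J_iE[of "kap i" x] by (simp add: prg_kap ppow_fm Dg_one)

lemma pg_tau: assumes "\<mu> \<in> Y_iota D" shows "pg \<mu> (\<tau> k) = - pg \<mu> k"
proof -
  have X: "tauX D (root D (\<tau> k)) = root D k" and p: "prg (tauY D \<mu>) (tauX D (root D (\<tau> k))) = pg \<mu> (\<tau> k)"
    using involution unfolding diagram_involution_def by (metis tau_tau)+
  have "tauY D \<mu> = - \<mu>" using assms by (simp add: Y_iota_def)
  then have "pg \<mu> (\<tau> k) = prg (- \<mu>) (root D k)" using X p by simp
  then show ?thesis by (simp add: prg_neg)
qed

lemma K_psum: assumes "\<mu> \<in> Y_iota D"
  shows "(fJ \<mu> * fK (- \<mu>)) * iE (X n) - iE (X n) * (fJ \<mu> * fK (- \<mu>)) \<in> II"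
proof -
  have 1: "Dg (\<lambda>k. qpow (pg (- \<mu>) k)) (X n) = X n"
    by (rule psum_Dg) (simp add: pg_tau[OF assms] prg_neg qpow_uminus mult.commute)
  have 2: "Dg (\<lambda>k. ppow (nat \<bar>pg \<mu> k\<bar>)) (X n) = X n"
    by (rule psum_Dg) (simp add: pg_tau[OF assms])
  have "fJ \<mu> * (fK (- \<mu>) * iE (X n) - iE (X n) * fK (- \<mu>)) + (fJ \<mu> * iE (X n) - iE (X n) * fJ \<mu>) * fK (- \<mu>) \<in> II"
    using II_add[OF II_left[OF K_iE[of "- \<mu>" "X n", unfolded 1]] II_right[OF J_iE[of \<mu> "X n", unfolded 2]]] .
  then show ?thesis by (simp add: algebra_simps)
qed

section \<open>From the generators to the whole \<iota>quantum covering group\<close>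

definition intertw :: "('i, 'y) Uelem \<Rightarrow> bool" where
  "intertw u \<longleftrightarrow> (\<exists>a b. \<psi>\<^sub>\<iota> u = cls D a \<and> \<psi> u = cls D b \<and> nul (\<lambda>n. a * iE (X n) - iE (X n) * b))"

lemma intertw_smul: assumes "intertw (cls D a)" "cls D a \<in> U_iota D" shows "intertw (cls D (c \<cdot> a))"
proof -
  obtain x y where "\<psi>\<^sub>\<iota> (cls D a) = cls D x" "\<psi> (cls D a) = cls D y" "nul (\<lambda>n. x * iE (X n) - iE (X n) * y)"
    using assms(1) by (auto simp: intertw_def)
  then have "\<psi>\<^sub>\<iota> (cls D (c \<cdot> a)) = cls D (qbar c \<cdot> x)" "\<psi> (cls D (c \<cdot> a)) = cls D (qbar c \<cdot> y)"
    "nul (\<lambda>n. (qbar c \<cdot> x) * iE (X n) - iE (X n) * (qbar c \<cdot> y))"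
    using nul_smul[of "\<lambda>n. x * iE (X n) - iE (X n) * y" "qbar c"]
    by (simp_all add: psi_iota_hom(4)[OF assms(2)] psi_smul cls_smul fa.scale_right_diff_distrib)
  then show ?thesis unfolding intertw_def by blast
qed

lemma intertw_one: "intertw (cls D 1)"
  unfolding intertw_def by (intro exI[of _ 1] conjI psi_iota_hom(3) psi_one) (simp add: nul_0)

lemma intertw_incl:
  assumes "u \<in> range (\<lambda>c. cls D (scal c)) \<union> (range (UB D) \<union> range (Jtilde D) \<union> UK D ` Y_iota D)"
  shows "intertw u"
proof -
  from assms consider c where "u = cls D (c \<cdot> 1)" | i where "u = UB D i" | i where "u = UJ D (kap i)"
    | \<mu> where "\<mu> \<in> Y_iota D" "u = UK D \<mu>"
    by (auto simp: scal_one kap_def)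
  then show ?thesis
  proof cases
    case 1 then show ?thesis using intertw_smul[OF intertw_one U_iota_one] by simp
  next
    case (2 i)
    then have "\<psi>\<^sub>\<iota> u = cls D (fB i)" using ibar by (simp add: ibar_involution_def UB_cls)
    then show ?thesis using 2 psi_UB[of i] nul_B[of i] unfolding intertw_def by blast
  next
    case (3 i)
    then have "\<psi>\<^sub>\<iota> u = UJ D (kap i)" using ibar by (simp add: ibar_involution_def kap_def)
    moreover have "nul (\<lambda>n. fJ (kap i) * iE (X n) - iE (X n) * fJ (kap i))"
      by (rule nul_II) (rule J_commutes)
    ultimately show ?thesis using 3 psi_gen(3)[of "kap i"] unfolding intertw_def by blast
  next
    case (4 \<mu>)
    then have "\<psi>\<^sub>\<iota> u = cls D (fJ \<mu> * fK (- \<mu>))" using ibar by (simp add: ibar_involution_def cls_mult)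
    moreover have "nul (\<lambda>n. (fJ \<mu> * fK (- \<mu>)) * iE (X n) - iE (X n) * (fJ \<mu> * fK (- \<mu>)))"
      by (rule nul_II) (rule K_psum[OF 4(1)])
    ultimately show ?thesis using 4 psi_gen(4)[of \<mu>] unfolding intertw_def by blast
  qed
qed

lemma intertw_U_iota: assumes "u \<in> U_iota D" shows "intertw u"
proof -
  let ?S = "range (\<lambda>c. cls D (scal c)) \<union> (range (UB D) \<union> range (Jtilde D) \<union> UK D ` Y_iota D)"
  have S: "v \<in> U_iota D \<longleftrightarrow> v \<in> generate_ring UU ?S" for v by (simp add: U_iota_def subalgebra_gen_def)
  from assms have "u \<in> generate_ring UU ?S" by (simp only: S)
  then show ?thesis
  proof (induction rule: generate_ring.induct)
    case one
    then show ?case using intertw_one by (simp add: cls_one)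
  next
    case (incl h)
    then show ?case by (rule intertw_incl)
  next
    case (a_inv h)
    then have h: "h \<in> U_iota D" by (simp only: S)
    then obtain a where a: "h = cls D a" using cls_cases U_iota_carrier by metis
    have "intertw (cls D ((- 1) \<cdot> a))" by (rule intertw_smul) (use a_inv h a in auto)
    then show ?case using a cls_uminus[of a] by simp
  next
    case (eng_add g h)
    then obtain a b c d where 1: "\<psi>\<^sub>\<iota> g = cls D a" "\<psi> g = cls D b" "nul (\<lambda>n. a * iE (X n) - iE (X n) * b)"
      and 2: "\<psi>\<^sub>\<iota> h = cls D c" "\<psi> h = cls D d" "nul (\<lambda>n. c * iE (X n) - iE (X n) * d)"
      by (auto simp: intertw_def)
    have gh: "g \<in> U_iota D" "h \<in> U_iota D" using eng_add by (simp_all only: S)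
    obtain g' h' where "g = cls D g'" "h = cls D h'" using gh cls_cases U_iota_carrier by metis
    then have "\<psi>\<^sub>\<iota> (g \<oplus>\<^bsub>UU\<^esub> h) = cls D (a + c)" "\<psi> (g \<oplus>\<^bsub>UU\<^esub> h) = cls D (b + d)"
      using psi_add[of g' h'] psi_iota_hom(2)[OF gh] 1 2 by (simp_all add: cls_add)
    moreover have "nul (\<lambda>n. (a + c) * iE (X n) - iE (X n) * (b + d))"
      using nul_add[OF 1(3) 2(3)] by (simp add: algebra_simps)
    ultimately show ?case unfolding intertw_def by blast
  next
    case (eng_mult g h)
    then obtain a b c d where 1: "\<psi>\<^sub>\<iota> g = cls D a" "\<psi> g = cls D b" "nul (\<lambda>n. a * iE (X n) - iE (X n) * b)"
      and 2: "\<psi>\<^sub>\<iota> h = cls D c" "\<psi> h = cls D d" "nul (\<lambda>n. c * iE (X n) - iE (X n) * d)"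
      by (auto simp: intertw_def)
    have gh: "g \<in> U_iota D" "h \<in> U_iota D" using eng_mult by (simp_all only: S)
    obtain g' h' where "g = cls D g'" "h = cls D h'" using gh cls_cases U_iota_carrier by metis
    then have "\<psi>\<^sub>\<iota> (g \<otimes>\<^bsub>UU\<^esub> h) = cls D (a * c)" "\<psi> (g \<otimes>\<^bsub>UU\<^esub> h) = cls D (b * d)"
      using psi_mult[of g' h'] psi_iota_hom(1)[OF gh] 1 2 by (simp_all add: cls_mult)
    moreover have "nul (\<lambda>n. a * (c * iE (X n) - iE (X n) * d) + (a * iE (X n) - iE (X n) * b) * d)"
      by (intro nul_add nul_left[OF 2(3)] nul_right[OF 1(3) cau_const])
    then have "nul (\<lambda>n. (a * c) * iE (X n) - iE (X n) * (b * d))" by (simp add: algebra_simps)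
    ultimately show ?case unfolding intertw_def by blast
  qed
qed

lemma existence: "quasi_K_matrix D \<psi> \<psi>\<^sub>\<iota> (\<lambda>\<mu>. cls D (iE (xm \<mu>)))"
  unfolding quasi_K_matrix_def
proof (intro conjI allI ballI)
  show "cls D (iE (xm \<mu>)) \<in> U_plus D \<mu>" for \<mu> using xm_homog U_plus_iff by blast
  show "cls D (iE (xm (\<lambda>_. 0))) = \<one>\<^bsub>UU\<^esub>" by (simp add: xm_0 iE_1 cls_one)
  fix u assume u: "u \<in> U_iota D"
  obtain a b where "\<psi>\<^sub>\<iota> u = cls D a" "\<psi> u = cls D b" "nul (\<lambda>n. a * iE (X n) - iE (X n) * b)"
    using intertw_U_iota[OF u] unfolding intertw_def by blast
  then show "to_hat D (\<psi>\<^sub>\<iota> u) \<otimes>\<^bsub>U_hat D\<^esub> hat_sum D (\<lambda>\<mu>. cls D (iE (xm \<mu>)))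
      = hat_sum D (\<lambda>\<mu>. cls D (iE (xm \<mu>))) \<otimes>\<^bsub>U_hat D\<^esub> to_hat D (\<psi> u)"
    using hat_identity[of xm a b] xm_homog by simp
qed

lemma quasi_K_theorem:
  "(\<exists>!\<Upsilon>. quasi_K_matrix D \<psi> \<psi>\<^sub>\<iota> \<Upsilon>) \<and>
   (\<forall>\<Upsilon>. quasi_K_matrix D \<psi> \<psi>\<^sub>\<iota> \<Upsilon> \<longrightarrow> (\<forall>\<mu>. odd (weight_par D \<mu>) \<longrightarrow> \<Upsilon> \<mu> = \<zero>\<^bsub>U D\<^esub>))"
proof (intro conjI allI impI)
  show "\<exists>!\<Upsilon>. quasi_K_matrix D \<psi> \<psi>\<^sub>\<iota> \<Upsilon>"
    using existence uniqueness by blast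
  fix \<Upsilon> \<mu> assume "quasi_K_matrix D \<psi> \<psi>\<^sub>\<iota> \<Upsilon>" and \<mu>: "odd (weight_par D \<mu>)"
  then have "\<Upsilon> = (\<lambda>\<mu>. cls D (iE (xm \<mu>)))" using existence uniqueness by blast
  then show "\<Upsilon> \<mu> = \<zero>\<^bsub>U D\<^esub>" by (simp add: xm_odd[OF \<mu>] iE_simps cls_zero)
qed

end

section \<open>Odd nodes paired with an orthogonal node\<close>

text \<open>With \<open>j = \<tau> i\<close> and \<open>Z = K\<^sub>i\<^sup>-\<^sup>1 K\<^sub>j\<^sup>-\<^sup>1\<close>, the element \<open>B\<^sub>i B\<^sub>j - \<pi> B\<^sub>j B\<^sub>i\<close> shows that
  \<open>(\<pi> - 1) Z\<close> lies in the \<open>\<iota>\<close>quantum covering group, and its bar conjugate is forced to be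
  \<open>w0 = (\<pi> - 1) (J\<^sub>i K\<^sub>i K\<^sub>j\<^sup>-\<^sup>1 + J\<^sub>j K\<^sub>j K\<^sub>i\<^sup>-\<^sup>1 - Z)\<close>. Since \<open>Z\<close> shifts \<open>F\<^sub>i\<close> by
  \<open>t = q\<^sub>i\<^sup>2\<close> and \<open>E\<^sub>j K\<^sub>i\<^sup>-\<^sup>1\<close> by \<open>t\<^sup>-\<^sup>1\<close>, it satisfies
  \<open>Z\<^sup>2 B\<^sub>i - (t + t\<^sup>-\<^sup>1) Z B\<^sub>i Z + B\<^sub>i Z\<^sup>2 = 0\<close>; the conjugate relation fails on the vacuum.\<close>

locale isat_odd_pair = isat_bar D \<psi> \<psi>\<^sub>\<iota>
  for D :: "('i::finite, 'x::ab_group_add, 'y::ab_group_add) isatake_datum" and \<psi> \<psi>\<^sub>\<iota> +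
  fixes i :: 'i
  assumes ni: "tau D i \<noteq> i" and a0: "cartan D i (tau D i) = 0" and odd: "par D i = 1"
begin

definition j where "j = \<tau> i"

lemma tj: "\<tau> i = j" "\<tau> j = i" and ij: "i \<noteq> j" "j \<noteq> i"
  using ni by (auto simp: j_def)

lemma f0: "fm i j = 0" "fm j i = 0" and c0: "ca i j = 0" "ca j i = 0" and fjj: "fm j j = fm i i"
  and pj: "pr j = 1" and hj: "hh j = hh i"
  using a0 fm_sym[of i j] odd fm_tau[of i i] hh_tau[of i] pr_tau[of i] by (simp_all add: ca_zero tj)

abbreviation "p \<equiv> ppow 1"
abbreviation "t \<equiv> qpow (fm i i)"
abbreviation "u \<equiv> qpow (- fm i i)"
abbreviation "v \<equiv> vs i"

lemma pp: "p * p = 1" "p * (p * x) = x"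
  by (simp_all flip: mult.assoc)

lemma tu: "t * u = 1" "u * t = 1"
  using qpow_uminus[of "fm i i"] by (simp_all add: mult.commute)

lemma vs_j: "vs j = v" and qbar_v: "qbar v = v"
proof -
  have "\<forall>i. \<tau> i \<noteq> i \<and> ca i (\<tau> i) = 0 \<longrightarrow> qbar (vs i) = vs i \<and> vs i = vs (\<tau> i)"
    using admissible unfolding admissible_parameters_def by (elim conjE)
  then have e: "qbar v = v \<and> v = vs j" using ni a0 tj by metis
  from e[THEN conjunct2] show "vs j = v" by (rule sym)
  from e[THEN conjunct1] show "qbar v = v" .
qed

lemma unit_v: "v dvd 1"
  using admissible unfolding admissible_parameters_def by blast

lemma qbar_hh: "qbar (hh i) = - hh i"
proof -
  have "ppow (dg i) = p" using dg_par[of i] odd by (intro ppow_cong) presburger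
  then have "qbar (qi D i) = p * qpow (- int (dg i))" "qbar (inverse (qi D i)) = p * qpow (int (dg i))"
    by (simp_all add: qi_qpow qbar_qpow inverse_qpow)
  moreover have "inverse (qi D i) = qpow (- int (dg i))" by (simp add: qi_qpow inverse_qpow)
  ultimately show ?thesis
    by (simp add: hh_def ppii_ppow odd qbar_hom qbar_ppow qi_qpow pp del: One_nat_def)
qed

lemma serre_zero:
  assumes "k \<noteq> l" "ca k l = 0" "pr k = 1" "pr l = 1"
  shows "serre D x k l = x l * x k - p \<cdot> (x k * x l)"
proof -
  have "serre D x k l = (\<Sum>n=0..sm k l. sc k l n \<cdot> (x k ^ n * x l * x k ^ (sm k l - n)))"
    unfolding serre_def Let_def sm_def[symmetric] by (simp only: sc_def scal_smul mult.assoc smul_mult_left)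
  then show ?thesis using sc_1[OF assms(1,2)] assms(3,4) by (simp add: sc_0)
qed

abbreviation "a \<equiv> kap i - kap j"
abbreviation "s \<equiv> kap i + kap j"
abbreviation "Zf \<equiv> fK (- s)"

lemma pg_s: "pg (- s) k = - fm i k - fm j k" and pg_a: "pg a k = fm i k - fm j k" "pg (- a) k = fm j k - fm i k"
  using prg_add[of "kap i" "kap j"] prg_add[of "kap i" "- kap j"] prg_neg[of s] prg_neg[of a]
  by (simp_all add: prg_neg prg_kap)

text \<open>The commutator of F + E K^-1 terms is expanded into four parts: the pure F and pure E
  parts vanish by the Serre relations for orthogonal odd nodes, and each mixed part reduces to the
  torus by a relation between E and F.\<close>

lemma G_combination:
  fixes F1 F2 E1 E2 K1 K2 K1' K2' J1 J2 Z Ka Kb :: "('i, 'y) free_alg"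
  assumes p: "p * p = 1"
    and s1: "F1 * F2 - p \<cdot> (F2 * F1) \<in> II" and s2: "E2 * E1 - p \<cdot> (E1 * E2) \<in> II"
    and c1: "K2' * F1 - F1 * K2' \<in> II" and c2: "K1' * F2 - F2 * K1' \<in> II"
    and e1: "E1 * F1 - p \<cdot> (F1 * E1) - hi \<cdot> (J1 * K1 - K1') \<in> II"
    and e2: "E2 * F2 - p \<cdot> (F2 * E2) - hi \<cdot> (J2 * K2 - K2') \<in> II"
    and m1: "K1' * E1 - u \<cdot> (E1 * K1') \<in> II" and m2: "K2' * E2 - u \<cdot> (E2 * K2') \<in> II"
    and z1: "K1' * K2' - Z \<in> II" and z2: "K2' * K1' - Z \<in> II"
    and ka: "K1 * K2' - Ka \<in> II" and kb: "K2 * K1' - Kb \<in> II"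
  shows "(F1 + v \<cdot> (E2 * K1')) * (F2 + v \<cdot> (E1 * K2')) - p \<cdot> ((F2 + v \<cdot> (E1 * K2')) * (F1 + v \<cdot> (E2 * K1')))
    - (v * hi) \<cdot> ((p - 1) \<cdot> Z + J2 * Kb - p \<cdot> (J1 * Ka)) \<in> II"
proof -
  have p': "p * (p * x) = x" for x using p by (simp flip: mult.assoc)
  have 1: "F1 * (E1 * K2') - p \<cdot> ((E1 * K2') * F1) - (- (p * hi)) \<cdot> (J1 * Ka - Z) \<in> II"
  proof -
    have "F1 * (E1 * K2') - p \<cdot> ((E1 * K2') * F1) - (- (p * hi)) \<cdot> (J1 * Ka - Z)
      = - (p \<cdot> (E1 * (K2' * F1 - F1 * K2'))) - p \<cdot> ((E1 * F1 - p \<cdot> (F1 * E1) - hi \<cdot> (J1 * K1 - K1')) * K2')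
        - (p * hi) \<cdot> (J1 * (K1 * K2' - Ka)) + (p * hi) \<cdot> (K1' * K2' - Z)"
      by (simp add: algebra_simps p p' fa.scale_right_diff_distrib fa.scale_right_distrib)
    then show ?thesis
      by (simp only:) (intro II_add II_diff II_minus II_smul II_left[OF c1] II_right[OF e1] II_left[OF ka] z1)
  qed
  have 2: "(E2 * K1') * F2 - p \<cdot> (F2 * (E2 * K1')) - hi \<cdot> (J2 * Kb - Z) \<in> II"
  proof -
    have "(E2 * K1') * F2 - p \<cdot> (F2 * (E2 * K1')) - hi \<cdot> (J2 * Kb - Z)
      = E2 * (K1' * F2 - F2 * K1') + (E2 * F2 - p \<cdot> (F2 * E2) - hi \<cdot> (J2 * K2 - K2')) * K1'
        + hi \<cdot> (J2 * (K2 * K1' - Kb)) - hi \<cdot> (K2' * K1' - Z)"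
      by (simp add: algebra_simps fa.scale_right_diff_distrib fa.scale_right_distrib)
    then show ?thesis
      by (simp only:) (intro II_add II_diff II_smul II_left[OF c2] II_right[OF e2] II_left[OF kb] z2)
  qed
  have 3: "(E2 * K1') * (E1 * K2') - p \<cdot> ((E1 * K2') * (E2 * K1')) \<in> II"
  proof -
    have "(E2 * K1') * (E1 * K2') - p \<cdot> ((E1 * K2') * (E2 * K1'))
      = E2 * ((K1' * E1 - u \<cdot> (E1 * K1')) * K2') - p \<cdot> (E1 * ((K2' * E2 - u \<cdot> (E2 * K2')) * K1'))
        + u \<cdot> ((E2 * E1 - p \<cdot> (E1 * E2)) * (K1' * K2')) + (u * p) \<cdot> (E1 * E2 * ((K1' * K2' - Z) - (K2' * K1' - Z)))"
      by (simp add: algebra_simps fa.scale_right_diff_distrib fa.scale_right_distrib)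
    then show ?thesis
      by (simp only:) (intro II_add II_diff II_smul II_left[OF II_right[OF m1]] II_left[OF II_right[OF m2]] II_right[OF s2] II_left II_diff z1 z2)
  qed
  have "(F1 + v \<cdot> (E2 * K1')) * (F2 + v \<cdot> (E1 * K2')) - p \<cdot> ((F2 + v \<cdot> (E1 * K2')) * (F1 + v \<cdot> (E2 * K1')))
    - (v * hi) \<cdot> ((p - 1) \<cdot> Z + J2 * Kb - p \<cdot> (J1 * Ka))
    = (F1 * F2 - p \<cdot> (F2 * F1)) + v \<cdot> (F1 * (E1 * K2') - p \<cdot> ((E1 * K2') * F1) - (- (p * hi)) \<cdot> (J1 * Ka - Z))
      + v \<cdot> ((E2 * K1') * F2 - p \<cdot> (F2 * (E2 * K1')) - hi \<cdot> (J2 * Kb - Z))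
      + (v * v) \<cdot> ((E2 * K1') * (E1 * K2') - p \<cdot> ((E1 * K2') * (E2 * K1')))"
    by (simp add: algebra_simps fa.scale_right_diff_distrib fa.scale_right_distrib fa.scale_left_diff_distrib)
  then show ?thesis by (simp only:) (intro II_add II_smul s1 1 2 3)
qed

lemma G_eq: "fB i * fB j - p \<cdot> (fB j * fB i)
  - (v * inverse (hh i)) \<cdot> ((p - 1) \<cdot> Zf + fJ (kap j) * fK (- a) - p \<cdot> (fJ (kap i) * fK a)) \<in> II"
  unfolding fB_def tj vs_j
proof (rule G_combination)
  show "fF i * fF j - p \<cdot> (fF j * fF i) \<in> II"
    using II_relator[OF serre_F[OF ij(2)]] serre_zero[OF ij(2) c0(2) pj odd] by metis
  show "fE j * fE i - p \<cdot> (fE i * fE j) \<in> II"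
    using II_relator[OF serre_E[OF ij(1)]] serre_zero[OF ij(1) c0(1) odd pj] by metis
  show "fK (- kap j) * fF i - fF i * fK (- kap j) \<in> II" "fK (- kap i) * fF j - fF j * fK (- kap i) \<in> II"
    using rel_KF[of "- kap j" i] rel_KF[of "- kap i" j] by (simp_all add: prg_neg prg_kap f0)
  show "fE i * fF i - p \<cdot> (fF i * fE i) - inverse (hh i) \<cdot> (fJ (kap i) * fK (kap i) - fK (- kap i)) \<in> II"
    using rel_EF[of i i] by (simp add: odd)
  show "fE j * fF j - p \<cdot> (fF j * fE j) - inverse (hh i) \<cdot> (fJ (kap j) * fK (kap j) - fK (- kap j)) \<in> II"
    using rel_EF[of j j] by (simp add: pj hj)
  show "fK (- kap i) * fE i - u \<cdot> (fE i * fK (- kap i)) \<in> II" "fK (- kap j) * fE j - u \<cdot> (fE j * fK (- kap j)) \<in> II"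
    using rel_KE[of "- kap i" i] rel_KE[of "- kap j" j] by (simp_all add: prg_neg prg_kap fjj)
  show "fK (- kap i) * fK (- kap j) - Zf \<in> II" "fK (- kap j) * fK (- kap i) - Zf \<in> II"
    "fK (kap i) * fK (- kap j) - fK a \<in> II" "fK (kap j) * fK (- kap i) - fK (- a) \<in> II"
    using rel_KK[of "- kap i" "- kap j"] rel_KK[of "- kap j" "- kap i"] rel_KK[of "kap i" "- kap j"] rel_KK[of "kap j" "- kap i"]
    by (simp_all add: add.commute)
qed (rule pp(1))

section \<open>Bar conjugates of explicit elements\<close>

definition ib :: "('i, 'y) free_alg \<Rightarrow> ('i, 'y) free_alg \<Rightarrow> bool" where
  "ib x y \<longleftrightarrow> cls D x \<in> U_iota D \<and> \<psi>\<^sub>\<iota> (cls D x) = cls D y"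

lemma ib_cong: assumes "ib x y" "x - x' \<in> II" "y - y' \<in> II" shows "ib x' y'"
proof -
  have "cls D x = cls D x'" "cls D y = cls D y'" using assms by (simp_all add: cls_eq)
  then show ?thesis using assms(1) by (simp add: ib_def)
qed

lemma ib_mult: assumes "ib x y" "ib x' y'" shows "ib (x * x') (y * y')"
proof -
  have "cls D x \<otimes>\<^bsub>UU\<^esub> cls D x' \<in> U_iota D"
    using assms unfolding ib_def U_iota_def subalgebra_gen_def by (blast intro: generate_ring.eng_mult)
  then show ?thesis using assms psi_iota_hom(1)[of "cls D x" "cls D x'"] by (simp add: ib_def cls_mult)
qed

lemma ib_add: assumes "ib x y" "ib x' y'" shows "ib (x + x') (y + y')"
proof -
  have "cls D x \<oplus>\<^bsub>UU\<^esub> cls D x' \<in> U_iota D"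
    using assms unfolding ib_def U_iota_def subalgebra_gen_def by (blast intro: generate_ring.eng_add)
  then show ?thesis using assms psi_iota_hom(2)[of "cls D x" "cls D x'"] by (simp add: ib_def cls_add)
qed

lemma ib_smul: assumes "ib x y" shows "ib (c \<cdot> x) (qbar c \<cdot> y)"
proof -
  have "cls D (c \<cdot> 1) \<otimes>\<^bsub>UU\<^esub> cls D x \<in> U_iota D"
    using assms U_iota_gen(4)[of c] unfolding ib_def U_iota_def subalgebra_gen_def by (blast intro: generate_ring.eng_mult)
  then show ?thesis using assms psi_iota_hom(4)[of x c] by (simp add: ib_def cls_mult cls_smul)
qed

lemma ib_gen: "ib (fB k) (fB k)" "ib (fJ (kap k)) (fJ (kap k))" "\<mu> \<in> Y_iota D \<Longrightarrow> ib (fK \<mu>) (fJ \<mu> * fK (- \<mu>))"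
proof -
  show "ib (fB k) (fB k)" "ib (fJ (kap k)) (fJ (kap k))"
    using ibar U_iota_gen(1,2)[of k] unfolding ibar_involution_def ib_def UB_cls[symmetric] kap_def by blast+
  show "\<mu> \<in> Y_iota D \<Longrightarrow> ib (fK \<mu>) (fJ \<mu> * fK (- \<mu>))"
    using ibar U_iota_gen(3)[of \<mu>] by (simp add: ibar_involution_def ib_def cls_mult)
qed

lemma Y_a: "a \<in> Y_iota D" "- a \<in> Y_iota D"
proof -
  have ad: "additive (tauY D)" and co: "\<And>k. tauY D (coroot D k) = coroot D (\<tau> k)"
    using involution by (auto simp: diagram_involution_def)
  have "tauY D (\<Sum>_<n. x) = (\<Sum>_<n. tauY D x)" for n :: nat and x
    by (rule additive.sum[OF ad])
  then have "tauY D (zscale c x) = zscale c (tauY D x)" for c x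
    by (simp add: zscale_def additive.diff[OF ad])
  then have k: "tauY D (kap k) = kap (\<tau> k)" for k by (simp add: kap_def co)
  have "tauY D a = - a" by (simp add: additive.diff[OF ad] k tj)
  then show "a \<in> Y_iota D" "- a \<in> Y_iota D" unfolding Y_iota_def using additive.minus[OF ad, of a] by simp_all
qed

abbreviation "z0 \<equiv> (p - 1) \<cdot> Zf"

definition w0 :: "('i, 'y) free_alg" where
  "w0 = - ((p - 1) \<cdot> Zf + fJ (kap j) * fK (- a) - p \<cdot> (fJ (kap i) * fK a))
    - fJ (kap j) * (fJ (- a) * fK a) + p \<cdot> (fJ (kap i) * (fJ a * fK (- a)))"

text \<open>With c = \<open>hh i\<close> / \<varsigma>_i, \<open>G_eq\<close> expresses c (B_i B_j -
  \<pi> B_j B_i) as \<open>z0\<close> plus torus terms whose conjugates are prescribed. Conjugation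
  fixes the B's and \<varsigma>_i and changes the sign of \<open>hh i\<close>, so the conjugate of
  \<open>z0\<close> can be solved for.\<close>

lemma ib_z0: "ib z0 w0"
proof -
  let ?G = "fB i * fB j + (- p) \<cdot> (fB j * fB i)" and ?c = "hh i * inverse v"
  let ?R = "z0 + fJ (kap j) * fK (- a) - p \<cdot> (fJ (kap i) * fK a)"
  have v: "v * inverse v = 1" using pi_ext_mult_inverse[OF unit_v] .
  have h: "hh i * inverse (hh i) = 1" using pi_ext_mult_inverse[OF unit_hh[of i]] .
  have "?c * (v * inverse (hh i)) = (v * inverse v) * (hh i * inverse (hh i))" by (simp only: mult_ac)
  then have c1: "?c * (v * inverse (hh i)) = 1" by (simp add: v h)
  have "v * qbar (inverse v) = 1"
    using arg_cong[OF v, of qbar] by (simp add: qbar_hom qbar_v)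
  then have "qbar (inverse v) = inverse v" using v by (rule inverse_unique_ring)
  then have qc: "qbar ?c = - ?c" by (simp add: qbar_hom qbar_hh)
  have G: "?c \<cdot> ?G - ?R \<in> II"
  proof -
    have "?c \<cdot> (x - p \<cdot> y - (v * inverse (hh i)) \<cdot> z) = ?c \<cdot> (x + (- p) \<cdot> y) - z" for x y z :: "('i, 'y) free_alg"
      using c1 by (simp add: fa.scale_right_diff_distrib fa.scale_right_distrib)
    from this[of "fB i * fB j" "fB j * fB i" ?R] show ?thesis using II_smul[OF G_eq, of ?c] by simp
  qed
  have qp: "qbar p = p" by (simp add: qbar_ppow del: One_nat_def)
  have qm: "qbar (- 1) = - 1" "qbar (- p) = - p" by (simp_all add: qbar_hom qp del: One_nat_def)
  let ?x = "?c \<cdot> ?G + ((- 1) \<cdot> (fJ (kap j) * fK (- a)) + p \<cdot> (fJ (kap i) * fK a))"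
  let ?y = "qbar ?c \<cdot> (fB i * fB j + qbar (- p) \<cdot> (fB j * fB i))
    + (qbar (- 1) \<cdot> (fJ (kap j) * (fJ (- a) * fK (- (- a)))) + qbar p \<cdot> (fJ (kap i) * (fJ a * fK (- a))))"
  have "ib ?x ?y" by (intro ib_add ib_smul ib_mult ib_gen Y_a)
  moreover have "?x - z0 \<in> II" using G by (simp add: algebra_simps)
  moreover have "?y - w0 \<in> II"
  proof -
    have "?y - w0 = - (?c \<cdot> ?G - ?R)"
      unfolding qc qp qm w0_def by (simp add: algebra_simps del: One_nat_def)
    then show ?thesis using II_minus[OF G] by simp
  qed
  ultimately show ?thesis by (rule ib_cong)
qed

text \<open>If z and x commute up to t', then z z x - c z x z + x z z is a multiple of t'^2 - c t' +
  1. For c = t + t^-1 both t and t^-1 are roots, which serves the two summands of B_i at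
  once.\<close>

lemma q_serre:
  assumes "z * x - t' \<cdot> (x * z) \<in> II" "t' * t' - c * t' + 1 = 0"
  shows "z * z * x - c \<cdot> (z * x * z) + x * z * z \<in> II"
proof -
  have "(t' - c) * t' = - 1" using assms(2) by (simp add: algebra_simps eq_neg_iff_add_eq_0)
  then have e: "((t' - c) * t') \<cdot> (x * z * z) = - (x * z * z)" by simp
  have "z * z * x - c \<cdot> (z * x * z) + x * z * z
    = z * (z * x - t' \<cdot> (x * z)) + (t' - c) \<cdot> ((z * x - t' \<cdot> (x * z)) * z) + (((t' - c) * t') \<cdot> (x * z * z) + x * z * z)"
    by (simp add: algebra_simps fa.scale_left_diff_distrib fa.scale_right_diff_distrib fa.scale_right_distrib)
  then show ?thesis unfolding e by (simp only:) (auto intro!: II_add II_smul II_left[OF assms(1)] II_right[OF assms(1)] simp: II_0)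
qed

definition relQ :: "('i, 'y) free_alg \<Rightarrow> ('i, 'y) free_alg" where
  "relQ z = z * z * fB i + (- (t + u)) \<cdot> (z * fB i * z) + fB i * z * z"

lemma relQ_z0: "relQ z0 \<in> II"
proof -
  let ?E = "fE j * fK (- kap i)"
  have F: "z0 * fF i - t \<cdot> (fF i * z0) \<in> II"
  proof -
    have "Zf * fF i - t \<cdot> (fF i * Zf) \<in> II"
      using rel_KF[of "- s" i] unfolding pg_s by (simp only: f0) simp
    from II_smul[OF this, of "p - 1"] show ?thesis by (simp add: fa.scale_right_diff_distrib mult.commute)
  qed
  have E: "z0 * ?E - u \<cdot> (?E * z0) \<in> II"
  proof -
    have 1: "Zf * fE j - u \<cdot> (fE j * Zf) \<in> II"
      using rel_KE[of "- s" j] unfolding pg_s by (simp only: f0 fjj) simp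
    have 2: "Zf * fK (- kap i) - fK (- kap i) * Zf \<in> II"
      using II_diff[OF rel_KK[of "- s" "- kap i"] rel_KK[of "- kap i" "- s"]] by (simp add: add.commute)
    have "(Zf * fE j - u \<cdot> (fE j * Zf)) * fK (- kap i) + u \<cdot> (fE j * (Zf * fK (- kap i) - fK (- kap i) * Zf)) \<in> II"
      by (rule II_add[OF II_right[OF 1] II_smul[OF II_left[OF 2]]])
    then have "Zf * ?E - u \<cdot> (?E * Zf) \<in> II"
      by (simp add: algebra_simps fa.scale_right_diff_distrib)
    from II_smul[OF this, of "p - 1"] show ?thesis by (simp add: fa.scale_right_diff_distrib mult.commute)
  qed
  have split: "z * z * (F + c \<cdot> E) + (- d) \<cdot> (z * (F + c \<cdot> E) * z) + (F + c \<cdot> E) * z * z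
      = (z * z * F - d \<cdot> (z * F * z) + F * z * z) + c \<cdot> (z * z * E - d \<cdot> (z * E * z) + E * z * z)"
    for z F E :: "('i, 'y) free_alg" and c d
    by (simp add: distrib_left distrib_right fa.scale_right_diff_distrib fa.scale_right_distrib mult.commute[of c d])
  have "relQ z0 = (z0 * z0 * fF i - (t + u) \<cdot> (z0 * fF i * z0) + fF i * z0 * z0)
      + v \<cdot> (z0 * z0 * ?E - (t + u) \<cdot> (z0 * ?E * z0) + ?E * z0 * z0)"
    unfolding relQ_def fB_def tj by (rule split)
  moreover have "t * t - (t + u) * t + 1 = 0" "u * u - (t + u) * u + 1 = 0"
    using tu by (simp_all add: algebra_simps)
  ultimately show ?thesis using II_add[OF q_serre[OF F] II_smul[OF q_serre[OF E]]] by simp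
qed

text \<open>Conjugation fixes B_i and the coefficient t + t^-1: it exchanges t and t^-1 without a
  factor \<pi>, because the exponent (i, i) is even.\<close>

lemma relQ_w0: "relQ w0 \<in> II"
proof -
  have "qbar t = u" "qbar u = t"
    using fm_diag(2)[of i] by (simp_all add: qbar_qpow ppow_even even_nat_iff)
  then have c: "qbar (- (t + u)) = - (t + u)" by (simp add: qbar_hom add.commute)
  have "ib (relQ z0) (relQ w0)"
    unfolding relQ_def by (subst (2) c[symmetric]) (intro ib_add ib_smul ib_mult ib_z0 ib_gen)
  moreover have "ib (0 \<cdot> fB i) (qbar 0 \<cdot> fB i)" by (intro ib_smul ib_gen)
  then have "ib 0 0" by (simp add: qbar_hom)
  moreover have "cls D (relQ z0) = cls D 0" using relQ_z0 by (simp add: cls_eq)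
  ultimately have "cls D (relQ w0) = cls D 0" by (simp add: ib_def)
  then show ?thesis by (simp add: cls_eq)
qed

section \<open>The conjugate relation on the universal Verma module\<close>

lemma JM_a: "JM a m = m" "JM (- a) m = m"
proof -
  have "ppow (nat \<bar>fm i k - fm j k\<bar>) = 1" "ppow (nat \<bar>fm j k - fm i k\<bar>) = 1" for k
    by (rule ppow_even, simp add: even_nat_iff fm_even)+
  then show "JM a m = m" "JM (- a) m = m" unfolding JM_def pg_a by (simp_all add: Dg_one)
qed

lemma act_w0: "act w0 m = sM (p - 1) (KM a m + KM (- a) m - KM (- s) m)"
  by (simp add: w0_def RM.rep_simps RM.rep_mult lin_minus[OF RM.lin_rep] act_gen JM_kap JM_a MM.scale_right_diff_distrib MM.scale_right_distrib
      MM.scale_left_diff_distrib algebra_simps del: One_nat_def minus_diff_eq)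

definition W0 :: "'y \<Rightarrow> 'y \<Rightarrow> ('y \<Rightarrow> qpi) \<Rightarrow> 'y \<Rightarrow> qpi" where
  "W0 x y f \<kappa> = (p - 1) * (f (\<kappa> - x) + f (\<kappa> + x) - f (\<kappa> + y))"
definition W1 :: "'y \<Rightarrow> 'y \<Rightarrow> ('y \<Rightarrow> qpi) \<Rightarrow> 'y \<Rightarrow> qpi" where
  "W1 x y f \<kappa> = (p - 1) * (u * f (\<kappa> - x) + t * f (\<kappa> + x) - t * f (\<kappa> + y))"

text \<open>In a product of two of these operators the total translation is 0 only for a step by x
  combined with a step by -x; the four inequalities exclude every other coincidence. With t u = 1
  the value is -(p - 1)^2 (t - u)^2.\<close>

lemma W_combination:
  assumes f: "f 0 = 1" "\<And>\<kappa>. \<kappa> \<noteq> 0 \<Longrightarrow> f \<kappa> = 0"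
    and nz: "x + x \<noteq> 0" "y + y \<noteq> 0" "y - x \<noteq> 0" "y + x \<noteq> 0"
  shows "W1 x y (W1 x y f) 0 - (t + u) * W1 x y (W0 x y f) 0 + W0 x y (W0 x y f) 0
    = (p - 1) * (p - 1) * (2 * (t * u) + 2 - (t + u) * (t + u))"
proof -
  have "- x - x \<noteq> 0" "- x + y \<noteq> 0" "x + y \<noteq> 0"
    using nz by (auto simp: algebra_simps add_eq_0_iff)
  then show ?thesis using nz by (simp add: W0_def W1_def f) (simp add: algebra_simps)
qed

lemma act_w0_0: "act w0 (\<lambda>\<kappa>. f \<kappa> \<cdot> 1) = (\<lambda>\<kappa>. W0 a s f \<kappa> \<cdot> 1)"
proof -
  have "KM \<mu> (\<lambda>\<kappa>. f \<kappa> \<cdot> 1) = (\<lambda>\<kappa>. f (\<kappa> - \<mu>) \<cdot> 1)" for \<mu>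
    by (simp add: KM_def lin_smul[OF lin_Dg])
  then show ?thesis
    unfolding act_w0 by (simp only: W0_def sM_def plus_fun_apply minus_apply diff_minus_eq_add fa.scale_left_distrib
       fa.scale_left_diff_distrib smul_smul[symmetric])
qed

lemma act_w0_1: "act w0 (\<lambda>\<kappa>. f \<kappa> \<cdot> wd [i]) = (\<lambda>\<kappa>. W1 a s f \<kappa> \<cdot> wd [i])"
proof -
  have "KM \<mu> (\<lambda>\<kappa>. f \<kappa> \<cdot> wd [i]) = (\<lambda>\<kappa>. (qpow (- pg \<mu> i) * f (\<kappa> - \<mu>)) \<cdot> wd [i])" for \<mu>
    by (simp add: KM_def lin_smul[OF lin_Dg] mult.commute)
  moreover have "pg a i = fm i i" "pg (- a) i = - fm i i" "pg (- s) i = - fm i i"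
    unfolding pg_a pg_s by (simp_all add: f0)
  ultimately show ?thesis
    unfolding act_w0 by (simp only: W1_def sM_def plus_fun_apply minus_apply diff_minus_eq_add minus_minus fa.scale_left_distrib
       fa.scale_left_diff_distrib smul_smul[symmetric])
qed

lemma act_B_0: "act (fB i) (\<lambda>\<kappa>. f \<kappa> \<cdot> 1) = (\<lambda>\<kappa>. f \<kappa> \<cdot> wd [i])"
proof -
  have "EM j (KM (- kap i) (\<lambda>\<kappa>. f \<kappa> \<cdot> 1)) = 0"
    by (simp add: fun_eq_iff EM_def[of j] KM_def lin_smul[OF lin_Dg] lin_smul[OF lin_ld] lin_smul[OF lin_rd] lin_0[OF lin_Kq] lin_0[OF lin_Sgn])
  then show ?thesis
    by (simp add: fB_def tj RM.rep_simps RM.rep_mult act_gen) (simp add: fun_eq_iff FM_def sM_def)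
qed

lemma kap_ij: assumes "zscale x (kap i) + zscale y (kap j) = 0" shows "x = 0" "y = 0"
proof -
  let ?c = "\<lambda>k. (if k = i then x else 0) + (if k = j then y else 0)"
  have "(\<Sum>k\<in>UNIV. zscale (?c k) (kap k))
    = (\<Sum>k\<in>UNIV. (if k = i then zscale x (kap i) else 0) + (if k = j then zscale y (kap j) else 0))"
    by (intro sum.cong refl) (simp add: zmod.scale_left_distrib)
  then have "(\<Sum>k\<in>UNIV. zscale (?c k) (kap k)) = 0" using assms by (simp add: sum.distrib)
  from kap_independent[OF this, of i] kap_independent[OF this, of j] show "x = 0" "y = 0"
    using ij by simp_all
qed

lemma nonzero: "a + a \<noteq> 0" "s + s \<noteq> 0" "s - a \<noteq> 0" "s + a \<noteq> 0"
proof -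
  have two: "zscale 2 x = x + x" "zscale (- 2) x = - x - x" "zscale 0 x = 0" for x :: 'y
    using zmod.scale_left_distrib[of 1 1 x] zmod.scale_left_distrib[of "- 1" "- 1" x] by simp_all
  show "a + a \<noteq> 0" using kap_ij[of 2 "- 2"] unfolding two by (auto simp: algebra_simps)
  show "s + s \<noteq> 0" using kap_ij[of 2 2] unfolding two by (auto simp: algebra_simps)
  show "s - a \<noteq> 0" using kap_ij[of 0 2] unfolding two by (auto simp: algebra_simps)
  show "s + a \<noteq> 0" using kap_ij[of 2 0] unfolding two by (auto simp: algebra_simps)
qed

lemma no_ibar_involution: False
proof -
  define f :: "'y \<Rightarrow> qpi" where "f \<kappa> = (if \<kappa> = 0 then 1 else 0)" for \<kappa>
  let ?m = "\<lambda>\<kappa>. f \<kappa> \<cdot> (1 :: 'i word \<Rightarrow>\<^sub>0 qpi)" and ?C = "(p - 1) * (p - 1) * (2 * (t * u) + 2 - (t + u) * (t + u))"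
  have "bd 0 ?m" using spn_wd[of _ "[]"] by (auto simp: bd_def wd_Nil intro!: spn_smul)
  then have "?m \<in> Bd" unfolding Bd_def by blast
  then have "act (relQ w0) ?m \<in> NM" by (rule act_II[OF relQ_w0])
  then have 1: "act (relQ w0) ?m 0 \<in> Rad" by (simp only: NM_def mem_Collect_eq)
  have "act (relQ w0) ?m 0
    = (W1 a s (W1 a s f) 0 - (t + u) * W1 a s (W0 a s f) 0 + W0 a s (W0 a s f) 0) \<cdot> wd [i]"
    unfolding relQ_def RM.rep_simps RM.rep_mult act_B_0 act_w0_0 act_w0_1
    by (simp only: sM_def plus_fun_apply fa.scale_left_distrib fa.scale_left_diff_distrib smul_smul mult_minus_left
        fa.scale_minus_left add_uminus_conv_diff)
  also have "\<dots> = ?C \<cdot> wd [i]"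
    by (subst W_combination) (use nonzero in \<open>simp_all add: f_def\<close>)
  finally have "?C \<cdot> wd [i] \<in> Rad" using 1 by simp
  then have "formw [i] (?C \<cdot> wd [i]) = 0" unfolding Rad_def by blast
  then have C: "?C = 0" using ld_Cons[of i i 1] by (simp add: lin_smul[OF lin_ld] lookup_smul)
  have "1 - ppow 0 * qpow (2 * fm i i) dvd 1" by (rule unit_one_minus) (use fm_diag[of i] in simp)
  moreover have "qpow (2 * fm i i) = t * t" by (simp only: mult_2 qpow_add)
  ultimately have d: "(1 - t * t) * (1 - t * t) dvd 1" by (intro unit_mult) simp_all
  have t2: "t * (t * (u * (u * x))) = x" "t * (u * x) = x" for x
    using tu(1) by (simp_all add: mult.assoc[symmetric])
  \<comment> \<open>Both sides are (t - u)^2, since t u = 1; the left one shows that it is a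
    unit.\<close>
  have "u * u * ((1 - t * t) * (1 - t * t)) = - (2 * (t * u) + 2 - (t + u) * (t + u))"
    using tu t2 by (simp add: algebra_simps)
  then have "u * u * ((1 - t * t) * (1 - t * t)) * ((p - 1) * (p - 1)) = u * u * ((1 - t * t) * (1 - t * t)) * 0"
    using C by (simp only: mult_minus_left mult.commute[of "2 * (t * u) + 2 - (t + u) * (t + u)"] mult_zero_right minus_zero)
  then have "(p - 1) * (p - 1) = 0"
    by (rule unit_cancel[rotated]) (intro unit_mult d unit_qpow)
  \<comment> \<open>(p - 1)^2 = 2 - 2 p because p^2 = 1. As \<open>qpi\<close> has zero divisors,
    the square is expanded here; 2 is then cancelled as a unit.\<close>
  then have "2 * p = 2 * 1" using pp(1) by (simp add: algebra_simps)
  then have "p = 1" by (rule unit_cancel[OF unit_two])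
  then show False by (simp add: ppow_def ppi_def one_pi_ext_def times_pi_ext_def)
qed

end

theorem theorem4p6:
  fixes D :: "('i::finite, 'x::ab_group_add, 'y::ab_group_add) isatake_datum"
    and \<psi> \<psi>\<^sub>\<iota> :: "('i, 'y) Uelem \<Rightarrow> ('i, 'y) Uelem"
  assumes "super_root_datum D"
    and "diagram_involution D"
    and "admissible_parameters D"
    and isolated: "\<And>i. tau D i = i \<Longrightarrow> (\<forall>j. j \<noteq> i \<longrightarrow> cartan D i j = 0) \<Longrightarrow>
          qbar (varsigma D i * qi D i) = varsigma D i * qi D i"
    and "bar_involution D \<psi>"
    and "ibar_involution D \<psi>\<^sub>\<iota>"
  shows "(\<exists>!\<Upsilon>. quasi_K_matrix D \<psi> \<psi>\<^sub>\<iota> \<Upsilon>) \<and>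
         (\<forall>\<Upsilon>. quasi_K_matrix D \<psi> \<psi>\<^sub>\<iota> \<Upsilon> \<longrightarrow>
            (\<forall>\<mu>. odd (weight_par D \<mu>) \<longrightarrow> \<Upsilon> \<mu> = \<zero>\<^bsub>U D\<^esub>))"
proof -
  interpret isat_bar D \<psi> \<psi>\<^sub>\<iota>
    by unfold_locales (use assms in \<open>auto simp: super_root_datum_def\<close>)
  have "par D i = 0" if "tau D i \<noteq> i" "cartan D i (tau D i) = 0" for i
  proof (rule ccontr)
    assume "par D i \<noteq> 0"
    then have "par D i = 1" by (auto simp: par_def)
    then interpret isat_odd_pair D \<psi> \<psi>\<^sub>\<iota> i by unfold_locales (use that in auto)
    show False by (rule no_ibar_involution)
  qed
  then interpret isat_good_bar D \<psi> \<psi>\<^sub>\<iota> by unfold_locales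
  show ?thesis by (rule quasi_K_theorem)
qed

end
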